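(* Let $R$ be a commutative ring, $P$ a balanced polytope admitting a column vector, $\mathfrak P$ a doubling spectrum starting with $P$, and let $V\subset\mathrm{Col}(\mathfrak P)$ be a rigid system supported by the graph $\mathbf F$, where $t$ is the maximal degree of an edge of $\mathbf F$. (a) For each $r\in\{1,\dots,t-1\}$ there is an exact sequence $$0\to A_r(R,V)\to G_r(R,V)\to G_{r+1}(R,V)\to 0,$$ where $G_r(R,V)\to G_{r+1}(R,V)$ is given by $\epsilon\mapsto\epsilon_r^{-1}\epsilon$ with $\epsilon=\epsilon_r\circ\cdots\circ\epsilon_t$ the canonical representation. This surjective homomorphism is split by the inclusion $G_{r+1}(R,V)\to G_r(R,V)$. (b) If $Q$ is another balanced polytope and $W\subset\mathrm{Col}(Q)$ is a rigid system supported by the same graph $\mathbf F$, then for each $r\in\{1,\dots,t\}$ the assignment $e_w^\lambda\mapsto e_v^\lambda$, where $w\in [W]$ and $v\in [V]$ correspond to the same path in $\mathbf F$, gives rise to a group isomorphism $G_r(R,W)\to G_r(R,V)$. (c) If $U\subset\mathrm{Col}(\mathfrak P)$ is another rigid system, then $$G(R,U)\cap G(R,V)=G(R,[U]\cap[V]).$$ (d) The natural surjective mappings $G_r'(R,V)\to G_r(R,V)$, $x_v^\lambda\mapsto e_v^\lambda$, $r\in\{1,\dots,t\}$, are isomorphisms. The analogues of (a)–(c), as well as of the following two statements, hold for the groups $G'_r(R,V)\subset\mathrm{St}(R,P)$ (with $x_v^\lambda$, $\tau'_r$, $A'_r(R,V)$, $G'_r(R,V)$, $G'(R,V)$ in place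 of $e_v^\lambda$, $\tau_r$, $A_r(R,V)$, $G_r(R,V)$, $G(R,V)$): the maps $\tau_r$ are injective homomorphisms on $(R^{N_r},+)$; and every $\epsilon\in G_r(R,V)$ has a unique representation $\epsilon=\epsilon_r\circ\cdots\circ\epsilon_t$ with $\epsilon_s\in A_s(R,V)$.
   Context: **Polytopes and column vectors.** All polytopes are convex lattice polytopes $P\subset\mathbb{R}^n$ (vertices in $\mathbb{Z}^n$), with $\dim P=n$ and $\mathbb{Z}^n$ the smallest affine lattice containing $L_P:=P\cap\mathbb{Z}^n$. For a facet $F$ of $P$ let $\langle F,-\rangle:\mathbb{Z}^n\to\mathbb{Z}$ (extended linearly to $\mathbb{R}^n$) be the unique surjective homomorphism that is constant on $F$ and whose minimum $b_F$ over $P$ is attained exactly on $F$. A nonzero $v\in\mathbb{Z}^n$ is a column vector of $P$ if there is a facet $F$ with $x+v\in P$ for all $x\in L_P\setminus F$; then $F$ is unique, called the base facet of $v$ and denoted $P_v$. $\mathrm{Col}(P)$ is the set of column vectors. For $u,v\in\mathrm{Col}(P)$ the product $uv$ exists if $u+v\ne0$ and $x+u\notin P_v$ for every $x\in L_P\setminus P_u$; then $uv:=u+v\in\mathrm{Col}(P)$. $P$ is balanced if $\langle P_u,v\rangle\le1$ for all $u,v\in\mathrm{Col}(P)$. **Doubling and stable groups.** For a facet $F$ put $\mathrm{ht}_F(x)=\langle F,x\rangle-b_F$. The doubling of $P$ along $F$ is (up to integral-affine equivalence) $P^{\square_F}=\{(x,s):x\in P,\ 0\le s\le \mathrm{ht}_F(x)\}\subset\mathbb{R}^{n+1}$;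 identify $P$ with $P\times\{0\}$; then $\mathrm{Col}(P)\subset\mathrm{Col}(P^{\square_F})$. For $v\in\mathrm{Col}(P)$ put $P^{\square_v}:=P^{\square_{P_v}}$. A doubling spectrum $\mathfrak P=(P=P_0\subset P_1\subset\cdots)$ is a chain such that for each $i$ there is $v\in\mathrm{Col}(P_i)$ with $P_{i+1}=P_i^{\square_v}$, and for each $i$ and each $v\in\mathrm{Col}(P_i)$ there is $j\ge i$ with $P_{j+1}=P_j^{\square_v}$. $\mathrm{Col}(\mathfrak P)=\bigcup_i\mathrm{Col}(P_i)$, with the induced partial product. $R[P]=R[S_P]$ is the semigroup ring of the subsemigroup $S_P\subset\mathbb{Z}^{n+1}$ generated by $(z,1)$, $z\in L_P$. For $v\in\mathrm{Col}(P)$ and $\lambda\in R$, $e_v^\lambda$ is the graded $R$-algebra automorphism of $R[P]$ given by $x\mapsto(1+\lambda v)^{\mathrm{ht}_v(x)}x$, $x\in S_P$, computed in $R[\mathbb{Z}^{n+1}]$, where $v$ is identified with the monomial $(v,0)$ and $\mathrm{ht}_v(x',x'')=\langle P_v,x'\rangle-x''b_{P_v}$. For $v\in\mathrm{Col}(\mathfrak P)$ these are compatible and define $e_v^\lambda$ on $R[\mathfrak P]=\bigcup_iR[P_i]$. $\mathbb{E}(R,P)$ is the group generated by all $e_v^\lambda$, $v\in\mathrm{Col}(\mathfrak P)$, $\lambda\in R$; it is independent of $\mathfrak P$ up to natural isomorphism. $\mathrm{St}(R,P)$ ($P$ balanced) is the group generated by symbols $x_v^\lambda$, $v\in\mathrm{Col}(\mathfrak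 P)$, $\lambda\in R$, with relations $x_v^\lambda x_v^\mu=x_v^{\lambda+\mu}$; $[x_u^\lambda,x_v^\mu]=x_{uv}^{-\lambda\mu}$ if $uv$ exists; $[x_u^\lambda,x_v^\mu]=1$ if $u+v\notin\mathrm{Col}(\mathfrak P)\cup\{0\}$ (where $[a,b]=aba^{-1}b^{-1}$). There is a natural surjection $\mathrm{St}(R,P)\to\mathbb{E}(R,P)$, $x_v^\lambda\mapsto e_v^\lambda$. **Rigid systems.** A product $v_1\cdots v_m$ exists (strongly) if $v_iv_{i+1}$ exists for all $i<m$ and $\sum_{i=r}^sv_i\ne0$ for all $1\le r<s\le m$; it exists weakly if for some bracketing all recursively formed products of pairs exist. For a set $V$ of column vectors, $[V]$ (resp. $\langle V\rangle$) is the set of all strongly (resp. weakly) existing products of elements of $V$ (including the elements of $V$). A graph is a finite directed graph without isolated vertices, multiple edges or loops such that if $a,b$ are joined by an edge there is no other directed path connecting them. $\mathrm{path}(\mathbf F)$ is the set of nonempty directed paths with concatenation as partial product; $\overline{\mathrm{path}}(\mathbf F)$ is its quotient identifying paths with the same initial and the same end point. $V\subset\mathrm{Col}(P)$ is rigid if (1) $[V]$ contains no pair $\{v,-v\}$; (2) $[V]=\langle V\rangle$; (3) there are a graph $\mathbf F$ and an isomorphism of partial product structures $[V]\approx\overline{\mathrm{path}}(\mathbf F)$; then $\mathbf F$ (with a fixed isomorphism) is said to support $V$. $V\subset\mathrm{Col}(\mathfrak P)$ is rigid if it is a rigid system in some $\mathrm{Col}(P_j)$. The intersection $[U]\cap[V]$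 for rigid $U,V$ is again rigid. **Triangular groups.** For $V$ rigid, $G(R,V)\subset\mathbb{E}(R,P)$ is the subgroup generated by the $e_v^\lambda$, $v\in V$, $\lambda\in R$, and $G'(R,V)\subset\mathrm{St}(R,P)$ the subgroup generated by the $x_v^\lambda$ (trivial groups if $V=\emptyset$). Order the edges of $\mathbf F$ by $f\le g$ if some path has first edge $f$ and last edge $g$. An edge $f$ has degree $r$ if there is a chain $f_1<\cdots<f_r=f$ but no chain with $r+1$ elements ending in $f$; $t$ is the maximal degree. $[V]^r=\{v_{r1},\dots,v_{rN_r}\}$ is the set of elements of $[V]$ corresponding to paths whose initial edge has degree $r$; $[V]_r$ is the set of those whose initial edge has degree $\ge r$. $G_r(R,V)$ (resp. $G_r'(R,V)$) is the subgroup generated by the $e_v^\lambda$ (resp. $x_v^\lambda$) with $\lambda\in R$, $v\in[V]_r$. Put $\tau_r:R^{N_r}\to G_r(R,V)$, $(\lambda_1,\dots,\lambda_{N_r})\mapsto e_{v_{r1}}^{\lambda_1}\circ\cdots\circ e_{v_{rN_r}}^{\lambda_{N_r}}$, $A_r(R,V)=\mathrm{Im}(\tau_r)$; $\tau_r'$ and $A'_r(R,V)$ are defined in the same way with $x$ in place of $e$. Every $\epsilon\in G_r(R,V)$ has a unique representation $\epsilon=\epsilon_r\circ\cdots\circ\epsilon_t$ with $\epsilon_s\in A_s(R,V)$, called the canonical representation. *)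

theory Defs
  imports "HOL-Analysis.Analysis" "HOL-Algebra.Algebra" "HOL-Analysis.Finite_Function_Topology"
begin

section \<open>Lattice polytopes and column vectors\<close>

text \<open>
  All polytopes live in the space of finitely supported real sequences. The space \<open>R^n\<close> consists
  of the sequences supported on \<open>{..<n}\<close>, so that the identification of \<open>P\<close> with \<open>P \<times> {0}\<close> is the
  identity and a doubling spectrum is a literal chain of inclusions.
\<close>

type_synonym pt = "nat \<Rightarrow>\<^sub>0 real"

definition Rn :: "nat \<Rightarrow> pt set" where
  "Rn n = {x. Poly_Mapping.keys x \<subseteq> {..<n}}"

definition Zn :: "nat \<Rightarrow> pt set" where
  "Zn n = {x \<in> Rn n. \<forall>i. Poly_Mapping.lookup x i \<in> \<int>}"

definition pdim :: "pt set \<Rightarrow> nat" where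
  "pdim P = (THE n. affine hull P = Rn n)"

definition lattice_points :: "pt set \<Rightarrow> pt set" where
  "lattice_points P = P \<inter> Zn (pdim P)"

definition affine_sublattice :: "nat \<Rightarrow> pt set \<Rightarrow> bool" where
  "affine_sublattice n A \<longleftrightarrow> A \<subseteq> Zn n \<and>
     (\<exists>z H. 0 \<in> H \<and> (\<forall>a\<in>H. \<forall>b\<in>H. a - b \<in> H) \<and> A = (+) z ` H)"

definition lattice_polytope :: "pt set \<Rightarrow> bool" where
  "lattice_polytope P \<longleftrightarrow> polytope P \<and>
     (\<exists>n. affine hull P = Rn n \<and> (\<forall>x. x extreme_point_of P \<longrightarrow> x \<in> Zn n) \<and>
          (\<forall>A. affine_sublattice n A \<and> lattice_points P \<subseteq> A \<longrightarrow> A = Zn n))"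

text \<open>
  The library's \<^const>\<open>facet_of\<close> and \<^const>\<open>aff_dim\<close> require a Euclidean space. As in the definition
  of \<^const>\<open>aff_dim\<close>, the dimension of a face is read off from an affine basis of its affine hull:
  a facet has such a basis with \<open>pdim P\<close> elements, i.e. dimension \<open>pdim P - 1\<close>.
\<close>

definition facet :: "pt set \<Rightarrow> pt set \<Rightarrow> bool" where
  "facet P F \<longleftrightarrow> F face_of P \<and> F \<noteq> {} \<and>
     (\<exists>B. finite B \<and> \<not> affine_dependent B \<and> affine hull B = affine hull F \<and> card B = pdim P)"

text \<open>
  The linear extension of \<open>\<langle>F,-\<rangle>\<close>. Its values on the unit vectors outside \<open>R^n\<close> are irrelevant and
  set to 0 to make the functional unique.
\<close>

definition facet_form :: "pt set \<Rightarrow> pt set \<Rightarrow> pt \<Rightarrow> real" where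
  "facet_form P F = (THE \<phi>. linear \<phi> \<and> \<phi> ` Zn (pdim P) = \<int> \<and>
     (\<forall>i\<ge>pdim P. \<phi> (Poly_Mapping.single i 1) = 0) \<and>
     (\<exists>b. (\<forall>x\<in>F. \<phi> x = b) \<and> (\<forall>x\<in>P - F. b < \<phi> x)))"

definition facet_min :: "pt set \<Rightarrow> pt set \<Rightarrow> real" where
  "facet_min P F = Inf (facet_form P F ` P)"

definition facet_height :: "pt set \<Rightarrow> pt set \<Rightarrow> pt \<Rightarrow> real" where
  "facet_height P F x = facet_form P F x - facet_min P F"

definition base_facet_of :: "pt set \<Rightarrow> pt \<Rightarrow> pt set \<Rightarrow> bool" where
  "base_facet_of P v F \<longleftrightarrow> facet P F \<and> (\<forall>x \<in> lattice_points P - F. x + v \<in> P)"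

definition Col :: "pt set \<Rightarrow> pt set" where
  "Col P = {v \<in> Zn (pdim P). v \<noteq> 0 \<and> (\<exists>F. base_facet_of P v F)}"

definition base_facet :: "pt set \<Rightarrow> pt \<Rightarrow> pt set" where
  "base_facet P v = (THE F. base_facet_of P v F)"

definition col_prod :: "pt set \<Rightarrow> pt \<Rightarrow> pt \<Rightarrow> pt option" where
  "col_prod P u v =
     (if u \<in> Col P \<and> v \<in> Col P \<and> u + v \<noteq> 0 \<and>
         (\<forall>x \<in> lattice_points P - base_facet P u. x + u \<notin> base_facet P v)
      then Some (u + v) else None)"

definition balanced :: "pt set \<Rightarrow> bool" where
  "balanced P \<longleftrightarrow> (\<forall>u\<in>Col P. \<forall>v\<in>Col P. facet_form P (base_facet P u) v \<le> 1)"


section \<open>Doubling spectra\<close>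

definition doubling :: "pt set \<Rightarrow> pt set \<Rightarrow> pt set" where
  "doubling P F =
     {x + Poly_Mapping.single (pdim P) s | x s. x \<in> P \<and> 0 \<le> s \<and> s \<le> facet_height P F x}"

definition doubling_spectrum :: "(nat \<Rightarrow> pt set) \<Rightarrow> bool" where
  "doubling_spectrum PP \<longleftrightarrow>
     (\<forall>i. \<exists>v\<in>Col (PP i). PP (Suc i) = doubling (PP i) (base_facet (PP i) v)) \<and>
     (\<forall>i. \<forall>v\<in>Col (PP i). \<exists>j\<ge>i. PP (Suc j) = doubling (PP j) (base_facet (PP j) v))"

definition spec_Col :: "(nat \<Rightarrow> pt set) \<Rightarrow> pt set" where
  "spec_Col PP = (\<Union>i. Col (PP i))"

definition spec_prod :: "(nat \<Rightarrow> pt set) \<Rightarrow> pt \<Rightarrow> pt \<Rightarrow> pt option" where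
  "spec_prod PP u v = (if \<exists>i. col_prod (PP i) u v \<noteq> None then Some (u + v) else None)"


section \<open>Semigroup rings and elementary automorphisms\<close>

text \<open>
  The group ring of all of \<open>pt \<times> int\<close> serves as the ambient ring; \<open>R[P]\<close> consists of its elements
  supported on \<open>S_P\<close>, where \<open>S_P\<close> contains the neutral element.
\<close>

type_synonym 'r galg = "(pt \<times> int) \<Rightarrow>\<^sub>0 'r"

inductive_set semigrp :: "pt set \<Rightarrow> (pt \<times> int) set" for P where
  zero: "0 \<in> semigrp P"
| step: "x \<in> semigrp P \<Longrightarrow> z \<in> lattice_points P \<Longrightarrow> x + (z, 1) \<in> semigrp P"

definition semigrp_ring :: "pt set \<Rightarrow> 'r::comm_ring_1 galg set" where
  "semigrp_ring P = {f. Poly_Mapping.keys f \<subseteq> semigrp P}"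

definition col_height :: "pt set \<Rightarrow> pt \<Rightarrow> pt \<times> int \<Rightarrow> real" where
  "col_height P v x = facet_form P (base_facet P v) (fst x)
                      - of_int (snd x) * facet_min P (base_facet P v)"

text \<open>The \<open>R\<close>-linear extension of \<open>x \<mapsto> (1 + \<alpha>v)^(ht_v x) x\<close>; heights on \<open>S_P\<close> are natural numbers.\<close>

definition elem_aut :: "pt set \<Rightarrow> pt \<Rightarrow> 'r \<Rightarrow> 'r::comm_ring_1 galg \<Rightarrow> 'r galg" where
  "elem_aut P v \<alpha> f =
     (\<Sum>x\<in>Poly_Mapping.keys f.
        (1 + Poly_Mapping.single (v, 0) \<alpha>) ^ nat \<lfloor>col_height P v x\<rfloor>
        * Poly_Mapping.single x (Poly_Mapping.lookup f x))"

definition spec_ring :: "(nat \<Rightarrow> pt set) \<Rightarrow> 'r::comm_ring_1 galg set" where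
  "spec_ring PP = (\<Union>i. semigrp_ring (PP i))"

text \<open>
  On \<open>f \<in> R[P_i]\<close> with \<open>v \<in> Col(P_i)\<close> the action is that of \<open>P_i\<close>; by compatibility any such \<open>i\<close>
  gives the same result. Outside \<open>R[PP]\<close> the map is \<^const>\<open>undefined\<close>, as \<^const>\<open>BijGroup\<close> requires.
\<close>

definition spec_aut :: "(nat \<Rightarrow> pt set) \<Rightarrow> pt \<Rightarrow> 'r \<Rightarrow> 'r::comm_ring_1 galg \<Rightarrow> 'r galg" where
  "spec_aut PP v \<alpha> =
     (\<lambda>f\<in>spec_ring PP. elem_aut (PP (LEAST i. v \<in> Col (PP i) \<and> f \<in> semigrp_ring (PP i))) v \<alpha> f)"

text \<open>
  For a family \<open>g v \<alpha>\<close> of elements of a group \<open>\<Gamma>\<close> (either \<open>e_v^\<alpha>\<close> or \<open>x_v^\<alpha>\<close>), the subgroup generated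
  by the members with \<open>v \<in> S\<close>.
\<close>

definition gen_subgroup :: "'g monoid \<Rightarrow> (pt \<Rightarrow> 'r \<Rightarrow> 'g) \<Rightarrow> pt set \<Rightarrow> 'g monoid" where
  "gen_subgroup \<Gamma> g S = \<Gamma>\<lparr>carrier := generate \<Gamma> {g v \<alpha> | v \<alpha>. v \<in> S}\<rparr>"

definition elem_group ::
    "'r::comm_ring_1 itself \<Rightarrow> (nat \<Rightarrow> pt set) \<Rightarrow> ('r galg \<Rightarrow> 'r galg) monoid" where
  "elem_group _ PP = gen_subgroup (BijGroup (spec_ring PP)) (spec_aut PP) (spec_Col PP)"


section \<open>Stable Steinberg groups\<close>

text \<open>
  Groups given by generators \<open>S\<close> and relations: words in signed generators (\<open>False\<close> marks a formal
  inverse) modulo the congruence generated by free cancellation and the relations.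
\<close>

type_synonym 'g gword = "(bool \<times> 'g) list"

inductive_set pres_cong :: "'g set \<Rightarrow> ('g gword \<times> 'g gword) set \<Rightarrow> ('g gword \<times> 'g gword) set"
  for S rels where
  refl: "w \<in> lists (UNIV \<times> S) \<Longrightarrow> (w, w) \<in> pres_cong S rels"
| sym: "(w, w') \<in> pres_cong S rels \<Longrightarrow> (w', w) \<in> pres_cong S rels"
| trans: "(w, w') \<in> pres_cong S rels \<Longrightarrow> (w', w'') \<in> pres_cong S rels \<Longrightarrow> (w, w'') \<in> pres_cong S rels"
| cancel: "u \<in> lists (UNIV \<times> S) \<Longrightarrow> w \<in> lists (UNIV \<times> S) \<Longrightarrow> a \<in> S \<Longrightarrow>
           (u @ [(b, a), (\<not> b, a)] @ w, u @ w) \<in> pres_cong S rels"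
| relation: "u \<in> lists (UNIV \<times> S) \<Longrightarrow> w \<in> lists (UNIV \<times> S) \<Longrightarrow>
             l \<in> lists (UNIV \<times> S) \<Longrightarrow> r \<in> lists (UNIV \<times> S) \<Longrightarrow> (l, r) \<in> rels \<Longrightarrow>
             (u @ l @ w, u @ r @ w) \<in> pres_cong S rels"

definition presented_group :: "'g set \<Rightarrow> ('g gword \<times> 'g gword) set \<Rightarrow> 'g gword set monoid" where
  "presented_group S rels =
     \<lparr>carrier = lists (UNIV \<times> S) // pres_cong S rels,
      mult = (\<lambda>A B. \<Union>a\<in>A. \<Union>b\<in>B. pres_cong S rels `` {a @ b}),
      one = pres_cong S rels `` {[]}\<rparr>"

definition comm_word :: "'g \<Rightarrow> 'g \<Rightarrow> 'g gword" where
  "comm_word a b = [(True, a), (True, b), (False, a), (False, b)]"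

definition st_gens :: "(nat \<Rightarrow> pt set) \<Rightarrow> (pt \<times> 'r) set" where
  "st_gens PP = spec_Col PP \<times> UNIV"

definition st_rels :: "(nat \<Rightarrow> pt set) \<Rightarrow> ((pt \<times> 'r::comm_ring_1) gword \<times> (pt \<times> 'r) gword) set" where
  "st_rels PP =
     {([(True, (v, \<alpha>)), (True, (v, \<mu>))], [(True, (v, \<alpha> + \<mu>))]) | v \<alpha> \<mu>. v \<in> spec_Col PP}
   \<union> {(comm_word (u, \<alpha>) (v, \<mu>), [(True, (w, - (\<alpha> * \<mu>)))]) | u v w \<alpha> \<mu>. spec_prod PP u v = Some w}
   \<union> {(comm_word (u, \<alpha>) (v, \<mu>), []) | u v \<alpha> \<mu>.
        u \<in> spec_Col PP \<and> v \<in> spec_Col PP \<and> u + v \<notin> spec_Col PP \<union> {0}}"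

definition steinberg ::
    "'r::comm_ring_1 itself \<Rightarrow> (nat \<Rightarrow> pt set) \<Rightarrow> (pt \<times> 'r) gword set monoid" where
  "steinberg _ PP = presented_group (st_gens PP) (st_rels PP)"

definition st_gen :: "(nat \<Rightarrow> pt set) \<Rightarrow> pt \<Rightarrow> 'r::comm_ring_1 \<Rightarrow> (pt \<times> 'r) gword set" where
  "st_gen PP v \<alpha> = pres_cong (st_gens PP) (st_rels PP) `` {[(True, (v, \<alpha>))]}"


section \<open>Graphs and their paths\<close>

text \<open>
  A graph is given by its edge relation. As there are no isolated vertices, the vertex set is
  \<^term>\<open>Field E\<close>. A path is the list of its edges; vertices may be repeated a priori, but the last
  condition of \<open>graph\<close> rules out directed cycles.
\<close>

definition dpaths :: "'n rel \<Rightarrow> ('n \<times> 'n) list set" where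
  "dpaths E = {p. p \<noteq> [] \<and> set p \<subseteq> E \<and> (\<forall>i. Suc i < length p \<longrightarrow> snd (p ! i) = fst (p ! Suc i))}"

definition path_start :: "('n \<times> 'n) list \<Rightarrow> 'n" where
  "path_start p = fst (hd p)"

definition path_end :: "('n \<times> 'n) list \<Rightarrow> 'n" where
  "path_end p = snd (last p)"

definition graph :: "'n rel \<Rightarrow> bool" where
  "graph E \<longleftrightarrow> finite E \<and> irrefl E \<and>
     (\<forall>(a, b) \<in> E. \<forall>p \<in> dpaths E. path_start p = a \<and> path_end p = b \<longrightarrow> p = [(a, b)])"

definition same_ends :: "'n rel \<Rightarrow> ('n \<times> 'n) list rel" where
  "same_ends E = {(p, q). p \<in> dpaths E \<and> q \<in> dpaths E \<and>
                          path_start p = path_start q \<and> path_end p = path_end q}"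

definition path_bar :: "'n rel \<Rightarrow> ('n \<times> 'n) list set set" where
  "path_bar E = dpaths E // same_ends E"

definition bar_prod ::
    "'n rel \<Rightarrow> ('n \<times> 'n) list set \<Rightarrow> ('n \<times> 'n) list set \<Rightarrow> ('n \<times> 'n) list set option" where
  "bar_prod E C D =
     (if \<exists>p\<in>C. \<exists>q\<in>D. path_end p = path_start q
      then Some (\<Union>p\<in>C. \<Union>q\<in>D. same_ends E `` {p @ q}) else None)"

definition edge_le :: "'n rel \<Rightarrow> 'n \<times> 'n \<Rightarrow> 'n \<times> 'n \<Rightarrow> bool" where
  "edge_le E f g \<longleftrightarrow> (\<exists>p\<in>dpaths E. hd p = f \<and> last p = g)"

definition edge_chain :: "'n rel \<Rightarrow> 'n \<times> 'n \<Rightarrow> nat \<Rightarrow> bool" where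
  "edge_chain E f r \<longleftrightarrow>
     (\<exists>fs. fs \<noteq> [] \<and> length fs = r \<and> set fs \<subseteq> E \<and> last fs = f \<and>
           sorted_wrt (\<lambda>g h. edge_le E g h \<and> g \<noteq> h) fs)"

definition edge_degree :: "'n rel \<Rightarrow> 'n \<times> 'n \<Rightarrow> nat" where
  "edge_degree E f = (THE r. edge_chain E f r \<and> \<not> edge_chain E f (Suc r))"

definition max_degree :: "'n rel \<Rightarrow> nat" where
  "max_degree E = Max (insert 0 (edge_degree E ` E))"


section \<open>Rigid systems\<close>

text \<open>
  A partial product is a map \<open>m\<close> into an option type. For column vectors \<open>uv = u + v\<close> whenever \<open>uv\<close>
  exists, so the value of any existing product \<open>v_1 \<cdots> v_m\<close> is the sum of its factors.
\<close>

definition strong_prods :: "(pt \<Rightarrow> pt \<Rightarrow> pt option) \<Rightarrow> pt set \<Rightarrow> pt set" where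
  "strong_prods m V = {sum_list vs | vs. vs \<noteq> [] \<and> set vs \<subseteq> V \<and>
     (\<forall>i. Suc i < length vs \<longrightarrow> m (vs ! i) (vs ! Suc i) \<noteq> None) \<and>
     (\<forall>r s. r < s \<and> s < length vs \<longrightarrow> (\<Sum>i=r..s. vs ! i) \<noteq> 0)}"

inductive weak_prod :: "(pt \<Rightarrow> pt \<Rightarrow> pt option) \<Rightarrow> pt list \<Rightarrow> pt \<Rightarrow> bool" for m where
  single: "weak_prod m [v] v"
| bracket: "weak_prod m us a \<Longrightarrow> weak_prod m vs b \<Longrightarrow> m a b = Some c \<Longrightarrow> weak_prod m (us @ vs) c"

definition weak_prods :: "(pt \<Rightarrow> pt \<Rightarrow> pt option) \<Rightarrow> pt set \<Rightarrow> pt set" where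
  "weak_prods m V = {a. \<exists>vs. set vs \<subseteq> V \<and> weak_prod m vs a}"

definition partial_prod_iso ::
    "('a \<Rightarrow> 'b) \<Rightarrow> 'a set \<Rightarrow> ('a \<Rightarrow> 'a \<Rightarrow> 'a option) \<Rightarrow> 'b set \<Rightarrow> ('b \<Rightarrow> 'b \<Rightarrow> 'b option) \<Rightarrow> bool" where
  "partial_prod_iso h A m B m' \<longleftrightarrow> bij_betw h A B \<and>
     (\<forall>x\<in>A. \<forall>y\<in>A. map_option h (m x y) = m' (h x) (h y))"

text \<open>\<open>E\<close> supports \<open>V\<close> by means of the fixed isomorphism \<open>h\<close>.\<close>

definition supports ::
    "(pt \<Rightarrow> pt \<Rightarrow> pt option) \<Rightarrow> pt set \<Rightarrow> 'n rel \<Rightarrow> (pt \<Rightarrow> ('n \<times> 'n) list set) \<Rightarrow> bool" where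
  "supports m V E h \<longleftrightarrow>
     graph E \<and> partial_prod_iso h (strong_prods m V) m (path_bar E) (bar_prod E)"

text \<open>Finite graphs may be taken on natural numbers, hence the type of the existential below.\<close>

definition rigid :: "pt set \<Rightarrow> pt set \<Rightarrow> bool" where
  "rigid P V \<longleftrightarrow> V \<subseteq> Col P \<and>
     \<not> (\<exists>v. v \<in> strong_prods (col_prod P) V \<and> - v \<in> strong_prods (col_prod P) V) \<and>
     strong_prods (col_prod P) V = weak_prods (col_prod P) V \<and>
     (\<exists>(E :: nat rel) h. supports (col_prod P) V E h)"

definition spec_rigid :: "(nat \<Rightarrow> pt set) \<Rightarrow> pt set \<Rightarrow> bool" where
  "spec_rigid PP V \<longleftrightarrow> (\<exists>j. rigid (PP j) V)"

text \<open>
  \<open>degree_part\<close> is \<open>[V]^r\<close> and \<open>degree_tail\<close> is \<open>[V]_r\<close>. All paths in a class have the same initial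
  vertex, hence initial edges of the same degree.
\<close>

definition degree_part ::
    "(pt \<Rightarrow> pt \<Rightarrow> pt option) \<Rightarrow> pt set \<Rightarrow> 'n rel \<Rightarrow> (pt \<Rightarrow> ('n \<times> 'n) list set) \<Rightarrow> nat \<Rightarrow> pt set" where
  "degree_part m V E h r = {v \<in> strong_prods m V. \<exists>p\<in>h v. edge_degree E (hd p) = r}"

definition degree_tail ::
    "(pt \<Rightarrow> pt \<Rightarrow> pt option) \<Rightarrow> pt set \<Rightarrow> 'n rel \<Rightarrow> (pt \<Rightarrow> ('n \<times> 'n) list set) \<Rightarrow> nat \<Rightarrow> pt set" where
  "degree_tail m V E h r = {v \<in> strong_prods m V. \<exists>p\<in>h v. r \<le> edge_degree E (hd p)}"


section \<open>The filtration of a triangular group\<close>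

definition additive_group :: "'r::comm_ring_1 monoid" where
  "additive_group = \<lparr>carrier = UNIV, mult = (+), one = 0\<rparr>"

definition additive_power :: "nat \<Rightarrow> (nat \<Rightarrow> 'r::comm_ring_1) monoid" where
  "additive_power N = product_group {..<N} (\<lambda>_. additive_group)"

text \<open>
  \<open>\<tau>\<close> and \<open>A\<close> for an enumeration \<open>vs\<close> of \<open>[V]^r\<close>; \<open>\<Gamma>\<close> and \<open>g\<close> are as for \<^const>\<open>gen_subgroup\<close>.
\<close>

definition tau :: "'g monoid \<Rightarrow> (pt \<Rightarrow> 'r \<Rightarrow> 'g) \<Rightarrow> pt list \<Rightarrow> (nat \<Rightarrow> 'r) \<Rightarrow> 'g" where
  "tau \<Gamma> g vs l = foldr (\<lambda>i a. g (vs ! i) (l i) \<otimes>\<^bsub>\<Gamma>\<^esub> a) [0..<length vs] \<one>\<^bsub>\<Gamma>\<^esub>"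

definition tau_image :: "'g monoid \<Rightarrow> (pt \<Rightarrow> 'r::comm_ring_1 \<Rightarrow> 'g) \<Rightarrow> pt list \<Rightarrow> 'g set" where
  "tau_image \<Gamma> g vs = tau \<Gamma> g vs ` carrier (additive_power (length vs))"

text \<open>\<open>\<epsilon> = \<epsilon>_r \<epsilon>_{r+1} \<cdots> \<epsilon>_t\<close> with \<open>\<epsilon>_s \<in> A s\<close>.\<close>

definition canonical_rep ::
    "'g monoid \<Rightarrow> (nat \<Rightarrow> 'g set) \<Rightarrow> nat \<Rightarrow> nat \<Rightarrow> 'g \<Rightarrow> (nat \<Rightarrow> 'g) \<Rightarrow> bool" where
  "canonical_rep \<Gamma> A r t \<epsilon> es \<longleftrightarrow> es \<in> (\<Pi>\<^sub>E s\<in>{r..t}. A s) \<and>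
     \<epsilon> = foldr (\<lambda>s a. es s \<otimes>\<^bsub>\<Gamma>\<^esub> a) [r..<Suc t] \<one>\<^bsub>\<Gamma>\<^esub>"

definition strip_first :: "'g monoid \<Rightarrow> (nat \<Rightarrow> 'g set) \<Rightarrow> nat \<Rightarrow> nat \<Rightarrow> 'g \<Rightarrow> 'g" where
  "strip_first \<Gamma> A r t \<epsilon> = inv\<^bsub>\<Gamma>\<^esub> ((THE es. canonical_rep \<Gamma> A r t \<epsilon> es) r) \<otimes>\<^bsub>\<Gamma>\<^esub> \<epsilon>"

end

theory Submission
  imports Defs
begin

text \<open>
  Everything rests on the integers \<open>\<langle>P_w,u\<rangle>\<close> for column vectors \<open>u\<close>, \<open>w\<close>. They are at least \<open>-1\<close>, with
  equality exactly for equal base facets; they are at most 1 by balancedness, which survives doubling;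
  and \<open>uw\<close> exists precisely when \<open>u + w \<noteq> 0\<close> and the value is 1. With this, the Steinberg relations
  for the \<open>e_v\<close> are binomial identities on monomials.

  A rigid system thus gives elements \<open>x_p\<close>, \<open>p\<close> in the transitive closure of the edges, that satisfy the relations
  of elementary unitriangular matrices, both in \<open>\<bbbE>(R,P)\<close> and in \<open>St(R,P)\<close>. Independence is detected by
  coefficients: let \<open>x\<close> be a monomial of height 1 over the base facet of \<open>v\<close>, and let \<open>g\<close> be a product of
  elements \<open>e_w\<close> with \<open>w\<close> in a product-closed set in which \<open>v\<close> is not a product. The coefficient of \<open>v x\<close> in
  \<open>g x\<close> is then the sum of the parameters of the factors \<open>e_v\<close>, because a sum of at least two
  elements of such a set is never \<open>v\<close>. Composed with the natural map, the same coefficients are available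
  in the Steinberg group.

  Removing the elements of a finite transitive relation one by one, shortest first, yields normal forms
  from these coefficients. Hence a homomorphism that matches the generators of two triangular groups with the
  same \<open>\<bold>F\<close> is an isomorphism; this gives (d) directly, and (b) through the subgroup of the product
  generated by the pairs. In (c), the coefficients at \<open>v \<in> [V] - [U]\<close> vanish on \<open>G(R,U)\<close>, so that only
  factors from \<open>[U] \<inter> [V]\<close> are left in the normal form.
\<close>

section \<open>Finitely supported sequences\<close>

text \<open>The parameter of \<open>e_v\<close> can be read off over any commutative ring because a
  monomial of height 1 meets \<open>1 + \<alpha> v\<close> only to the first power, so no binomial
  coefficients enter. The price is that other factors must not interfere. Their contributions to
  \<open>v x\<close> are excluded only while \<open>v\<close> is not a product inside the set of
  column vectors at hand, and a product of two pairs has more intermediate vertices than either of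
  them; this dictates the order in which pairs are split off and the requirement that the remaining
  set stay closed under products. That \<open>v\<close> lowers its own facet form by exactly 1 comes
  from walking along \<open>v\<close> until the base facet is reached, combined with the fact that
  the lattice points of \<open>P\<close> generate the lattice. A triangular group has no
  presentation to start from, so a map given on generators is not known to be well defined. What is
  available is the converse: an existing homomorphism that matches generators is injective as soon
  as its target has coefficients. The natural map and the two projections of a product are such
  homomorphisms.\<close>

abbreviation ee :: "nat \<Rightarrow> pt" where "ee i \<equiv> Poly_Mapping.single i 1"
abbreviation lk :: "pt \<Rightarrow> nat \<Rightarrow> real" where "lk \<equiv> Poly_Mapping.lookup"

lemma lookup_scaleR: "lk (r *\<^sub>R x) i = r * lk x i"
proof -
  have "finite {i. r *\<^sub>R lk x i \<noteq> 0}"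
    by (rule finite_subset[of _ "{i. lk x i \<noteq> 0}"]) auto
  then show ?thesis by (simp add: scaleR_poly_mapping_def)
qed

lemma linear_lookup: "linear (\<lambda>x. lk x i)"
  by (rule linearI) (simp_all add: lookup_add lookup_scaleR)

lemma Rn_iff: "x \<in> Rn n \<longleftrightarrow> (\<forall>i\<ge>n. lk x i = 0)"
  by (auto simp: Rn_def in_keys_iff subset_iff not_le)

lemma subspace_Rn: "subspace (Rn n)"
  by (auto simp: subspace_def Rn_iff lookup_add lookup_scaleR)

lemma scaleR_ee: "r *\<^sub>R ee i = Poly_Mapping.single i r"
  by (rule poly_mapping_eqI) (simp add: lookup_scaleR lookup_single when_def)

lemma Rn_expand:
  assumes "x \<in> Rn n" shows "x = (\<Sum>i<n. lk x i *\<^sub>R ee i)"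
proof (rule poly_mapping_eqI)
  fix k
  have "lk (\<Sum>i<n. lk x i *\<^sub>R ee i) k = (\<Sum>i<n. if i = k then lk x i else 0)"
    by (simp add: lookup_sum lookup_scaleR lookup_single when_def if_distrib cong: if_cong)
  also have "\<dots> = lk x k" using assms by (auto simp: Rn_iff)
  finally show "lk x k = lk (\<Sum>i<n. lk x i *\<^sub>R ee i) k" by simp
qed

lemma ee_in_Rn: "i < n \<Longrightarrow> ee i \<in> Rn n"
  by (auto simp: Rn_iff lookup_single when_def)

lemma Rn_eq_span: "Rn n = span (ee ` {..<n})"
proof
  show "Rn n \<subseteq> span (ee ` {..<n})"
  proof
    fix x assume "x \<in> Rn n"
    then have "x = (\<Sum>i<n. lk x i *\<^sub>R ee i)" by (rule Rn_expand)
    also have "\<dots> \<in> span (ee ` {..<n})"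
      by (intro span_sum span_scale span_base) auto
    finally show "x \<in> span (ee ` {..<n})" .
  qed
  show "span (ee ` {..<n}) \<subseteq> Rn n"
    by (rule span_minimal) (auto simp: subspace_Rn intro: ee_in_Rn)
qed

lemma linear_Rn:
  assumes "linear \<phi>" "x \<in> Rn n" shows "\<phi> x = (\<Sum>i<n. lk x i *\<^sub>R \<phi> (ee i))"
proof -
  have "\<phi> x = \<phi> (\<Sum>i<n. lk x i *\<^sub>R ee i)" using Rn_expand[OF assms(2)] by simp
  then show ?thesis by (simp only: linear_sum[OF assms(1)] linear_scale[OF assms(1)])
qed

lemma in_some_Rn: "\<exists>N\<ge>n. x \<in> Rn N"
proof -
  obtain m where "\<forall>i\<in>Poly_Mapping.keys x. i < m"
    using finite_nat_set_iff_bounded[of "Poly_Mapping.keys x"] by auto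
  then have "x \<in> Rn (max n m)" by (fastforce simp: Rn_def)
  then show ?thesis by (meson max.cobounded1)
qed

lemma linear_eq_ee:
  assumes "linear \<phi>" "linear \<psi>" "\<And>i. \<phi> (ee i) = \<psi> (ee i)" shows "\<phi> = \<psi>"
proof
  fix x obtain N where "x \<in> Rn N" using in_some_Rn by blast
  then show "\<phi> x = \<psi> x" using linear_Rn[of \<phi> x N] linear_Rn[of \<psi> x N] assms by simp
qed

lemma card_ee: "card (ee ` {..<n}) = n"
  by (subst card_image) (auto simp: inj_on_def, metis lookup_single_eq lookup_single_not_eq zero_neq_one)

lemma independent_ee: "independent (ee ` {..<n})"
proof (induction n)
  case (Suc n)
  have "ee n \<notin> span (ee ` {..<n})"
    by (simp add: Rn_eq_span[symmetric] Rn_iff) (metis lookup_single_eq order_refl zero_neq_one)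
  then have "independent (insert (ee n) (ee ` {..<n}))" by (rule independent_insertI) (rule Suc)
  then show ?case by (simp add: lessThan_Suc)
qed (simp add: independent_empty)

text \<open>The ambient space has infinite dimension, so dimension counts inside \<open>Rn n\<close>
  go through the exchange lemma, with the unit vectors as finite spanning set.\<close>

lemma Rn_independent_bound:
  assumes "independent B" "B \<subseteq> Rn n" shows "finite B \<and> card B \<le> n"
  using independent_span_bound[of "ee ` {..<n}" B] assms by (simp add: Rn_eq_span card_ee)

lemma Rn_subset_span_card:
  assumes "Rn n \<subseteq> span B" "finite B" shows "n \<le> card B"
  using independent_span_bound[OF assms(2) independent_ee[of n]] assms(1)
  by (auto simp: card_ee intro: ee_in_Rn)

lemma Rn_span_full:
  assumes "independent B" "B \<subseteq> Rn n" "card B = n" shows "Rn n \<subseteq> span B"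
proof
  fix x assume x: "x \<in> Rn n"
  show "x \<in> span B"
  proof (rule ccontr)
    assume nx: "x \<notin> span B"
    then have "independent (insert x B)" using assms by (intro independent_insertI)
    then have "card (insert x B) \<le> n" using Rn_independent_bound[of "insert x B" n] assms x by auto
    moreover have "x \<notin> B" using nx span_base by blast
    ultimately show False using assms Rn_independent_bound[OF assms(1,2)] by simp
  qed
qed

text \<open>Makes the description in \<open>pdim\<close> unambiguous: the affine hull determines the
  number of coordinates.\<close>

lemma Rn_inject: "Rn n = Rn m \<longleftrightarrow> n = m"
proof
  assume eq: "Rn n = Rn m"
  show "n = m" using Rn_subset_span_card[of n "ee ` {..<m}"] Rn_subset_span_card[of m "ee ` {..<n}"]
    eq by (simp add: Rn_eq_span card_ee)
qed simp

lemma Rn_mono: "n \<le> m \<Longrightarrow> Rn n \<subseteq> Rn m" by (auto simp: Rn_iff)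

lemma pdim_eqI: "affine hull P = Rn n \<Longrightarrow> pdim P = n"
  unfolding pdim_def by (rule the_equality) (auto simp: Rn_inject)

lemma Zn_iff: "x \<in> Zn n \<longleftrightarrow> (\<forall>i\<ge>n. lk x i = 0) \<and> (\<forall>i. lk x i \<in> \<int>)"
  by (auto simp: Zn_def Rn_iff)

lemma Zn_mono: "n \<le> m \<Longrightarrow> Zn n \<subseteq> Zn m" by (auto simp: Zn_iff)
lemma Zn_sub_Rn: "Zn n \<subseteq> Rn n" by (auto simp: Zn_def)
lemma Zn_0: "0 \<in> Zn n" by (auto simp: Zn_iff)
lemma Zn_add: "x \<in> Zn n \<Longrightarrow> y \<in> Zn n \<Longrightarrow> x + y \<in> Zn n" by (auto simp: Zn_iff lookup_add)
lemma Zn_diff: "x \<in> Zn n \<Longrightarrow> y \<in> Zn n \<Longrightarrow> x - y \<in> Zn n" by (auto simp: Zn_iff lookup_minus)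
lemma Zn_scale: "x \<in> Zn n \<Longrightarrow> r \<in> \<int> \<Longrightarrow> r *\<^sub>R x \<in> Zn n" by (auto simp: Zn_iff lookup_scaleR)
lemma ee_in_Zn: "i < n \<Longrightarrow> ee i \<in> Zn n"
  by (auto simp: Zn_iff lookup_single when_def)

section \<open>Affine dimension and faces of convex hulls\<close>

lemma subspace_translate_eq:
  fixes S T :: "'a::real_vector set"
  assumes "subspace S" "subspace T" "(+) a ` S = (+) b ` T" shows "S = T"
proof -
  have inc: "S \<subseteq> T" if "subspace S" "subspace T" "(+) a ` S = (+) b ` T" for S T :: "'a set" and a b
  proof
    fix s assume "s \<in> S"
    then have "a + s \<in> (+) b ` T" using that by auto
    then obtain t where t: "t \<in> T" "a + s = b + t" by auto
    have "a + 0 \<in> (+) b ` T" using that(3) subspace_0[OF that(1)] by blast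
    then obtain t' where t': "t' \<in> T" "a = b + t'" by auto
    have "s = t - t'" using t t' by (simp add: algebra_simps)
    then show "s \<in> T" using t t' that(2) subspace_diff by blast
  qed
  show ?thesis using inc[OF assms] inc[OF assms(2,1) assms(3)[symmetric]] by blast
qed

text \<open>For \<open>a\<close> in \<open>F\<close> the span of these differences is the direction
  space of the affine hull of \<open>F\<close>; facet dimensions are computed there.\<close>

definition dirs :: "pt set \<Rightarrow> pt \<Rightarrow> pt set" where "dirs F a = (\<lambda>x. x - a) ` F"

lemma affine_hull_dirs:
  assumes "a \<in> F" shows "affine hull F = (+) a ` span (dirs F a)"
proof -
  have "(\<lambda>x. - a + x) ` F = dirs F a" by (auto simp: dirs_def)
  then show ?thesis using affine_hull_span_gen[OF hull_inc[OF assms]] by metis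
qed

text \<open>Translation by a base point removes one element from an affine basis and leaves a linear
  basis of the direction space. The clause of \<open>facet\<close> about affine bases thus becomes a
  condition on \<open>dim\<close>, with \<open>Suc\<close> for the removed point.\<close>

lemma affine_basis_card:
  assumes "a \<in> F" "F \<subseteq> Rn n"
  shows "(\<exists>B. finite B \<and> \<not> affine_dependent B \<and> affine hull B = affine hull F \<and> card B = m)
     \<longleftrightarrow> Suc (dim (dirs F a)) = m"
proof
  assume "\<exists>B. finite B \<and> \<not> affine_dependent B \<and> affine hull B = affine hull F \<and> card B = m"
  then obtain B where B: "finite B" "\<not> affine_dependent B" "affine hull B = affine hull F" "card B = m"
    by blast
  have "a \<in> affine hull B" using assms(1) B(3) by (simp add: hull_inc)
  then have "B \<noteq> {}" by (metis affine_hull_empty empty_iff)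
  then obtain b where b: "b \<in> B" by blast
  let ?C = "(\<lambda>x. - b + x) ` (B - {b})"
  have ind: "independent ?C" using affine_dependent_iff_dependent2[OF b] B by simp
  have "(+) b ` span ?C = (+) a ` span (dirs F a)"
    using affine_hull_span2[OF b] affine_hull_dirs[OF assms(1)] B(3) by metis
  then have sC: "span ?C = span (dirs F a)" by (rule subspace_translate_eq[OF subspace_span subspace_span])
  have "dim (dirs F a) = dim (span ?C)" unfolding sC by (rule real_vector.dim_span[symmetric])
  also have "\<dots> = card ?C" by (rule real_vector.dim_span_eq_card_independent[OF ind])
  also have "\<dots> = card (B - {b})" by (rule card_image) (auto simp: inj_on_def)
  also have "\<dots> = m - 1" using B b by simp
  finally show "Suc (dim (dirs F a)) = m" using B(1,4) b by (metis Suc_diff_1 card_gt_0_iff empty_iff)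
next
  assume m: "Suc (dim (dirs F a)) = m"
  have sub: "dirs F a \<subseteq> Rn n" using assms by (auto simp: dirs_def intro: subspace_diff[OF subspace_Rn])
  obtain C where C: "C \<subseteq> dirs F a" "independent C" "dirs F a \<subseteq> span C" "card C = dim (dirs F a)"
    using real_vector.basis_exists by blast
  have fC: "finite C" using Rn_independent_bound[of C n] C sub by blast
  have sp: "span C = span (dirs F a)"
    using span_mono[OF C(1)] span_mono[OF C(3)] unfolding span_span by (rule subset_antisym)
  have z: "0 \<notin> C" using C(2) dependent_zero by blast
  let ?B = "insert a ((+) a ` C)"
  have an: "a \<notin> (+) a ` C" using z by force
  have e: "(\<lambda>x. - a + x) ` ((+) a ` C) = C" by (auto simp: image_image)
  have "\<not> affine_dependent ?B" using affine_dependent_iff_dependent[OF an] e C by simp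
  moreover have "affine hull ?B = affine hull F"
    unfolding affine_hull_insert_span_gen e sp affine_hull_dirs[OF assms(1)] ..
  moreover have "card ?B = m" using an fC m C(4) by (simp add: card_image)
  ultimately show "\<exists>B. finite B \<and> \<not> affine_dependent B \<and> affine hull B = affine hull F \<and> card B = m"
    using fC by (metis finite_imageI finite_insert)
qed

lemma facet_iff:
  assumes "a \<in> F" "F \<subseteq> Rn (pdim P)"
  shows "facet P F \<longleftrightarrow> F face_of P \<and> Suc (dim (dirs F a)) = pdim P"
  using affine_basis_card[OF assms, of "pdim P"] assms unfolding facet_def by auto

text \<open>The weight \<open>1 - sum u C\<close> missing from the combination is placed on
  \<open>a\<close>.\<close>

lemma convex_combination_from:
  fixes F :: "'a::real_vector set"
  assumes "convex F" "a \<in> F" "finite C" "\<And>t. t \<in> C \<Longrightarrow> a + t \<in> F"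
    "\<And>t. t \<in> C \<Longrightarrow> 0 \<le> u t" "sum u C \<le> 1"
  shows "a + (\<Sum>t\<in>C. u t *\<^sub>R t) \<in> F"
proof (cases "sum u C = 0")
  case True
  then have "\<forall>t\<in>C. u t = 0" using assms by (simp add: sum_nonneg_eq_0_iff)
  then show ?thesis using assms by simp
next
  case False
  let ?s = "sum u C"
  have s: "0 < ?s" using False sum_nonneg[of C u] assms(5) by (simp add: less_le)
  have 1: "(\<Sum>t\<in>C. (u t / ?s) *\<^sub>R (a + t)) \<in> F"
    by (rule convex_sum) (use assms s in \<open>auto simp: sum_divide_distrib[symmetric]\<close>)
  have "(1 - ?s) *\<^sub>R a + ?s *\<^sub>R (\<Sum>t\<in>C. (u t / ?s) *\<^sub>R (a + t)) \<in> F"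
    using assms s by (intro convexD[OF assms(1) assms(2) 1]) auto
  also have "?s *\<^sub>R (\<Sum>t\<in>C. (u t / ?s) *\<^sub>R (a + t)) = (\<Sum>t\<in>C. u t *\<^sub>R (a + t))"
    using s by (simp add: scaleR_sum_right)
  also have "\<dots> = ?s *\<^sub>R a + (\<Sum>t\<in>C. u t *\<^sub>R t)"
    by (simp add: scaleR_add_right sum.distrib scaleR_sum_left)
  finally show ?thesis by (simp add: algebra_simps)
qed

text \<open>In a convex combination that attains the minimum \<open>b\<close>, every point with
  positive weight attains it as well, since all terms \<open>u s * (\<phi> s - b)\<close> are
  nonnegative and sum to zero.\<close>

lemma convex_hull_Int_face:
  fixes \<phi> :: "'a::real_vector \<Rightarrow> real"
  assumes "finite S" "linear \<phi>" "\<And>x. x \<in> convex hull S \<Longrightarrow> b \<le> \<phi> x"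
  shows "{x \<in> convex hull S. \<phi> x = b} = convex hull {s \<in> S. \<phi> s = b}"
proof
  show "convex hull {s \<in> S. \<phi> s = b} \<subseteq> {x \<in> convex hull S. \<phi> x = b}"
  proof (rule hull_minimal)
    show "{s \<in> S. \<phi> s = b} \<subseteq> {x \<in> convex hull S. \<phi> x = b}" by (auto simp: hull_inc)
    have "convex (convex hull S \<inter> \<phi> -` {b})"
      using assms(2) by (intro convex_Int convex_linear_vimage) auto
    moreover have "convex hull S \<inter> \<phi> -` {b} = {x \<in> convex hull S. \<phi> x = b}" by auto
    ultimately show "convex {x \<in> convex hull S. \<phi> x = b}" by simp
  qed
  show "{x \<in> convex hull S. \<phi> x = b} \<subseteq> convex hull {s \<in> S. \<phi> s = b}"
  proof
    fix x assume x: "x \<in> {x \<in> convex hull S. \<phi> x = b}"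
    then obtain u where u: "\<forall>s\<in>S. 0 \<le> u s" "sum u S = 1" "x = (\<Sum>s\<in>S. u s *\<^sub>R s)"
      using convex_hull_finite[OF assms(1)] by auto
    have "(\<Sum>s\<in>S. u s * (\<phi> s - b)) = \<phi> x - b"
      using u by (simp add: right_diff_distrib sum_subtractf linear_sum[OF assms(2)]
          linear_scale[OF assms(2)] sum_distrib_right[symmetric])
    then have "(\<Sum>s\<in>S. u s * (\<phi> s - b)) = 0" using x by simp
    moreover have ge: "0 \<le> u s * (\<phi> s - b)" if "s \<in> S" for s
      using that u(1) assms(3)[OF hull_inc[of s S]] by simp
    ultimately have z: "\<forall>s\<in>S. u s * (\<phi> s - b) = 0"
      using assms(1) by (simp add: sum_nonneg_eq_0_iff)
    let ?T = "{s \<in> S. \<phi> s = b}"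
    have "sum u ?T = sum u S" by (rule sum.mono_neutral_left) (use assms(1) z in auto)
    moreover have "(\<Sum>s\<in>?T. u s *\<^sub>R s) = (\<Sum>s\<in>S. u s *\<^sub>R s)"
      by (rule sum.mono_neutral_left) (use assms(1) z in auto)
    moreover have "finite ?T" using assms(1) by simp
    moreover have "\<forall>s\<in>?T. 0 \<le> u s" using u(1) by simp
    ultimately show "x \<in> convex hull ?T"
      using u by (subst convex_hull_finite) (auto intro!: exI[of _ u])
  qed
qed

lemma exposed_face_of_linear:
  fixes \<phi> :: "'a::real_vector \<Rightarrow> real"
  assumes "linear \<phi>" "convex P" "\<And>x. x \<in> P \<Longrightarrow> b \<le> \<phi> x"
  shows "{x \<in> P. \<phi> x = b} face_of P"
  unfolding face_of_def
proof (intro conjI ballI impI)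
  have "convex (P \<inter> \<phi> -` {b})" using assms by (intro convex_Int convex_linear_vimage) auto
  moreover have "P \<inter> \<phi> -` {b} = {x \<in> P. \<phi> x = b}" by auto
  ultimately show "convex {x \<in> P. \<phi> x = b}" by simp
next
  fix p q x assume pq: "p \<in> P" "q \<in> P" and x: "x \<in> {x \<in> P. \<phi> x = b}" "x \<in> open_segment p q"
  obtain u where u: "0 < u" "u < 1" "x = (1 - u) *\<^sub>R p + u *\<^sub>R q"
    using x(2) by (auto simp: in_segment)
  have "(1 - u) * (\<phi> p - b) + u * (\<phi> q - b) = \<phi> x - b"
    unfolding u(3) linear_add[OF assms(1)] linear_scale[OF assms(1)] by (simp add: algebra_simps)
  then have e: "(1 - u) * (\<phi> p - b) + u * (\<phi> q - b) = 0" using x by simp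
  have "0 \<le> (1 - u) * (\<phi> p - b)" "0 \<le> u * (\<phi> q - b)" using u assms(3) pq by simp_all
  then have "(1 - u) * (\<phi> p - b) = 0" "u * (\<phi> q - b) = 0" using e by linarith+
  then show "p \<in> {x \<in> P. \<phi> x = b}" "q \<in> {x \<in> P. \<phi> x = b}" using u pq by auto
qed auto

lemma polytope_integral_vertices:
  fixes P :: "'a::real_vector set"
  assumes "polytope P" shows "\<exists>S. finite S \<and> P = convex hull S \<and> (\<forall>s\<in>S. s extreme_point_of P)"
proof -
  obtain S0 where S0: "finite S0" "P = convex hull S0" using assms unfolding polytope_def by blast
  \<comment> \<open>A generating set of least size has no redundant point, and a point outside the
    hull of the others is extreme.\<close>
  define k where "k = (LEAST k. \<exists>S. finite S \<and> P = convex hull S \<and> card S = k)"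
  have "\<exists>S. finite S \<and> P = convex hull S \<and> card S = k"
    unfolding k_def by (rule LeastI[of _ "card S0"]) (use S0 in blast)
  then obtain S where S: "finite S" "P = convex hull S" "card S = k" by blast
  have "s extreme_point_of P" if s: "s \<in> S" for s
  proof -
    have n: "s \<notin> convex hull (S - {s})"
    proof
      assume "s \<in> convex hull (S - {s})"
      then have "P = convex hull (S - {s})" using S(2) s by (metis hull_redundant insert_Diff)
      then have "k \<le> card (S - {s})" unfolding k_def by (intro Least_le) (use S(1) in blast)
      then show False using s S by (metis card_Diff1_less not_le)
    qed
    show ?thesis using extreme_point_of_convex_hull_insert[OF _ n] S s by (simp add: insert_absorb)
  qed
  then show ?thesis using S by blast
qed

section \<open>Facets and facet forms\<close>

text \<open>\<open>S\<close> is any finite set of lattice points with hull \<open>P\<close>. It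
  carries the finiteness arguments, and for a doubling such a set is explicit: the points of
  \<open>S\<close> and their lifts.\<close>

locale lpoly =
  fixes P :: "pt set" and n :: nat and S :: "pt set"
  assumes finS: "finite S" and SZ: "S \<subseteq> Zn n" and PS: "P = convex hull S"
    and affP: "affine hull P = Rn n"
    and gen: "\<And>A. affine_sublattice n A \<Longrightarrow> P \<inter> Zn n \<subseteq> A \<Longrightarrow> A = Zn n"

lemma lpoly_of_lattice_polytope:
  assumes "lattice_polytope P" shows "\<exists>S. lpoly P (pdim P) S"
proof -
  obtain n where n: "affine hull P = Rn n" "\<forall>x. x extreme_point_of P \<longrightarrow> x \<in> Zn n"
    "\<forall>A. affine_sublattice n A \<and> lattice_points P \<subseteq> A \<longrightarrow> A = Zn n" "polytope P"
    using assms unfolding lattice_polytope_def by blast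
  obtain S where S: "finite S" "P = convex hull S" "\<forall>s\<in>S. s extreme_point_of P"
    using polytope_integral_vertices[OF n(4)] by blast
  have p: "pdim P = n" using n(1) by (rule pdim_eqI)
  have "lpoly P n S" using n S p by unfold_locales (auto simp: lattice_points_def)
  then show ?thesis using p by blast
qed

context lpoly begin

lemma pdimP: "pdim P = n" using affP by (rule pdim_eqI)

abbreviation "L \<equiv> P \<inter> Zn n"

lemma lattice_pts: "lattice_points P = L" by (simp add: lattice_points_def pdimP)

lemma lattice_polytopeI: "lattice_polytope P"
  unfolding lattice_polytope_def
proof (intro conjI exI[of _ n] allI impI)
  show "polytope P" using finS PS by (auto simp: polytope_def)
  show "x \<in> Zn n" if "x extreme_point_of P" for x
    using that extreme_point_of_convex_hull[of x S] SZ unfolding PS by blast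
qed (use affP gen lattice_pts in auto)

lemma convexP: "convex P" by (simp add: PS)
lemma P_sub: "P \<subseteq> Rn n" using affP hull_subset[of P affine] by simp
lemma S_sub: "S \<subseteq> L" using SZ hull_subset[of S convex] by (auto simp: PS)

lemma P_ne: "P \<noteq> {}"
proof
  assume "P = {}"
  then have "Rn n = {}" using affP by simp
  then show False using subspace_0[OF subspace_Rn] by blast
qed

lemma S_ne: "S \<noteq> {}" using P_ne by (auto simp: PS)

text \<open>The affine space \<open>a + span B\<close> contains \<open>S\<close>, hence the affine
  hull of \<open>P\<close>. This bounds the number of directions from below, both for facets and for
  faces with the column property.\<close>

lemma affine_translate_span_P:
  assumes "a \<in> P" "\<And>s. s \<in> S \<Longrightarrow> s - a \<in> span B" shows "Rn n \<subseteq> span B"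
proof -
  have 1: "P \<subseteq> (+) a ` span B"
    unfolding PS
  proof (rule hull_minimal)
    show "S \<subseteq> (+) a ` span B" using assms(2) by (force simp: image_iff algebra_simps)
    show "convex ((+) a ` span B)" by (intro convex_translation subspace_imp_convex) simp
  qed
  have 2: "Rn n \<subseteq> (+) a ` span B"
    unfolding affP[symmetric]
    by (rule hull_minimal[OF 1]) (metis affine_translation subspace_imp_affine subspace_span)
  show ?thesis
  proof
    fix x assume x: "x \<in> Rn n"
    have "a \<in> Rn n" using assms(1) P_sub by blast
    then have "x + a \<in> Rn n" using x subspace_add[OF subspace_Rn] by blast
    then show "x \<in> span B" using 2 by (auto simp: algebra_simps)
  qed
qed

lemma functional_const_on_P:
  assumes "linear \<psi>" "\<And>x. x \<in> P \<Longrightarrow> \<psi> x = b" "x \<in> Rn n" shows "\<psi> x = 0"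
proof -
  have "P \<subseteq> \<psi> -` {b}" using assms(2) by auto
  then have "affine hull P \<subseteq> \<psi> -` {b}"
    by (intro hull_minimal) (auto simp: affine_def linear_add[OF assms(1)] linear_scale[OF assms(1)]
        scaleR_add_left[symmetric])
  then have "Rn n \<subseteq> \<psi> -` {b}" using affP by simp
  then have "\<psi> x = b" "\<psi> 0 = b" using assms(3) subspace_0[OF subspace_Rn] by auto
  then show ?thesis by (simp add: linear_0[OF assms(1)])
qed

lemma facet_sub: "facet P F \<Longrightarrow> F \<subseteq> P" by (auto simp: facet_def dest: face_of_imp_subset)
lemma facet_ne: "facet P F \<Longrightarrow> F \<noteq> {}" by (auto simp: facet_def)

lemma facet_dirs:
  assumes "facet P F" "a \<in> F"
  obtains C where "C \<subseteq> dirs F a" "independent C" "finite C" "dirs F a \<subseteq> span C" "Suc (card C) = n"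
proof -
  have FR: "F \<subseteq> Rn n" using facet_sub[OF assms(1)] P_sub by blast
  have d: "Suc (dim (dirs F a)) = n" using facet_iff[OF assms(2), of P] FR assms pdimP by simp
  obtain C where C: "C \<subseteq> dirs F a" "independent C" "dirs F a \<subseteq> span C" "card C = dim (dirs F a)"
    using real_vector.basis_exists by blast
  have "dirs F a \<subseteq> Rn n" using FR assms(2) by (auto simp: dirs_def intro: subspace_diff[OF subspace_Rn])
  then have "finite C" using Rn_independent_bound[of C n] C by blast
  then show ?thesis using that C d by metis
qed

text \<open>If all of \<open>S\<close> lay in \<open>F\<close>, the \<open>n - 1\<close> directions
  of the facet would span \<open>Rn n\<close>.\<close>

lemma facet_proper:
  assumes "facet P F" obtains p where "p \<in> S" "p \<notin> F"
proof -
  obtain a where a: "a \<in> F" using facet_ne[OF assms] by blast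
  obtain C where C: "C \<subseteq> dirs F a" "finite C" "dirs F a \<subseteq> span C" "Suc (card C) = n"
    by (rule facet_dirs[OF assms a])
  have "\<exists>p\<in>S. p \<notin> F"
  proof (rule ccontr)
    assume "\<not> ?thesis"
    then have "Rn n \<subseteq> span C"
      using C(3) a facet_sub[OF assms] by (intro affine_translate_span_P) (auto simp: dirs_def)
    then have "n \<le> card C" using Rn_subset_span_card C by blast
    then show False using C by simp
  qed
  then show ?thesis using that by blast
qed

text \<open>The directions of the facet together with one vector leading from \<open>F\<close> to a
  point off \<open>F\<close> form a basis of \<open>Rn n\<close>. A functional that is constant on
  \<open>F\<close> vanishes on the former, so its value on the latter determines it.\<close>

lemma functional_scale:
  fixes \<phi> \<psi> :: "pt \<Rightarrow> real"
  assumes F: "facet P F" and "linear \<phi>" "\<And>x. x \<in> F \<Longrightarrow> \<phi> x = b" "\<And>x. x \<in> P - F \<Longrightarrow> \<phi> x \<noteq> b"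
    and "linear \<psi>" "\<And>x. x \<in> F \<Longrightarrow> \<psi> x = c"
  shows "\<exists>\<kappa>. \<forall>x\<in>Rn n. \<psi> x = \<kappa> * \<phi> x"
proof -
  obtain a where a: "a \<in> F" using facet_ne[OF F] by blast
  obtain C where C: "C \<subseteq> dirs F a" "independent C" "finite C" "dirs F a \<subseteq> span C" "Suc (card C) = n"
    by (rule facet_dirs[OF F a])
  obtain p where p: "p \<in> S" "p \<notin> F" by (rule facet_proper[OF F])
  have pP: "p \<in> P" using p S_sub by blast
  have z\<phi>: "\<phi> x = 0" if "x \<in> C" for x
    using that C(1) assms(3) a by (auto simp: dirs_def linear_diff[OF assms(2)])
  have z\<psi>: "\<psi> x = 0" if "x \<in> C" for x
    using that C(1) assms(6) a by (auto simp: dirs_def linear_diff[OF assms(5)])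
  let ?q = "p - a"
  have q: "\<phi> ?q \<noteq> 0" using assms(3,4) a p pP by (auto simp: linear_diff[OF assms(2)])
  have "\<phi> x = 0" if "x \<in> span C" for x
    using linear_eq_0_on_span[OF assms(2) z\<phi> that] .
  then have qn: "?q \<notin> span C" using q by blast
  have ind: "independent (insert ?q C)" by (rule independent_insertI[OF qn C(2)])
  have FR: "F \<subseteq> Rn n" using facet_sub[OF F] P_sub by blast
  have "C \<subseteq> Rn n" using C(1) FR a by (auto simp: dirs_def intro: subspace_diff[OF subspace_Rn])
  moreover have "?q \<in> Rn n" using pP a FR P_sub by (auto intro: subspace_diff[OF subspace_Rn])
  moreover have "?q \<notin> C" using qn span_base by blast
  ultimately have sp: "Rn n \<subseteq> span (insert ?q C)" using C ind by (intro Rn_span_full) auto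
  define \<kappa> where "\<kappa> = \<psi> ?q / \<phi> ?q"
  have lin: "linear (\<lambda>x. \<kappa> * \<phi> x)"
    using assms(2) linear_compose_scale_right[of \<phi> \<kappa>] by (simp add: real_scaleR_def)
  have "\<psi> x = \<kappa> * \<phi> x" if "x \<in> Rn n" for x
  proof (rule linear_eq_on[OF assms(5) lin])
    show "x \<in> span (insert ?q C)" using sp that by blast
    fix y assume "y \<in> insert ?q C"
    then show "\<psi> y = \<kappa> * \<phi> y" using q z\<phi> z\<psi> by (auto simp: \<kappa>_def)
  qed
  then show ?thesis by blast
qed

text \<open>A facet is given as a face of the right dimension, so it must first be shown to be
  exposed. A functional killing its directions has the correct level set because a point of
  \<open>P\<close> in the affine hull of \<open>F\<close> already lies in \<open>F\<close>: the
  segment from that point to a relatively interior point of \<open>F\<close> can be prolonged within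
  \<open>F\<close>, and the face property applies.\<close>

lemma exists_supporting_functional:
  assumes F: "facet P F"
  shows "\<exists>\<phi> b. linear \<phi> \<and> (\<forall>x\<in>F. \<phi> x = b) \<and> (\<forall>x\<in>P - F. b < (\<phi> x :: real))"
proof -
  have face: "F face_of P" and cF: "convex F" using F by (auto simp: facet_def face_of_imp_convex)
  obtain a where a: "a \<in> F" using facet_ne[OF F] by blast
  obtain C where C: "C \<subseteq> dirs F a" "independent C" "finite C" "dirs F a \<subseteq> span C" "Suc (card C) = n"
    by (rule facet_dirs[OF F a])
  have FR: "F \<subseteq> Rn n" using facet_sub[OF F] P_sub by blast
  have CR: "C \<subseteq> Rn n" using C(1) FR a by (auto simp: dirs_def intro: subspace_diff[OF subspace_Rn])
  have "\<exists>q\<in>Rn n. q \<notin> span C"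
    using Rn_subset_span_card[of n C] C by (metis Suc_n_not_le_n subsetI)
  then obtain q where q: "q \<in> Rn n" "q \<notin> span C" by blast
  have ind: "independent (insert q C)" by (rule independent_insertI[OF q(2) C(2)])
  have qC: "q \<notin> C" using q span_base by blast
  then have sp: "Rn n \<subseteq> span (insert q C)" using C ind q CR by (intro Rn_span_full) auto
  obtain \<phi> :: "pt \<Rightarrow> real" where \<phi>: "linear \<phi>" "\<forall>x\<in>insert q C. \<phi> x = (if x = q then 1 else 0)"
    using linear_independent_extend[OF ind, of "\<lambda>x. if x = q then 1 else 0"] by blast
  have \<phi>C: "\<phi> x = 0" if "x \<in> span C" for x
    by (rule linear_eq_0_on_span[OF \<phi>(1) _ that]) (use \<phi>(2) qC in auto)
  have on: "\<phi> x = \<phi> a" if "x \<in> F" for x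
  proof -
    have "x - a \<in> span C" using C(4) that by (auto simp: dirs_def)
    from \<phi>C[OF this] show ?thesis by (simp add: linear_diff[OF \<phi>(1)])
  qed
  have inF: "x \<in> F" if xP: "x \<in> P" and x0: "\<phi> x = \<phi> a" for x
  proof -
    have "x - a \<in> Rn n" using xP a FR P_sub by (auto intro: subspace_diff[OF subspace_Rn])
    then have "x - a \<in> span (insert q C)" using sp by blast
    then obtain k where k: "x - a - k *\<^sub>R q \<in> span C" by (metis span_breakdown_eq)
    have "\<phi> (x - a - k *\<^sub>R q) = - k"
      using x0 \<phi>(2) by (simp add: linear_diff[OF \<phi>(1)] linear_scale[OF \<phi>(1)])
    then have "k = 0" using \<phi>C[OF k] by simp
    then have "x - a \<in> span C" using k by simp
    then obtain u where u: "x - a = (\<Sum>t\<in>C. u t *\<^sub>R t)" using span_finite[OF C(3)] by auto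
    \<comment> \<open>\<open>N\<close> weights \<open>a\<close> and the points \<open>a + t\<close>
      equally, so \<open>?m\<close> below is the barycentre of a simplex in \<open>F\<close>. The
      point \<open>?y\<close> is \<open>?m + \<epsilon> (?m - x)\<close>; \<open>d\<close> bounds
      the deviations of the coordinates, and \<open>\<epsilon>\<close> is small enough for
      \<open>?y\<close> to remain in the simplex.\<close>
    define N where "N = 1 / (real (card C) + 1)"
    define d where "d = (\<Sum>t\<in>C. \<bar>u t - N\<bar>)"
    define \<epsilon> where "\<epsilon> = N / (1 + d)"
    have d0: "0 \<le> d" unfolding d_def by (simp add: sum_nonneg)
    have N0: "0 < N" by (simp add: N_def)
    have N1: "real (card C) * N = 1 - N" by (simp add: N_def field_simps)
    have \<epsilon>0: "0 < \<epsilon>" using N0 d0 by (simp add: \<epsilon>_def)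
    have ed: "\<epsilon> * d \<le> N" using N0 d0 by (simp add: \<epsilon>_def field_simps)
    have bnd: "\<bar>u t - N\<bar> \<le> d" if "t \<in> C" for t
      unfolding d_def by (rule member_le_sum) (use that C in auto)
    let ?m = "a + (\<Sum>t\<in>C. N *\<^sub>R t)"
    let ?y = "a + (\<Sum>t\<in>C. (N - \<epsilon> * (u t - N)) *\<^sub>R t)"
    have aC: "a + t \<in> F" if "t \<in> C" for t using that C(1) by (auto simp: dirs_def)
    have mF: "?m \<in> F"
      by (rule convex_combination_from[OF cF a C(3) aC]) (use N0 N1 in auto)
    have yF: "?y \<in> F"
    proof (rule convex_combination_from[OF cF a C(3) aC])
      fix t assume t: "t \<in> C"
      have "\<epsilon> * (u t - N) \<le> \<epsilon> * d" using bnd[OF t] \<epsilon>0 by (intro mult_left_mono) auto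
      then show "0 \<le> N - \<epsilon> * (u t - N)" using ed by linarith
    next
      have "(\<Sum>t\<in>C. N - \<epsilon> * (u t - N)) = real (card C) * N - \<epsilon> * (\<Sum>t\<in>C. u t - N)"
        by (simp add: sum_subtractf sum_distrib_left[symmetric])
      moreover have "- d \<le> (\<Sum>t\<in>C. u t - N)"
        using sum_abs[of "\<lambda>t. u t - N" C] unfolding d_def by linarith
      then have "\<epsilon> * (- d) \<le> \<epsilon> * (\<Sum>t\<in>C. u t - N)" using \<epsilon>0 by (intro mult_left_mono) auto
      ultimately show "(\<Sum>t\<in>C. N - \<epsilon> * (u t - N)) \<le> 1" using N1 ed N0 by simp
    qed
    have xe: "x = a + (\<Sum>t\<in>C. u t *\<^sub>R t)" using u by (simp add: algebra_simps)
    \<comment> \<open>The weight that places \<open>?m\<close> on the segment from \<open>x\<close>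
      to \<open>?y\<close>.\<close>
    define \<theta> where "\<theta> = 1 / (1 + \<epsilon>)"
    have \<theta>: "0 < \<theta>" "\<theta> < 1" using \<epsilon>0 by (auto simp: \<theta>_def)
    have "(1 - \<theta>) *\<^sub>R x + \<theta> *\<^sub>R ?y = a + (\<Sum>t\<in>C. ((1 - \<theta>) * u t + \<theta> * (N - \<epsilon> * (u t - N))) *\<^sub>R t)"
      unfolding xe
      by (simp add: scaleR_add_right scaleR_sum_right sum.distrib[symmetric] scaleR_add_left[symmetric]
          algebra_simps del: scaleR_add_left)
    also have "(\<Sum>t\<in>C. ((1 - \<theta>) * u t + \<theta> * (N - \<epsilon> * (u t - N))) *\<^sub>R t) = (\<Sum>t\<in>C. N *\<^sub>R t)"
    proof (rule sum.cong[OF HOL.refl])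
      fix t
      have "(1 - \<theta>) * u t + \<theta> * (N - \<epsilon> * (u t - N)) = N"
        if e: "\<theta> * (1 + \<epsilon>) = 1"
      proof -
        have "(1 - \<theta>) * u t + \<theta> * (N - \<epsilon> * (u t - N)) = N * (\<theta> * (1 + \<epsilon>)) + u t * (1 - \<theta> * (1 + \<epsilon>))"
          by (simp add: algebra_simps)
        then show ?thesis unfolding e by simp
      qed
      then have "(1 - \<theta>) * u t + \<theta> * (N - \<epsilon> * (u t - N)) = N" using \<epsilon>0 by (simp add: \<theta>_def)
      then show "((1 - \<theta>) * u t + \<theta> * (N - \<epsilon> * (u t - N))) *\<^sub>R t = N *\<^sub>R t" by simp
    qed
    finally have me: "?m = (1 - \<theta>) *\<^sub>R x + \<theta> *\<^sub>R ?y" by simp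
    show "x \<in> F"
    proof (cases "x = ?y")
      case False
      then have "?m \<in> open_segment x ?y" using \<theta> me by (auto simp: in_segment)
      then show ?thesis using face_ofD[OF face _ xP _ mF] yF facet_sub[OF F] by blast
    qed (use yF in simp)
  qed
  \<comment> \<open>Points strictly on both sides would be joined by a segment meeting the level of
    \<open>F\<close>; the crossing point lies in \<open>F\<close>, and the face property would put
    \<open>p\<close> in \<open>F\<close>.\<close>
  have side: "\<not> (\<phi> p < \<phi> a \<and> \<phi> a < \<phi> r)" if pr: "p \<in> P" "r \<in> P" for p r
  proof
    assume l: "\<phi> p < \<phi> a \<and> \<phi> a < \<phi> r"
    define \<theta> where "\<theta> = (\<phi> a - \<phi> p) / (\<phi> r - \<phi> p)"
    have \<theta>: "0 < \<theta>" "\<theta> < 1" using l by (auto simp: \<theta>_def)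
    let ?z = "(1 - \<theta>) *\<^sub>R p + \<theta> *\<^sub>R r"
    have "\<theta> * (\<phi> r - \<phi> p) = \<phi> a - \<phi> p" using l by (simp add: \<theta>_def)
    then have "\<phi> ?z = \<phi> a"
      unfolding linear_add[OF \<phi>(1)] linear_scale[OF \<phi>(1)] by (simp add: algebra_simps)
    moreover have "?z \<in> P" using pr \<theta> by (intro convexD[OF convexP]) auto
    ultimately have zF: "?z \<in> F" by (rule inF[rotated])
    have "?z \<in> open_segment p r" using \<theta> l by (auto simp: in_segment)
    then have "p \<in> F" using face_ofD[OF face _ pr zF] by blast
    then show False using on l by fastforce
  qed
  show ?thesis
  proof (cases "\<exists>p\<in>P. \<phi> p < \<phi> a")
    case True
    then have "\<phi> x < \<phi> a" if "x \<in> P - F" for x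
      using side inF that by (metis DiffD1 DiffD2 linorder_neqE)
    then have "linear (\<lambda>x. - \<phi> x) \<and> (\<forall>x\<in>F. - \<phi> x = - \<phi> a) \<and> (\<forall>x\<in>P - F. - \<phi> a < - \<phi> x)"
      using on \<phi>(1) by (auto intro: linear_compose_neg)
    then show ?thesis by blast
  next
    case False
    then have "\<phi> a < \<phi> x" if "x \<in> P - F" for x
      using inF that by (metis DiffD1 DiffD2 linorder_neqE)
    then show ?thesis using on \<phi>(1) by blast
  qed
qed

end

lemma rational_functional:
  fixes a :: real assumes "a \<noteq> 0"
  shows "\<exists>f :: real \<Rightarrow> rat. (\<forall>x y. f (x + y) = f x + f y) \<and>
    (\<forall>(k::int) x. f (of_int k * x) = of_int k * f x) \<and> f a = 1"
proof -
  \<comment> \<open>The reals as a vector space over the rationals, with the one-dimensional target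
    \<open>rat\<close>.\<close>
  interpret vector_space_pair "\<lambda>(q::rat) (x::real). of_rat q * x" "(*) :: rat \<Rightarrow> rat \<Rightarrow> rat"
    by unfold_locales (simp_all add: distrib_left distrib_right of_rat_add of_rat_mult mult.assoc)
  have "vs1.independent {a}" using assms by simp
  then obtain f where f: "Vector_Spaces.linear (\<lambda>(q::rat) (x::real). of_rat q * x) (*) f" "f a = 1"
    using linear_independent_extend[of "{a}" "\<lambda>_. 1"] by auto
  interpret f: Vector_Spaces.linear "\<lambda>(q::rat) (x::real). of_rat q * x" "(*) :: rat \<Rightarrow> rat \<Rightarrow> rat" f
    by (rule f(1))
  have "f (of_int k * x) = of_int k * f x" for k :: int and x
    using f.scale[of "of_int k" x] by simp
  then show ?thesis using f.add f(2) by blast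
qed

lemma rat_common_denominator:
  fixes c :: "nat \<Rightarrow> real" assumes "\<And>i. i < n \<Longrightarrow> c i \<in> \<rat>"
  shows "\<exists>N::int. 0 < N \<and> (\<forall>i<n. of_int N * c i \<in> \<int>)"
  using assms
proof (induction n)
  case (Suc n)
  then obtain N :: int where N: "0 < N" "\<forall>i<n. of_int N * c i \<in> \<int>" by auto
  obtain p q where pq: "c n = of_int p / of_int q" "0 < (q::int)"
    using Suc.prems[of n] by (auto elim!: Rats_cases')
  have "of_int (N * q) * c i \<in> \<int>" if "i < Suc n" for i
  proof (cases "i = n")
    case True
    then have "of_int (N * q) * c i = of_int (N * p)" using pq by simp
    then show ?thesis by (metis Ints_of_int)
  next
    case False
    then have "of_int N * c i \<in> \<int>" using that N by auto
    from Ints_mult[OF Ints_of_int this] have "of_int q * (of_int N * c i) \<in> \<int>" .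
    then show ?thesis by (simp only: of_int_mult mult_ac)
  qed
  then show ?case using N pq by (meson mult_pos_pos)
qed (auto intro: exI[of _ 1])

lemma int_subgroup_principal:
  fixes G :: "int set"
  assumes "\<And>a b. a \<in> G \<Longrightarrow> b \<in> G \<Longrightarrow> a - b \<in> G" "\<And>k a. a \<in> G \<Longrightarrow> k * a \<in> G" "\<exists>g\<in>G. g \<noteq> 0"
  shows "\<exists>d>0. G = range ((*) d)"
proof -
  obtain g where "g \<in> G" "g \<noteq> 0" using assms(3) by blast
  moreover have "sgn g * g \<in> G" using \<open>g \<in> G\<close> by (rule assms(2))
  then have "\<bar>g\<bar> \<in> G" by (simp add: abs_sgn mult.commute)
  ultimately have ex: "\<exists>k::nat. 0 < k \<and> int k \<in> G" by (intro exI[of _ "nat \<bar>g\<bar>"]) simp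
  define d where "d = (LEAST k::nat. 0 < k \<and> int k \<in> G)"
  have d: "0 < d" "int d \<in> G" using LeastI_ex[OF ex] unfolding d_def by auto
  have dle: "d \<le> k" if "0 < k" "int k \<in> G" for k
    unfolding d_def by (rule Least_le) (use that in auto)
  have "x \<in> range ((*) (int d))" if x: "x \<in> G" for x
  proof -
    have "x mod int d = x - (x div int d) * int d" by (simp add: minus_div_mult_eq_mod)
    also have "\<dots> \<in> G" by (rule assms(1)[OF x assms(2)[OF d(2)]])
    finally have m: "x mod int d \<in> G" .
    have "x mod int d = 0"
    proof (rule ccontr)
      assume "x mod int d \<noteq> 0"
      then have p: "0 < x mod int d" using d(1) pos_mod_sign[of "int d" x] by linarith
      then have "d \<le> nat (x mod int d)" using m by (intro dle) auto
      then show False using d(1) pos_mod_bound[of "int d" x] p by linarith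
    qed
    then have "x = int d * (x div int d)" using minus_div_mult_eq_mod[of x "int d"] by (simp add: mult.commute)
    then show ?thesis by (rule range_eqI)
  qed
  moreover have "int d * k \<in> G" for k using assms(2)[OF d(2), of k] by (simp add: mult.commute)
  ultimately show ?thesis using d(1) by (intro exI[of _ "int d"]) auto
qed

definition is_form :: "pt set \<Rightarrow> nat \<Rightarrow> pt set \<Rightarrow> (pt \<Rightarrow> real) \<Rightarrow> real \<Rightarrow> bool" where
  "is_form P n F \<phi> b \<longleftrightarrow> linear \<phi> \<and> \<phi> ` Zn n = \<int> \<and> (\<forall>i\<ge>n. \<phi> (ee i) = 0) \<and>
     (\<forall>x\<in>F. \<phi> x = b) \<and> (\<forall>x\<in>P - F. b < \<phi> x)"

context lpoly begin

text \<open>The supporting functional has real coefficients. Composing it with a \<open>\<rat>\<close>-linear functional on \<open>\<real>\<close>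
  makes them rational and keeps it constant on the facet, whose vertices are lattice points; clearing
  denominators and dividing by the generator of the value group makes it primitive.\<close>

lemma is_form_exists:
  assumes F: "facet P F" shows "\<exists>\<phi> b. is_form P n F \<phi> b"
proof -
  obtain \<phi> :: "pt \<Rightarrow> real" and b where \<phi>': "linear \<phi>" "\<forall>x\<in>F. \<phi> x = b" "\<forall>x\<in>P - F. b < \<phi> x"
    using exists_supporting_functional[OF F] by blast
  have \<phi>: "linear \<phi>" "\<And>x. x \<in> F \<Longrightarrow> \<phi> x = b" "\<And>x. x \<in> P - F \<Longrightarrow> b < \<phi> x"
    using \<phi>' by auto
  obtain a where a: "a \<in> F" using facet_ne[OF F] by blast
  obtain p where p: "p \<in> S" "p \<notin> F" by (rule facet_proper[OF F])
  have pP: "p \<in> P - F" using p S_sub by blast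
  have FP: "F \<subseteq> P" by (rule facet_sub[OF F])
  have ge: "b \<le> \<phi> x" if "x \<in> P" for x using \<phi>(2,3) that by (cases "x \<in> F") force+
  have Feq: "F = {x \<in> P. \<phi> x = b}" using FP \<phi>(2,3) by force
  then have Fhull: "F = convex hull {s \<in> S. \<phi> s = b}"
    using convex_hull_Int_face[OF finS \<phi>(1), of b] ge unfolding PS by simp
  \<comment> \<open>At a nonzero coefficient the rational functional can be normalised to 1; this
    keeps the rational form from being zero.\<close>
  have "\<exists>i<n. \<phi> (ee i) \<noteq> 0"
  proof (rule ccontr)
    assume "\<not> ?thesis"
    then have "\<phi> x = 0" if "x \<in> P" for x using linear_Rn[OF \<phi>(1), of x n] that P_sub by auto
    then show False using \<phi>(2,3) a pP FP by force
  qed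
  then obtain i0 where i0: "i0 < n" "\<phi> (ee i0) \<noteq> 0" by blast
  obtain f :: "real \<Rightarrow> rat" where f': "(\<forall>x y. f (x + y) = f x + f y) \<and>
    (\<forall>(k::int) x. f (of_int k * x) = of_int k * f x) \<and> f (\<phi> (ee i0)) = 1"
    using rational_functional[OF i0(2)] ..
  have f: "f (x + y) = f x + f y" "f (of_int k * x) = of_int k * f x" "f (\<phi> (ee i0)) = 1" for x y k
    using f' by auto
  have f0: "f 0 = 0" using f(1)[of 0 0] by simp
  have fsum: "f (sum g A) = (\<Sum>i\<in>A. f (g i))" if "finite A" for g and A :: "nat set"
    using that by induction (auto simp: f f0)
  define c :: "nat \<Rightarrow> real" where "c i = of_rat (f (\<phi> (ee i)))" for i
  define \<phi>1 :: "pt \<Rightarrow> real" where "\<phi>1 x = (\<Sum>i<n. lk x i * c i)" for x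
  have lin1: "linear \<phi>1"
    unfolding \<phi>1_def by (rule linearI)
      (simp_all add: lookup_add lookup_scaleR distrib_right sum.distrib sum_distrib_left mult.assoc)
  have \<phi>1ee: "\<phi>1 (ee i) = (if i < n then c i else 0)" for i
    by (auto simp: \<phi>1_def lookup_single when_def if_distrib if_distribR cong: if_cong)
  have \<phi>1Z: "\<phi>1 z = of_rat (f (\<phi> z))" if z: "z \<in> Zn n" for z
  proof -
    have k: "lk z i = of_int \<lfloor>lk z i\<rfloor>" for i using z by (metis Ints_cases floor_of_int Zn_iff)
    have "\<phi> z = (\<Sum>i<n. of_int \<lfloor>lk z i\<rfloor> * \<phi> (ee i))"
    proof -
      have "\<phi> z = (\<Sum>i<n. lk z i *\<^sub>R \<phi> (ee i))" using linear_Rn[OF \<phi>(1)] z Zn_sub_Rn by blast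
      also have "\<dots> = (\<Sum>i<n. of_int \<lfloor>lk z i\<rfloor> * \<phi> (ee i))" by (rule sum.cong) (use k in auto)
      finally show ?thesis .
    qed
    then have "f (\<phi> z) = (\<Sum>i<n. of_int \<lfloor>lk z i\<rfloor> * f (\<phi> (ee i)))"
      by (simp add: fsum f)
    then have "of_rat (f (\<phi> z)) = (\<Sum>i<n. of_int \<lfloor>lk z i\<rfloor> * c i)"
      by (simp add: of_rat_sum of_rat_mult c_def)
    also have "\<dots> = \<phi>1 z" unfolding \<phi>1_def by (rule sum.cong) (use k in auto)
    finally show ?thesis ..
  qed
  have on1: "\<phi>1 x = of_rat (f b)" if "x \<in> F" for x
  proof -
    \<comment> \<open>Lattice points on \<open>F\<close> are sent by \<open>\<phi>1\<close> to the
      same value \<open>f b\<close>, and the hull of the points of \<open>S\<close> on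
      \<open>F\<close> is all of \<open>F\<close>.\<close>
    have "{s \<in> S. \<phi> s = b} \<subseteq> \<phi>1 -` {of_rat (f b)}" using \<phi>1Z SZ by auto
    then have "convex hull {s \<in> S. \<phi> s = b} \<subseteq> \<phi>1 -` {of_rat (f b)}"
      by (rule hull_minimal) (intro convex_linear_vimage[OF lin1], simp)
    then show ?thesis using that Fhull by auto
  qed
  obtain \<kappa> where \<kappa>: "\<forall>x\<in>Rn n. \<phi>1 x = \<kappa> * \<phi> x"
    using functional_scale[OF F \<phi>(1,2) _ lin1 on1] \<phi>(3) by force
  have ci0: "\<phi>1 (ee i0) = 1" using i0 f(3) by (simp add: \<phi>1ee c_def)
  have "\<kappa> \<noteq> 0" using \<kappa> ee_in_Rn[OF i0(1)] ci0 by force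
  have "c i \<in> \<rat>" for i by (simp add: c_def)
  then obtain N :: int where N: "0 < N" "\<forall>i<n. of_int N * c i \<in> \<int>"
    using rat_common_denominator[of n c] by blast
  have NZ: "of_int N * \<phi>1 z \<in> \<int>" if "z \<in> Zn n" for z
  proof -
    have "of_int N * \<phi>1 z = (\<Sum>i<n. lk z i * (of_int N * c i))"
      by (simp add: \<phi>1_def sum_distrib_left mult_ac)
    also have "\<dots> \<in> \<int>"
    proof (rule Ints_sum)
      fix i assume "i \<in> {..<n}"
      then have "of_int N * c i \<in> \<int>" using N by simp
      moreover have "lk z i \<in> \<int>" using that by (simp add: Zn_iff)
      ultimately show "lk z i * (of_int N * c i) \<in> \<int>" by (rule Ints_mult[rotated])
    qed
    finally show ?thesis .
  qed
  \<comment> \<open>The value group of \<open>of_int N * \<phi>1\<close> on the lattice; its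
    generator \<open>d\<close> is the factor by which this integral form fails to be
    primitive.\<close>
  define G where "G = {k::int. \<exists>z\<in>Zn n. of_int N * \<phi>1 z = of_int k}"
  have "\<exists>d>0. G = range ((*) d)"
  proof (rule int_subgroup_principal)
    fix k l assume "k \<in> G" "l \<in> G"
    then obtain z w where "z \<in> Zn n" "w \<in> Zn n" "of_int N * \<phi>1 z = of_int k" "of_int N * \<phi>1 w = of_int l"
      by (auto simp: G_def)
    then show "k - l \<in> G" unfolding G_def
      by (auto intro!: bexI[of _ "z - w"] Zn_diff simp: linear_diff[OF lin1] right_diff_distrib)
  next
    fix k l assume "l \<in> G"
    then obtain z where "z \<in> Zn n" "of_int N * \<phi>1 z = of_int l" by (auto simp: G_def)
    then show "k * l \<in> G" unfolding G_def
      by (auto intro!: bexI[of _ "of_int k *\<^sub>R z"] Zn_scale simp: linear_scale[OF lin1] mult_ac)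
  next
    have "N \<in> G" unfolding G_def using ci0 ee_in_Zn[OF i0(1)] by (auto intro!: bexI[of _ "ee i0"])
    then show "\<exists>g\<in>G. g \<noteq> 0" using N by (intro bexI[of _ N]) auto
  qed
  then obtain d where d: "0 < d" "G = range ((*) d)" by blast
  \<comment> \<open>A functional from the reals to the rationals need not preserve the order, so
    \<open>\<kappa>\<close> may be negative; \<open>\<sigma>\<close> restores the sign that makes
    the form minimal on \<open>F\<close>.\<close>
  define \<sigma> :: int where "\<sigma> = (if 0 < \<kappa> then 1 else -1)"
  have \<sigma>: "\<sigma> * \<sigma> = 1" "0 < of_int \<sigma> * \<kappa>" using \<open>\<kappa> \<noteq> 0\<close> by (auto simp: \<sigma>_def)
  define r where "r = of_int \<sigma> * of_int N / (of_int d :: real)"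
  define \<phi>3 where "\<phi>3 x = r * \<phi>1 x" for x
  have lin3: "linear \<phi>3" unfolding \<phi>3_def
    using lin1 linear_compose_scale_right[of \<phi>1 r] by (simp add: real_scaleR_def)
  have im: "\<phi>3 ` Zn n = \<int>"
  proof
    show "\<phi>3 ` Zn n \<subseteq> \<int>"
    proof
      fix y assume "y \<in> \<phi>3 ` Zn n"
      then obtain z where z: "z \<in> Zn n" "y = \<phi>3 z" by blast
      then obtain k where k: "of_int N * \<phi>1 z = of_int k" using NZ by (meson Ints_cases)
      then have "k \<in> G" using z by (auto simp: G_def)
      then obtain m where "k = d * m" using d by auto
      have "y = of_int \<sigma> * (of_int N * \<phi>1 z) / of_int d" using z by (simp add: \<phi>3_def r_def)
      also have "\<dots> = of_int (\<sigma> * m)" unfolding k \<open>k = d * m\<close> using d(1) by simp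
      finally have "y = of_int (\<sigma> * m)" .
      then show "y \<in> \<int>" by simp
    qed
    show "\<int> \<subseteq> \<phi>3 ` Zn n"
    proof
      fix y :: real assume "y \<in> \<int>"
      then obtain m :: int where m: "y = of_int m" by (rule Ints_cases)
      have "d * (\<sigma> * m) \<in> G" using d by auto
      then obtain z where z: "z \<in> Zn n" "of_int N * \<phi>1 z = of_int (d * (\<sigma> * m))" by (auto simp: G_def)
      have "\<phi>3 z = of_int \<sigma> * (of_int N * \<phi>1 z) / of_int d" by (simp add: \<phi>3_def r_def)
      also have "\<dots> = of_int (\<sigma> * \<sigma> * m)" unfolding z(2) using d(1) by simp
      also have "\<dots> = y" unfolding \<sigma>(1) m by simp
      finally have "\<phi>3 z = y" .
      then show "y \<in> \<phi>3 ` Zn n" using z by blast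
    qed
  qed
  have "\<phi>3 x - \<phi>3 a = (of_int \<sigma> * \<kappa>) * (of_int N / of_int d) * (\<phi> x - b)" if "x \<in> P" for x
  proof -
    have "x \<in> Rn n" "a \<in> Rn n" using that P_sub FP a by auto
    then have "\<phi>1 x = \<kappa> * \<phi> x" "\<phi>1 a = \<kappa> * b" using \<kappa> \<phi>(2)[OF a] by auto
    then have "\<phi>3 x - \<phi>3 a = r * (\<kappa> * (\<phi> x - b))" by (simp add: \<phi>3_def right_diff_distrib)
    then show ?thesis by (simp add: r_def mult_ac)
  qed
  moreover have "0 < (of_int \<sigma> * \<kappa>) * (of_int N / of_int d :: real)" using \<sigma> N d by simp
  ultimately have "\<phi>3 a < \<phi>3 x" if "x \<in> P - F" for x
    using that \<phi>(3)[OF that] by (metis DiffD1 diff_gt_0_iff_gt mult_pos_pos)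
  moreover have "\<phi>3 x = \<phi>3 a" if "x \<in> F" for x using on1 that a by (simp add: \<phi>3_def)
  moreover have "\<phi>3 (ee i) = 0" if "n \<le> i" for i using that by (simp add: \<phi>3_def \<phi>1ee)
  ultimately have "is_form P n F \<phi>3 (\<phi>3 a)" using lin3 im by (auto simp: is_form_def)
  then show ?thesis by blast
qed

text \<open>Two forms differ by a factor \<open>\<kappa>\<close>, positive because both grow away
  from \<open>F\<close>. As both are onto the integers, \<open>\<kappa>\<close> and its inverse are
  integers.\<close>

lemma is_form_unique:
  fixes \<phi> \<psi> :: "pt \<Rightarrow> real"
  assumes F: "facet P F" and "is_form P n F \<phi> b" "is_form P n F \<psi> c"
  shows "\<phi> = \<psi>"
proof -
  obtain a where a: "a \<in> F" using facet_ne[OF F] by blast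
  obtain p where p: "p \<in> S" "p \<notin> F" by (rule facet_proper[OF F])
  have pP: "p \<in> P - F" using p S_sub by blast
  have FP: "F \<subseteq> P" by (rule facet_sub[OF F])
  note \<phi> = assms(2)[unfolded is_form_def] and \<psi> = assms(3)[unfolded is_form_def]
  obtain \<kappa> where \<kappa>: "\<forall>x\<in>Rn n. \<psi> x = \<kappa> * \<phi> x"
    using functional_scale[OF F, of \<phi> b \<psi> c] \<phi> \<psi> by (auto simp: less_imp_neq[symmetric])
  have "p \<in> Rn n" "a \<in> Rn n" using P_sub pP a FP by auto
  then have "\<psi> p - \<psi> a = \<kappa> * (\<phi> p - \<phi> a)" using \<kappa> by (simp add: right_diff_distrib)
  moreover have "0 < \<psi> p - \<psi> a" "0 < \<phi> p - \<phi> a" using \<phi> \<psi> pP a by auto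
  ultimately have \<kappa>0: "0 < \<kappa>" by (metis zero_less_mult_pos2)
  have "1 \<in> \<phi> ` Zn n" "1 \<in> \<psi> ` Zn n" using \<phi> \<psi> by auto
  then obtain z w where z: "z \<in> Zn n" "\<phi> z = 1" and w: "w \<in> Zn n" "\<psi> w = 1" by force
  have "z \<in> Rn n" "w \<in> Rn n" using z w Zn_sub_Rn by auto
  then have "\<psi> z = \<kappa>" "1 = \<kappa> * \<phi> w" using \<kappa> z w by auto
  moreover have "\<psi> z \<in> \<int>" "\<phi> w \<in> \<int>" using z w \<phi> \<psi> by blast+
  ultimately obtain k m where km: "\<kappa> = of_int k" "\<phi> w = of_int m" "1 = \<kappa> * \<phi> w" by (metis Ints_cases)
  then have "(1::real) = of_int (k * m)" by simp
  then have "k * m = 1" by linarith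
  then have "k = 1" using \<kappa>0 km(1) by (auto simp: zmult_eq_1_iff)
  then have eq: "\<psi> x = \<phi> x" if "x \<in> Rn n" for x using \<kappa> km that by simp
  show ?thesis
  proof (rule linear_eq_ee)
    show "\<phi> (ee i) = \<psi> (ee i)" for i
      using eq[OF ee_in_Rn, of i] \<phi> \<psi> by (cases "i < n") auto
  qed (use \<phi> \<psi> in auto)
qed

text \<open>The descriptions in \<open>facet_form\<close> and \<open>facet_min\<close> are evaluated
  by exhibiting one form; this is how the forms of a doubling are computed.\<close>

lemma facet_form_eqI:
  assumes F: "facet P F" and "is_form P n F \<phi> b"
  shows "facet_form P F = \<phi>" "facet_min P F = b"
proof -
  show eq: "facet_form P F = \<phi>"
    unfolding facet_form_def pdimP
  proof (rule the_equality)
    show "linear \<phi> \<and> \<phi> ` Zn n = \<int> \<and> (\<forall>i\<ge>n. \<phi> (ee i) = 0) \<and>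
      (\<exists>b. (\<forall>x\<in>F. \<phi> x = b) \<and> (\<forall>x\<in>P - F. b < \<phi> x))" using assms(2) unfolding is_form_def by blast
  next
    fix \<psi> :: "pt \<Rightarrow> real" assume "linear \<psi> \<and> \<psi> ` Zn n = \<int> \<and> (\<forall>i\<ge>n. \<psi> (ee i) = 0) \<and>
      (\<exists>b. (\<forall>x\<in>F. \<psi> x = b) \<and> (\<forall>x\<in>P - F. b < \<psi> x))"
    then obtain c where "is_form P n F \<psi> c" unfolding is_form_def by blast
    then show "\<psi> = \<phi>" using is_form_unique[OF F _ assms(2)] by blast
  qed
  obtain a where a: "a \<in> F" using facet_ne[OF F] by blast
  show "facet_min P F = b"
    unfolding facet_min_def eq
  proof (rule cInf_eq_minimum)
    show "b \<in> \<phi> ` P" using a facet_sub[OF F] assms(2) unfolding is_form_def by (metis imageI subsetD)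
    show "b \<le> x" if "x \<in> \<phi> ` P" for x using that assms(2) unfolding is_form_def by (metis DiffI imageE less_eq_real_def)
  qed
qed

lemma facet_form_props:
  assumes F: "facet P F"
  shows "is_form P n F (facet_form P F) (facet_min P F)"
proof -
  obtain \<phi> b where \<phi>: "is_form P n F \<phi> b" using is_form_exists[OF F] by blast
  show ?thesis unfolding facet_form_eqI[OF F \<phi>] by (rule \<phi>)
qed

lemma
  assumes F: "facet P F"
  shows linear_facet_form: "linear (facet_form P F)"
    and facet_form_Ints: "z \<in> Zn n \<Longrightarrow> facet_form P F z \<in> \<int>"
    and facet_form_outside: "n \<le> i \<Longrightarrow> facet_form P F (ee i) = 0"
    and facet_form_on: "x \<in> F \<Longrightarrow> facet_form P F x = facet_min P F"
    and facet_form_gt: "x \<in> P \<Longrightarrow> x \<notin> F \<Longrightarrow> facet_min P F < facet_form P F x"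
    and facet_form_ge: "x \<in> P \<Longrightarrow> facet_min P F \<le> facet_form P F x"
    and facet_eq: "F = {x \<in> P. facet_form P F x = facet_min P F}"
    and facet_form_onto: "\<exists>z\<in>Zn n. facet_form P F z = 1"
proof -
  note f = facet_form_props[OF F, unfolded is_form_def]
  show "linear (facet_form P F)" "z \<in> Zn n \<Longrightarrow> facet_form P F z \<in> \<int>" "n \<le> i \<Longrightarrow> facet_form P F (ee i) = 0"
    "x \<in> F \<Longrightarrow> facet_form P F x = facet_min P F"
    "x \<in> P \<Longrightarrow> x \<notin> F \<Longrightarrow> facet_min P F < facet_form P F x"
    using f by auto
  show "x \<in> P \<Longrightarrow> facet_min P F \<le> facet_form P F x" using f by (cases "x \<in> F") (auto simp: less_imp_le)
  show "F = {x \<in> P. facet_form P F x = facet_min P F}"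
  proof (intro equalityI subsetI)
    fix x assume "x \<in> F" then show "x \<in> {x \<in> P. facet_form P F x = facet_min P F}"
      using f facet_sub[OF F] by auto
  next
    fix x assume x: "x \<in> {x \<in> P. facet_form P F x = facet_min P F}"
    show "x \<in> F"
    proof (rule ccontr)
      assume "x \<notin> F"
      then have "facet_min P F < facet_form P F x" using f x by blast
      then show False using x by simp
    qed
  qed
  have "1 \<in> facet_form P F ` Zn n" using f by simp
  then show "\<exists>z\<in>Zn n. facet_form P F z = 1" by auto
qed

lemma facet_hull:
  assumes F: "facet P F" shows "F = convex hull {s \<in> S. facet_form P F s = facet_min P F}"
proof -
  have "{x \<in> P. facet_form P F x = facet_min P F} = convex hull {s \<in> S. facet_form P F s = facet_min P F}"
    unfolding PS
    by (rule convex_hull_Int_face[OF finS linear_facet_form[OF F, unfolded PS]])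
       (use facet_form_ge[OF F] in \<open>simp add: PS\<close>)
  then show ?thesis using facet_eq[OF F] by simp
qed

lemma facet_vertex_iff: "facet P F \<Longrightarrow> s \<in> S \<Longrightarrow> facet_form P F s = facet_min P F \<longleftrightarrow> s \<in> F"
  using S_sub facet_form_on[of F s] facet_form_gt[of F s] by (metis IntD1 less_irrefl subsetD)

lemma facet_lattice_point:
  assumes F: "facet P F" obtains s where "s \<in> S" "s \<in> F"
proof -
  have "{s \<in> S. facet_form P F s = facet_min P F} \<noteq> {}"
    using facet_ne[OF F] facet_hull[OF F] by (metis convex_hull_empty)
  then show ?thesis using that facet_vertex_iff[OF F] by auto
qed

lemma facet_min_Ints: assumes F: "facet P F" shows "facet_min P F \<in> \<int>"
proof -
  obtain s where s: "s \<in> S" "s \<in> F" by (rule facet_lattice_point[OF F])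
  then show ?thesis using facet_form_on[OF F s(2)] facet_form_Ints[OF F, of s] SZ by auto
qed

lemma facet_form_scale:
  fixes \<psi> :: "pt \<Rightarrow> real"
  assumes F: "facet P F" "linear \<psi>" "\<And>x. x \<in> F \<Longrightarrow> \<psi> x = c"
  shows "\<exists>\<kappa>. \<forall>x\<in>Rn n. \<psi> x = \<kappa> * facet_form P F x"
proof (rule functional_scale[OF F(1) linear_facet_form[OF F(1)] facet_form_on[OF F(1)] _ F(2,3)])
  show "facet_form P F x \<noteq> facet_min P F" if "x \<in> P - F" for x
    using facet_form_gt[OF F(1), of x] that by auto
qed

text \<open>If \<open>\<psi>\<close> were constant on the vertices of \<open>F\<close>, then up to a constant it would be a multiple of the
  facet form, hence cut out \<open>F\<close> itself.\<close>

lemma facet_not_subset: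
  fixes \<psi> :: "pt \<Rightarrow> real"
  assumes F: "facet P F" and "linear \<psi>" "\<And>x. x \<in> P \<Longrightarrow> c \<le> \<psi> x" "\<exists>x\<in>P. \<psi> x \<noteq> c"
    "F \<noteq> {x \<in> P. \<psi> x = c}"
  shows "\<exists>s\<in>S. s \<in> F \<and> c < \<psi> s"
proof (rule ccontr)
  assume n: "\<not> ?thesis"
  have "{s \<in> S. facet_form P F s = facet_min P F} \<subseteq> \<psi> -` {c}"
  proof
    fix s assume s: "s \<in> {s \<in> S. facet_form P F s = facet_min P F}"
    then have "\<not> c < \<psi> s" using n facet_vertex_iff[OF F] by auto
    moreover have "c \<le> \<psi> s" using assms(3)[of s] s S_sub by auto
    ultimately show "s \<in> \<psi> -` {c}" by simp
  qed
  then have "convex hull {s \<in> S. facet_form P F s = facet_min P F} \<subseteq> \<psi> -` {c}"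
    by (rule hull_minimal) (intro convex_linear_vimage[OF assms(2)], simp)
  then have "F \<subseteq> \<psi> -` {c}" using facet_hull[OF F] by simp
  then have on: "\<psi> x = c" if "x \<in> F" for x using that by auto
  obtain \<kappa> where \<kappa>: "\<forall>x\<in>Rn n. \<psi> x = \<kappa> * facet_form P F x" using facet_form_scale[OF F assms(2) on] by blast
  obtain a where a: "a \<in> F" using facet_ne[OF F] by blast
  have e: "\<psi> x - c = \<kappa> * (facet_form P F x - facet_min P F)" if "x \<in> P" for x
  proof -
    have "\<psi> a = c" "facet_form P F a = facet_min P F" "a \<in> P"
      using on[OF a] facet_form_on[OF F a] a facet_sub[OF F] by auto
    moreover have "x \<in> Rn n" "a \<in> Rn n" using that calculation P_sub by auto
    ultimately show ?thesis using \<kappa> by (metis right_diff_distrib)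
  qed
  have "\<kappa> \<noteq> 0" using e assms(4) by auto
  then have "\<psi> x = c \<longleftrightarrow> facet_form P F x = facet_min P F" if "x \<in> P" for x
    using e[OF that] by auto
  then have "F = {x \<in> P. \<psi> x = c}" using facet_eq[OF F] by auto
  then show False using assms(5) by simp
qed

section \<open>Column vectors\<close>

lemma coord_bounded: "\<exists>K. \<forall>y\<in>P. \<bar>lk y i\<bar> \<le> K"
proof -
  define K where "K = (\<Sum>s\<in>S. \<bar>lk s i\<bar>)"
  have "S \<subseteq> (\<lambda>y. lk y i) -` {-K..K}"
  proof
    fix s assume "s \<in> S"
    then have "\<bar>lk s i\<bar> \<le> K" unfolding K_def by (intro member_le_sum) (auto simp: finS)
    then show "s \<in> (\<lambda>y. lk y i) -` {-K..K}" by auto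
  qed
  then have "convex hull S \<subseteq> (\<lambda>y. lk y i) -` {-K..K}"
    by (rule hull_minimal) (intro convex_linear_vimage[OF linear_lookup], simp)
  then show ?thesis unfolding PS[symmetric] by (intro exI[of _ K]) (auto simp: abs_le_iff)
qed

text \<open>While the facet is not reached, every step along \<open>v\<close> stays in
  \<open>P\<close>. As \<open>P\<close> is bounded and \<open>v\<close> is nonzero, the walk has to
  end, and it can end only in \<open>F\<close>. The number \<open>k\<close> is that of the first
  visit.\<close>

lemma column_walk:
  assumes v: "v \<in> Zn n" "v \<noteq> 0" and col: "\<And>x. x \<in> L \<Longrightarrow> x \<notin> F \<Longrightarrow> x + v \<in> P" and x: "x \<in> L"
  shows "\<exists>k::nat. x + real k *\<^sub>R v \<in> F \<and> (\<forall>j\<le>k. x + real j *\<^sub>R v \<in> L) \<and> (\<forall>j<k. x + real j *\<^sub>R v \<notin> F)"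
proof -
  have step: "x + real j *\<^sub>R v \<in> L" if "\<forall>i<j. x + real i *\<^sub>R v \<notin> F" for j
    using that
  proof (induction j)
    case (Suc j)
    then have "x + real j *\<^sub>R v \<in> L" "x + real j *\<^sub>R v \<notin> F" by auto
    then have "x + real j *\<^sub>R v + v \<in> L" using col v Zn_add by blast
    then show ?case by (simp add: algebra_simps)
  qed (use x in simp)
  have "\<exists>k. x + real k *\<^sub>R v \<in> F"
  proof (rule ccontr)
    assume "\<not> ?thesis"
    then have all: "x + real j *\<^sub>R v \<in> P" for j using step by blast
    obtain i where i: "lk v i \<noteq> 0" using v(2) by (metis poly_mapping_eqI lookup_zero)
    obtain K where K: "\<forall>y\<in>P. \<bar>lk y i\<bar> \<le> K" using coord_bounded by blast
    obtain j :: nat where j: "(K + \<bar>lk x i\<bar>) / \<bar>lk v i\<bar> < real j" using reals_Archimedean2 by blast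
    then have "K + \<bar>lk x i\<bar> < real j * \<bar>lk v i\<bar>" using i by (simp add: divide_less_eq)
    also have "\<dots> = \<bar>real j * lk v i\<bar>" by (simp add: abs_mult)
    finally have "K < \<bar>lk x i + real j * lk v i\<bar>" by linarith
    then show False using K all[of j] by (auto simp: lookup_add lookup_scaleR)
  qed
  then obtain k where k: "x + real k *\<^sub>R v \<in> F" "\<forall>j<k. x + real j *\<^sub>R v \<notin> F"
    using exists_least_iff[of "\<lambda>k. x + real k *\<^sub>R v \<in> F"] by blast
  moreover have "x + real j *\<^sub>R v \<in> L" if "j \<le> k" for j using step[of j] k(2) that by auto
  ultimately show ?thesis by blast
qed

text \<open>Walking along the column direction reaches the face from every lattice point, so that the face
  together with \<open>v\<close> spans the whole space: a proper exposed face with the column property has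
  codimension 1.\<close>

lemma facet_if_column:
  fixes \<psi> :: "pt \<Rightarrow> real"
  assumes "linear \<psi>" "\<And>x. x \<in> P \<Longrightarrow> b \<le> \<psi> x" "\<exists>x\<in>P. \<psi> x \<noteq> b"
    and v: "v \<in> Zn n" "v \<noteq> 0" and col: "\<And>x. x \<in> L \<Longrightarrow> \<psi> x \<noteq> b \<Longrightarrow> x + v \<in> P"
  shows "facet P {x \<in> P. \<psi> x = b}"
proof -
  let ?F = "{x \<in> P. \<psi> x = b}"
  have walk: "\<exists>k::nat. x + real k *\<^sub>R v \<in> ?F" if "x \<in> L" for x
    using column_walk[OF v _ that, of ?F] col by blast
  obtain s0 where "s0 \<in> S" using S_ne by blast
  then obtain a where a: "a \<in> ?F" using walk S_sub by blast
  have FR: "?F \<subseteq> Rn n" using P_sub by auto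
  have dR: "dirs ?F a \<subseteq> Rn n" using FR a by (auto simp: dirs_def intro!: subspace_diff[OF subspace_Rn])
  obtain C where C: "C \<subseteq> dirs ?F a" "independent C" "dirs ?F a \<subseteq> span C" "card C = dim (dirs ?F a)"
    using real_vector.basis_exists by blast
  have fC: "finite C" using Rn_independent_bound[of C n] C dR by blast
  have "Rn n \<subseteq> span (insert v C)"
  proof (rule affine_translate_span_P)
    show "a \<in> P" using a by simp
    fix s assume "s \<in> S"
    then obtain k where k: "s + real k *\<^sub>R v \<in> ?F" using walk S_sub by blast
    then have "s + real k *\<^sub>R v - a \<in> dirs ?F a" by (auto simp: dirs_def)
    then have "s + real k *\<^sub>R v - a \<in> span (insert v C)" using C(3) span_mono[of C "insert v C"] by blast
    moreover have "real k *\<^sub>R v \<in> span (insert v C)" by (intro span_scale span_base) simp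
    ultimately have "(s + real k *\<^sub>R v - a) - real k *\<^sub>R v \<in> span (insert v C)" by (rule span_diff)
    then show "s - a \<in> span (insert v C)" by (simp add: algebra_simps)
  qed
  then have "n \<le> card (insert v C)" using Rn_subset_span_card fC by blast
  then have 1: "n \<le> Suc (card C)" using card_insert_le_m1[of "Suc (card C)" C v] by simp
  obtain p where p: "p \<in> P" "\<psi> p \<noteq> b" using assms(3) by blast
  have "\<psi> x = 0" if "x \<in> span C" for x
    by (rule linear_eq_0_on_span[OF assms(1) _ that])
       (use C(1) a in \<open>auto simp: dirs_def linear_diff[OF assms(1)]\<close>)
  moreover have "\<psi> (p - a) \<noteq> 0" using p a by (auto simp: linear_diff[OF assms(1)])
  ultimately have pn: "p - a \<notin> span C" by blast
  have "independent (insert (p - a) C)" by (rule independent_insertI[OF pn C(2)])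
  moreover have "insert (p - a) C \<subseteq> Rn n"
    using C(1) dR p a P_sub FR by (auto intro!: subspace_diff[OF subspace_Rn])
  ultimately have "card (insert (p - a) C) \<le> n" using Rn_independent_bound by blast
  moreover have "p - a \<notin> C" using pn span_base by blast
  ultimately have "Suc (card C) \<le> n" using fC by simp
  then have "Suc (dim (dirs ?F a)) = n" using 1 C(4) by simp
  moreover have "?F face_of P" by (rule exposed_face_of_linear[OF assms(1) convexP assms(2)])
  ultimately show ?thesis using facet_iff[OF a, of P] FR pdimP by simp
qed

lemma base_facet_of_iff: "base_facet_of P v F \<longleftrightarrow> facet P F \<and> (\<forall>x\<in>L - F. x + v \<in> P)"
  by (simp add: base_facet_of_def lattice_pts)

text \<open>The walk from any lattice point of \<open>P\<close> ends on \<open>F\<close>, so the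
  values of the form at these points differ from the minimum by multiples of its value at
  \<open>v\<close>. The points generate the lattice and the form is onto the integers, so this value
  is 1 or -1; it is negative because a walk from outside \<open>F\<close> descends to the
  minimum.\<close>

lemma column_form:
  assumes v: "v \<in> Zn n" "v \<noteq> 0" and "base_facet_of P v F"
  shows "facet_form P F v = -1"
proof -
  have F: "facet P F" and col: "\<And>x. x \<in> L \<Longrightarrow> x \<notin> F \<Longrightarrow> x + v \<in> P"
    using assms(3) by (auto simp: base_facet_of_iff)
  let ?\<phi> = "facet_form P F" and ?b = "facet_min P F"
  note lin = linear_facet_form[OF F]
  have walk: "\<exists>k::nat. ?\<phi> x + real k * ?\<phi> v = ?b" if x: "x \<in> L" for x
  proof -
    obtain k :: nat where "x + real k *\<^sub>R v \<in> F" using column_walk[OF v col x] by blast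
    from facet_form_on[OF F this] show ?thesis
      by (intro exI[of _ k]) (simp add: linear_add[OF lin] linear_scale[OF lin])
  qed
  obtain p where p: "p \<in> S" "p \<notin> F" by (rule facet_proper[OF F])
  then obtain k :: nat where k: "?\<phi> p + real k * ?\<phi> v = ?b" using walk S_sub by blast
  have "?b < ?\<phi> p" using facet_form_gt[OF F _ p(2)] p S_sub by blast
  then have neg: "?\<phi> v < 0" using k by (metis add.commute add_increasing leD linorder_not_less mult_nonneg_nonneg of_nat_0_le_iff order_refl)
  obtain z0 where z0: "z0 \<in> S" "z0 \<in> F" by (rule facet_lattice_point[OF F])
  have z0Z: "z0 \<in> Zn n" and z0b: "?\<phi> z0 = ?b" using z0 SZ facet_form_on[OF F] by auto
  define H where "H = {h \<in> Zn n. \<exists>j::int. ?\<phi> h = of_int j * ?\<phi> v}"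
  have "affine_sublattice n ((+) z0 ` H)"
    unfolding affine_sublattice_def
  proof (intro conjI exI)
    show "(+) z0 ` H \<subseteq> Zn n" using z0Z Zn_add by (auto simp: H_def)
    show "0 \<in> H" by (auto simp: H_def Zn_0 linear_0[OF lin] intro: exI[of _ 0])
    show "\<forall>a\<in>H. \<forall>b\<in>H. a - b \<in> H"
    proof (intro ballI)
      fix a b assume "a \<in> H" "b \<in> H"
      then obtain i j :: int where "a \<in> Zn n" "b \<in> Zn n" "?\<phi> a = of_int i * ?\<phi> v" "?\<phi> b = of_int j * ?\<phi> v"
        by (auto simp: H_def)
      then show "a - b \<in> H"
        by (auto simp: H_def Zn_diff linear_diff[OF lin] left_diff_distrib intro!: exI[of _ "i - j"])
    qed
  qed simp
  moreover have "L \<subseteq> (+) z0 ` H"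
  proof
    fix x assume x: "x \<in> L"
    obtain k :: nat where k: "?\<phi> x + real k * ?\<phi> v = ?b" using walk[OF x] by blast
    then have "?\<phi> (x - z0) = of_int (- int k) * ?\<phi> v" using z0b by (simp add: linear_diff[OF lin])
    then have "x - z0 \<in> H" using x z0Z Zn_diff unfolding H_def by blast
    then show "x \<in> (+) z0 ` H" by (auto intro!: image_eqI[of _ _ "x - z0"])
  qed
  ultimately have AZ: "(+) z0 ` H = Zn n" by (rule gen)
  obtain z where z: "z \<in> Zn n" "?\<phi> z = 1" using facet_form_onto[OF F] by blast
  then have "z0 + z \<in> (+) z0 ` H" using AZ z0Z Zn_add by simp
  then have "z \<in> H" by auto
  then obtain j :: int where j: "1 = of_int j * ?\<phi> v" using z by (auto simp: H_def)
  obtain m :: int where m: "?\<phi> v = of_int m" using facet_form_Ints[OF F v(1)] by (meson Ints_cases)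
  have "(1::real) = of_int (j * m)" using j m by simp
  then have "j * m = 1" by linarith
  then have "m = 1 \<or> m = -1" by (auto simp: zmult_eq_1_iff)
  then show ?thesis using neg m by auto
qed

text \<open>A facet other than \<open>F\<close> contains a point of \<open>S\<close> off
  \<open>F\<close>, which \<open>v\<close> moves inside \<open>P\<close>; there the form of
  \<open>G\<close> cannot drop below its minimum.\<close>

lemma column_form_other:
  assumes v: "v \<in> Zn n" "v \<noteq> 0" and "base_facet_of P v F" and G: "facet P G" "G \<noteq> F"
  shows "0 \<le> facet_form P G v" and "\<exists>s\<in>S. s \<in> G \<and> s \<notin> F"
proof -
  have F: "facet P F" and col: "\<And>x. x \<in> L \<Longrightarrow> x \<notin> F \<Longrightarrow> x + v \<in> P"
    using assms(3) by (auto simp: base_facet_of_iff)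
  obtain p where p: "p \<in> S" "p \<notin> F" by (rule facet_proper[OF F])
  then have "\<exists>x\<in>P. facet_form P F x \<noteq> facet_min P F" using facet_vertex_iff[OF F] S_sub by blast
  then obtain s where s: "s \<in> S" "s \<in> G" "facet_min P F < facet_form P F s"
    using facet_not_subset[OF G(1) linear_facet_form[OF F] facet_form_ge[OF F]] facet_eq[OF F] G(2)
    by blast
  then have sF: "s \<notin> F" using facet_form_on[OF F, of s] by auto
  then show "\<exists>s\<in>S. s \<in> G \<and> s \<notin> F" using s by blast
  have "s + v \<in> P" using col[of s] s sF S_sub by blast
  from facet_form_ge[OF G(1) this] show "0 \<le> facet_form P G v"
    using facet_form_on[OF G(1) s(2)] by (simp add: linear_add[OF linear_facet_form[OF G(1)]])
qed

lemma base_facet_eqI: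
  assumes v: "v \<in> Zn n" "v \<noteq> 0" and F: "base_facet_of P v F"
  shows "base_facet P v = F"
  unfolding base_facet_def
proof (rule the_equality)
  show "base_facet_of P v F" by (rule F)
next
  fix G assume G: "base_facet_of P v G"
  show "G = F"
  proof (rule ccontr)
    assume "G \<noteq> F"
    then have "0 \<le> facet_form P G v" using column_form_other(1)[OF v F] G by (simp add: base_facet_of_iff)
    then show False using column_form[OF v G] by simp
  qed
qed

lemma ColD:
  assumes "v \<in> Col P"
  shows "v \<in> Zn n" "v \<noteq> 0" "base_facet_of P v (base_facet P v)" "facet P (base_facet P v)"
    "\<And>x. x \<in> L \<Longrightarrow> x \<notin> base_facet P v \<Longrightarrow> x + v \<in> P"
    "facet_form P (base_facet P v) v = -1"
proof -
  show v: "v \<in> Zn n" "v \<noteq> 0" using assms by (auto simp: Col_def pdimP)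
  obtain F where "base_facet_of P v F" using assms by (auto simp: Col_def)
  then show b: "base_facet_of P v (base_facet P v)" using base_facet_eqI[OF v] by simp
  then show "facet P (base_facet P v)"
    "\<And>x. x \<in> L \<Longrightarrow> x \<notin> base_facet P v \<Longrightarrow> x + v \<in> P" by (auto simp: base_facet_of_iff)
  show "facet_form P (base_facet P v) v = -1" by (rule column_form[OF v b])
qed

lemma ColI:
  assumes "v \<in> Zn n" "v \<noteq> 0" "facet P F" "\<And>x. x \<in> L \<Longrightarrow> x \<notin> F \<Longrightarrow> x + v \<in> P"
  shows "v \<in> Col P" "base_facet P v = F"
proof -
  have b: "base_facet_of P v F" using assms by (auto simp: base_facet_of_iff)
  then show "v \<in> Col P" using assms by (auto simp: Col_def pdimP)
  show "base_facet P v = F" by (rule base_facet_eqI[OF assms(1,2) b])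
qed

abbreviation "bf \<equiv> base_facet P"
abbreviation "ff v \<equiv> facet_form P (base_facet P v)"
abbreviation "fm v \<equiv> facet_min P (base_facet P v)"

lemma ff_cases:
  assumes u: "u \<in> Col P" and F: "facet P F"
  shows "F = bf u \<and> facet_form P F u = -1 \<or> F \<noteq> bf u \<and> 0 \<le> facet_form P F u"
  using ColD(6)[OF u] column_form_other(1)[OF ColD(1-3)[OF u] F] by (cases "F = bf u") simp_all

text \<open>The last lattice point of a walk before it enters the base facet has height 1.\<close>

lemma height_one:
  assumes v: "v \<in> Col P" shows "\<exists>x\<in>L. ff v x = fm v + 1"
proof -
  note F = ColD(4)[OF v]
  obtain p where p: "p \<in> S" "p \<notin> bf v" by (rule facet_proper[OF F])
  then obtain k :: nat where k: "p + real k *\<^sub>R v \<in> bf v" "\<forall>j\<le>k. p + real j *\<^sub>R v \<in> L"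
    using column_walk[OF ColD(1,2)[OF v] ColD(5)[OF v], where x = p] S_sub by blast
  have "k \<noteq> 0" using k p by (cases k) auto
  then obtain j where j: "k = Suc j" by (cases k) auto
  let ?x = "p + real j *\<^sub>R v"
  have "?x \<in> L" using k j by simp
  moreover have "p + real k *\<^sub>R v = ?x + v" using j by (simp add: scaleR_add_left add_ac)
  then have "ff v (?x + v) = fm v" using facet_form_on[OF F k(1)] by metis
  then have "ff v ?x = fm v + 1" using ColD(6)[OF v] by (simp add: linear_add[OF linear_facet_form[OF F]])
  ultimately show ?thesis by blast
qed

text \<open>A positive value means that \<open>u\<close> moves points of \<open>P\<close> off
  \<open>bf w\<close>. Otherwise the defining condition fails at an explicit point: for equal base
  facets at a point of height 1, which \<open>u\<close> moves onto the facet, and for value 0 at a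
  point of \<open>S\<close> on \<open>bf w\<close> outside \<open>bf u\<close>, which
  \<open>u\<close> keeps on \<open>bf w\<close>.\<close>

lemma col_prod_iff:
  "col_prod P u w \<noteq> None \<longleftrightarrow> u \<in> Col P \<and> w \<in> Col P \<and> u + w \<noteq> 0 \<and> 0 < ff w u"
proof (cases "u \<in> Col P \<and> w \<in> Col P \<and> u + w \<noteq> 0")
  case True
  then have u: "u \<in> Col P" and w: "w \<in> Col P" by auto
  note Fu = ColD(4)[OF u] and Fw = ColD(4)[OF w]
  note lin = linear_facet_form[OF Fw]
  have "(\<forall>x\<in>L - bf u. x + u \<notin> bf w) \<longleftrightarrow> 0 < ff w u"
  proof
    assume *: "\<forall>x\<in>L - bf u. x + u \<notin> bf w"
    show "0 < ff w u"
    proof (rule ccontr)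
      assume n: "\<not> 0 < ff w u"
      consider "bf w = bf u" | "bf w \<noteq> bf u" "ff w u = 0" using ff_cases[OF u Fw] n by force
      then show False
      proof cases
        case 1
        obtain x where x: "x \<in> L" "ff u x = fm u + 1" using height_one[OF u] by blast
        then have xF: "x \<notin> bf u" using facet_form_on[OF Fu, of x] by auto
        then have "x + u \<in> P" using ColD(5)[OF u x(1)] by blast
        moreover have "ff u (x + u) = fm u" using x ColD(6)[OF u] by (simp add: linear_add[OF linear_facet_form[OF Fu]])
        ultimately have "x + u \<in> bf u" using facet_eq[OF Fu] by blast
        then show False using * x xF 1 by simp
      next
        case 2
        obtain s where s: "s \<in> S" "s \<in> bf w" "s \<notin> bf u"
          using column_form_other(2)[OF ColD(1-3)[OF u] Fw 2(1)] by blast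
        have sL: "s \<in> L" using s S_sub by blast
        then have "s + u \<in> P" using ColD(5)[OF u sL s(3)] by blast
        moreover have "ff w (s + u) = fm w" using 2 facet_form_on[OF Fw s(2)] by (simp add: linear_add[OF lin])
        ultimately have "s + u \<in> bf w" using facet_eq[OF Fw] by blast
        then show False using * sL s by blast
      qed
    qed
  next
    assume p: "0 < ff w u"
    show "\<forall>x\<in>L - bf u. x + u \<notin> bf w"
    proof
      fix x assume x: "x \<in> L - bf u"
      then have "fm w < ff w (x + u)" using p facet_form_ge[OF Fw, of x] by (auto simp: linear_add[OF lin])
      then show "x + u \<notin> bf w" using facet_form_on[OF Fw, of "x + u"] by auto
    qed
  qed
  then show ?thesis using True by (simp add: col_prod_def lattice_pts)
qed (auto simp: col_prod_def)

lemma col_prod_Some: "col_prod P u w = Some z \<Longrightarrow> z = u + w"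
  by (auto simp: col_prod_def split: if_splits)

text \<open>After a step along \<open>u\<close> a lattice point is off \<open>bf w\<close>, so a
  step along \<open>w\<close> is possible.\<close>

lemma col_product:
  assumes u: "u \<in> Col P" and w: "w \<in> Col P" and "u + w \<noteq> 0" "0 < ff w u"
  shows "u + w \<in> Col P" "bf (u + w) = bf u"
proof -
  note Fu = ColD(4)[OF u] and Fw = ColD(4)[OF w]
  have col: "x + (u + w) \<in> P" if x: "x \<in> L" "x \<notin> bf u" for x
  proof -
    have xu: "x + u \<in> P" using ColD(5)[OF u x] .
    then have xuL: "x + u \<in> L" using x ColD(1)[OF u] Zn_add by blast
    have "fm w < ff w (x + u)" using assms(4) facet_form_ge[OF Fw, of x] x
      by (auto simp: linear_add[OF linear_facet_form[OF Fw]])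
    then have "x + u \<notin> bf w" using facet_form_on[OF Fw, of "x + u"] by auto
    then have "x + u + w \<in> P" using ColD(5)[OF w xuL] by blast
    then show ?thesis by (simp add: add.assoc)
  qed
  show "u + w \<in> Col P" "bf (u + w) = bf u"
    using ColI[OF Zn_add[OF ColD(1)[OF u] ColD(1)[OF w]] assms(3) Fu col] by blast+
qed

section \<open>Heights on the semigroup of a polytope\<close>

lemma col_height_add: "v \<in> Col P \<Longrightarrow> col_height P v (x + y) = col_height P v x + col_height P v y"
  using linear_add[OF linear_facet_form[OF ColD(4)[of v]]] by (simp add: col_height_def distrib_right)

text \<open>Induction on the generators. If the last generator \<open>z\<close> lies off the base
  facet, the shift by \<open>v\<close> is applied to it; otherwise \<open>z\<close> has height 0 and
  the shift is applied to the remaining element.\<close>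

lemma col_height_semigrp:
  assumes v: "v \<in> Col P" and x: "x \<in> semigrp P"
  shows "col_height P v x \<in> \<int>" "0 \<le> col_height P v x"
    "0 < col_height P v x \<Longrightarrow> x + (v, 0) \<in> semigrp P"
proof -
  note F = ColD(4)[OF v]
  have "col_height P v x \<in> \<int> \<and> 0 \<le> col_height P v x \<and> (0 < col_height P v x \<longrightarrow> x + (v, 0) \<in> semigrp P)"
    using x
  proof induction
    case zero
    then show ?case by (simp add: col_height_def zero_prod_def linear_0[OF linear_facet_form[OF F]])
  next
    case (step x z)
    then have z: "z \<in> L" by (simp add: lattice_pts)
    have e: "col_height P v (x + (z, 1)) = col_height P v x + (ff v z - fm v)"
      by (simp add: col_height_add[OF v]) (simp add: col_height_def)
    have i: "ff v z - fm v \<in> \<int>" using z facet_form_Ints[OF F] facet_min_Ints[OF F] by auto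
    have g: "0 \<le> ff v z - fm v" using z facet_form_ge[OF F] by auto
    have "x + (z, 1) + (v, 0) \<in> semigrp P" if p: "0 < col_height P v (x + (z, 1))"
    proof (cases "z \<in> bf v")
      case True
      then have "0 < col_height P v x" using p e facet_form_on[OF F] by auto
      then have "x + (v, 0) + (z, 1) \<in> semigrp P" using step semigrp.step by blast
      then show ?thesis by (simp add: add_ac)
    next
      case False
      then have "z + v \<in> L" using ColD(5)[OF v z] z ColD(1)[OF v] Zn_add by blast
      then have "x + (z + v, 1) \<in> semigrp P" using step semigrp.step by (simp add: lattice_pts)
      moreover have "x + (z, 1) + (v, 0) = x + (z + v, 1)" by (cases x) (simp add: add.assoc)
      ultimately show ?thesis by metis
    qed
    then show ?case using e i g step by auto
  qed
  then show "col_height P v x \<in> \<int>" "0 \<le> col_height P v x"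
    "0 < col_height P v x \<Longrightarrow> x + (v, 0) \<in> semigrp P" by auto
qed

end

section \<open>Doublings\<close>

lemma single_scaleR: "Poly_Mapping.single i s = s *\<^sub>R ee i" by (simp add: scaleR_ee)

lemma int_mult_eq_minus_1: "(i::int) * j = - 1 \<Longrightarrow> 0 \<le> j \<Longrightarrow> i = - 1 \<and> j = 1"
  using zmult_eq_1_iff[of "- i" j] by auto

context lpoly begin

lemma facet_const:
  fixes \<psi> :: "pt \<Rightarrow> real"
  assumes F: "facet P F" and "linear \<psi>" "\<And>s. s \<in> S \<Longrightarrow> s \<in> F \<Longrightarrow> \<psi> s = c" "x \<in> F"
  shows "\<psi> x = c"
proof -
  have "{s \<in> S. facet_form P F s = facet_min P F} \<subseteq> \<psi> -` {c}"
    using assms(3) facet_vertex_iff[OF F] by auto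
  then have "convex hull {s \<in> S. facet_form P F s = facet_min P F} \<subseteq> \<psi> -` {c}"
    by (rule hull_minimal) (intro convex_linear_vimage[OF assms(2)], simp)
  then show ?thesis using facet_hull[OF F] assms(4) by auto
qed

lemma vertices_const:
  fixes \<psi> :: "pt \<Rightarrow> real"
  assumes "linear \<psi>" "\<And>s. s \<in> S \<Longrightarrow> \<psi> s = c" "x \<in> P"
  shows "\<psi> x = c"
proof -
  have "S \<subseteq> \<psi> -` {c}" using assms(2) by auto
  then have "convex hull S \<subseteq> \<psi> -` {c}"
    by (rule hull_minimal) (intro convex_linear_vimage[OF assms(1)], simp)
  then show ?thesis using assms(3) by (auto simp: PS[symmetric])
qed

lemma Ints_ge_1: "(a::real) \<in> \<int> \<Longrightarrow> 0 < a \<Longrightarrow> 1 \<le> a"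
  by (auto elim!: Ints_cases)

lemma facet_gap: "facet P F \<Longrightarrow> x \<in> L \<Longrightarrow> x \<notin> F \<Longrightarrow> facet_min P F + 1 \<le> facet_form P F x"
  using Ints_ge_1[of "facet_form P F x - facet_min P F"] facet_form_Ints[of F x] facet_min_Ints[of F]
    facet_form_gt[of F x] by auto

end

locale doub = lpoly + fixes F assumes F: "facet P F"
begin

abbreviation "\<phi> \<equiv> facet_form P F"
abbreviation "b \<equiv> facet_min P F"
abbreviation "D \<equiv> doubling P F"
text \<open>The point of the doubling at full height above \<open>x\<close>; over \<open>F\<close>
  it is \<open>x\<close> itself.\<close>

definition "lift x = x + (\<phi> x - b) *\<^sub>R ee n" for x
definition "S' = S \<union> lift ` S"

lemma lin\<phi>: "linear \<phi>" by (rule linear_facet_form[OF F])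

lemma P_lk: "x \<in> P \<Longrightarrow> n \<le> i \<Longrightarrow> lk x i = 0" using P_sub by (auto simp: Rn_iff)

text \<open>The form of \<open>F\<close> ignores the new coordinate, so the doubling is described by
  inequalities in \<open>y\<close> itself, from which convexity can be read off.\<close>

lemma D_iff: "y \<in> D \<longleftrightarrow> y - lk y n *\<^sub>R ee n \<in> P \<and> 0 \<le> lk y n \<and> lk y n \<le> \<phi> y - b"
proof -
  have "\<phi> (y - lk y n *\<^sub>R ee n) = \<phi> y"
    using facet_form_outside[OF F, of n] by (simp add: linear_diff[OF lin\<phi>] linear_scale[OF lin\<phi>])
  moreover have "y \<in> D \<longleftrightarrow> y - lk y n *\<^sub>R ee n \<in> P \<and> 0 \<le> lk y n \<and> lk y n \<le> \<phi> (y - lk y n *\<^sub>R ee n) - b"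
    unfolding doubling_def pdimP facet_height_def
  proof safe
    fix x s assume x: "x \<in> P" "0 \<le> s" "s \<le> \<phi> x - b"
    have l: "lk (x + Poly_Mapping.single n s) n = s" using P_lk[OF x(1)] by (simp add: lookup_add)
    have e: "x + Poly_Mapping.single n s - s *\<^sub>R ee n = x" by (simp add: single_scaleR[of n s])
    show "x + Poly_Mapping.single n s - lk (x + Poly_Mapping.single n s) n *\<^sub>R ee n \<in> P"
      "0 \<le> lk (x + Poly_Mapping.single n s) n"
      "lk (x + Poly_Mapping.single n s) n \<le> \<phi> (x + Poly_Mapping.single n s - lk (x + Poly_Mapping.single n s) n *\<^sub>R ee n) - b"
      unfolding l e using x by auto
  next
    assume "y - lk y n *\<^sub>R ee n \<in> P" "0 \<le> lk y n" "lk y n \<le> \<phi> (y - lk y n *\<^sub>R ee n) - b"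
    then show "\<exists>x s. y = x + Poly_Mapping.single n s \<and> x \<in> P \<and> 0 \<le> s \<and> s \<le> \<phi> x - b"
      by (intro exI[of _ "y - lk y n *\<^sub>R ee n"] exI[of _ "lk y n"]) (simp add: single_scaleR[of n "lk y n"])
  qed
  ultimately show ?thesis by simp
qed

lemma form_ee_n: "facet P G \<Longrightarrow> facet_form P G (y + s *\<^sub>R ee n) = facet_form P G y"
  using facet_form_outside[of G n] linear_facet_form[of G] by (simp add: linear_add linear_scale)

lemma D_add_iff: "x \<in> Rn n \<Longrightarrow> x + s *\<^sub>R ee n \<in> D \<longleftrightarrow> x \<in> P \<and> 0 \<le> s \<and> s \<le> \<phi> x - b"
  by (simp add: D_iff lookup_add lookup_scaleR Rn_iff form_ee_n[OF F])

lemma P_D: "P \<subseteq> D"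
proof
  fix x assume x: "x \<in> P"
  then show "x \<in> D" using D_add_iff[of x 0] facet_form_ge[OF F x] P_sub by auto
qed

lemma linear_proj: "linear (\<lambda>y. y - lk y n *\<^sub>R ee n)"
  by (rule linearI) (simp_all add: lookup_add lookup_scaleR scaleR_add_left scaleR_diff_right)

lemma doubling_convex: "convex D"
proof -
  have 1: "convex ((\<lambda>y. y - lk y n *\<^sub>R ee n) -` P)" by (rule convex_linear_vimage[OF linear_proj convexP])
  have 2: "convex ((\<lambda>y. lk y n) -` {0..})" by (rule convex_linear_vimage[OF linear_lookup]) simp
  have 3: "convex ((\<lambda>y. \<phi> y - lk y n) -` {b..})"
    by (rule convex_linear_vimage[OF linear_compose_sub[OF lin\<phi> linear_lookup]]) simp
  have "D = (\<lambda>y. y - lk y n *\<^sub>R ee n) -` P \<inter> ((\<lambda>y. lk y n) -` {0..} \<inter> (\<lambda>y. \<phi> y - lk y n) -` {b..})"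
    by (auto simp: D_iff)
  then show ?thesis using 1 2 3 by (simp add: convex_Int)
qed

lemma lift_D: "x \<in> P \<Longrightarrow> lift x \<in> D"
  unfolding lift_def using D_add_iff[of x] P_sub facet_form_ge[OF F] by auto

text \<open>A point of the doubling lies on the vertical segment from its projection
  \<open>x\<close> to \<open>lift x\<close>, and \<open>lift\<close> is affine on \<open>P\<close>,
  so it maps hulls to hulls.\<close>

lemma D_hull: "D = convex hull S'"
proof
  show "convex hull S' \<subseteq> D"
  proof (rule hull_minimal)
    show "S' \<subseteq> D" using S_sub P_D lift_D by (auto simp: S'_def)
    show "convex D" by (rule doubling_convex)
  qed
  show "D \<subseteq> convex hull S'"
  proof
    fix y assume y: "y \<in> D"
    define x where "x = y - lk y n *\<^sub>R ee n"
    have x: "x \<in> P" "0 \<le> lk y n" "lk y n \<le> \<phi> x - b" "y = x + lk y n *\<^sub>R ee n"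
      using y D_iff[of y] form_ee_n[OF F, of x "lk y n"] by (auto simp: x_def)
    define g where "g = (\<lambda>x. x + \<phi> x *\<^sub>R ee n)"
    define z where "z = (- b) *\<^sub>R ee n"
    have ling: "linear g" unfolding g_def
      by (rule linearI) (simp_all add: linear_add[OF lin\<phi>] linear_scale[OF lin\<phi>] scaleR_add_left scaleR_add_right)
    have t: "lift ` W = (\<lambda>x. z + x) ` (g ` W)" for W
      by (auto simp: image_image lift_def g_def z_def algebra_simps)
    have "convex hull (lift ` S) = (\<lambda>x. z + x) ` (g ` (convex hull S))"
      by (simp only: t convex_hull_translation convex_hull_linear_image[OF ling])
    then have "lift ` P = convex hull (lift ` S)" using t[of P] PS by simp
    moreover have "convex hull (lift ` S) \<subseteq> convex hull S'" by (rule hull_mono) (simp add: S'_def)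
    ultimately have tx: "lift x \<in> convex hull S'" using x(1) by blast
    have "convex hull S \<subseteq> convex hull S'" by (rule hull_mono) (simp add: S'_def)
    then have xx: "x \<in> convex hull S'" using x(1) PS by blast
    show "y \<in> convex hull S'"
    proof (cases "\<phi> x - b = 0")
      case True
      then show ?thesis using x xx by simp
    next
      case False
      define \<theta> where "\<theta> = lk y n / (\<phi> x - b)"
      have \<theta>: "0 \<le> \<theta>" "\<theta> \<le> 1" "\<theta> * (\<phi> x - b) = lk y n" using x False by (auto simp: \<theta>_def)
      have "(1 - \<theta>) *\<^sub>R x + \<theta> *\<^sub>R lift x = x + (\<theta> * (\<phi> x - b)) *\<^sub>R ee n"
        by (simp add: lift_def algebra_simps)
      also have "\<dots> = y" using \<theta>(3) x(4) by simp
      finally show ?thesis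
        using convexD[OF convex_convex_hull xx tx, of "1 - \<theta>" \<theta>] \<theta> by simp
    qed
  qed
qed

lemma lift_Z: "s \<in> S \<Longrightarrow> lift s \<in> Zn (Suc n)"
  unfolding lift_def using SZ Zn_mono[of n "Suc n"] facet_form_Ints[OF F] facet_min_Ints[OF F]
  by (intro Zn_add Zn_scale ee_in_Zn) auto

lemma lpoly_D: "lpoly D (Suc n) S'"
proof
  show "finite S'" by (simp add: S'_def finS)
  show "S' \<subseteq> Zn (Suc n)" using SZ Zn_mono[of n "Suc n"] lift_Z by (auto simp: S'_def)
  show "D = convex hull S'" by (rule D_hull)
  \<comment> \<open>A lattice point off the facet has height at least 1, so the doubling contains
    both \<open>p\<close> and \<open>p + ee n\<close>; their difference is the new direction, for
    the affine hull as well as for the lattice.\<close>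
  obtain p where p: "p \<in> S" "p \<notin> F" by (rule facet_proper[OF F])
  have pL: "p \<in> L" using p S_sub by blast
  have hp: "1 \<le> \<phi> p - b" using facet_gap[OF F pL p(2)] by simp
  have p1: "p + 1 *\<^sub>R ee n \<in> D"
  proof -
    have "p \<in> Rn n" "p \<in> P" using pL P_sub by auto
    then show ?thesis unfolding D_add_iff[OF \<open>p \<in> Rn n\<close>] using hp by simp
  qed
  have pD: "p \<in> D" using pL P_D by blast
  have DR: "D \<subseteq> Rn (Suc n)"
  proof
    fix y assume "y \<in> D"
    then have "y - lk y n *\<^sub>R ee n \<in> Rn n" using D_iff P_sub by blast
    then have "y - lk y n *\<^sub>R ee n + lk y n *\<^sub>R ee n \<in> Rn (Suc n)"
      using Rn_mono[of n "Suc n"] by (intro subspace_add subspace_scale subspace_Rn ee_in_Rn) auto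
    then show "y \<in> Rn (Suc n)" by simp
  qed
  show "affine hull D = Rn (Suc n)"
  proof
    show "affine hull D \<subseteq> Rn (Suc n)"
      by (rule hull_minimal[OF DR]) (rule subspace_imp_affine[OF subspace_Rn])
    have RnD: "Rn n \<subseteq> affine hull D" using affP hull_mono[OF P_D, of affine] by simp
    then have "0 \<in> affine hull D" using subspace_0[OF subspace_Rn] by blast
    then have sp: "affine hull D = span D" by (rule affine_hull_span_0)
    have "(p + 1 *\<^sub>R ee n) - p \<in> span D" by (intro span_diff span_base p1 pD)
    then have "ee n \<in> span D" by simp
    moreover have "ee i \<in> span D" if "i < n" for i using RnD sp ee_in_Rn[OF that] by blast
    ultimately have "ee ` {..<Suc n} \<subseteq> span D" by (auto simp: less_Suc_eq)
    then show "Rn (Suc n) \<subseteq> affine hull D" unfolding sp Rn_eq_span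
      by (rule span_minimal) simp
  qed
  fix A assume A: "affine_sublattice (Suc n) A" "D \<inter> Zn (Suc n) \<subseteq> A"
  then obtain z H where H: "0 \<in> H" "\<forall>a\<in>H. \<forall>b\<in>H. a - b \<in> H" "A = (+) z ` H" "A \<subseteq> Zn (Suc n)"
    by (auto simp: affine_sublattice_def)
  have Hneg: "- a \<in> H" if "a \<in> H" for a using H(1,2) that by (metis diff_0)
  have Hadd: "a + c \<in> H" if "a \<in> H" "c \<in> H" for a c using H(2) that Hneg by (metis diff_minus_eq_add)
  have pA: "p \<in> A" using A(2) pD pL Zn_mono[of n "Suc n"] by auto
  \<comment> \<open>The coset is moved to the base point \<open>p\<close>, so that \<open>H\<close>
    can be compared with the lattice of \<open>P\<close>.\<close>
  have A_p: "A = (+) p ` H"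
  proof -
    obtain h where h: "h \<in> H" "p = z + h" using pA H(3) by auto
    have "z + a \<in> (+) p ` H" if "a \<in> H" for a
      using H(2) that h by (intro image_eqI[of _ _ "a - h"]) auto
    moreover have "p + a \<in> (+) z ` H" if "a \<in> H" for a
      using Hadd[OF that h(1)] h by (intro image_eqI[of _ _ "a + h"]) auto
    ultimately show ?thesis unfolding H(3) by blast
  qed
  have HZ: "h \<in> Zn (Suc n)" if "h \<in> H" for h
  proof -
    have "p + h \<in> Zn (Suc n)" using that H(4) A_p by blast
    moreover have "p \<in> Zn (Suc n)" using pL Zn_mono[of n "Suc n"] by auto
    ultimately have "(p + h) - p \<in> Zn (Suc n)" by (rule Zn_diff)
    then show ?thesis by simp
  qed
  have "(+) p ` (H \<inter> Zn n) = Zn n"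
  proof (rule gen)
    show "affine_sublattice n ((+) p ` (H \<inter> Zn n))"
      unfolding affine_sublattice_def
    proof (intro conjI exI)
      show "(+) p ` (H \<inter> Zn n) \<subseteq> Zn n" using pL Zn_add by auto
      show "0 \<in> H \<inter> Zn n" using H(1) Zn_0 by simp
      show "\<forall>a\<in>H \<inter> Zn n. \<forall>b\<in>H \<inter> Zn n. a - b \<in> H \<inter> Zn n" using H(2) Zn_diff by blast
    qed simp
    show "L \<subseteq> (+) p ` (H \<inter> Zn n)"
    proof
      fix x assume x: "x \<in> L"
      then have "x \<in> A" using A(2) P_D Zn_mono[of n "Suc n"] by auto
      then obtain h where h: "h \<in> H" "x = p + h" using A_p by auto
      then have "h = x - p" by simp
      then have "h \<in> Zn n" using x pL Zn_diff by blast
      then show "x \<in> (+) p ` (H \<inter> Zn n)" using h by blast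
    qed
  qed
  then have ZH: "Zn n \<subseteq> H"
  proof -
    assume e: "(+) p ` (H \<inter> Zn n) = Zn n"
    show ?thesis
    proof
      fix h assume "h \<in> Zn n"
      then have "p + h \<in> Zn n" using pL Zn_add by blast
      then have "p + h \<in> (+) p ` (H \<inter> Zn n)" using e by simp
      then show "h \<in> H" by auto
    qed
  qed
  have "p + 1 *\<^sub>R ee n \<in> Zn (Suc n)" using pL Zn_mono[of n "Suc n"] by (intro Zn_add Zn_scale ee_in_Zn) auto
  then have "p + ee n \<in> A" using A(2) p1 by auto
  then have eH: "ee n \<in> H" using A_p by auto
  have natH: "real k *\<^sub>R ee n \<in> H" for k :: nat
    by (induction k) (auto simp: H(1) scaleR_add_left intro: Hadd eH)
  have intH: "of_int k *\<^sub>R ee n \<in> H" for k :: int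
  proof (cases "0 \<le> k")
    case True
    then show ?thesis using natH[of "nat k"] by simp
  next
    case False
    then show ?thesis using Hneg[OF natH[of "nat (-k)"]] by simp
  qed
  show "A = Zn (Suc n)"
  proof
    show "A \<subseteq> Zn (Suc n)" by (rule H(4))
    show "Zn (Suc n) \<subseteq> A"
    proof
      fix y assume y: "y \<in> Zn (Suc n)"
      then have "y - p \<in> Zn (Suc n)" using pL Zn_mono[of n "Suc n"] by (intro Zn_diff) auto
      then have yp: "\<And>i. lk (y - p) i \<in> \<int>" "\<And>i. Suc n \<le> i \<Longrightarrow> lk (y - p) i = 0" by (auto simp: Zn_iff)
      obtain k :: int where k: "lk (y - p) n = of_int k" using yp(1) by (meson Ints_cases)
      have "y - p - of_int k *\<^sub>R ee n \<in> Zn n"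
        unfolding Zn_iff
      proof (intro conjI allI impI)
        show "lk (y - p - of_int k *\<^sub>R ee n) i \<in> \<int>" for i
          using yp(1)[of i] by (simp add: lookup_minus lookup_scaleR lookup_single when_def)
        fix i assume "n \<le> i"
        then show "lk (y - p - of_int k *\<^sub>R ee n) i = 0"
          using k yp(2)[of i] by (cases "i = n") (auto simp: lookup_minus[of "y - p"] lookup_scaleR lookup_single)
      qed
      then have "(y - p - of_int k *\<^sub>R ee n) + of_int k *\<^sub>R ee n \<in> H" using ZH intH Hadd by blast
      then have "y - p \<in> H" by simp
      then have "p + (y - p) \<in> A" using A_p by blast
      then show "y \<in> A" by simp
    qed
  qed
qed

sublocale D: lpoly D "Suc n" S' by (rule lpoly_D)

lemma L_D: "L \<subseteq> D \<inter> Zn (Suc n)" using P_D Zn_mono[of n "Suc n"] by auto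

text \<open>For \<open>bf v = F\<close> the base facet of \<open>v\<close> becomes the graph of the
  height function, since \<open>v\<close> lowers the height; otherwise it is the part of the
  doubling over \<open>bf v\<close>.\<close>

definition "dform v = (if bf v = F then (\<lambda>y. \<phi> y - lk y n) else ff v)" for v

lemma Col_doubling:
  assumes v: "v \<in> Col P"
  shows "v \<in> Col D" "facet_form D (base_facet D v) = dform v" "facet_min D (base_facet D v) = fm v"
    "base_facet D v = {y \<in> D. dform v y = fm v}"
proof -
  let ?\<psi> = "dform v"
  let ?G = "{y \<in> D. ?\<psi> y = fm v}"
  note Fv = ColD(4)[OF v]
  note linv = linear_facet_form[OF Fv]
  have lin: "linear ?\<psi>" unfolding dform_def using linv linear_compose_sub[OF lin\<phi> linear_lookup] by simp
  have \<psi>P: "?\<psi> x = ff v x" if "x \<in> Rn n" for x using that by (auto simp: dform_def Rn_iff)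
  have ffproj: "ff v y = ff v (y - lk y n *\<^sub>R ee n)" for y
    using form_ee_n[OF Fv, of "y - lk y n *\<^sub>R ee n" "lk y n"] by simp
  have ge: "fm v \<le> ?\<psi> y" if y: "y \<in> D" for y
  proof (cases "bf v = F")
    case True
    then show ?thesis using y by (auto simp: dform_def D_iff)
  next
    case False
    then show ?thesis using y facet_form_ge[OF Fv] ffproj[of y] by (auto simp: dform_def D_iff)
  qed
  obtain p where p: "p \<in> S" "p \<notin> bf v" by (rule facet_proper[OF Fv])
  have pP: "p \<in> P" using p S_sub by blast
  have pne: "?\<psi> p \<noteq> fm v" using \<psi>P pP P_sub p facet_vertex_iff[OF Fv] by auto
  have vZ: "v \<in> Zn (Suc n)" using ColD(1)[OF v] Zn_mono[of n "Suc n"] by auto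
  have vlk: "lk v n = 0" using ColD(1)[OF v] by (simp add: Zn_iff)
  have col: "y + v \<in> D" if y: "y \<in> D \<inter> Zn (Suc n)" "?\<psi> y \<noteq> fm v" for y
  proof -
    let ?x = "y - lk y n *\<^sub>R ee n"
    have xP: "?x \<in> P" using y D_iff by blast
    have int: "lk y n \<in> \<int>" using y by (simp add: Zn_iff)
    have xZ: "?x \<in> Zn n"
      using y xP P_sub int by (auto simp: Zn_def) (auto simp: lookup_minus lookup_scaleR lookup_single when_def Zn_iff)
    have l: "lk (y + v) n = lk y n" using vlk by (simp add: lookup_add)
    show ?thesis
    proof (cases "bf v = F")
      case True
      have lt: "b < \<phi> y - lk y n" using y ge[of y] True by (auto simp: dform_def)
      have i: "\<phi> y - lk y n - b \<in> \<int>"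
        using facet_form_Ints[OF F xZ] ffproj[of y] True facet_min_Ints[OF F] int by auto
      \<comment> \<open>A lattice point below the graph is below it by at least 1, and
        \<open>v\<close> lowers the height by exactly 1.\<close>
      have "1 \<le> \<phi> y - lk y n - b" using Ints_ge_1[OF i] lt by simp
      then have ub: "lk y n \<le> \<phi> (y + v) - b" using ColD(6)[OF v] True by (simp add: linear_add[OF lin\<phi>])
      have "0 \<le> lk y n" using y D_iff by blast
      then have "\<phi> ?x \<noteq> b" using lt ffproj[of y] True by auto
      then have "?x \<notin> bf v" using facet_form_on[OF F] True by auto
      then have "?x + v \<in> P" using ColD(5)[OF v] xP xZ by blast
      then have "y + v - lk y n *\<^sub>R ee n \<in> P" by (simp add: algebra_simps)
      then show ?thesis using ub \<open>0 \<le> lk y n\<close> by (simp add: D_iff[of "y + v"] l)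
    next
      case False
      then have "ff v ?x \<noteq> fm v" using y ffproj[of y] by (auto simp: dform_def)
      then have "?x \<notin> bf v" using facet_form_on[OF Fv] by auto
      then have xv: "?x + v \<in> P" using ColD(5)[OF v] xP xZ by blast
      have "0 \<le> \<phi> v" using ff_cases[OF v F] False by auto
      then have "lk y n \<le> \<phi> (y + v) - b" using y by (auto simp: D_iff linear_add[OF lin\<phi>])
      moreover have "0 \<le> lk y n" using y D_iff by blast
      moreover have "y + v - lk y n *\<^sub>R ee n \<in> P" using xv by (simp add: algebra_simps)
      ultimately show ?thesis by (simp add: D_iff[of "y + v"] l)
    qed
  qed
  have G: "facet D ?G"
    by (rule D.facet_if_column[OF lin ge _ vZ ColD(2)[OF v] col]) (use pne pP P_D in auto)
  show "v \<in> Col D" and bfe: "base_facet D v = ?G"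
    using D.ColI[OF vZ ColD(2)[OF v] G] col by auto
  have int: "?\<psi> z \<in> \<int>" if z: "z \<in> Zn (Suc n)" for z
  proof -
    have li: "lk z n \<in> \<int>" using z by (simp add: Zn_iff)
    have "z - lk z n *\<^sub>R ee n \<in> Zn n"
      using z li by (auto simp: Zn_iff lookup_minus lookup_scaleR lookup_single when_def)
    then have "ff v z \<in> \<int>" using ffproj[of z] facet_form_Ints[OF Fv] by simp
    then show ?thesis using li by (auto simp: dform_def)
  qed
  have "is_form D (Suc n) ?G ?\<psi> (fm v)"
    unfolding is_form_def
  proof (intro conjI ballI allI impI)
    show "?\<psi> ` Zn (Suc n) = \<int>"
    proof
      show "?\<psi> ` Zn (Suc n) \<subseteq> \<int>" using int by auto
      have "ff v ` Zn n = \<int>" using facet_form_props[OF Fv] by (simp add: is_form_def)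
      moreover have "ff v ` Zn n = ?\<psi> ` Zn n" using \<psi>P Zn_sub_Rn by (intro image_cong) (auto simp: subset_iff)
      ultimately have "\<int> = ?\<psi> ` Zn n" by simp
      also have "\<dots> \<subseteq> ?\<psi> ` Zn (Suc n)" by (rule image_mono[OF Zn_mono]) simp
      finally show "\<int> \<subseteq> ?\<psi> ` Zn (Suc n)" .
    qed
    fix i assume "Suc n \<le> i"
    then show "?\<psi> (ee i) = 0" using facet_form_outside[OF Fv, of i] facet_form_outside[OF F, of i]
      by (auto simp: dform_def lookup_single)
  next
    fix x assume "x \<in> D - ?G"
    then show "fm v < ?\<psi> x" using ge[of x] by auto
  qed (use lin in auto)
  from D.facet_form_eqI[OF G this]
  show "facet_form D (base_facet D v) = ?\<psi>" "facet_min D (base_facet D v) = fm v" by (simp_all add: bfe)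
qed

lemma linear_eq_split:
  fixes \<psi> \<rho> :: "pt \<Rightarrow> real"
  assumes "linear \<psi>" "linear \<rho>" "\<And>x. x \<in> Rn n \<Longrightarrow> \<psi> x = \<rho> x" "\<psi> (ee n) = \<rho> (ee n)"
    "\<And>i. n < i \<Longrightarrow> \<psi> (ee i) = \<rho> (ee i)"
  shows "\<psi> = \<rho>"
  by (rule linear_eq_ee[OF assms(1,2)]) (use assms ee_in_Rn in \<open>metis linorder_neqE_nat\<close>)

text \<open>The base facet of a column vector \<open>u\<close> of the doubling is the bottom, the graph of the height function,
  or lies over a base facet of \<open>P\<close>. The cases depend on whether the facet form of \<open>u\<close> is constant on \<open>P\<close> and
  whether the projection \<open>u'\<close> of \<open>u\<close> to \<open>R^n\<close> vanishes; otherwise \<open>u'\<close> is a column vector of \<open>P\<close>.\<close>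

lemma doubling_column_cases:
  assumes bal: "balanced P" and v0: "v0 \<in> Col P" "bf v0 = F" and u: "u \<in> Col D"
  shows "lk u n \<le> 1 \<and> \<phi> u - lk u n \<le> 1 \<and> (\<forall>v\<in>Col P. ff v u \<le> 1) \<and>
    (D.ff u = (\<lambda>y. lk y n) \<or> D.ff u = (\<lambda>y. \<phi> y - lk y n) \<or> (\<exists>v\<in>Col P. D.ff u = ff v))"
proof -
  let ?\<psi> = "D.ff u" and ?b = "D.fm u"
  note Fu = D.ColD(4)[OF u]
  note lin = D.linear_facet_form[OF Fu]
  define c where "c = lk u n"
  define u' where "u' = u - c *\<^sub>R ee n"
  define \<beta> where "\<beta> = ?\<psi> (ee n)"
  have uZ: "u \<in> Zn (Suc n)" and \<psi>u: "?\<psi> u = -1" using D.ColD[OF u] by auto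
  have cZ: "c \<in> \<int>" using uZ by (simp add: c_def Zn_iff)
  have u'Z: "u' \<in> Zn n"
    using uZ cZ by (auto simp: u'_def c_def Zn_iff lookup_minus lookup_scaleR lookup_single when_def)
  have ue: "u = u' + c *\<^sub>R ee n" by (simp add: u'_def)
  have \<beta>Z: "\<beta> \<in> \<int>" unfolding \<beta>_def by (rule D.facet_form_Ints[OF Fu ee_in_Zn]) simp
  have \<psi>add: "?\<psi> (x + s *\<^sub>R ee n) = ?\<psi> x + s * \<beta>" for x s
    by (simp add: \<beta>_def linear_add[OF lin] linear_scale[OF lin])
  have \<psi>u': "?\<psi> u' + c * \<beta> = -1" using \<psi>u \<psi>add[of u' c] ue by simp
  have out: "?\<psi> (ee i) = 0" "\<phi> (ee i) = 0" "lk (ee i) n = 0" if "n < i" for i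
    using D.facet_form_outside[OF Fu, of i] facet_form_outside[OF F, of i] that by (auto simp: lookup_single)
  have \<phi>n: "\<phi> (ee n) = 0" using facet_form_outside[OF F, of n] by simp
  have ffu: "facet_form P G u = facet_form P G u'" if "facet P G" for G
    using form_ee_n[OF that, of u' c] ue by simp
  \<comment> \<open>The column property of \<open>u\<close>, read at the lattice point
    \<open>x\<close> of \<open>P\<close> raised to the integral level \<open>k\<close>.\<close>
  have col: "x + u' \<in> P \<and> 0 \<le> real k + c \<and> real k + c \<le> \<phi> (x + u') - b"
    if x: "x \<in> L" and k: "real k \<le> \<phi> x - b" and ne: "?\<psi> x + real k * \<beta> \<noteq> ?b" for x k
  proof -
    have xR: "x \<in> Rn n" using x Zn_sub_Rn by blast
    have "x + real k *\<^sub>R ee n \<in> D" using D_add_iff[OF xR] x k by auto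
    moreover have "x + real k *\<^sub>R ee n \<in> Zn (Suc n)"
      using x Zn_mono[of n "Suc n"] by (intro Zn_add Zn_scale ee_in_Zn) auto
    moreover have "x + real k *\<^sub>R ee n \<notin> D.bf u" using ne \<psi>add D.facet_form_on[OF Fu] by metis
    ultimately have "x + real k *\<^sub>R ee n + u \<in> D" using D.ColD(5)[OF u] by blast
    moreover have "x + real k *\<^sub>R ee n + u = (x + u') + (real k + c) *\<^sub>R ee n"
      by (subst ue) (simp add: scaleR_add_left)
    moreover have "x + u' \<in> Rn n" using x u'Z Zn_add Zn_sub_Rn by blast
    ultimately show ?thesis using D_add_iff by metis
  qed
  have geP: "?b \<le> ?\<psi> x" "?b \<le> ?\<psi> x + (\<phi> x - b) * \<beta>" if "x \<in> P" for x
    using D.facet_form_ge[OF Fu, of x] D.facet_form_ge[OF Fu, of "lift x"] that P_D lift_D \<psi>add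
    by (auto simp: lift_def)
  have bal': "ff v w \<le> 1" if "v \<in> Col P" "w \<in> Col P" for v w using bal that by (simp add: balanced_def)
  have linlk: "linear (\<lambda>y. lk y n)" and lin\<phi>lk: "linear (\<lambda>y. \<phi> y - lk y n)"
    using linear_lookup linear_compose_sub[OF lin\<phi> linear_lookup] by auto
  obtain x0 where x0: "x0 \<in> L" "\<phi> x0 = b + 1" using height_one[OF v0(1)] v0(2) by auto
  have Rlk: "lk x n = 0" if "x \<in> Rn n" for x using that by (simp add: Rn_iff)
  show ?thesis
  proof (cases "\<forall>x\<in>P. ?\<psi> x = ?b")
    case True
    have z: "?\<psi> x = 0" if "x \<in> Rn n" for x
      by (rule functional_const_on_P[OF lin _ that, of ?b]) (use True in auto)
    have b0: "?b = 0" using True z x0 P_sub by force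
    have bc: "c * \<beta> = -1" using \<psi>u' z u'Z Zn_sub_Rn by force
    \<comment> \<open>At the top of the column over \<open>x0\<close> the form is not below its
      minimum. Among integers with product -1 only \<open>\<beta> = 1\<close> and
      \<open>c = -1\<close> remain, and the base facet is the bottom.\<close>
    have "0 \<le> \<beta>" using geP(2)[of x0] x0 True b0 by auto
    moreover obtain i j :: int where ij: "c = of_int i" "\<beta> = of_int j" using cZ \<beta>Z by (meson Ints_cases)
    moreover have "of_int (i * j) = (of_int (- 1) :: real)" using bc ij by simp
    then have "i * j = -1" by (simp only: of_int_eq_iff)
    ultimately have \<beta>1: "\<beta> = 1" "c = -1" using int_mult_eq_minus_1[of i j] by auto
    have "?\<psi> = (\<lambda>y. lk y n)"
      by (rule linear_eq_split[OF lin linlk]) (use z out \<beta>1 Rlk in \<open>auto simp: \<beta>_def\<close>)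
    \<comment> \<open>The point \<open>x + ee n\<close> is off the bottom, so \<open>u\<close> may
      be applied to it; the vertical part -1 of \<open>u\<close> leads back to
      \<open>P\<close>.\<close>
    moreover have colF: "x + u' \<in> P" if x: "x \<in> L" "x \<notin> F" for x
      using col[OF x(1), of 1] facet_gap[OF F x] True x b0 \<beta>1 by auto
    have "\<phi> u' \<le> 0 \<and> (\<forall>v\<in>Col P. ff v u' \<le> 1)"
    proof (cases "u' = 0")
      case True
      then show ?thesis using linear_0[OF lin\<phi>] linear_0[OF linear_facet_form[OF ColD(4)]] by simp
    next
      case False
      have u'C: "u' \<in> Col P" "bf u' = F" using ColI[OF u'Z False F colF] by auto
      then show ?thesis using ColD(6)[OF u'C(1)] bal'[OF _ u'C(1)] by auto
    qed
    ultimately show ?thesis using \<beta>1 ffu[OF F] ffu[OF ColD(4)] by (auto simp: c_def)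
  next
    case False
    then have "\<exists>s\<in>S. ?\<psi> s \<noteq> ?b" using vertices_const[OF lin, of ?b] by blast
    then obtain s where s: "s \<in> L" "?\<psi> s \<noteq> ?b" using S_sub by blast
    have s0: "real 0 \<le> \<phi> x - b" if "x \<in> L" for x using facet_form_ge[OF F, of x] that by auto
    show ?thesis
    proof (cases "u' = 0")
      case True
      have bc: "c * \<beta> = -1" using \<psi>u' True linear_0[OF lin] by simp
      have "0 \<le> c" using col[OF s(1) s0[OF s(1)]] s(2) by simp
      moreover obtain i j :: int where ij: "c = of_int i" "\<beta> = of_int j" using cZ \<beta>Z by (meson Ints_cases)
      moreover have "of_int (i * j) = (of_int (- 1) :: real)" using bc ij by simp
      then have "i * j = -1" by (simp only: of_int_eq_iff)
      ultimately have c1: "\<beta> = -1" "c = 1" using int_mult_eq_minus_1[of j i] by (auto simp: mult.commute)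
      \<comment> \<open>Over a point of \<open>F\<close> the column has height 0, so
        \<open>u\<close>, which now points upwards, cannot be applicable there.\<close>
      have onS: "?\<psi> s = ?b" if "s \<in> S" "s \<in> F" for s
      proof (rule ccontr)
        assume "?\<psi> s \<noteq> ?b"
        then have "c \<le> \<phi> s - b" using col[of s 0] s0[of s] that S_sub True by auto
        then show False using c1 facet_form_on[OF F that(2)] by simp
      qed
      have on: "?\<psi> x = ?b" if "x \<in> F" for x by (rule facet_const[OF F lin onS that])
      obtain \<kappa> where \<kappa>: "\<forall>x\<in>Rn n. ?\<psi> x = \<kappa> * \<phi> x" using facet_form_scale[OF F lin on] by blast
      obtain a where a: "a \<in> S" "a \<in> F" by (rule facet_lattice_point[OF F])
      have aR: "a \<in> Rn n" "x0 \<in> Rn n" using a x0 S_sub P_sub by auto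
      have kx: "?\<psi> x0 = ?b + \<kappa>"
        using \<kappa> aR on[OF a(2)] facet_form_on[OF F a(2)] x0 by (simp add: distrib_left)
      have "1 \<le> \<kappa>" using geP(2)[of x0] x0 kx c1 by simp
      \<comment> \<open>The column over \<open>x0\<close> has height 1, so the upward walk from
        \<open>x0\<close> reaches the base facet in at most one step.\<close>
      moreover have "\<kappa> \<le> 1"
      proof -
        have ue1: "u = ee n" using ue True c1 by simp
        obtain k :: nat where k: "x0 + real k *\<^sub>R u \<in> D.bf u"
          using D.column_walk[OF D.ColD(1,2)[OF u] D.ColD(5)[OF u], where x = x0] x0 L_D by blast
        then have "x0 + real k *\<^sub>R ee n \<in> D" using D.facet_sub[OF Fu] ue1 by auto
        then have "real k \<le> 1" using D_add_iff[OF aR(2)] x0 by auto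
        moreover have "?\<psi> x0 - real k = ?b" using D.facet_form_on[OF Fu k] ue1 \<psi>add c1 by simp
        ultimately show ?thesis using kx by simp
      qed
      ultimately have "\<kappa> = 1" by simp
      then have "?\<psi> = (\<lambda>y. \<phi> y - lk y n)"
        by (intro linear_eq_split[OF lin lin\<phi>lk]) (use \<kappa> out c1 Rlk \<phi>n in \<open>auto simp: \<beta>_def\<close>)
      moreover have "facet_form P G u = 0" if "facet P G" for G
        using ffu[OF that] True linear_0[OF linear_facet_form[OF that]] by simp
      ultimately show ?thesis using c1 F ColD(4) by (auto simp: c_def)
    next
      case u'0: False
      let ?F = "{x \<in> P. ?\<psi> x = ?b}"
      have col0: "x + u' \<in> P" "0 \<le> c" "c \<le> \<phi> (x + u') - b" if "x \<in> L" "?\<psi> x \<noteq> ?b" for x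
        using col[OF that(1) s0[OF that(1)]] that(2) by auto
      have F': "facet P ?F"
        by (rule facet_if_column[OF lin geP(1) _ u'Z u'0]) (use False col0 in auto)
      have u'C: "u' \<in> Col P" "bf u' = ?F" using ColI[OF u'Z u'0 F'] col0 by auto
      have le1: "\<forall>v\<in>Col P. ff v u \<le> 1" using bal'[OF _ u'C(1)] ffu[OF ColD(4)] by simp
      have \<phi>u': "\<phi> u' \<le> 1" using bal'[OF v0(1) u'C(1)] v0(2) by simp
      obtain \<kappa> where \<kappa>: "\<forall>x\<in>Rn n. ?\<psi> x = \<kappa> * ff u' x"
        using facet_form_scale[OF F' lin, of ?b] u'C(2) by auto
      have "u' \<in> Rn n" using u'Z Zn_sub_Rn by blast
      then have \<kappa>1: "- \<kappa> + c * \<beta> = -1" using \<kappa> \<psi>u' ColD(6)[OF u'C(1)] by simp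
      show ?thesis
      proof (cases "?F = F")
        case True
        have ffe: "ff u' = \<phi>" using u'C(2) True by simp
        have \<phi>m1: "\<phi> u' = -1" using ColD(6)[OF u'C(1)] ffe by simp
        \<comment> \<open>A point of height 1 over \<open>F\<close> is moved onto \<open>F\<close>,
          which leaves no vertical room, so \<open>c = 0\<close>. One level higher the point must
          belong to the base facet, whence \<open>\<beta> = -1\<close>.\<close>
        have x0n: "x0 \<notin> F" using x0(2) facet_form_on[OF F, of x0] by auto
        then have "?\<psi> x0 \<noteq> ?b" using True x0 by blast
        then have "0 \<le> c" "c \<le> \<phi> (x0 + u') - b" using col0 x0 by auto
        then have c0: "c = 0" using x0(2) \<phi>m1 by (simp add: linear_add[OF lin\<phi>])
        then have k1: "\<kappa> = 1" using \<kappa>1 by simp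
        have "?\<psi> x0 + real 1 * \<beta> = ?b"
        proof (rule ccontr)
          assume "?\<psi> x0 + real 1 * \<beta> \<noteq> ?b"
          then have "real 1 + c \<le> \<phi> (x0 + u') - b" using col[OF x0(1), of 1] x0(2) by simp
          then show False using c0 x0(2) \<phi>m1 by (simp add: linear_add[OF lin\<phi>])
        qed
        moreover obtain a where a: "a \<in> S" "a \<in> F" by (rule facet_lattice_point[OF F])
        then have "?\<psi> a = ?b" "\<phi> a = b" using True facet_form_on[OF F] by auto
        moreover have "a \<in> Rn n" "x0 \<in> Rn n" using a x0 S_sub P_sub by auto
        ultimately have "\<beta> = -1" using \<kappa> k1 ffe x0(2) by simp
        then have "?\<psi> = (\<lambda>y. \<phi> y - lk y n)"
          by (intro linear_eq_split[OF lin lin\<phi>lk]) (use \<kappa> out k1 ffe Rlk \<phi>n in \<open>auto simp: \<beta>_def\<close>)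
        then show ?thesis using c0 \<phi>m1 ffu[OF F] le1 by (simp add: c_def)
      next
        case ne: False
        obtain s where s: "s \<in> S" "s \<in> F" "s \<notin> ?F"
          using column_form_other(2)[OF ColD(1-3)[OF u'C(1)] F] u'C(2) ne by metis
        then have sb: "?\<psi> s \<noteq> ?b" "s \<in> L" using S_sub by auto
        have cb: "0 \<le> c" "c \<le> \<phi> u'" using col0[OF sb(2,1)] facet_form_on[OF F s(2)] by (auto simp: linear_add[OF lin\<phi>])
        obtain s' where s': "s' \<in> S" "s' \<in> ?F" "s' \<notin> F"
          using column_form_other(2)[OF ColD(1-3)[OF v0(1)] F'] v0(2) ne by metis
        have s'L: "s' \<in> L" using s' S_sub by blast
        \<comment> \<open>One level above a point of the facet of \<open>u'\<close> the vector
          \<open>u\<close> is not applicable either, since its projection would leave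
          \<open>P\<close>; so the form does not see the new coordinate.\<close>
        have "?\<psi> s' + real 1 * \<beta> = ?b"
        proof (rule ccontr)
          assume "?\<psi> s' + real 1 * \<beta> \<noteq> ?b"
          then have "s' + u' \<in> P" using col[OF s'L, of 1] facet_gap[OF F s'L s'(3)] by simp
          then have "fm u' \<le> ff u' (s' + u')" using facet_form_ge[OF ColD(4)[OF u'C(1)]] by blast
          moreover have "ff u' s' = fm u'" using facet_form_on[OF ColD(4)[OF u'C(1)]] s'(2) u'C(2) by simp
          ultimately show False using ColD(6)[OF u'C(1)] by (simp add: linear_add[OF linear_facet_form[OF ColD(4)[OF u'C(1)]]])
        qed
        then have \<beta>0: "\<beta> = 0" using s'(2) by simp
        then have k1: "\<kappa> = 1" using \<kappa>1 by simp
        have "?\<psi> = ff u'"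
          by (rule linear_eq_split[OF lin linear_facet_form[OF ColD(4)[OF u'C(1)]]])
             (use \<kappa> out k1 \<beta>0 facet_form_outside[OF ColD(4)[OF u'C(1)]] in \<open>auto simp: \<beta>_def\<close>)
        then show ?thesis using cb \<phi>u' ffu[OF F] le1 u'C(1) by (auto simp: c_def)
      qed
    qed
  qed
qed

text \<open>The forms that can occur as \<open>D.ff u\<close> are among those which the first
  clauses of \<open>doubling_column_cases\<close> bound at every column vector
  \<open>w\<close>.\<close>

lemma balanced_doubling:
  assumes "balanced P" "v0 \<in> Col P" "bf v0 = F" shows "balanced D"
  unfolding balanced_def
proof (intro ballI)
  fix u w assume "u \<in> Col D" "w \<in> Col D"
  then show "D.ff u w \<le> 1"
    using doubling_column_cases[OF assms, of u] doubling_column_cases[OF assms, of w] by fastforce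
qed

end

section \<open>Spectra\<close>

text \<open>\<open>C\<close>, \<open>M\<close> and \<open>H\<close> stand for the column vectors, the monomials and the heights \<open>ht_v\<close> of a spectrum.\<close>

locale col_system =
  fixes C :: "pt set" and M :: "(pt \<times> int) set" and H :: "pt \<Rightarrow> pt \<times> int \<Rightarrow> real"
  assumes H_add: "u \<in> C \<Longrightarrow> H u (x + y) = H u x + H u y"
    and H_M: "u \<in> C \<Longrightarrow> x \<in> M \<Longrightarrow> H u x \<in> \<nat>"
    and M_shift: "u \<in> C \<Longrightarrow> x \<in> M \<Longrightarrow> 0 < H u x \<Longrightarrow> x + (u, 0) \<in> M"
    and H_self: "u \<in> C \<Longrightarrow> H u (u, 0) = -1"
    and H_Ints: "u \<in> C \<Longrightarrow> w \<in> C \<Longrightarrow> H u (w, 0) \<in> \<int>"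
    and H_ge: "u \<in> C \<Longrightarrow> w \<in> C \<Longrightarrow> -1 \<le> H u (w, 0)"
    and H_le: "u \<in> C \<Longrightarrow> w \<in> C \<Longrightarrow> H u (w, 0) \<le> 1"
    and H_eq: "u \<in> C \<Longrightarrow> w \<in> C \<Longrightarrow> H u (w, 0) = -1 \<Longrightarrow> H u = H w"
    and H_prod: "u \<in> C \<Longrightarrow> w \<in> C \<Longrightarrow> H w (u, 0) = 1 \<Longrightarrow> u + w \<noteq> 0 \<Longrightarrow> u + w \<in> C \<and> H (u + w) = H u"
    and C_nonzero: "u \<in> C \<Longrightarrow> u \<noteq> 0"
    and height_one: "u \<in> C \<Longrightarrow> \<exists>x\<in>M. H u x = 1"

locale spectrum =
  fixes PP :: "nat \<Rightarrow> pt set"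
  assumes lat0: "lattice_polytope (PP 0)" and bal0: "balanced (PP 0)" and spec: "doubling_spectrum PP"
begin

abbreviation "dm i \<equiv> pdim (PP i)"
abbreviation "fform i v \<equiv> facet_form (PP i) (base_facet (PP i) v)"
abbreviation "fmin i v \<equiv> facet_min (PP i) (base_facet (PP i) v)"

lemma doubling_step:
  assumes "lattice_polytope (PP i)"
  obtains S v where "doub (PP i) (dm i) S (base_facet (PP i) v)" "v \<in> Col (PP i)"
    "PP (Suc i) = doubling (PP i) (base_facet (PP i) v)"
proof -
  obtain S where S: "lpoly (PP i) (dm i) S" using lpoly_of_lattice_polytope[OF assms] by blast
  interpret lpoly "PP i" "dm i" S by (rule S)
  obtain v where v: "v \<in> Col (PP i)" "PP (Suc i) = doubling (PP i) (base_facet (PP i) v)"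
    using spec unfolding doubling_spectrum_def by blast
  have "doub (PP i) (dm i) S (base_facet (PP i) v)"
    using S ColD(4)[OF v(1)] by (simp add: doub_def doub_axioms_def)
  then show ?thesis using that v by blast
qed

lemma all_lattice_balanced: "lattice_polytope (PP i) \<and> balanced (PP i) \<and> dm i = dm 0 + i"
proof (induction i)
  case 0
  then show ?case using lat0 bal0 by simp
next
  case (Suc i)
  then have lat: "lattice_polytope (PP i)" by blast
  obtain S v where d: "doub (PP i) (dm i) S (base_facet (PP i) v)" "v \<in> Col (PP i)"
    "PP (Suc i) = doubling (PP i) (base_facet (PP i) v)" by (rule doubling_step[OF lat])
  interpret doub "PP i" "dm i" S "base_facet (PP i) v" by (rule d(1))
  show ?case using d(3) D.lattice_polytopeI D.pdimP balanced_doubling[OF _ d(2)] Suc by simp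
qed

lemma lpoly_at: "\<exists>S. lpoly (PP i) (dm i) S"
  using all_lattice_balanced lpoly_of_lattice_polytope by blast

text \<open>Agreement of the forms is claimed on the old space only: the form of the doubled facet
  acquires the coefficient -1 at the new coordinate.\<close>

lemma step_stable:
  shows "PP i \<subseteq> PP (Suc i)"
    and "v \<in> Col (PP i) \<Longrightarrow> v \<in> Col (PP (Suc i)) \<and> (\<forall>y\<in>Rn (dm i). fform (Suc i) v y = fform i v y) \<and>
      fmin (Suc i) v = fmin i v"
proof -
  have lat: "lattice_polytope (PP i)" using all_lattice_balanced by blast
  obtain S u where d: "doub (PP i) (dm i) S (base_facet (PP i) u)" "u \<in> Col (PP i)"
    "PP (Suc i) = doubling (PP i) (base_facet (PP i) u)" by (rule doubling_step[OF lat])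
  interpret doub "PP i" "dm i" S "base_facet (PP i) u" by (rule d(1))
  show "PP i \<subseteq> PP (Suc i)" using P_D d(3) by simp
  assume v: "v \<in> Col (PP i)"
  have "dform v y = ff v y" if "y \<in> Rn (dm i)" for y using that by (auto simp: dform_def Rn_iff)
  then show "v \<in> Col (PP (Suc i)) \<and> (\<forall>y\<in>Rn (dm i). fform (Suc i) v y = fform i v y) \<and>
      fmin (Suc i) v = fmin i v"
    using Col_doubling[OF v] d(3) by simp
qed

lemma dm_mono: "i \<le> j \<Longrightarrow> dm i \<le> dm j"
  using all_lattice_balanced[of i] all_lattice_balanced[of j] by simp

lemma Rn_dm_mono: "i \<le> j \<Longrightarrow> Rn (dm i) \<subseteq> Rn (dm j)" using Rn_mono dm_mono by blast

lemma PP_mono: "i \<le> j \<Longrightarrow> PP i \<subseteq> PP j"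
  by (rule lift_Suc_mono_le[of PP]) (use step_stable(1) in auto)

lemma stable:
  assumes "v \<in> Col (PP i)" "i \<le> j"
  shows "v \<in> Col (PP j)" "\<And>y. y \<in> Rn (dm i) \<Longrightarrow> fform j v y = fform i v y" "fmin j v = fmin i v"
proof -
  have "v \<in> Col (PP j) \<and> (\<forall>y\<in>Rn (dm i). fform j v y = fform i v y) \<and> fmin j v = fmin i v"
    using assms(2)
  proof (induction j rule: dec_induct)
    case base
    then show ?case using assms by simp
  next
    case (step j)
    moreover have "Rn (dm i) \<subseteq> Rn (dm j)" using step by (intro Rn_dm_mono)
    ultimately show ?case using step_stable(2)[of v j] by (metis subsetD)
  qed
  then show "v \<in> Col (PP j)" "\<And>y. y \<in> Rn (dm i) \<Longrightarrow> fform j v y = fform i v y" "fmin j v = fmin i v"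
    by auto
qed

lemma lattice_points_mono: "i \<le> j \<Longrightarrow> lattice_points (PP i) \<subseteq> lattice_points (PP j)"
  using PP_mono Zn_mono dm_mono unfolding lattice_points_def by blast

lemma semigrp_mono: "i \<le> j \<Longrightarrow> semigrp (PP i) \<subseteq> semigrp (PP j)"
proof
  fix x assume ij: "i \<le> j" and "x \<in> semigrp (PP i)"
  from this(2) show "x \<in> semigrp (PP j)"
    by induction (use lattice_points_mono[OF ij] in \<open>auto intro: semigrp.intros\<close>)
qed

lemma semigrp_Rn: "x \<in> semigrp (PP i) \<Longrightarrow> fst x \<in> Rn (dm i)"
proof (induction rule: semigrp.induct)
  case (step x z)
  then have "z \<in> Rn (dm i)" using Zn_sub_Rn by (auto simp: lattice_points_def)
  then show ?case using step subspace_add[OF subspace_Rn] by simp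
qed (simp add: subspace_0[OF subspace_Rn])

definition "SM = (\<Union>i. semigrp (PP i))"
text \<open>Forms gain coordinates along the spectrum, so the stage must see both \<open>v\<close>
  and the point; by \<open>SH_at\<close> every such stage gives the same height.\<close>

definition "SH v x = col_height (PP (LEAST i. v \<in> Col (PP i) \<and> fst x \<in> Rn (dm i))) v x"

lemma col_height_stable:
  assumes "v \<in> Col (PP i)" "fst x \<in> Rn (dm i)" "i \<le> j"
  shows "col_height (PP j) v x = col_height (PP i) v x"
  using stable[OF assms(1,3)] assms(2) by (simp add: col_height_def)

lemma SH_at:
  assumes "v \<in> Col (PP i)" "fst x \<in> Rn (dm i)" shows "SH v x = col_height (PP i) v x"
proof -
  let ?P = "\<lambda>i. v \<in> Col (PP i) \<and> fst x \<in> Rn (dm i)"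
  have "?P (LEAST i. ?P i)" by (rule LeastI[of ?P i]) (use assms in simp)
  moreover have "(LEAST i. ?P i) \<le> i" by (rule Least_le) (use assms in simp)
  ultimately show ?thesis using col_height_stable[of v "LEAST i. ?P i" x i] by (simp add: SH_def)
qed

text \<open>Column vectors persist and the dimension grows by 1 at each stage, so finitely many
  vectors and points meet at a common stage.\<close>

lemma common_index:
  assumes "finite A" "A \<subseteq> spec_Col PP" "finite B"
  shows "\<exists>i. A \<subseteq> Col (PP i) \<and> B \<subseteq> Rn (dm i)"
proof -
  have "\<exists>i. A \<subseteq> Col (PP i)" using assms(1,2)
  proof (induction A)
    case (insert a A)
    then obtain i j where ij: "A \<subseteq> Col (PP i)" "a \<in> Col (PP j)" by (auto simp: spec_Col_def)
    then have "insert a A \<subseteq> Col (PP (max i j))" using stable(1)[of _ i "max i j"] stable(1)[of a j "max i j"] by auto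
    then show ?case by blast
  qed simp
  then obtain i where i: "A \<subseteq> Col (PP i)" by blast
  have "\<exists>N. B \<subseteq> Rn N" using assms(3)
  proof (induction B)
    case (insert b B)
    then obtain N where "B \<subseteq> Rn N" by blast
    moreover obtain N' where "N' \<ge> N" "b \<in> Rn N'" using in_some_Rn by blast
    ultimately show ?case using Rn_mono by (intro exI[of _ N']) blast
  qed simp
  then obtain N where N: "B \<subseteq> Rn N" by blast
  have "N \<le> dm (max i N)" using all_lattice_balanced[of "max i N"] by simp
  then have "B \<subseteq> Rn (dm (max i N))" using N Rn_mono by blast
  moreover have "A \<subseteq> Col (PP (max i N))" using i stable(1)[of _ i "max i N"] by auto
  ultimately show ?thesis by blast
qed

lemma Col_Zn: "v \<in> Col (PP i) \<Longrightarrow> v \<in> Zn (dm i)" by (simp add: Col_def)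

lemma SH_col: "u \<in> Col (PP i) \<Longrightarrow> w \<in> Col (PP i) \<Longrightarrow> SH u (w, 0) = fform i u w"
  using SH_at[of u i "(w, 0)"] Col_Zn[of w i] Zn_sub_Rn by (auto simp: col_height_def)

lemma col_system: "col_system (spec_Col PP) SM SH"
proof
  fix u assume u: "u \<in> spec_Col PP"
  fix x y :: "pt \<times> int"
  obtain i where i: "{u} \<subseteq> Col (PP i)" "{fst x, fst y} \<subseteq> Rn (dm i)"
    using common_index[of "{u}" "{fst x, fst y}"] u by auto
  obtain S where S: "lpoly (PP i) (dm i) S" using lpoly_at by blast
  have "fst (x + y) \<in> Rn (dm i)" using i subspace_add[OF subspace_Rn] by simp
  then show "SH u (x + y) = SH u x + SH u y"
    using lpoly.col_height_add[OF S, of u x y] i SH_at[of u i] by simp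
next
  fix u x assume u: "u \<in> spec_Col PP" and x: "x \<in> SM"
  obtain i j where ij: "u \<in> Col (PP i)" "x \<in> semigrp (PP j)" using u x by (auto simp: spec_Col_def SM_def)
  define k where "k = max i j"
  have k: "u \<in> Col (PP k)" "x \<in> semigrp (PP k)"
    using ij stable(1)[of u i k] semigrp_mono[of j k] by (auto simp: k_def)
  obtain S where S: "lpoly (PP k) (dm k) S" using lpoly_at by blast
  have e: "SH u x = col_height (PP k) u x" by (rule SH_at[OF k(1) semigrp_Rn[OF k(2)]])
  show "SH u x \<in> \<nat>" unfolding e using lpoly.col_height_semigrp(1,2)[OF S k] by (simp add: Nats_altdef2)
  show "x + (u, 0) \<in> SM" if "0 < SH u x"
    using lpoly.col_height_semigrp(3)[OF S k] that unfolding e SM_def by blast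
next
  fix u assume u: "u \<in> spec_Col PP"
  then obtain i where i: "u \<in> Col (PP i)" by (auto simp: spec_Col_def)
  obtain S where S: "lpoly (PP i) (dm i) S" using lpoly_at by blast
  show "SH u (u, 0) = -1" using SH_col[OF i i] lpoly.ColD(6)[OF S i] by simp
  show "u \<noteq> 0" using lpoly.ColD(2)[OF S i] .
  obtain x where x: "x \<in> PP i \<inter> Zn (dm i)" "fform i u x = fmin i u + 1" using lpoly.height_one[OF S i] by blast
  have "0 + (x, 1) \<in> semigrp (PP i)" using x by (intro semigrp.intros) (auto simp: lattice_points_def)
  then have m: "(x, 1) \<in> semigrp (PP i)" by simp
  then have "SH u (x, 1) = 1" using SH_at[OF i semigrp_Rn[OF m]] x by (simp add: col_height_def)
  then show "\<exists>x\<in>SM. SH u x = 1" using m unfolding SM_def by blast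
next
  fix u w assume u: "u \<in> spec_Col PP" and w: "w \<in> spec_Col PP"
  obtain i where i: "u \<in> Col (PP i)" "w \<in> Col (PP i)" using common_index[of "{u, w}" "{}"] u w by auto
  obtain S where S: "lpoly (PP i) (dm i) S" using lpoly_at by blast
  interpret lpoly "PP i" "dm i" S by (rule S)
  note e = SH_col[OF i]
  show "SH u (w, 0) \<in> \<int>" unfolding e by (rule facet_form_Ints[OF ColD(4)[OF i(1)] Col_Zn[OF i(2)]])
  show "-1 \<le> SH u (w, 0)" unfolding e using ff_cases[OF i(2) ColD(4)[OF i(1)]] by auto
  show "SH u (w, 0) \<le> 1" unfolding e using all_lattice_balanced[of i] i by (simp add: balanced_def)
  show "SH u = SH w" if m: "SH u (w, 0) = -1"
  proof
    fix x :: "pt \<times> int"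
    obtain j where j: "{u, w} \<subseteq> Col (PP j)" "{fst x} \<subseteq> Rn (dm j)"
      using common_index[of "{u, w}" "{fst x}"] u w by auto
    then have j: "u \<in> Col (PP j)" "w \<in> Col (PP j)" "fst x \<in> Rn (dm j)" by auto
    obtain S' where S': "lpoly (PP j) (dm j) S'" using lpoly_at by blast
    have "fform j u w = -1" using SH_col[OF j(1,2)] m by simp
    then have "base_facet (PP j) u = base_facet (PP j) w"
      using lpoly.ff_cases[OF S' j(2) lpoly.ColD(4)[OF S' j(1)]] by auto
    then show "SH u x = SH w x" using SH_at[OF j(1,3)] SH_at[OF j(2,3)] by (simp add: col_height_def)
  qed
  assume p: "SH w (u, 0) = 1" "u + w \<noteq> 0"
  have prod: "u + w \<in> Col (PP j) \<and> base_facet (PP j) (u + w) = base_facet (PP j) u"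
    if j: "u \<in> Col (PP j)" "w \<in> Col (PP j)" for j
  proof -
    obtain S' where S': "lpoly (PP j) (dm j) S'" using lpoly_at by blast
    show ?thesis using lpoly.col_product[OF S' j p(2)] SH_col[OF j(2,1)] p(1) by simp
  qed
  have uw: "u + w \<in> spec_Col PP" using prod[OF i] by (auto simp: spec_Col_def)
  moreover have "SH (u + w) = SH u"
  proof
    fix x :: "pt \<times> int"
    obtain j where j: "{u, w} \<subseteq> Col (PP j)" "{fst x} \<subseteq> Rn (dm j)"
      using common_index[of "{u, w}" "{fst x}"] u w by auto
    then have j: "u \<in> Col (PP j)" "w \<in> Col (PP j)" "fst x \<in> Rn (dm j)" by auto
    show "SH (u + w) x = SH u x" using SH_at[of "u + w" j x] SH_at[OF j(1,3)] prod[OF j(1,2)] j(3)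
      by (simp add: col_height_def)
  qed
  ultimately show "u + w \<in> spec_Col PP \<and> SH (u + w) = SH u" by blast
qed

sublocale C: col_system "spec_Col PP" SM SH by (rule col_system)

text \<open>Existence of a product at one stage means a positive value; integrality and balancedness
  turn this into the value 1 of \<open>SH\<close>, which does not depend on the stage.\<close>

lemma col_prod_at:
  assumes "u \<in> Col (PP i)" "w \<in> Col (PP i)"
  shows "col_prod (PP i) u w = (if u + w \<noteq> 0 \<and> SH w (u, 0) = 1 then Some (u + w) else None)"
proof -
  obtain S where S: "lpoly (PP i) (dm i) S" using lpoly_at by blast
  have uw: "u \<in> spec_Col PP" "w \<in> spec_Col PP" using assms by (auto simp: spec_Col_def)
  have "0 < SH w (u, 0) \<longleftrightarrow> SH w (u, 0) = 1"
    using lpoly.Ints_ge_1[OF S C.H_Ints[OF uw(2,1)]] C.H_le[OF uw(2,1)] by auto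
  then have "col_prod (PP i) u w \<noteq> None \<longleftrightarrow> u + w \<noteq> 0 \<and> SH w (u, 0) = 1"
    using lpoly.col_prod_iff[OF S, of u w] assms SH_col[OF assms(2,1)] by simp
  then show ?thesis using lpoly.col_prod_Some[OF S, of u w] by (cases "col_prod (PP i) u w") auto
qed

lemma spec_prod_eq:
  "spec_prod PP u w = (if u \<in> spec_Col PP \<and> w \<in> spec_Col PP \<and> u + w \<noteq> 0 \<and> SH w (u, 0) = 1
     then Some (u + w) else None)"
proof -
  have "(\<exists>i. col_prod (PP i) u w \<noteq> None) \<longleftrightarrow> u \<in> spec_Col PP \<and> w \<in> spec_Col PP \<and> u + w \<noteq> 0 \<and> SH w (u, 0) = 1"
  proof
    assume "\<exists>i. col_prod (PP i) u w \<noteq> None"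
    then obtain i where i: "col_prod (PP i) u w \<noteq> None" by blast
    then have "u \<in> Col (PP i)" "w \<in> Col (PP i)" by (auto simp: col_prod_def split: if_splits)
    then show "u \<in> spec_Col PP \<and> w \<in> spec_Col PP \<and> u + w \<noteq> 0 \<and> SH w (u, 0) = 1"
      using i col_prod_at[of u i w] by (auto simp: spec_Col_def split: if_splits)
  next
    assume r: "u \<in> spec_Col PP \<and> w \<in> spec_Col PP \<and> u + w \<noteq> 0 \<and> SH w (u, 0) = 1"
    then obtain i where i: "u \<in> Col (PP i)" "w \<in> Col (PP i)" using common_index[of "{u, w}" "{}"] by auto
    then show "\<exists>i. col_prod (PP i) u w \<noteq> None" using col_prod_at[OF i] r by auto
  qed
  then show ?thesis by (simp add: spec_prod_def)
qed

lemma spec_prod_at: "u \<in> Col (PP i) \<Longrightarrow> w \<in> Col (PP i) \<Longrightarrow> col_prod (PP i) u w = spec_prod PP u w"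
  using col_prod_at[of u i w] spec_prod_eq[of u w] by (auto simp: spec_Col_def)

lemma finite_SM: "finite A \<Longrightarrow> A \<subseteq> SM \<Longrightarrow> \<exists>i. A \<subseteq> semigrp (PP i)"
proof (induction A rule: finite_induct)
  case (insert a A)
  then obtain i j where ij: "A \<subseteq> semigrp (PP i)" "a \<in> semigrp (PP j)" by (auto simp: SM_def)
  then have "insert a A \<subseteq> semigrp (PP (max i j))"
    using semigrp_mono[of i "max i j"] semigrp_mono[of j "max i j"] by auto
  then show ?case by blast
qed simp

lemma spec_ring_eq: "spec_ring PP = {f. Poly_Mapping.keys f \<subseteq> SM}"
proof
  show "spec_ring PP \<subseteq> {f. Poly_Mapping.keys f \<subseteq> SM}" by (auto simp: spec_ring_def semigrp_ring_def SM_def)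
  show "{f. Poly_Mapping.keys f \<subseteq> SM} \<subseteq> spec_ring PP"
    using finite_SM[OF finite_keys] by (auto simp: spec_ring_def semigrp_ring_def) blast
qed

text \<open>Removes the choice of a stage from \<open>spec_aut\<close>, which then acts through the
  heights of the spectrum.\<close>

lemma spec_aut_eq:
  fixes f :: "'r::comm_ring_1 galg"
  assumes v: "v \<in> spec_Col PP" and f: "f \<in> spec_ring PP"
  shows "spec_aut PP v \<alpha> f = (\<Sum>x\<in>Poly_Mapping.keys f.
    (1 + Poly_Mapping.single (v, 0) \<alpha>) ^ nat \<lfloor>SH v x\<rfloor> * Poly_Mapping.single x (Poly_Mapping.lookup f x))"
proof -
  let ?Q = "\<lambda>i. v \<in> Col (PP i) \<and> f \<in> semigrp_ring (PP i)"
  obtain i j where ij: "v \<in> Col (PP i)" "f \<in> semigrp_ring (PP j)" using v f by (auto simp: spec_Col_def spec_ring_def)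
  have "?Q (max i j)" using stable(1)[OF ij(1), of "max i j"] semigrp_mono[of j "max i j"] ij(2)
    by (auto simp: semigrp_ring_def)
  then have "?Q (LEAST i. ?Q i)" by (rule LeastI[of ?Q])
  then obtain k where k: "?Q k" "k = (LEAST i. ?Q i)" by blast
  have "spec_aut PP v \<alpha> f = elem_aut (PP k) v \<alpha> f" using f by (simp add: spec_aut_def k(2))
  also have "\<dots> = (\<Sum>x\<in>Poly_Mapping.keys f.
    (1 + Poly_Mapping.single (v, 0) \<alpha>) ^ nat \<lfloor>SH v x\<rfloor> * Poly_Mapping.single x (Poly_Mapping.lookup f x))"
    unfolding elem_aut_def
  proof (rule sum.cong)
    fix x assume "x \<in> Poly_Mapping.keys f"
    then have "x \<in> semigrp (PP k)" using k by (auto simp: semigrp_ring_def)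
    then have "SH v x = col_height (PP k) v x" using SH_at semigrp_Rn k by blast
    then show "(1 + Poly_Mapping.single (v, 0) \<alpha>) ^ nat \<lfloor>col_height (PP k) v x\<rfloor> * Poly_Mapping.single x (Poly_Mapping.lookup f x)
      = (1 + Poly_Mapping.single (v, 0) \<alpha>) ^ nat \<lfloor>SH v x\<rfloor> * Poly_Mapping.single x (Poly_Mapping.lookup f x)" by simp
  qed simp
  finally show ?thesis .
qed

end

section \<open>Elementary automorphisms\<close>

text \<open>Inverses of generators are again generators here, so an element is built by multiplying
  one generator at a time from the left, as the coefficient computations require.\<close>

lemma (in group) generate_left_induct [consumes 1, case_names carrier inv one mult]:
  assumes g: "g \<in> generate G A" and A: "A \<subseteq> carrier G" "\<And>a. a \<in> A \<Longrightarrow> inv a \<in> A"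
    and one: "P \<one>" and mult: "\<And>a g. a \<in> A \<Longrightarrow> g \<in> generate G A \<Longrightarrow> P g \<Longrightarrow> P (a \<otimes> g)"
  shows "P g"
proof -
  have "\<forall>h\<in>generate G A. P h \<longrightarrow> P (g \<otimes> h)"
    using g
  proof (induction rule: generate.induct)
    case one
    then show ?case using generate_in_carrier[OF A(1)] by simp
  next
    case (incl a)
    then show ?case using mult by blast
  next
    case (inv a)
    then show ?case using mult A(2) by blast
  next
    case (eng g1 g2)
    then show ?case
      using generate_in_carrier[OF A(1)] generate.eng by (metis m_assoc)
  qed
  then have "P (g \<otimes> \<one>)" using one generate.one by blast
  then show ?thesis using generate_in_carrier[OF A(1) g] by simp
qed

lemma poly_mapping_sum_single: "f = (\<Sum>x\<in>Poly_Mapping.keys f. Poly_Mapping.single x (Poly_Mapping.lookup f x))"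
proof (rule poly_mapping_eqI)
  fix k
  have "Poly_Mapping.lookup (\<Sum>x\<in>Poly_Mapping.keys f. Poly_Mapping.single x (Poly_Mapping.lookup f x)) k =
      (\<Sum>x\<in>Poly_Mapping.keys f. if x = k then Poly_Mapping.lookup f x else 0)"
    by (simp add: lookup_sum lookup_single when_def)
  then show "Poly_Mapping.lookup f k =
      Poly_Mapping.lookup (\<Sum>x\<in>Poly_Mapping.keys f. Poly_Mapping.single x (Poly_Mapping.lookup f x)) k"
    by (simp add: in_keys_iff)
qed

lemma scaleR_of_nat_sum_mset: "real j *\<^sub>R (v::pt) = sum_mset (replicate_mset j v)"
  by (induction j) (simp_all add: scaleR_add_left)

abbreviation vmon :: "pt \<Rightarrow> 'r::comm_ring_1 \<Rightarrow> 'r galg" where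
  "vmon v \<alpha> \<equiv> Poly_Mapping.single (v, 0) \<alpha>"

lemma vmon_power: "vmon v \<mu> ^ j = Poly_Mapping.single (real j *\<^sub>R v, 0) (\<mu> ^ j)"
proof (induction j)
  case 0
  then show ?case by (simp add: zero_prod_def[symmetric])
next
  case (Suc j)
  then show ?case by (simp add: mult_single scaleR_add_left)
qed

context col_system begin

section \<open>The action on monomials\<close>

definition hn :: "pt \<Rightarrow> pt \<times> int \<Rightarrow> nat" where "hn u x = nat \<lfloor>H u x\<rfloor>"

definition act :: "pt \<Rightarrow> 'r \<Rightarrow> 'r::comm_ring_1 galg \<Rightarrow> 'r galg" where
  "act v \<alpha> f = (\<Sum>x\<in>Poly_Mapping.keys f.
     (1 + vmon v \<alpha>) ^ hn v x * Poly_Mapping.single x (Poly_Mapping.lookup f x))"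

definition RM :: "'r::comm_ring_1 galg set" where "RM = {f. Poly_Mapping.keys f \<subseteq> M}"

lemma act_superset:
  assumes "finite A" "Poly_Mapping.keys f \<subseteq> A"
  shows "act v \<alpha> f = (\<Sum>x\<in>A. (1 + vmon v \<alpha>) ^ hn v x * Poly_Mapping.single x (Poly_Mapping.lookup f x))"
  unfolding act_def
  by (rule sum.mono_neutral_left) (use assms in \<open>auto simp: in_keys_iff\<close>)

lemma act_add: "act v \<alpha> (f + g) = act v \<alpha> f + act v \<alpha> g"
proof -
  let ?A = "Poly_Mapping.keys f \<union> Poly_Mapping.keys g"
  have k: "Poly_Mapping.keys (f + g) \<subseteq> ?A" by (rule Poly_Mapping.keys_add)
  show ?thesis
    using act_superset[of ?A f v \<alpha>] act_superset[of ?A g v \<alpha>] act_superset[of ?A "f + g" v \<alpha>] k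
    by (simp add: lookup_add single_add distrib_left sum.distrib)
qed

lemma act_zero [simp]: "act v \<alpha> 0 = 0" by (simp add: act_def)

lemma act_sum: "act v \<alpha> (sum q I) = (\<Sum>i\<in>I. act v \<alpha> (q i))"
  by (induction I rule: infinite_finite_induct) (simp_all add: act_add)

lemma act_single: "act v \<alpha> (Poly_Mapping.single x c) = (1 + vmon v \<alpha>) ^ hn v x * Poly_Mapping.single x c"
  using act_superset[of "{x}" "Poly_Mapping.single x c" v \<alpha>] by simp

text \<open>Reduces each relation to an identity for single monomials of \<open>M\<close>, where
  heights are natural numbers and the binomial theorem applies.\<close>

lemma act_eqI:
  fixes F G :: "'r::comm_ring_1 galg \<Rightarrow> 'r galg"
  assumes "f \<in> RM" "\<And>x c. x \<in> M \<Longrightarrow> F (Poly_Mapping.single x c) = G (Poly_Mapping.single x c)"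
    "\<And>f g. F (f + g) = F f + F g" "\<And>f g. G (f + g) = G f + G g"
  shows "F f = G f"
proof -
  have F0: "F 0 = 0" and G0: "G 0 = 0" using assms(3)[of 0 0] assms(4)[of 0 0] by simp_all
  have s: "F (sum q I) = (\<Sum>i\<in>I. F (q i))" "G (sum q I) = (\<Sum>i\<in>I. G (q i))" for q :: "pt \<times> int \<Rightarrow> 'r galg" and I
    by (induction I rule: infinite_finite_induct) (simp_all add: assms F0 G0)
  have "F f = (\<Sum>x\<in>Poly_Mapping.keys f. F (Poly_Mapping.single x (Poly_Mapping.lookup f x)))"
    by (subst poly_mapping_sum_single[of f]) (rule s)
  also have "\<dots> = (\<Sum>x\<in>Poly_Mapping.keys f. G (Poly_Mapping.single x (Poly_Mapping.lookup f x)))"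
    by (rule sum.cong) (use assms(1,2) in \<open>auto simp: RM_def\<close>)
  also have "\<dots> = G f"
    by (subst (3) poly_mapping_sum_single[of f]) (rule s[symmetric])
  finally show ?thesis .
qed

lemma H_0: "u \<in> C \<Longrightarrow> H u 0 = 0" using H_add[of u 0 0] by simp

lemma H_mult: "u \<in> C \<Longrightarrow> H u (real j *\<^sub>R v, 0) = real j * H u (v, 0)"
proof (induction j)
  case 0
  then show ?case using H_0 by (simp add: zero_prod_def)
next
  case (Suc j)
  then show ?case using H_add[of u "(real j *\<^sub>R v, 0)" "(v, 0)"]
    by (simp add: scaleR_add_left distrib_right add.commute)
qed

lemma hn_M: "u \<in> C \<Longrightarrow> x \<in> M \<Longrightarrow> H u x = real (hn u x)"
  using H_M[of u x] by (auto simp: hn_def elim!: Nats_cases)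

lemma hn_shift:
  assumes "u \<in> C" "x \<in> M"
  shows "H u (v, 0) = 0 \<Longrightarrow> hn u (x + (real j *\<^sub>R v, 0)) = hn u x"
    and "H u (v, 0) = 1 \<Longrightarrow> hn u (x + (real j *\<^sub>R v, 0)) = hn u x + j"
    and "H u (v, 0) = -1 \<Longrightarrow> j \<le> hn u x \<Longrightarrow> hn u (x + (real j *\<^sub>R v, 0)) = hn u x - j"
proof -
  have e: "H u (x + (real j *\<^sub>R v, 0)) = real (hn u x) + real j * H u (v, 0)"
    using H_add[OF assms(1)] H_mult[OF assms(1)] hn_M[OF assms] by simp
  have n: "hn u (x + (real j *\<^sub>R v, 0)) = k" if "H u (x + (real j *\<^sub>R v, 0)) = real k" for k
    using that by (simp add: hn_def)
  show "H u (v, 0) = 0 \<Longrightarrow> hn u (x + (real j *\<^sub>R v, 0)) = hn u x"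
    "H u (v, 0) = 1 \<Longrightarrow> hn u (x + (real j *\<^sub>R v, 0)) = hn u x + j"
    "H u (v, 0) = -1 \<Longrightarrow> j \<le> hn u x \<Longrightarrow> hn u (x + (real j *\<^sub>R v, 0)) = hn u x - j"
    by (rule n, simp add: e of_nat_diff)+
qed

lemma M_shift_iter:
  assumes "v \<in> C" "x \<in> M" "j \<le> hn v x"
  shows "x + (real j *\<^sub>R v, 0) \<in> M"
  using assms(3)
proof (induction j)
  case 0
  then show ?case using assms(2) by (simp add: zero_prod_def[symmetric])
next
  case (Suc j)
  then have m: "x + (real j *\<^sub>R v, 0) \<in> M" by simp
  have "hn v (x + (real j *\<^sub>R v, 0)) = hn v x - j"
    using hn_shift(3)[OF assms(1,2) H_self[OF assms(1)]] Suc.prems by simp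
  then have "0 < H v (x + (real j *\<^sub>R v, 0))" using hn_M[OF assms(1) m] Suc.prems by simp
  then have "x + (real j *\<^sub>R v, 0) + (v, 0) \<in> M" by (rule M_shift[OF assms(1) m])
  moreover have "x + (real (Suc j) *\<^sub>R v, 0) = x + (real j *\<^sub>R v, 0) + (v, 0)"
    by (simp add: scaleR_add_left add.assoc add.commute[of v])
  ultimately show ?case by metis
qed

lemma binomial_one: "(1 + a) ^ k = (\<Sum>j\<le>k. of_nat (k choose j) * a ^ j)" for a :: "'b::comm_ring_1"
  unfolding add.commute[of 1 a] binomial_ring by simp

lemma of_nat_mult_single: "of_nat k * Poly_Mapping.single x (c::'r::comm_ring_1) = Poly_Mapping.single x (of_nat k * c)"
  by (metis add_0 mult_single single_of_nat)

text \<open>Expanding the power of \<open>1 + \<mu> v\<close> leaves monomials \<open>x v^j\<close>,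
  on which \<open>u\<close> acts with an exponent that depends on \<open>j\<close> only through
  \<open>H u (v, 0)\<close>. The following lemmas resum the expression for the values 0, 1 and
  -1.\<close>

lemma act_expand:
  "act u \<kappa> ((1 + vmon v \<mu>) ^ k * Poly_Mapping.single x c) =
    (\<Sum>j\<le>k. of_nat (k choose j) * vmon v \<mu> ^ j * ((1 + vmon u \<kappa>) ^ hn u (x + (real j *\<^sub>R v, 0)) * Poly_Mapping.single x c))"
proof -
  have "(1 + vmon v \<mu>) ^ k * Poly_Mapping.single x c =
     (\<Sum>j\<le>k. Poly_Mapping.single (x + (real j *\<^sub>R v, 0)) (of_nat (k choose j) * \<mu> ^ j * c))"
    by (simp add: binomial_one sum_distrib_right vmon_power mult_single of_nat_mult_single add.commute)
  moreover have "act u \<kappa> (Poly_Mapping.single (x + (real j *\<^sub>R v, 0)) (of_nat (k choose j) * \<mu> ^ j * c)) =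
    of_nat (k choose j) * vmon v \<mu> ^ j * ((1 + vmon u \<kappa>) ^ hn u (x + (real j *\<^sub>R v, 0)) * Poly_Mapping.single x c)" for j
  proof -
    have e: "Poly_Mapping.single (x + (real j *\<^sub>R v, 0)) (of_nat (k choose j) * \<mu> ^ j * c) =
       of_nat (k choose j) * vmon v \<mu> ^ j * Poly_Mapping.single x c"
      by (simp add: vmon_power mult_single of_nat_mult_single add.commute)
    show ?thesis unfolding act_single by (subst e) (simp only: mult_ac)
  qed
  ultimately show ?thesis by (simp add: act_sum)
qed

lemma act_power_0:
  assumes "u \<in> C" "x \<in> M" "H u (v, 0) = 0"
  shows "act u \<kappa> ((1 + vmon v \<mu>) ^ k * Poly_Mapping.single x c) =
    (1 + vmon v \<mu>) ^ k * ((1 + vmon u \<kappa>) ^ hn u x * Poly_Mapping.single x c)"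
  unfolding act_expand hn_shift(1)[OF assms] by (simp add: binomial_one[of _ k] sum_distrib_right)

lemma act_power_1:
  assumes "u \<in> C" "x \<in> M" "H u (v, 0) = 1"
  shows "act u \<kappa> ((1 + vmon v \<mu>) ^ k * Poly_Mapping.single x c) =
    (1 + vmon v \<mu> * (1 + vmon u \<kappa>)) ^ k * ((1 + vmon u \<kappa>) ^ hn u x * Poly_Mapping.single x c)"
  unfolding act_expand hn_shift(2)[OF assms] binomial_one[of "vmon v \<mu> * (1 + vmon u \<kappa>)" k] sum_distrib_right
  by (rule sum.cong[OF HOL.refl]) (simp add: power_add power_mult_distrib mult_ac)

text \<open>Each factor \<open>v\<close> uses up one factor \<open>1 + \<kappa> u\<close>, so the
  sum is again a binomial expansion; this is where the exponent \<open>k\<close> has to equal the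
  height of \<open>x\<close>.\<close>

lemma act_power_minus_1:
  assumes "u \<in> C" "x \<in> M" "H u (v, 0) = -1" "k = hn u x"
  shows "act u \<kappa> ((1 + vmon v \<mu>) ^ k * Poly_Mapping.single x c) =
    (vmon v \<mu> + (1 + vmon u \<kappa>)) ^ k * Poly_Mapping.single x c"
proof -
  have "act u \<kappa> ((1 + vmon v \<mu>) ^ k * Poly_Mapping.single x c) =
    (\<Sum>j\<le>k. of_nat (k choose j) * vmon v \<mu> ^ j * (1 + vmon u \<kappa>) ^ (k - j) * Poly_Mapping.single x c)"
    unfolding act_expand
    by (rule sum.cong) (use hn_shift(3)[OF assms(1-3)] assms(4) in \<open>simp_all add: mult.assoc\<close>)
  then show ?thesis by (simp add: binomial_ring[of "vmon v \<mu>"] sum_distrib_right)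
qed

lemma act_add_param:
  assumes "v \<in> C" "f \<in> RM"
  shows "act v \<alpha> (act v \<beta> f) = act v (\<alpha> + \<beta>) f"
proof (rule act_eqI[OF assms(2)])
  fix x c assume "x \<in> M"
  then show "act v \<alpha> (act v \<beta> (Poly_Mapping.single x c)) = act v (\<alpha> + \<beta>) (Poly_Mapping.single x c)"
    using act_power_minus_1[OF assms(1) _ H_self[OF assms(1)] HOL.refl]
    by (simp add: act_single single_add add_ac)
qed (simp_all add: act_add)

lemma act_0: "act v 0 f = f"
  unfolding act_def by (simp add: poly_mapping_sum_single[symmetric])

lemma H_cases: "u \<in> C \<Longrightarrow> w \<in> C \<Longrightarrow> H u (w, 0) = -1 \<or> H u (w, 0) = 0 \<or> H u (w, 0) = 1"
proof -
  assume "u \<in> C" "w \<in> C"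
  then obtain k :: int where k: "H u (w, 0) = of_int k" and b: "-1 \<le> H u (w, 0)" "H u (w, 0) \<le> 1"
    using H_Ints[of u w] H_ge[of u w] H_le[of u w] by (meson Ints_cases)
  then have "-1 \<le> k" "k \<le> 1" by linarith+
  then have "k = -1 \<or> k = 0 \<or> k = 1" by arith
  then show ?thesis unfolding k by auto
qed

text \<open>A value -1 in one order forces equal heights, hence -1 in the other, so no mixed case
  occurs.\<close>

lemma act_commute:
  assumes u: "u \<in> C" and v: "v \<in> C" and "H u (v, 0) \<le> 0" "H v (u, 0) \<le> 0" "f \<in> RM"
  shows "act u \<kappa> (act v \<mu> f) = act v \<mu> (act u \<kappa> f)"
proof (rule act_eqI[OF assms(5)])
  fix x c assume x: "x \<in> M"
  consider "H u = H v" "H u (v, 0) = -1" "H v (u, 0) = -1" | "H u (v, 0) = 0" "H v (u, 0) = 0"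
  proof -
    have "H v (u, 0) = -1" "H u = H v" if "H u (v, 0) = -1"
      using H_eq[OF u v that] H_self[OF u] by simp_all
    moreover have "H u (v, 0) = -1" if "H v (u, 0) = -1"
      using H_eq[OF v u that] H_self[OF v] by simp
    moreover have "H u (v, 0) = -1 \<or> H u (v, 0) = 0" "H v (u, 0) = -1 \<or> H v (u, 0) = 0"
      using H_cases[OF u v] H_cases[OF v u] assms(3,4) by linarith+
    ultimately show ?thesis using that by blast
  qed
  then show "act u \<kappa> (act v \<mu> (Poly_Mapping.single x c)) = act v \<mu> (act u \<kappa> (Poly_Mapping.single x c))"
  proof cases
    case 1
    have h: "hn v x = hn u x" by (simp add: hn_def 1(1))
    have "act u \<kappa> (act v \<mu> (Poly_Mapping.single x c)) = (vmon v \<mu> + (1 + vmon u \<kappa>)) ^ hn u x * Poly_Mapping.single x c"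
      unfolding act_single h by (rule act_power_minus_1[OF u x 1(2) HOL.refl])
    moreover have "act v \<mu> (act u \<kappa> (Poly_Mapping.single x c)) = (vmon u \<kappa> + (1 + vmon v \<mu>)) ^ hn u x * Poly_Mapping.single x c"
      unfolding act_single h[symmetric] by (rule act_power_minus_1[OF v x 1(3) HOL.refl])
    moreover have "vmon v \<mu> + (1 + vmon u \<kappa>) = vmon u \<kappa> + (1 + vmon v \<mu>)" by (simp only: add_ac)
    ultimately show ?thesis by (simp only:)
  next
    case 2
    show ?thesis
      unfolding act_single act_power_0[OF u x 2(1)] act_power_0[OF v x 2(2)] by (rule mult.left_commute)
  qed
qed (simp_all add: act_add)

text \<open>The vectors \<open>u\<close> and \<open>u + v\<close> share one height function, with
  value -1 at both, so its value at \<open>v\<close> is 0.\<close>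

lemma product_form:
  assumes u: "u \<in> C" and v: "v \<in> C" and "H v (u, 0) = 1" "u + v \<noteq> 0"
  shows "u + v \<in> C" "H (u + v) = H u" "H u (v, 0) = 0"
proof -
  show uv: "u + v \<in> C" "H (u + v) = H u" using H_prod[OF u v assms(3,4)] by auto
  have "H (u + v) (u + v, 0) = H u (u, 0) + H u (v, 0)"
    using H_add[OF u, of "(u, 0)" "(v, 0)"] uv(2) by simp
  then show "H u (v, 0) = 0" using H_self[OF uv(1)] H_self[OF u] by simp
qed

text \<open>The commutator relation, cleared of inverses. After expansion in powers of
  \<open>u\<close>, the action of \<open>u + v\<close> completes the binomial sum, and the parameter
  \<open>- (\<kappa> * \<mu>)\<close> is the one that cancels the mixed term
  \<open>u v\<close>.\<close>

lemma act_product: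
  fixes \<kappa> \<mu> :: "'r::comm_ring_1"
  assumes u: "u \<in> C" and v: "v \<in> C" and uv: "H v (u, 0) = 1" "u + v \<noteq> 0" and f: "f \<in> RM"
  shows "act u \<kappa> (act v \<mu> f) = act (u + v) (- (\<kappa> * \<mu>)) (act v \<mu> (act u \<kappa> f))"
proof (rule act_eqI[OF f, where F = "\<lambda>f. act u \<kappa> (act v \<mu> f)"
      and G = "\<lambda>f. act (u + v) (- (\<kappa> * \<mu>)) (act v \<mu> (act u \<kappa> f))"])
  fix x and c :: 'r assume x: "x \<in> M"
  note p = product_form[OF u v uv]
  let ?w = "u + v" and ?\<nu> = "- (\<kappa> * \<mu>)"
  let ?U = "vmon u \<kappa>" and ?V = "vmon v \<mu>" and ?W = "vmon (u + v) (- (\<kappa> * \<mu>))"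
  let ?x = "Poly_Mapping.single x c" and ?h = "hn u x"
  have UVW: "?U * ?V + ?W = 0" by (simp add: mult_single single_uminus)
  have 1: "act u \<kappa> (act v \<mu> ?x) = (1 + ?V) ^ hn v x * ((1 + ?U) ^ ?h * ?x)"
    by (simp add: act_single act_power_0[OF u x p(3)])
  have "act v \<mu> (act u \<kappa> ?x) = (1 + ?U * (1 + ?V)) ^ ?h * ((1 + ?V) ^ hn v x * ?x)"
    by (simp add: act_single act_power_1[OF v x uv(1)])
  also have "\<dots> = (\<Sum>k\<le>?h. (1 + ?V) ^ (k + hn v x) * Poly_Mapping.single (x + (real k *\<^sub>R u, 0)) (of_nat (?h choose k) * \<kappa> ^ k * c))"
    unfolding binomial_one[of "?U * (1 + ?V)"] sum_distrib_right
  proof (rule sum.cong[OF HOL.refl])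
    fix k
    have "Poly_Mapping.single (x + (real k *\<^sub>R u, 0)) (of_nat (?h choose k) * \<kappa> ^ k * c) = of_nat (?h choose k) * ?U ^ k * ?x"
      by (simp add: vmon_power mult_single of_nat_mult_single add.commute)
    then show "of_nat (?h choose k) * (?U * (1 + ?V)) ^ k * ((1 + ?V) ^ hn v x * ?x) =
      (1 + ?V) ^ (k + hn v x) * Poly_Mapping.single (x + (real k *\<^sub>R u, 0)) (of_nat (?h choose k) * \<kappa> ^ k * c)"
      by (simp add: power_add power_mult_distrib mult_ac)
  qed
  finally have "act ?w ?\<nu> (act v \<mu> (act u \<kappa> ?x)) = (\<Sum>k\<le>?h. act ?w ?\<nu> ((1 + ?V) ^ (k + hn v x) *
      Poly_Mapping.single (x + (real k *\<^sub>R u, 0)) (of_nat (?h choose k) * \<kappa> ^ k * c)))"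
    by (simp add: act_sum)
  \<comment> \<open>The height of \<open>u + v\<close> at the monomial \<open>x u^k\<close> is
    \<open>?h - k\<close>, and its height function vanishes at \<open>v\<close>, so the powers of
    \<open>1 + ?V\<close> pass through unchanged.\<close>
  also have "\<dots> = (\<Sum>k\<le>?h. of_nat (?h choose k) * (?U * (1 + ?V)) ^ k * (1 + ?W) ^ (?h - k) * ((1 + ?V) ^ hn v x * ?x))"
  proof (rule sum.cong[OF HOL.refl])
    fix k assume k: "k \<in> {..?h}"
    have xk: "x + (real k *\<^sub>R u, 0) \<in> M" using M_shift_iter[OF u x] k by simp
    have "hn ?w (x + (real k *\<^sub>R u, 0)) = hn u (x + (real k *\<^sub>R u, 0))" by (simp add: hn_def p(2))
    then have hk: "hn ?w (x + (real k *\<^sub>R u, 0)) = ?h - k" using hn_shift(3)[OF u x H_self[OF u]] k by simp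
    have e: "Poly_Mapping.single (x + (real k *\<^sub>R u, 0)) (of_nat (?h choose k) * \<kappa> ^ k * c) = of_nat (?h choose k) * ?U ^ k * ?x"
      by (simp add: vmon_power mult_single of_nat_mult_single add.commute)
    have w0: "H ?w (v, 0) = 0" using p by simp
    show "act ?w ?\<nu> ((1 + ?V) ^ (k + hn v x) *
      Poly_Mapping.single (x + (real k *\<^sub>R u, 0)) (of_nat (?h choose k) * \<kappa> ^ k * c)) =
      of_nat (?h choose k) * (?U * (1 + ?V)) ^ k * (1 + ?W) ^ (?h - k) * ((1 + ?V) ^ hn v x * ?x)"
      unfolding act_power_0[OF p(1) xk w0] hk unfolding e by (simp add: power_add power_mult_distrib mult_ac)
  qed
  also have "\<dots> = (?U * (1 + ?V) + (1 + ?W)) ^ ?h * ((1 + ?V) ^ hn v x * ?x)"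
    by (simp add: binomial_ring[of "?U * (1 + ?V)"] sum_distrib_right)
  also have "?U * (1 + ?V) + (1 + ?W) = 1 + ?U + (?U * ?V + ?W)" by (simp add: algebra_simps)
  also have "\<dots> = 1 + ?U" unfolding UVW by simp
  finally show "act u \<kappa> (act v \<mu> ?x) = act ?w ?\<nu> (act v \<mu> (act u \<kappa> ?x))"
    using 1 by (simp add: mult_ac)
qed (simp_all add: act_add)

lemma keys_act_single:
  assumes v: "v \<in> C" and y: "y \<in> Poly_Mapping.keys (act v \<alpha> (Poly_Mapping.single x c))"
  shows "\<exists>j\<le>hn v x. y = x + (real j *\<^sub>R v, 0)"
proof -
  have "act v \<alpha> (Poly_Mapping.single x c) =
     (\<Sum>j\<le>hn v x. Poly_Mapping.single (x + (real j *\<^sub>R v, 0)) (of_nat (hn v x choose j) * \<alpha> ^ j * c))"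
    by (simp add: act_single binomial_one sum_distrib_right vmon_power mult_single of_nat_mult_single add.commute)
  then have "y \<in> Poly_Mapping.keys (\<Sum>j\<le>hn v x. Poly_Mapping.single (x + (real j *\<^sub>R v, 0)) (of_nat (hn v x choose j) * \<alpha> ^ j * c))"
    using y by (simp only:)
  then have "y \<in> (\<Union>j\<in>{..hn v x}. Poly_Mapping.keys (Poly_Mapping.single (x + (real j *\<^sub>R v, 0)) (of_nat (hn v x choose j) * \<alpha> ^ j * c)))"
    by (rule subsetD[OF keys_sum])
  then show ?thesis by (auto split: if_splits)
qed

lemma act_RM: "v \<in> C \<Longrightarrow> f \<in> RM \<Longrightarrow> act v \<alpha> f \<in> RM"
proof -
  assume v: "v \<in> C" and f: "f \<in> RM"
  have "act v \<alpha> f = (\<Sum>x\<in>Poly_Mapping.keys f. act v \<alpha> (Poly_Mapping.single x (Poly_Mapping.lookup f x)))"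
    by (simp add: act_def[of v \<alpha> f] act_single)
  then have "Poly_Mapping.keys (act v \<alpha> f) \<subseteq>
    (\<Union>x\<in>Poly_Mapping.keys f. Poly_Mapping.keys (act v \<alpha> (Poly_Mapping.single x (Poly_Mapping.lookup f x))))"
    by (simp only: keys_sum)
  also have "\<dots> \<subseteq> M"
    using keys_act_single[OF v] M_shift_iter[OF v] f by (fastforce simp: RM_def)
  finally show ?thesis by (simp add: RM_def)
qed

section \<open>Elementary automorphisms as elements of a group\<close>

definition ev :: "pt \<Rightarrow> 'r \<Rightarrow> 'r::comm_ring_1 galg \<Rightarrow> 'r galg" where
  "ev v \<alpha> = restrict (act v \<alpha>) RM"

abbreviation BG :: "('r::comm_ring_1 galg \<Rightarrow> 'r galg) monoid" where "BG \<equiv> BijGroup RM"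

lemma ev_Bij: "v \<in> C \<Longrightarrow> ev v \<alpha> \<in> carrier BG"
proof -
  assume v: "v \<in> C"
  have "bij_betw (act v \<alpha>) RM RM"
    by (rule bij_betw_byWitness[where f' = "act v (- \<alpha>)"])
       (auto simp: act_add_param[OF v] act_0 act_RM[OF v])
  then show ?thesis by (simp add: BijGroup_def Bij_def ev_def bij_betw_restrict_eq)
qed

lemma ev_mult_apply:
  "v \<in> C \<Longrightarrow> g \<in> carrier BG \<Longrightarrow> f \<in> RM \<Longrightarrow> (ev v \<alpha> \<otimes>\<^bsub>BG\<^esub> g) f = act v \<alpha> (g f)"
  using ev_Bij[of v \<alpha>] Bij_imp_funcset[of g RM]
  by (auto simp: BijGroup_def compose_def ev_def)

lemma ev_apply: "f \<in> RM \<Longrightarrow> ev v \<alpha> f = act v \<alpha> f" by (simp add: ev_def)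

lemma BG_eqI: "g \<in> carrier BG \<Longrightarrow> g' \<in> carrier BG \<Longrightarrow> (\<And>f. f \<in> RM \<Longrightarrow> g f = g' f) \<Longrightarrow> g = g'"
  by (auto simp: BijGroup_def Bij_def intro: extensionalityI)

lemma group_BG: "group BG" by (rule group_BijGroup)

lemma BG_mult: "g \<in> carrier BG \<Longrightarrow> g' \<in> carrier BG \<Longrightarrow> g \<otimes>\<^bsub>BG\<^esub> g' \<in> carrier BG"
  by (rule monoid.m_closed[OF group.is_monoid[OF group_BG]])

lemma ev_add: "v \<in> C \<Longrightarrow> ev v \<alpha> \<otimes>\<^bsub>BG\<^esub> ev v \<beta> = ev v (\<alpha> + \<beta>)"
  by (rule BG_eqI) (simp_all add: BG_mult ev_Bij ev_mult_apply ev_apply act_add_param)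

lemma ev_commute:
  "u \<in> C \<Longrightarrow> v \<in> C \<Longrightarrow> H u (v, 0) \<le> 0 \<Longrightarrow> H v (u, 0) \<le> 0 \<Longrightarrow>
   ev u \<kappa> \<otimes>\<^bsub>BG\<^esub> ev v \<mu> = ev v \<mu> \<otimes>\<^bsub>BG\<^esub> ev u \<kappa>"
  by (rule BG_eqI) (simp_all add: BG_mult ev_Bij ev_mult_apply ev_apply act_commute)

lemma ev_product:
  "u \<in> C \<Longrightarrow> v \<in> C \<Longrightarrow> H v (u, 0) = 1 \<Longrightarrow> u + v \<noteq> 0 \<Longrightarrow>
   ev u \<kappa> \<otimes>\<^bsub>BG\<^esub> ev v \<mu> = ev (u + v) (- (\<kappa> * \<mu>)) \<otimes>\<^bsub>BG\<^esub> (ev v \<mu> \<otimes>\<^bsub>BG\<^esub> ev u \<kappa>)"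
  by (rule BG_eqI) (simp_all add: BG_mult ev_Bij ev_mult_apply ev_apply act_product product_form)

lemma ev_0: "ev v 0 = \<one>\<^bsub>BG\<^esub>" by (auto simp: ev_def BijGroup_def act_0)

lemma ev_inv: "v \<in> C \<Longrightarrow> inv\<^bsub>BG\<^esub> (ev v \<alpha>) = ev v (- \<alpha>)"
  using group.inv_equality[OF group_BG, of "ev v (- \<alpha>)" "ev v \<alpha>"] ev_add[of v "- \<alpha>" \<alpha>]
  by (simp add: ev_Bij ev_0)

section \<open>Detecting parameters by coefficients\<close>

definition prod_closed :: "pt set \<Rightarrow> bool" where
  "prod_closed S \<longleftrightarrow> S \<subseteq> C \<and> (\<forall>p\<in>S. \<forall>q\<in>S. H q (p, 0) = 1 \<longrightarrow> p + q \<in> S) \<and> (\<forall>p\<in>S. - p \<notin> S)"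

text \<open>Irreducibility of \<open>v\<close> relative to \<open>S\<close>, where \<open>v\<close>
  itself may lie outside \<open>S\<close>.\<close>

definition indec :: "pt set \<Rightarrow> pt \<Rightarrow> bool" where
  "indec S v \<longleftrightarrow> (\<forall>p\<in>S. \<forall>q\<in>S. H q (p, 0) = 1 \<longrightarrow> p + q \<noteq> v)"

lemma H_sum_mset:
  assumes u: "u \<in> C" shows "H u (sum_mset A, 0) = (\<Sum>p\<in>#A. H u (p, 0))"
proof (induction A)
  case empty
  then show ?case using H_0[OF u] by (simp add: zero_prod_def)
next
  case (add p A)
  then show ?case using H_add[OF u, of "(p, 0)" "(sum_mset A, 0)"] by simp
qed

lemma sum_mset_nonpos: "(\<And>p. p \<in># A \<Longrightarrow> f p \<le> (0::real)) \<Longrightarrow> (\<Sum>p\<in>#A. f p) \<le> 0"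
  by (induction A) (auto intro: add_nonpos_nonpos)

text \<open>A sum of column vectors that is itself a column vector can be contracted by replacing two
  summands by their product. If no product exists, every summand has the base facet of the sum, and
  comparing heights over that facet leaves a single summand.\<close>

lemma sum_mset_column:
  assumes S: "prod_closed S" "indec S v" and v: "v \<in> C"
    and A: "set_mset A \<subseteq> S" "A \<noteq> {#}" "sum_mset A = v"
  shows "size A = 1"
  using A
proof (induction "size A" arbitrary: A rule: less_induct)
  case less
  have SC: "S \<subseteq> C" using S by (simp add: prod_closed_def)
  show ?case
  proof (cases "\<exists>p q B. A = {#p, q#} + B \<and> H q (p, 0) = 1")
    case True
    then obtain p q B where B: "A = {#p, q#} + B" "H q (p, 0) = 1" by blast
    have pq: "p \<in> S" "q \<in> S" "set_mset B \<subseteq> S" using less.prems B by auto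
    have "p + q \<in> S" using S pq B by (simp add: prod_closed_def)
    then have "size (add_mset (p + q) B) = 1"
      using less.hyps[of "add_mset (p + q) B"] less.prems(3) pq B by (simp add: add.assoc)
    \<comment> \<open>By induction the contracted sum consists of the single summand
      \<open>p + q\<close>, against the irreducibility of \<open>v\<close>.\<close>
    then have "p + q = v" using less.prems(3) B by simp
    then show ?thesis using S(2) pq B by (simp add: indec_def)
  next
    case False
    have le: "H q (p, 0) \<le> 0" if "q \<in># A" "p \<in># A - {#q#}" for p q
    proof -
      define B where "B = A - {#q#} - {#p#}"
      have "{#p, q#} + B = add_mset q (add_mset p B)" by simp
      also have "add_mset p B = A - {#q#}" unfolding B_def by (rule insert_DiffM[OF that(2)])
      also have "add_mset q (A - {#q#}) = A" by (rule insert_DiffM[OF that(1)])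
      finally have "A = {#p, q#} + B" ..
      then have "H q (p, 0) \<noteq> 1" using False by blast
      moreover have "p \<in> C" "q \<in> C" using that less.prems(1) SC by (auto dest: in_diffD)
      ultimately show ?thesis using H_cases[of q p] by linarith
    qed
    have eq: "H q = H v" if q: "q \<in># A" for q
    proof -
      have qC: "q \<in> C" using q less.prems(1) SC by auto
      have "H q (v, 0) = H q (q, 0) + (\<Sum>p\<in>#A - {#q#}. H q (p, 0))"
        using H_sum_mset[OF qC, of A] less.prems(3) q
        by (metis (no_types, lifting) image_mset_add_mset insert_DiffM sum_mset.insert)
      also have "\<dots> \<le> -1" using sum_mset_nonpos[of "A - {#q#}" "\<lambda>p. H q (p, 0)"] le[OF q] H_self[OF qC] by simp
      finally have "H q (v, 0) = -1" using H_ge[OF qC v] by simp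
      then show ?thesis by (rule H_eq[OF qC v])
    qed
    have "H v (p, 0) = -1" if "p \<in># A" for p
      using eq[OF that] H_self[of p] that less.prems(1) SC by (metis subsetD)
    then have "(\<Sum>p\<in>#A. H v (p, 0)) = (\<Sum>p\<in>#A. -1)" by (intro arg_cong[of _ _ sum_mset] image_mset_cong)
    then have "-1 = - real (size A)" using H_sum_mset[OF v, of A] less.prems(3) H_self[OF v] by simp
    then show ?thesis by simp
  qed
qed

definition xpt :: "pt \<Rightarrow> pt \<times> int" where "xpt v = (SOME x. x \<in> M \<and> H v x = 1)"

lemma xpt: "v \<in> C \<Longrightarrow> xpt v \<in> M" "v \<in> C \<Longrightarrow> hn v (xpt v) = 1"
proof -
  assume v: "v \<in> C"
  then have "\<exists>x. x \<in> M \<and> H v x = 1" using height_one by blast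
  then have "xpt v \<in> M \<and> H v (xpt v) = 1" unfolding xpt_def by (rule someI_ex)
  then show "xpt v \<in> M" "hn v (xpt v) = 1" by (auto simp: hn_def)
qed

text \<open>On a monomial \<open>x\<close> of height 1 over the base facet of \<open>v\<close>, the automorphism \<open>e_v\<close> with parameter \<open>\<alpha>\<close>
  adds \<open>\<alpha> v x\<close>; so \<open>cf v\<close> recovers \<open>\<alpha>\<close>.\<close>

definition cf :: "pt \<Rightarrow> ('r::comm_ring_1 galg \<Rightarrow> 'r galg) \<Rightarrow> 'r" where
  "cf v g = Poly_Mapping.lookup (g (Poly_Mapping.single (xpt v) 1)) (xpt v + (v, 0))"

text \<open>The monomials that may occur besides \<open>x\<close> and \<open>v x\<close>; the
  condition on the sum keeps the coefficient at \<open>v x\<close> apart from them.\<close>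

definition higher :: "pt set \<Rightarrow> pt \<Rightarrow> (pt \<times> int) set" where
  "higher S v = {xpt v + (sum_mset A, 0) | A. set_mset A \<subseteq> S \<and> A \<noteq> {#} \<and> sum_mset A \<noteq> v}"

text \<open>The shape of the image of \<open>x\<close> that further factors preserve. By the first
  clause a nonzero term at \<open>v x\<close> appears only for \<open>v\<close> in \<open>S\<close>,
  so that shifting it again yields sums of elements of \<open>S\<close>.\<close>

definition cf_inv :: "pt set \<Rightarrow> pt \<Rightarrow> ('r::comm_ring_1 galg \<Rightarrow> 'r galg) \<Rightarrow> 'r \<Rightarrow> bool" where
  "cf_inv S v g c \<longleftrightarrow> (c \<noteq> 0 \<longrightarrow> v \<in> S) \<and> (\<exists>r. Poly_Mapping.keys r \<subseteq> higher S v \<and>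
     g (Poly_Mapping.single (xpt v) 1) =
       Poly_Mapping.single (xpt v) 1 + Poly_Mapping.single (xpt v + (v, 0)) c + r)"

lemma xpt_shift_ne: "v \<in> C \<Longrightarrow> xpt v + (v, 0) \<noteq> xpt v"
  using C_nonzero[of v] by (cases "xpt v") auto

lemma cf_inv_cf: assumes v: "v \<in> C" and "cf_inv S v g c" shows "cf v g = c"
proof -
  obtain r where r: "Poly_Mapping.keys r \<subseteq> higher S v"
    "g (Poly_Mapping.single (xpt v) 1) = Poly_Mapping.single (xpt v) 1 + Poly_Mapping.single (xpt v + (v, 0)) c + r"
    using assms(2) by (auto simp: cf_inv_def)
  have "xpt v + (v, 0) \<notin> higher S v" by (cases "xpt v") (auto simp: higher_def)
  then have "Poly_Mapping.lookup r (xpt v + (v, 0)) = 0" using r(1) by (auto simp: in_keys_iff)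
  then show ?thesis using xpt_shift_ne[OF v] by (simp add: cf_def r(2) lookup_add lookup_single when_def)
qed

lemma act_single_split:
  assumes "w \<in> C"
  shows "\<exists>r. Poly_Mapping.keys r \<subseteq> {y + (real j *\<^sub>R w, 0) | j. 1 \<le> j} \<and>
    act w \<kappa> (Poly_Mapping.single y c) = Poly_Mapping.single y c + r"
proof -
  let ?q = "\<lambda>j. Poly_Mapping.single (y + (real j *\<^sub>R w, 0)) (of_nat (hn w y choose j) * \<kappa> ^ j * c)"
  have "act w \<kappa> (Poly_Mapping.single y c) = (\<Sum>j\<le>hn w y. ?q j)"
    by (simp add: act_single binomial_one sum_distrib_right vmon_power mult_single of_nat_mult_single add.commute)
  also have "{..hn w y} = insert 0 {1..hn w y}" by auto
  also have "(\<Sum>j\<in>insert 0 {1..hn w y}. ?q j) = Poly_Mapping.single y c + (\<Sum>j\<in>{1..hn w y}. ?q j)"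
    by (subst sum.insert) (auto simp: zero_prod_def[symmetric])
  finally have e: "act w \<kappa> (Poly_Mapping.single y c) = Poly_Mapping.single y c + (\<Sum>j\<in>{1..hn w y}. ?q j)" .
  have "Poly_Mapping.keys (\<Sum>j\<in>{1..hn w y}. ?q j) \<subseteq> (\<Union>j\<in>{1..hn w y}. Poly_Mapping.keys (?q j))"
    by (rule keys_sum)
  moreover have "(\<Union>j\<in>{1..hn w y}. Poly_Mapping.keys (?q j)) \<subseteq> {y + (real j *\<^sub>R w, 0) | j. 1 \<le> j}"
  proof
    fix z assume "z \<in> (\<Union>j\<in>{1..hn w y}. Poly_Mapping.keys (?q j))"
    then obtain j where j: "j \<in> {1..hn w y}" "z \<in> Poly_Mapping.keys (?q j)" by blast
    then have "z = y + (real j *\<^sub>R w, 0)" by (simp split: if_splits)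
    then show "z \<in> {y + (real j *\<^sub>R w, 0) | j. 1 \<le> j}" using j(1) by auto
  qed
  ultimately have "Poly_Mapping.keys (\<Sum>j\<in>{1..hn w y}. ?q j) \<subseteq> {y + (real j *\<^sub>R w, 0) | j. 1 \<le> j}"
    by (rule subset_trans)
  then show ?thesis using e by blast
qed

lemma keys_act:
  assumes "w \<in> C" "z \<in> Poly_Mapping.keys (act w \<kappa> f)"
  shows "\<exists>y\<in>Poly_Mapping.keys f. \<exists>j. z = y + (real j *\<^sub>R w, 0)"
proof -
  have "act w \<kappa> f = (\<Sum>x\<in>Poly_Mapping.keys f. act w \<kappa> (Poly_Mapping.single x (Poly_Mapping.lookup f x)))"
    by (simp add: act_def[of w \<kappa> f] act_single)
  then have "z \<in> Poly_Mapping.keys (\<Sum>x\<in>Poly_Mapping.keys f. act w \<kappa> (Poly_Mapping.single x (Poly_Mapping.lookup f x)))"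
    using assms(2) by (simp only:)
  then have "z \<in> (\<Union>x\<in>Poly_Mapping.keys f. Poly_Mapping.keys (act w \<kappa> (Poly_Mapping.single x (Poly_Mapping.lookup f x))))"
    by (rule subsetD[OF keys_sum])
  then obtain x where "x \<in> Poly_Mapping.keys f" "z \<in> Poly_Mapping.keys (act w \<kappa> (Poly_Mapping.single x (Poly_Mapping.lookup f x)))"
    by blast
  then show ?thesis using keys_act_single[OF assms(1)] by blast
qed

text \<open>By \<open>sum_mset_column\<close> two or more elements of \<open>S\<close> never add up
  to \<open>v\<close>, so terms already shifted cannot be moved to \<open>v x\<close>. The
  coefficient changes only when \<open>ev w\<close> with \<open>w = v\<close> acts on
  \<open>x\<close> itself.\<close>

lemma cf_inv_step:
  assumes S: "prod_closed S" "indec S v" and v: "v \<in> C" and w: "w \<in> S"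
    and g: "g \<in> carrier BG" and inv: "cf_inv S v g c"
  shows "cf_inv S v (ev w \<kappa> \<otimes>\<^bsub>BG\<^esub> g) ((if w = v then \<kappa> else 0) + c)"
proof -
  let ?x = "xpt v"
  have wC: "w \<in> C" using S w by (auto simp: prod_closed_def)
  have ne: "sum_mset A \<noteq> v" if "set_mset A \<subseteq> S" "2 \<le> size A" for A
  proof
    assume "sum_mset A = v"
    moreover have "A \<noteq> {#}" using that(2) by auto
    ultimately have "size A = 1" using sum_mset_column[OF S v that(1)] by blast
    then show False using that(2) by simp
  qed
  have high: "?x + (sum_mset A + real j *\<^sub>R w, 0) \<in> higher S v"
    if "set_mset A \<subseteq> S" "2 \<le> size A + j" for A j
  proof -
    let ?B = "A + replicate_mset j w"
    have e: "sum_mset A + real j *\<^sub>R w = sum_mset ?B" by (simp add: scaleR_of_nat_sum_mset)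
    have B: "set_mset ?B \<subseteq> S" using that(1) w by (auto simp: set_mset_replicate_mset_subset split: if_splits)
    have sz: "2 \<le> size ?B" using that(2) by simp
    then have "?B \<noteq> {#}" by (metis not_numeral_le_zero size_empty)
    then show ?thesis using ne[OF B sz] B unfolding e higher_def by (intro CollectI exI[of _ ?B] conjI) simp_all
  qed
  obtain r where r: "Poly_Mapping.keys r \<subseteq> higher S v" "c \<noteq> 0 \<longrightarrow> v \<in> S"
    "g (Poly_Mapping.single ?x 1) = Poly_Mapping.single ?x 1 + Poly_Mapping.single (?x + (v, 0)) c + r"
    using inv by (auto simp: cf_inv_def)
  have "\<exists>r1. Poly_Mapping.keys r1 \<subseteq> higher S v \<and> act w \<kappa> (Poly_Mapping.single ?x 1) =
      Poly_Mapping.single ?x 1 + Poly_Mapping.single (?x + (v, 0)) (if w = v then \<kappa> else 0) + r1"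
  proof (cases "w = v")
    case True
    \<comment> \<open>Height 1 makes the power linear, so no further terms arise.\<close>
    then have "act w \<kappa> (Poly_Mapping.single ?x 1) = Poly_Mapping.single ?x 1 + Poly_Mapping.single (?x + (v, 0)) \<kappa>"
      using xpt(2)[OF v] by (simp add: act_single distrib_right mult_single add.commute)
    then show ?thesis using True by (intro exI[of _ 0]) simp
  next
    case False
    obtain r1 where r1: "Poly_Mapping.keys r1 \<subseteq> {?x + (real j *\<^sub>R w, 0) | j. 1 \<le> j}"
      "act w \<kappa> (Poly_Mapping.single ?x 1) = Poly_Mapping.single ?x 1 + r1"
      using act_single_split[OF wC] by blast
    have "?x + (real j *\<^sub>R w, 0) \<in> higher S v" if "1 \<le> j" for j
    proof (cases "j = 1")
      case True
      then show ?thesis using w False by (auto simp: higher_def intro!: exI[of _ "{#w#}"])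
    next
      case False
      then show ?thesis using high[of "{#}" j] that by simp
    qed
    then have "Poly_Mapping.keys r1 \<subseteq> higher S v" using r1(1) by auto
    then show ?thesis using r1(2) False by (intro exI[of _ r1]) simp
  qed
  then obtain r1 where r1: "Poly_Mapping.keys r1 \<subseteq> higher S v" "act w \<kappa> (Poly_Mapping.single ?x 1) =
      Poly_Mapping.single ?x 1 + Poly_Mapping.single (?x + (v, 0)) (if w = v then \<kappa> else 0) + r1" by blast
  have "\<exists>r2. Poly_Mapping.keys r2 \<subseteq> higher S v \<and> act w \<kappa> (Poly_Mapping.single (?x + (v, 0)) c) =
      Poly_Mapping.single (?x + (v, 0)) c + r2"
  proof (cases "c = 0")
    case True
    then show ?thesis by (intro exI[of _ 0]) simp
  next
    case False
    then have vS: "v \<in> S" using r(2) by blast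
    obtain r2 where r2: "Poly_Mapping.keys r2 \<subseteq> {?x + (v, 0) + (real j *\<^sub>R w, 0) | j. 1 \<le> j}"
      "act w \<kappa> (Poly_Mapping.single (?x + (v, 0)) c) = Poly_Mapping.single (?x + (v, 0)) c + r2"
      using act_single_split[OF wC] by blast
    have "?x + (v, 0) + (real j *\<^sub>R w, 0) \<in> higher S v" if "1 \<le> j" for j
      using high[of "{#v#}" j] that vS by (simp add: add.assoc)
    then have "Poly_Mapping.keys r2 \<subseteq> higher S v" using r2(1) by auto
    then show ?thesis using r2(2) by blast
  qed
  then obtain r2 where r2: "Poly_Mapping.keys r2 \<subseteq> higher S v" "act w \<kappa> (Poly_Mapping.single (?x + (v, 0)) c) =
      Poly_Mapping.single (?x + (v, 0)) c + r2" by blast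
  have r3: "Poly_Mapping.keys (act w \<kappa> r) \<subseteq> higher S v"
  proof
    fix z assume "z \<in> Poly_Mapping.keys (act w \<kappa> r)"
    then obtain y j where y: "y \<in> Poly_Mapping.keys r" "z = y + (real j *\<^sub>R w, 0)" using keys_act[OF wC] by blast
    then have "y \<in> higher S v" using r(1) by blast
    then obtain A where A: "y = ?x + (sum_mset A, 0)" "set_mset A \<subseteq> S" "A \<noteq> {#}" "sum_mset A \<noteq> v"
      by (auto simp: higher_def)
    show "z \<in> higher S v"
    proof (cases "j = 0")
      case True
      then have "z = y" using y(2) by (simp add: zero_prod_def[symmetric])
      then show ?thesis using \<open>y \<in> higher S v\<close> by simp
    next
      case False
      have "size A \<noteq> 0" using A(3) by simp
      then have "2 \<le> size A + j" using False by linarith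
      then show ?thesis using high[OF A(2)] y(2) A(1) by (simp add: add.assoc)
    qed
  qed
  have X: "Poly_Mapping.single ?x 1 \<in> RM" using xpt(1)[OF v] by (simp add: RM_def)
  have "(ev w \<kappa> \<otimes>\<^bsub>BG\<^esub> g) (Poly_Mapping.single ?x 1) = act w \<kappa> (g (Poly_Mapping.single ?x 1))"
    by (rule ev_mult_apply[OF wC g X])
  also have "\<dots> = Poly_Mapping.single ?x 1 + Poly_Mapping.single (?x + (v, 0)) ((if w = v then \<kappa> else 0) + c)
      + (r1 + r2 + act w \<kappa> r)"
    unfolding r(3) act_add r1(2) r2(2) single_add by (simp only: add_ac)
  finally have "(ev w \<kappa> \<otimes>\<^bsub>BG\<^esub> g) (Poly_Mapping.single ?x 1) =
      Poly_Mapping.single ?x 1 + Poly_Mapping.single (?x + (v, 0)) ((if w = v then \<kappa> else 0) + c)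
      + (r1 + r2 + act w \<kappa> r)" .
  moreover have "Poly_Mapping.keys (r1 + r2 + act w \<kappa> r) \<subseteq> higher S v"
    using r1(1) r2(1) r3 Poly_Mapping.keys_add[of "r1 + r2" "act w \<kappa> r"] Poly_Mapping.keys_add[of r1 r2] by blast
  moreover have "(if w = v then \<kappa> else 0) + c \<noteq> 0 \<longrightarrow> v \<in> S" using w r(2) by auto
  ultimately show ?thesis unfolding cf_inv_def by blast
qed

lemma cf_inv_one: "v \<in> C \<Longrightarrow> cf_inv S v \<one>\<^bsub>BG\<^esub> 0"
  using xpt(1)[of v] by (auto simp: cf_inv_def BijGroup_def RM_def intro: exI[of _ 0])

lemma cf_one: "v \<in> C \<Longrightarrow> cf v \<one>\<^bsub>BG\<^esub> = 0"
  using cf_inv_cf[OF _ cf_inv_one[of v "{}"]] by simp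

abbreviation evs :: "pt set \<Rightarrow> ('r::comm_ring_1 galg \<Rightarrow> 'r galg) set" where
  "evs S \<equiv> {ev w \<alpha> | w \<alpha>. w \<in> S}"

lemma cf_step:
  assumes S: "prod_closed S" "indec S v" and v: "v \<in> C" and w: "w \<in> S" and g: "g \<in> generate BG (evs S)"
  shows "cf v (ev w \<kappa> \<otimes>\<^bsub>BG\<^esub> g) = (if w = v then \<kappa> else 0) + cf v g"
proof -
  interpret BG: group BG by (rule group_BG)
  have SC: "S \<subseteq> C" using S by (simp add: prod_closed_def)
  have sub: "evs S \<subseteq> carrier BG" using ev_Bij SC by blast
  have "g \<in> carrier BG \<and> (\<exists>c. cf_inv S v g c)"
    using g
  proof (induction rule: BG.generate_left_induct)
    case carrier
    then show ?case by (rule sub)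
  next
    case (inv a)
    then show ?case using ev_inv SC by blast
  next
    case one
    then show ?case using cf_inv_one[OF v] by blast
  next
    case (mult a g)
    then obtain w' \<alpha> where a: "a = ev w' \<alpha>" "w' \<in> S" by blast
    obtain c where g: "g \<in> carrier BG" "cf_inv S v g c" using mult by blast
    have "ev w' \<alpha> \<in> carrier BG" using ev_Bij a(2) SC by blast
    then have "a \<otimes>\<^bsub>BG\<^esub> g \<in> carrier BG" using BG_mult g(1) a(1) by blast
    moreover have "\<exists>c. cf_inv S v (a \<otimes>\<^bsub>BG\<^esub> g) c" using cf_inv_step[OF S v a(2) g] a(1) by blast
    ultimately show ?case ..
  qed
  then obtain c where c: "g \<in> carrier BG" "cf_inv S v g c" by blast
  then show ?thesis using cf_inv_cf[OF v cf_inv_step[OF S v w c]] cf_inv_cf[OF v c(2)] by simp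
qed

end

section \<open>Triangular groups\<close>

text \<open>Pairs play the role of matrix positions above the diagonal. The product relation is the
  commutator relation cleared of inverses, with the sign of the Steinberg relation; pairs that
  compose in neither order commute.\<close>

locale tri_rel = group \<Gamma> for \<Gamma> :: "'g monoid" (structure) +
  fixes T :: "'n rel" and x :: "'n \<times> 'n \<Rightarrow> 'r::comm_ring_1 \<Rightarrow> 'g"
  assumes finT: "finite T" and transT: "trans T" and irreflT: "irrefl T"
    and x_closed: "p \<in> T \<Longrightarrow> x p \<alpha> \<in> carrier \<Gamma>"
    and x_add: "p \<in> T \<Longrightarrow> x p \<alpha> \<otimes> x p \<beta> = x p (\<alpha> + \<beta>)"
    and x_prod: "(a, b) \<in> T \<Longrightarrow> (b, c) \<in> T \<Longrightarrow>
      x (a, b) \<alpha> \<otimes> x (b, c) \<beta> = x (a, c) (- (\<alpha> * \<beta>)) \<otimes> (x (b, c) \<beta> \<otimes> x (a, b) \<alpha>)"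
    and x_comm: "(a, b) \<in> T \<Longrightarrow> (c, d) \<in> T \<Longrightarrow> b \<noteq> c \<Longrightarrow> d \<noteq> a \<Longrightarrow>
      x (a, b) \<alpha> \<otimes> x (c, d) \<beta> = x (c, d) \<beta> \<otimes> x (a, b) \<alpha>"
begin

definition gs :: "('n \<times> 'n) set \<Rightarrow> 'g set" where
  "gs S = generate \<Gamma> {x p \<alpha> | p \<alpha>. p \<in> S}"

lemma trT: "(a, b) \<in> T \<Longrightarrow> (b, c) \<in> T \<Longrightarrow> (a, c) \<in> T" using transT by (rule transD)
lemma irT: "(a, a) \<notin> T" using irreflT by (simp add: irrefl_def)

lemma x_zero: "p \<in> T \<Longrightarrow> x p 0 = \<one>"
  using x_add[of p 0 0] x_closed[of p 0] by (simp add: r_cancel_one')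

lemma x_inv: "p \<in> T \<Longrightarrow> inv (x p \<alpha>) = x p (- \<alpha>)"
  using x_add[of p "- \<alpha>" \<alpha>] x_closed[of p] x_zero[of p] by (intro inv_equality) auto

lemma gens_carrier: "S \<subseteq> T \<Longrightarrow> {x p \<alpha> | p \<alpha>. p \<in> S} \<subseteq> carrier \<Gamma>" using x_closed by auto

lemma gs_induct [consumes 2, case_names one mult]:
  assumes "g \<in> gs S" "S \<subseteq> T" and "P \<one>"
    and "\<And>w \<alpha> g. w \<in> S \<Longrightarrow> g \<in> gs S \<Longrightarrow> P g \<Longrightarrow> P (x w \<alpha> \<otimes> g)"
  shows "P g"
  using assms(1) unfolding gs_def
proof (induction rule: generate_left_induct)
  case carrier
  then show ?case by (rule gens_carrier[OF assms(2)])
next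
  case (inv a)
  then show ?case using x_inv assms(2) by blast
next
  case one
  then show ?case by (rule assms(3))
next
  case (mult a g)
  then show ?case using assms(4) unfolding gs_def by blast
qed

lemma gs_subgroup: "S \<subseteq> T \<Longrightarrow> subgroup (gs S) \<Gamma>"
  unfolding gs_def by (rule generate_is_subgroup[OF gens_carrier])
lemma gs_carrier: "S \<subseteq> T \<Longrightarrow> g \<in> gs S \<Longrightarrow> g \<in> carrier \<Gamma>"
  using subgroup.mem_carrier[OF gs_subgroup] by blast
lemma gs_mult: "g \<in> gs S \<Longrightarrow> h \<in> gs S \<Longrightarrow> g \<otimes> h \<in> gs S" unfolding gs_def by (rule generate.eng)
lemma gs_one: "\<one> \<in> gs S" unfolding gs_def by (rule generate.one)
lemma gs_x: "p \<in> S \<Longrightarrow> x p \<alpha> \<in> gs S" unfolding gs_def by (rule generate.incl) blast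
lemma gs_inv: "S \<subseteq> T \<Longrightarrow> g \<in> gs S \<Longrightarrow> inv g \<in> gs S" by (rule subgroup.m_inv_closed[OF gs_subgroup])
lemma gs_mono: "S \<subseteq> S' \<Longrightarrow> gs S \<subseteq> gs S'" unfolding gs_def by (rule mono_generate) auto
lemma gs_empty: "gs {} = {\<one>}" unfolding gs_def by (simp add: generate_empty)

text \<open>The number of ways to write \<open>p\<close> as a product in \<open>T\<close>; it grows
  strictly under composition.\<close>

definition len :: "'n \<times> 'n \<Rightarrow> nat" where "len p = card {c. (fst p, c) \<in> T \<and> (c, snd p) \<in> T}"

lemma len_less:
  assumes "(a, b) \<in> T" "(b, c) \<in> T"
  shows "len (a, b) < len (a, c)" "len (b, c) < len (a, c)"
proof -
  have fin: "finite {d. (a, d) \<in> T \<and> (d, c) \<in> T}"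
    by (rule finite_subset[of _ "snd ` T"]) (use finT in force)+
  have "{d. (a, d) \<in> T \<and> (d, b) \<in> T} \<subset> {d. (a, d) \<in> T \<and> (d, c) \<in> T}"
    using assms trT irT by blast
  then show "len (a, b) < len (a, c)" unfolding len_def by (simp add: psubset_card_mono[OF fin])
  have "{d. (b, d) \<in> T \<and> (d, c) \<in> T} \<subset> {d. (a, d) \<in> T \<and> (d, c) \<in> T}"
    using assms trT irT by blast
  then show "len (b, c) < len (a, c)" unfolding len_def by (simp add: psubset_card_mono[OF fin])
qed

text \<open>A two-sided ideal of \<open>T\<close> as a partial semigroup. Closure under
  multiplication by all of \<open>T\<close>, and not only by the remaining pairs, allows a removed
  pair to be moved past the others.\<close>

definition ideal_in :: "('n \<times> 'n) set \<Rightarrow> bool" where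
  "ideal_in S \<longleftrightarrow> S \<subseteq> T \<and> (\<forall>a b c. (a, b) \<in> S \<and> (b, c) \<in> T \<longrightarrow> (a, c) \<in> S) \<and>
     (\<forall>a b c. (a, b) \<in> T \<and> (b, c) \<in> S \<longrightarrow> (a, c) \<in> S)"

lemma idealI:
  assumes "S \<subseteq> T" "\<And>a b c. (a, b) \<in> S \<Longrightarrow> (b, c) \<in> T \<Longrightarrow> (a, c) \<in> S"
    "\<And>a b c. (a, b) \<in> T \<Longrightarrow> (b, c) \<in> S \<Longrightarrow> (a, c) \<in> S"
  shows "ideal_in S"
  unfolding ideal_in_def using assms by blast

lemma ideal_sub: "ideal_in S \<Longrightarrow> p \<in> S \<Longrightarrow> p \<in> T" unfolding ideal_in_def by blast
lemma ideal_left: "ideal_in S \<Longrightarrow> (a, b) \<in> S \<Longrightarrow> (b, c) \<in> T \<Longrightarrow> (a, c) \<in> S"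
  unfolding ideal_in_def by blast
lemma ideal_right: "ideal_in S \<Longrightarrow> (a, b) \<in> T \<Longrightarrow> (b, c) \<in> S \<Longrightarrow> (a, c) \<in> S"
  unfolding ideal_in_def by blast
lemma ideal_trans: "ideal_in S \<Longrightarrow> trans S"
  by (rule transI) (rule ideal_left, assumption, assumption, rule ideal_sub)

lemma ideal_T: "ideal_in T" by (rule idealI) (use trT in blast)+

text \<open>A product is longer than its factors, so a shortest pair is not a product. Removing it
  leaves an ideal, and the pair has the irreducibility that its coefficient asks for.\<close>

lemma ideal_remove:
  assumes S: "ideal_in S" and v: "v \<in> S" "\<And>w. w \<in> S \<Longrightarrow> len v \<le> len w"
  shows "ideal_in (S - {v})" "v \<notin> S O S"
proof -
  have ne: "(a, c) \<noteq> v" if "(a, b) \<in> S" "(b, c) \<in> T" for a b c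
    using v(2)[OF that(1)] len_less(1)[OF ideal_sub[OF S that(1)] that(2)] by auto
  have ne': "(a, c) \<noteq> v" if "(a, b) \<in> T" "(b, c) \<in> S" for a b c
    using v(2)[OF that(2)] len_less(2)[OF that(1) ideal_sub[OF S that(2)]] by auto
  show "ideal_in (S - {v})"
  proof (rule idealI)
    show "S - {v} \<subseteq> T" using ideal_sub[OF S] by blast
    fix a b c
    show "(a, c) \<in> S - {v}" if "(a, b) \<in> S - {v}" "(b, c) \<in> T"
      using ne[of a b c] ideal_left[OF S, of a b c] that by simp
    show "(a, c) \<in> S - {v}" if "(a, b) \<in> T" "(b, c) \<in> S - {v}"
      using ne'[of a b c] ideal_right[OF S, of a b c] that by simp
  qed
  show "v \<notin> S O S"
  proof
    assume "v \<in> S O S"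
    then obtain a b c where "v = (a, c)" "(a, b) \<in> S" "(b, c) \<in> S" by (elim relcompE) simp
    then show False using ne[of a b c] ideal_sub[OF S] by simp
  qed
qed

text \<open>Collects all factors at \<open>v\<close> on the left. Exchanging \<open>x v\<close> with
  another generator costs at most one factor, at the composite of the two pairs; it lies in the
  smaller ideal and commutes with \<open>x v\<close>.\<close>

lemma ideal_split:
  assumes S: "ideal_in S" and v: "v \<in> S" "\<And>w. w \<in> S \<Longrightarrow> len v \<le> len w" and g: "g \<in> gs S"
  shows "\<exists>\<alpha> h. h \<in> gs (S - {v}) \<and> g = x v \<alpha> \<otimes> h"
proof -
  let ?S = "S - {v}"
  have ST: "S \<subseteq> T" and S'T: "?S \<subseteq> T" using ideal_sub[OF S] by auto
  have vT: "v \<in> T" using v(1) ST by blast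
  have S': "ideal_in ?S" using ideal_remove[OF S v(1)] v(2) by blast
  have swap: "\<exists>h\<in>gs ?S. x w \<mu> \<otimes> x v \<alpha> = x v \<alpha> \<otimes> h" if w: "w \<in> ?S" for w \<mu> \<alpha>
  proof -
    obtain a b c d where vw: "v = (a, b)" "w = (c, d)" by fastforce
    have wT: "w \<in> T" using w S'T by blast
    consider "b = c" | "b \<noteq> c" "d = a" | "b \<noteq> c" "d \<noteq> a" by blast
    then show ?thesis
    proof cases
      case 1
      have ad: "(a, d) \<in> ?S" using ideal_right[OF S', of a b d] w vT vw 1 by simp
      then have adT: "(a, d) \<in> T" using S'T by blast
      have ab: "a \<noteq> b" "b \<noteq> d" "d \<noteq> a" using vT wT vw 1 irT adT by blast+
      note cl = x_closed[OF vT[unfolded vw(1)]] x_closed[OF wT[unfolded vw(2)]] x_closed[OF adT]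
      \<comment> \<open>The correction starts where \<open>v\<close> starts, so by acyclicity the
        two pairs compose in neither order.\<close>
      have c1: "x (a, d) \<beta> \<otimes> x (a, b) \<alpha> = x (a, b) \<alpha> \<otimes> x (a, d) \<beta>" for \<beta>
        using x_comm[of a d a b \<beta> \<alpha>] adT vT vw ab by auto
      have "x (a, b) \<alpha> \<otimes> x (b, d) \<mu> = x (a, d) (- (\<alpha> * \<mu>)) \<otimes> (x (b, d) \<mu> \<otimes> x (a, b) \<alpha>)"
        using x_prod[of a b d \<alpha> \<mu>] vT wT vw 1 by simp
      then have "x (a, d) (\<alpha> * \<mu>) \<otimes> (x (a, b) \<alpha> \<otimes> x (b, d) \<mu>) =
          (x (a, d) (\<alpha> * \<mu>) \<otimes> x (a, d) (- (\<alpha> * \<mu>))) \<otimes> (x (b, d) \<mu> \<otimes> x (a, b) \<alpha>)"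
        using cl 1 by (simp add: m_assoc)
      also have "\<dots> = x (b, d) \<mu> \<otimes> x (a, b) \<alpha>"
        using cl 1 x_add[OF adT] x_zero[OF adT] by simp
      finally have "x w \<mu> \<otimes> x v \<alpha> = x (a, d) (\<alpha> * \<mu>) \<otimes> (x v \<alpha> \<otimes> x w \<mu>)" using vw 1 by simp
      also have "\<dots> = (x (a, d) (\<alpha> * \<mu>) \<otimes> x v \<alpha>) \<otimes> x w \<mu>" using cl vw by (simp add: m_assoc)
      also have "\<dots> = x v \<alpha> \<otimes> (x (a, d) (\<alpha> * \<mu>) \<otimes> x w \<mu>)" using cl vw c1 by (simp add: m_assoc)
      finally show ?thesis using gs_mult[OF gs_x[OF ad] gs_x[OF w]] by blast
    next
      case 2
      have cb: "(c, b) \<in> ?S" using ideal_left[OF S', of c a b] w vT vw 2 by simp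
      then have cbT: "(c, b) \<in> T" using S'T by blast
      have ab: "a \<noteq> b" "a \<noteq> c" "b \<noteq> c" using vT wT vw 2 irT cbT by blast+
      note cl = x_closed[OF vT[unfolded vw(1)]] x_closed[OF wT[unfolded vw(2)]] x_closed[OF cbT]
      have c1: "x (c, b) \<beta> \<otimes> x (a, b) \<alpha> = x (a, b) \<alpha> \<otimes> x (c, b) \<beta>" for \<beta>
        using x_comm[of c b a b \<beta> \<alpha>] cbT vT vw ab by auto
      have "x w \<mu> \<otimes> x v \<alpha> = x (c, b) (- (\<mu> * \<alpha>)) \<otimes> (x v \<alpha> \<otimes> x w \<mu>)"
        using x_prod[of c a b \<mu> \<alpha>] vT wT vw 2 by simp
      also have "\<dots> = (x (c, b) (- (\<mu> * \<alpha>)) \<otimes> x v \<alpha>) \<otimes> x w \<mu>" using cl vw by (simp add: m_assoc)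
      also have "\<dots> = x v \<alpha> \<otimes> (x (c, b) (- (\<mu> * \<alpha>)) \<otimes> x w \<mu>)" using cl vw c1 by (simp add: m_assoc)
      finally show ?thesis using gs_mult[OF gs_x[OF cb] gs_x[OF w]] by blast
    next
      case 3
      then have "x w \<mu> \<otimes> x v \<alpha> = x v \<alpha> \<otimes> x w \<mu>" using x_comm[of a b c d \<alpha> \<mu>] vT wT vw by simp
      then show ?thesis using gs_x[OF w] by blast
    qed
  qed
  show ?thesis using g ST
  proof (induction rule: gs_induct)
    case one
    then show ?case using gs_one x_zero[OF vT] by (intro exI[of _ 0] exI[of _ \<one>]) simp
  next
    case (mult w \<mu> g)
    then obtain \<alpha> h where h: "h \<in> gs ?S" "g = x v \<alpha> \<otimes> h" by blast
    have hc: "h \<in> carrier \<Gamma>" using gs_carrier[OF S'T h(1)] .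
    have wT: "w \<in> T" using mult ST by blast
    show ?case
    proof (cases "w = v")
      case True
      then have "x w \<mu> \<otimes> g = x v (\<mu> + \<alpha>) \<otimes> h"
        using h hc x_closed[OF vT] x_add[OF vT] by (simp add: m_assoc[symmetric])
      then show ?thesis using h by blast
    next
      case False
      then obtain k where k: "k \<in> gs ?S" "x w \<mu> \<otimes> x v \<alpha> = x v \<alpha> \<otimes> k" using swap mult by blast
      have "x w \<mu> \<otimes> g = (x w \<mu> \<otimes> x v \<alpha>) \<otimes> h"
        using h hc x_closed[OF vT] x_closed[OF wT] by (simp add: m_assoc)
      also have "\<dots> = x v \<alpha> \<otimes> (k \<otimes> h)"
        unfolding k(2) using hc x_closed[OF vT] gs_carrier[OF S'T k(1)] by (simp add: m_assoc)
      finally show ?thesis using gs_mult[OF k(1) h(1)] by blast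
    qed
  qed
qed

end

text \<open>\<open>c v\<close> abstracts the coefficient \<open>cf v\<close>; its existence makes the generators independent.\<close>

locale tri = tri_rel \<Gamma> T x for \<Gamma> :: "'g monoid" (structure) and T :: "'n rel" and x :: "'n \<times> 'n \<Rightarrow> 'r::comm_ring_1 \<Rightarrow> 'g" +
  fixes c :: "'n \<times> 'n \<Rightarrow> 'g \<Rightarrow> 'r"
  assumes c_one: "v \<in> T \<Longrightarrow> c v \<one> = 0"
    and c_step': "S \<subseteq> T \<Longrightarrow> trans S \<Longrightarrow> v \<in> T \<Longrightarrow> v \<notin> S O S \<Longrightarrow> w \<in> S \<Longrightarrow>
      g \<in> generate \<Gamma> {x p \<alpha> | p \<alpha>. p \<in> S} \<Longrightarrow> c v (x w \<alpha> \<otimes> g) = (if w = v then \<alpha> else 0) + c v g"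
begin

lemma c_step: "S \<subseteq> T \<Longrightarrow> trans S \<Longrightarrow> v \<in> T \<Longrightarrow> v \<notin> S O S \<Longrightarrow> w \<in> S \<Longrightarrow> g \<in> gs S \<Longrightarrow>
    c v (x w \<alpha> \<otimes> g) = (if w = v then \<alpha> else 0) + c v g"
  unfolding gs_def by (rule c_step')

text \<open>No two pairs of a transitive set without \<open>v\<close> compose to \<open>v\<close>,
  so the coefficient is additive and every factor contributes 0.\<close>

lemma c_zero:
  assumes "S \<subseteq> T" "trans S" "v \<in> T" "v \<notin> S" and g: "g \<in> gs S"
  shows "c v g = 0"
proof -
  have vn: "v \<notin> S O S" using assms(2,4) by (auto dest: transD)
  show ?thesis using g assms(1)
  proof (induction rule: gs_induct)
    case (mult w \<alpha> g)
    then show ?case using c_step[OF assms(1-3) vn mult(1,2), of \<alpha>] assms(4) by auto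
  qed (rule c_one[OF assms(3)])
qed

text \<open>The factor at a shortest \<open>v\<close> is split off; if \<open>v \<notin> D\<close>, its parameter is the coefficient at \<open>v\<close>, so it is 0.\<close>

lemma subgroup_Int_gs:
  assumes K: "subgroup K \<Gamma>" and D: "\<And>v \<alpha>. v \<in> D \<Longrightarrow> x v \<alpha> \<in> K" "D \<subseteq> T"
    and c0: "\<And>g v. g \<in> K \<Longrightarrow> v \<in> T \<Longrightarrow> v \<notin> D \<Longrightarrow> c v g = 0"
    and S: "ideal_in S" and g: "g \<in> K" "g \<in> gs S"
  shows "g \<in> gs D"
  using S g
proof (induction "card S" arbitrary: S g rule: less_induct)
  case less
  have ST: "S \<subseteq> T" using ideal_sub[OF less.prems(1)] by blast
  have finS: "finite S" using ST finT finite_subset by blast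
  show ?case
  proof (cases "S = {}")
    case True
    then show ?thesis using less.prems gs_empty gs_one by simp
  next
    case False
    have "\<exists>v\<in>S. \<forall>w\<in>S. len v \<le> len w"
      using ex_min_if_finite[of "len ` S"] finS False by (metis arg_min_if_finite(1,2) leI)
    then obtain v where v: "v \<in> S" "\<And>w. w \<in> S \<Longrightarrow> len v \<le> len w" by blast
    have vT: "v \<in> T" using v ST by blast
    obtain \<alpha> h where h: "h \<in> gs (S - {v})" "g = x v \<alpha> \<otimes> h"
      using ideal_split[OF less.prems(1) v less.prems(3)] by blast
    have S': "ideal_in (S - {v})" and vn: "v \<notin> S O S" using ideal_remove[OF less.prems(1) v] by auto
    have card: "card (S - {v}) < card S" using v finS by (intro psubset_card_mono) auto
    have hc: "h \<in> carrier \<Gamma>" using gs_carrier[of "S - {v}" h] ST h by blast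
    show ?thesis
    proof (cases "v \<in> D")
      case True
      \<comment> \<open>The split-off factor lies in \<open>K\<close>, so the rest stays in
        \<open>K\<close> and the induction continues.\<close>
      have "h = x v (- \<alpha>) \<otimes> g"
        using h hc x_closed[OF vT] x_add[OF vT] x_zero[OF vT] by (simp add: m_assoc[symmetric])
      also have "\<dots> \<in> K" using D(1)[OF True] less.prems(2) subgroup.m_closed[OF K] by blast
      finally have "h \<in> gs D" using less.hyps[OF card S'] h by blast
      then show ?thesis using h(2) gs_mult gs_x[OF True] by blast
    next
      case False
      have tr: "trans S" by (rule ideal_trans[OF less.prems(1)])
      have tr': "trans (S - {v})" by (rule ideal_trans[OF S'])
      have "h \<in> gs S" using h gs_mono[of "S - {v}" S] by blast
      then have "c v g = \<alpha> + c v h" using c_step[OF ST tr vT vn v(1)] h by simp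
      moreover have "c v h = 0" by (rule c_zero[OF _ tr' vT _ h(1)]) (use ST in auto)
      ultimately have "\<alpha> = 0" using c0[OF less.prems(2) vT False] by simp
      then have "g = h" using h x_zero[OF vT] hc by simp
      then show ?thesis using less.hyps[OF card S'] h less.prems(2) by blast
    qed
  qed
qed

end

section \<open>Comparing triangular groups\<close>

lemma tri_hom_iso:
  assumes rel: "tri_rel \<Gamma> T x" and tri: "tri \<Delta> T y c" and \<phi>: "\<phi> \<in> hom \<Gamma> \<Delta>"
    and \<phi>x: "\<And>p \<alpha>. p \<in> T \<Longrightarrow> \<phi> (x p \<alpha>) = y p \<alpha>"
  shows "tri \<Gamma> T x (\<lambda>v g. c v (\<phi> g))"
    and "S \<subseteq> T \<Longrightarrow> \<phi> \<in> iso (\<Gamma>\<lparr>carrier := generate \<Gamma> {x p \<alpha> | p \<alpha>. p \<in> S}\<rparr>)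
      (\<Delta>\<lparr>carrier := generate \<Delta> {y p \<alpha> | p \<alpha>. p \<in> S}\<rparr>)"
proof -
  interpret A: tri_rel \<Gamma> T x by (rule rel)
  interpret B: tri \<Delta> T y c by (rule tri)
  interpret h: group_hom \<Gamma> \<Delta> \<phi>
    using \<phi> A.is_group B.is_group by (simp add: group_hom_def group_hom_axioms_def)
  have img: "\<phi> ` A.gs S = B.gs S" if "S \<subseteq> T" for S
  proof -
    have "\<phi> ` {x p \<alpha> | p \<alpha>. p \<in> S} = {\<phi> (x p \<alpha>) | p \<alpha>. p \<in> S}" by blast
    also have "\<dots> = {y p \<alpha> | p \<alpha>. p \<in> S}" by (intro Collect_cong) (metis \<phi>x subsetD[OF that])
    finally have "\<phi> ` {x p \<alpha> | p \<alpha>. p \<in> S} = {y p \<alpha> | p \<alpha>. p \<in> S}" .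
    then show ?thesis using h.generate_img[OF A.gens_carrier[OF that]] by (simp add: A.gs_def B.gs_def)
  qed
  \<comment> \<open>Only relations are assumed in the source; its coefficients are those of the
    image.\<close>
  show tri': "tri \<Gamma> T x (\<lambda>v g. c v (\<phi> g))"
  proof
    show "c v (\<phi> \<one>\<^bsub>\<Gamma>\<^esub>) = 0" if "v \<in> T" for v using B.c_one[OF that] by simp
    fix S v w g and \<alpha> assume a: "S \<subseteq> T" "trans S" "v \<in> T" "v \<notin> S O S" "w \<in> S"
      "g \<in> generate \<Gamma> {x p \<alpha> | p \<alpha>. p \<in> S}"
    then have gA: "g \<in> A.gs S" by (simp add: A.gs_def)
    have "\<phi> (x w \<alpha> \<otimes>\<^bsub>\<Gamma>\<^esub> g) = y w \<alpha> \<otimes>\<^bsub>\<Delta>\<^esub> \<phi> g"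
      using \<phi>x[of w \<alpha>] A.x_closed[of w \<alpha>] A.gs_carrier[OF a(1) gA] a by (metis h.hom_mult subsetD)
    then show "c v (\<phi> (x w \<alpha> \<otimes>\<^bsub>\<Gamma>\<^esub> g)) = (if w = v then \<alpha> else 0) + c v (\<phi> g)"
      using B.c_step[OF a(1-5)] img[OF a(1)] gA by (metis imageI)
  qed
  interpret A': tri \<Gamma> T x "\<lambda>v g. c v (\<phi> g)" by (rule tri')
  assume S: "S \<subseteq> T"
  have ker: "g = \<one>\<^bsub>\<Gamma>\<^esub>" if g: "g \<in> A.gs T" "\<phi> g = \<one>\<^bsub>\<Delta>\<^esub>" for g
  proof -
    \<comment> \<open>All coefficients vanish on the kernel, so the intersection argument applies
      with the empty set of allowed generators.\<close>
    have "g \<in> A.gs {}"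
    proof (rule A'.subgroup_Int_gs[OF h.subgroup_kernel _ _ _ A.ideal_T _ g(1)])
      show "c v (\<phi> k) = 0" if "k \<in> kernel \<Gamma> \<Delta> \<phi>" "v \<in> T" for k v
        using that B.c_one by (auto simp: kernel_def)
      show "g \<in> kernel \<Gamma> \<Delta> \<phi>" using g A.gs_carrier by (auto simp: kernel_def)
    qed auto
    then show ?thesis using A.gs_empty by simp
  qed
  have inj: "inj_on \<phi> (A.gs S)"
  proof (rule inj_onI)
    fix g k assume gk: "g \<in> A.gs S" "k \<in> A.gs S" "\<phi> g = \<phi> k"
    then have c: "g \<in> carrier \<Gamma>" "k \<in> carrier \<Gamma>" using A.gs_carrier[OF S] by auto
    have "g \<otimes>\<^bsub>\<Gamma>\<^esub> inv\<^bsub>\<Gamma>\<^esub> k \<in> A.gs T"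
      using gk A.gs_mult A.gs_inv[OF S] A.gs_mono[OF S] by blast
    moreover have "\<phi> (g \<otimes>\<^bsub>\<Gamma>\<^esub> inv\<^bsub>\<Gamma>\<^esub> k) = \<one>\<^bsub>\<Delta>\<^esub>" using c gk(3) by simp
    ultimately have "g \<otimes>\<^bsub>\<Gamma>\<^esub> inv\<^bsub>\<Gamma>\<^esub> k = \<one>\<^bsub>\<Gamma>\<^esub>" by (rule ker)
    then show "g = k" using c by (metis A.inv_closed A.inv_inv A.inv_equality)
  qed
  have "\<phi> \<in> iso (\<Gamma>\<lparr>carrier := A.gs S\<rparr>) (\<Delta>\<lparr>carrier := B.gs S\<rparr>)"
    unfolding iso_def hom_def bij_betw_def using img[OF S] inj A.gs_carrier[OF S] by auto
  then show "\<phi> \<in> iso (\<Gamma>\<lparr>carrier := generate \<Gamma> {x p \<alpha> | p \<alpha>. p \<in> S}\<rparr>)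
      (\<Delta>\<lparr>carrier := generate \<Delta> {y p \<alpha> | p \<alpha>. p \<in> S}\<rparr>)" by (simp add: A.gs_def B.gs_def)
qed

lemma tri_rel_DirProd:
  assumes "tri_rel \<Gamma> T x" "tri_rel \<Delta> T y"
  shows "tri_rel (\<Gamma> \<times>\<times> \<Delta>) T (\<lambda>p \<alpha>. (x p \<alpha>, y p \<alpha>))"
proof -
  interpret A: tri_rel \<Gamma> T x by (rule assms)
  interpret B: tri_rel \<Delta> T y by (rule assms)
  interpret G: group "\<Gamma> \<times>\<times> \<Delta>" by (rule DirProd_group[OF A.is_group B.is_group])
  show ?thesis
    by unfold_locales
      (auto simp: A.finT A.transT A.irreflT A.x_closed B.x_closed A.x_add B.x_add
        intro: A.x_prod B.x_prod A.x_comm B.x_comm)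
qed

text \<open>The pairs of generators satisfy the relations in the direct product, and both targets of
  the projections have coefficients. So both projections are isomorphisms on the subgroup generated
  by the pairs, and one is composed with the inverse of the other.\<close>

lemma tri_iso:
  assumes A: "tri \<Gamma> T x c" and B: "tri \<Delta> T y d" and S: "S \<subseteq> T"
  shows "\<exists>\<theta> \<in> iso (\<Gamma>\<lparr>carrier := generate \<Gamma> {x p \<alpha> | p \<alpha>. p \<in> S}\<rparr>)
      (\<Delta>\<lparr>carrier := generate \<Delta> {y p \<alpha> | p \<alpha>. p \<in> S}\<rparr>). \<forall>p\<in>S. \<forall>\<alpha>. \<theta> (x p \<alpha>) = y p \<alpha>"
proof -
  interpret A: tri \<Gamma> T x c by (rule A)
  interpret B: tri \<Delta> T y d by (rule B)
  have rel: "tri_rel (\<Gamma> \<times>\<times> \<Delta>) T (\<lambda>p \<alpha>. (x p \<alpha>, y p \<alpha>))"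
    by (rule tri_rel_DirProd) unfold_locales
  interpret G: tri_rel "\<Gamma> \<times>\<times> \<Delta>" T "\<lambda>p \<alpha>. (x p \<alpha>, y p \<alpha>)" by (rule rel)
  let ?H = "(\<Gamma> \<times>\<times> \<Delta>)\<lparr>carrier := generate (\<Gamma> \<times>\<times> \<Delta>) {(x p \<alpha>, y p \<alpha>) | p \<alpha>. p \<in> S}\<rparr>"
  let ?A = "\<Gamma>\<lparr>carrier := generate \<Gamma> {x p \<alpha> | p \<alpha>. p \<in> S}\<rparr>"
  let ?B = "\<Delta>\<lparr>carrier := generate \<Delta> {y p \<alpha> | p \<alpha>. p \<in> S}\<rparr>"
  have 1: "fst \<in> iso ?H ?A"
    by (rule tri_hom_iso(2)[OF rel A _ _ S]) (auto simp: hom_def DirProd_def)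
  have 2: "snd \<in> iso ?H ?B"
    by (rule tri_hom_iso(2)[OF rel B _ _ S]) (auto simp: hom_def DirProd_def)
  have gH: "group ?H" using G.subgroup_imp_group[OF G.gs_subgroup[OF S]] by (simp add: G.gs_def)
  have inv: "inv_into (carrier ?H) fst \<in> iso ?A ?H" by (rule group.iso_set_sym[OF gH 1])
  let ?\<theta> = "snd \<circ> inv_into (carrier ?H) fst"
  have "?\<theta> \<in> iso ?A ?B" by (rule iso_set_trans[OF inv 2])
  moreover have "?\<theta> (x p \<alpha>) = y p \<alpha>" if "p \<in> S" for p \<alpha>
  proof -
    have "(x p \<alpha>, y p \<alpha>) \<in> generate (\<Gamma> \<times>\<times> \<Delta>) {(x p \<alpha>, y p \<alpha>) | p \<alpha>. p \<in> S}"
      by (rule generate.incl) (use that in blast)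
    then have "(x p \<alpha>, y p \<alpha>) \<in> carrier ?H" by simp
    moreover have "inj_on fst (carrier ?H)" using 1 by (simp add: iso_def bij_betw_def)
    ultimately have "inv_into (carrier ?H) fst (x p \<alpha>) = (x p \<alpha>, y p \<alpha>)"
      by (intro inv_into_f_eq) auto
    then show ?thesis by simp
  qed
  ultimately show ?thesis by blast
qed

section \<open>The degree filtration\<close>

text \<open>The degree is attached to the initial vertex of a pair. It is compared only at vertices
  that are themselves initial, hence the second pair in \<open>dg_less\<close>.\<close>

locale tri_deg = tri \<Gamma> T x c for \<Gamma> :: "'g monoid" (structure) and T :: "'n rel"
    and x :: "'n \<times> 'n \<Rightarrow> 'r::comm_ring_1 \<Rightarrow> 'g" and c +
  fixes dg :: "'n \<Rightarrow> nat" and t :: nat and en :: "nat \<Rightarrow> ('n \<times> 'n) list"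
  assumes dg_less: "(a, b) \<in> T \<Longrightarrow> (b, d) \<in> T \<Longrightarrow> dg a < dg b"
    and dg_le: "(a, b) \<in> T \<Longrightarrow> dg a \<le> t"
    and en: "r \<in> {1..t} \<Longrightarrow> distinct (en r) \<and> set (en r) = {p \<in> T. dg (fst p) = r}"
begin

definition part :: "nat \<Rightarrow> ('n \<times> 'n) set" where "part r = {p \<in> T. dg (fst p) = r}"
definition tail :: "nat \<Rightarrow> ('n \<times> 'n) set" where "tail r = {p \<in> T. r \<le> dg (fst p)}"

lemma part_T: "part r \<subseteq> T" and tail_T: "tail r \<subseteq> T" by (auto simp: part_def tail_def)
lemma tail_Un: "tail r = part r \<union> tail (Suc r)" by (auto simp: part_def tail_def)
lemma tail_empty: "tail (Suc t) = {}" using dg_le by (force simp: tail_def)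
text \<open>Composable pairs have initial vertices of different degrees. So pairs of one degree
  commute, and none of them is a product of others.\<close>

lemma part_comp: "part r O part r = {}" using dg_less by (fastforce simp: part_def)
lemma trans_part: "trans (part r)" by (rule transI) (use part_comp[of r] in blast)
lemma trans_tail: "trans (tail r)" by (rule transI) (auto simp: tail_def intro: trT)

lemma part_commute:
  assumes "p \<in> part r" "q \<in> part r" shows "x p \<alpha> \<otimes> x q \<beta> = x q \<beta> \<otimes> x p \<alpha>"
proof -
  obtain a b a' b' where pq: "p = (a, b)" "q = (a', b')" by fastforce
  have T: "(a, b) \<in> T" "(a', b') \<in> T" "dg a = r" "dg a' = r" using assms pq by (auto simp: part_def)
  have "b \<noteq> a'" "b' \<noteq> a" using dg_less[of a b b'] dg_less[of a' b' b] T by auto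
  then show ?thesis using x_comm[OF T(1,2)] pq by simp
qed

text \<open>A version of \<open>tau\<close> with a separate index list \<open>js\<close>, so that
  induction on the list leaves the indexing of \<open>es\<close> untouched.\<close>

definition ptau :: "('n \<times> 'n) list \<Rightarrow> nat list \<Rightarrow> (nat \<Rightarrow> 'r) \<Rightarrow> 'g" where
  "ptau es js l = foldr (\<lambda>i a. x (es ! i) (l i) \<otimes> a) js \<one>"

lemma ptau_Cons: "ptau es (j # js) l = x (es ! j) (l j) \<otimes> ptau es js l"
  and ptau_Nil: "ptau es [] l = \<one>" by (simp_all add: ptau_def)

lemma set_upt_sub: "set [0..<m] \<subseteq> {..<m}" by auto

context fixes es r assumes es: "set es \<subseteq> part r"
begin

lemma es_part: "i < length es \<Longrightarrow> es ! i \<in> part r" using es nth_mem by blast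
lemma es_T: "i < length es \<Longrightarrow> es ! i \<in> T" using es_part part_T by blast

lemma ptau_gs: "set js \<subseteq> {..<length es} \<Longrightarrow> ptau es js l \<in> gs (part r)"
proof (induction js)
  case (Cons j js)
  have "es ! j \<in> part r" using es_part[of j] Cons.prems by auto
  then show ?case using Cons gs_mult gs_x by (simp add: ptau_Cons)
qed (simp add: ptau_Nil gs_one)

lemma ptau_carrier: "set js \<subseteq> {..<length es} \<Longrightarrow> ptau es js l \<in> carrier \<Gamma>"
  using gs_carrier[OF part_T ptau_gs] by blast

lemma ptau_commute:
  assumes "p \<in> part r" shows "set js \<subseteq> {..<length es} \<Longrightarrow> x p \<alpha> \<otimes> ptau es js l = ptau es js l \<otimes> x p \<alpha>"
proof (induction js)
  case (Cons j js)
  have e: "es ! j \<in> part r" using es_part[of j] Cons.prems by auto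
  have c: "x p \<alpha> \<in> carrier \<Gamma>" "x (es ! j) (l j) \<in> carrier \<Gamma>" "ptau es js l \<in> carrier \<Gamma>"
    using x_closed[OF subsetD[OF part_T assms]] x_closed[OF subsetD[OF part_T e]] ptau_carrier[of js] Cons.prems
    by auto
  have "x p \<alpha> \<otimes> (x (es ! j) (l j) \<otimes> ptau es js l) = (x (es ! j) (l j) \<otimes> x p \<alpha>) \<otimes> ptau es js l"
    using c part_commute[OF assms e] by (simp add: m_assoc[symmetric])
  also have "\<dots> = x (es ! j) (l j) \<otimes> (ptau es js l \<otimes> x p \<alpha>)" using c Cons by (simp add: m_assoc)
  finally show ?case using c by (simp add: ptau_Cons m_assoc)
next
  case Nil
  then show ?case using x_closed[OF subsetD[OF part_T assms]] by (simp add: ptau_Nil)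
qed

lemma ptau_add:
  "set js \<subseteq> {..<length es} \<Longrightarrow> ptau es js (\<lambda>i. l i + l' i) = ptau es js l \<otimes> ptau es js l'"
proof (induction js)
  case (Cons j js)
  have e: "es ! j \<in> part r" using es_part[of j] Cons.prems by auto
  have eT: "es ! j \<in> T" using e part_T by blast
  have js: "set js \<subseteq> {..<length es}" using Cons.prems by simp
  note c = x_closed[OF eT] ptau_carrier[OF js]
  have "ptau es (j # js) (\<lambda>i. l i + l' i) = x (es ! j) (l j) \<otimes> (x (es ! j) (l' j) \<otimes> ptau es js l) \<otimes> ptau es js l'"
    using c Cons.IH[OF js] x_add[OF eT, symmetric] by (simp add: ptau_Cons m_assoc)
  also have "\<dots> = x (es ! j) (l j) \<otimes> (ptau es js l \<otimes> x (es ! j) (l' j)) \<otimes> ptau es js l'"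
    using ptau_commute[OF e js] by simp
  also have "\<dots> = ptau es (j # js) l \<otimes> ptau es (j # js) l'" using c by (simp add: ptau_Cons m_assoc)
  finally show ?case .
qed (simp add: ptau_Nil)

text \<open>Within one degree nothing composes, so every coefficient is additive; distinctness of
  \<open>es\<close> isolates the parameter at \<open>k\<close>. This yields injectivity of
  \<open>\<tau>\<close>.\<close>

lemma ptau_coeff:
  assumes "distinct es" "k < length es"
  shows "distinct js \<Longrightarrow> set js \<subseteq> {..<length es} \<Longrightarrow> c (es ! k) (ptau es js l) = (if k \<in> set js then l k else 0)"
proof (induction js)
  case Nil
  have "es ! k \<in> T" using es_T assms by blast
  then show ?case by (simp add: ptau_Nil c_one)
next
  case (Cons j js)
  have ek: "es ! k \<in> T" and ej: "es ! j \<in> part r" using es_T[of k] es_part[of j] assms Cons.prems by auto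
  have "c (es ! k) (ptau es (j # js) l) = (if es ! j = es ! k then l j else 0) + c (es ! k) (ptau es js l)"
    unfolding ptau_Cons
    by (rule c_step[OF part_T[of r] trans_part ek _ ej ptau_gs]) (use part_comp Cons.prems in auto)
  moreover have "es ! j = es ! k \<longleftrightarrow> j = k" using assms Cons.prems by (simp add: nth_eq_iff_index_eq)
  ultimately show ?case using Cons by auto
qed

lemma ptau_zero: "set js \<subseteq> {..<length es} \<Longrightarrow> (\<And>i. i \<in> set js \<Longrightarrow> l i = 0) \<Longrightarrow> ptau es js l = \<one>"
proof (induction js)
  case (Cons j js)
  have "es ! j \<in> T" using es_T[of j] Cons.prems by auto
  then show ?case using Cons x_zero by (simp add: ptau_Cons)
qed (simp add: ptau_Nil)

lemma ptau_delta:
  "distinct js \<Longrightarrow> set js \<subseteq> {..<length es} \<Longrightarrow> k \<in> set js \<Longrightarrow> ptau es js (\<lambda>i. if i = k then \<alpha> else 0) = x (es ! k) \<alpha>"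
proof (induction js)
  case (Cons j js)
  have eT: "es ! j \<in> T" using es_T[of j] Cons.prems by auto
  show ?case
  proof (cases "j = k")
    case True
    have "ptau es js (\<lambda>i. if i = k then \<alpha> else 0) = \<one>" by (rule ptau_zero) (use Cons.prems True in auto)
    then show ?thesis using True x_closed eT by (simp add: ptau_Cons)
  next
    case False
    then have "ptau es js (\<lambda>i. if i = k then \<alpha> else 0) = x (es ! k) \<alpha>" using Cons by auto
    moreover have "es ! k \<in> T" using es_T[of k] Cons.prems by auto
    ultimately show ?thesis using False x_zero[OF eT] x_closed by (simp add: ptau_Cons)
  qed
qed simp

end

abbreviation "W r l \<equiv> ptau (en r) [0..<length (en r)] l"

lemma W_gs: "r \<in> {1..t} \<Longrightarrow> W r l \<in> gs (part r)"
  using en[of r] by (intro ptau_gs) (auto simp: part_def)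

lemma W_add: "r \<in> {1..t} \<Longrightarrow> W r (\<lambda>i. l i + l' i) = W r l \<otimes> W r l'"
  using en[of r] by (intro ptau_add[where r = r]) (auto simp: part_def)

lemma W_coeff: "r \<in> {1..t} \<Longrightarrow> k < length (en r) \<Longrightarrow> c (en r ! k) (W r l) = l k"
  using en[of r] ptau_coeff[of "en r" r k "[0..<length (en r)]" l] set_upt_sub[of "length (en r)"]
  by (simp add: part_def)

lemma W_cong: "(\<And>i. i < length (en r) \<Longrightarrow> l i = l' i) \<Longrightarrow> W r l = W r l'"
  unfolding ptau_def by (rule foldr_cong) auto

lemma W_range: "r \<in> {1..t} \<Longrightarrow> gs (part r) = range (W r)"
proof
  assume r: "r \<in> {1..t}"
  have sub: "set (en r) \<subseteq> part r" using en[OF r] by (auto simp: part_def)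
  show "range (W r) \<subseteq> gs (part r)" using W_gs[OF r] by blast
  show "gs (part r) \<subseteq> range (W r)"
  proof
    fix g assume "g \<in> gs (part r)"
    then show "g \<in> range (W r)" using part_T[of r]
    proof (induction rule: gs_induct)
      case one
      have "W r (\<lambda>_. 0) = \<one>" by (rule ptau_zero[OF sub]) auto
      then show ?case by (intro range_eqI[of _ _ "\<lambda>_. 0"]) simp
    next
      case (mult w \<alpha> g)
      then obtain l where l: "g = W r l" by blast
      have "w \<in> set (en r)" using mult en[OF r] by (simp add: part_def)
      then obtain k where k: "k < length (en r)" "w = en r ! k" by (auto simp: in_set_conv_nth)
      have "x w \<alpha> = W r (\<lambda>i. if i = k then \<alpha> else 0)"
        using ptau_delta[OF sub _ set_upt_sub, of k] k by simp
      then have e: "x w \<alpha> \<otimes> g = W r (\<lambda>i. (if i = k then \<alpha> else 0) + l i)" using W_add[OF r] l by simp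
      show ?case unfolding e by (rule rangeI)
    qed
  qed
qed

text \<open>A pair of higher degree composes with a pair of degree \<open>r\<close> only on its
  right, which keeps the initial vertex, so the correction factor has degree \<open>r\<close> again.
  Thus the tail normalises the part of degree \<open>r\<close>.\<close>

lemma part_tail_swap:
  assumes w: "w \<in> tail (Suc r)" and a: "a \<in> gs (part r)"
  shows "\<exists>a'\<in>gs (part r). x w \<mu> \<otimes> a = a' \<otimes> x w \<mu>"
  using a part_T[of r]
proof (induction rule: gs_induct)
  case one
  have "x w \<mu> \<in> carrier \<Gamma>" using w tail_T by (intro x_closed) blast
  then show ?case using gs_one by (intro bexI[of _ \<one>]) simp_all
next
  case (mult v \<alpha> g)
  then obtain g' where g': "g' \<in> gs (part r)" "x w \<mu> \<otimes> g = g' \<otimes> x w \<mu>" by blast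
  obtain a b d e where vw: "v = (a, b)" "w = (d, e)" by fastforce
  have T: "(a, b) \<in> T" "(d, e) \<in> T" "dg a = r" "Suc r \<le> dg d" using mult w vw by (auto simp: part_def tail_def)
  have ea: "e \<noteq> a" using dg_less[of d e b] T by auto
  have gc: "g \<in> carrier \<Gamma>" "g' \<in> carrier \<Gamma>" using gs_carrier[OF part_T] mult g' by auto
  have "\<exists>z\<in>gs (part r). x w \<mu> \<otimes> x v \<alpha> = z \<otimes> x w \<mu>"
  proof (cases "b = d")
    case True
    have aeT: "(a, e) \<in> T" using trT[of a b e] T True by simp
    then have ae: "(a, e) \<in> part r" using T by (simp add: part_def)
    note cl = x_closed[OF T(1)] x_closed[OF T(2)] x_closed[OF aeT]
    have "x (a, b) \<alpha> \<otimes> x (b, e) \<mu> = x (a, e) (- (\<alpha> * \<mu>)) \<otimes> (x (b, e) \<mu> \<otimes> x (a, b) \<alpha>)"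
      using x_prod[of a b e \<alpha> \<mu>] T True by simp
    then have "x (a, e) (\<alpha> * \<mu>) \<otimes> (x (a, b) \<alpha> \<otimes> x (b, e) \<mu>) =
        (x (a, e) (\<alpha> * \<mu>) \<otimes> x (a, e) (- (\<alpha> * \<mu>))) \<otimes> (x (b, e) \<mu> \<otimes> x (a, b) \<alpha>)"
      using cl True by (simp add: m_assoc)
    also have "\<dots> = x (b, e) \<mu> \<otimes> x (a, b) \<alpha>" using cl True x_add[OF aeT] x_zero[OF aeT] by simp
    finally have "x w \<mu> \<otimes> x v \<alpha> = (x (a, e) (\<alpha> * \<mu>) \<otimes> x v \<alpha>) \<otimes> x w \<mu>" using vw True cl by (simp add: m_assoc)
    then show ?thesis using gs_mult[OF gs_x[OF ae] gs_x[OF mult(1)]] by blast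
  next
    case False
    then have "x w \<mu> \<otimes> x v \<alpha> = x v \<alpha> \<otimes> x w \<mu>" using x_comm[OF T(1,2)] ea vw by simp
    then show ?thesis using gs_x[OF mult(1)] by blast
  qed
  then obtain z where z: "z \<in> gs (part r)" "x w \<mu> \<otimes> x v \<alpha> = z \<otimes> x w \<mu>" by blast
  have c: "x w \<mu> \<in> carrier \<Gamma>" "x v \<alpha> \<in> carrier \<Gamma>" "z \<in> carrier \<Gamma>"
    using x_closed T vw gs_carrier[OF part_T z(1)] by auto
  have "x w \<mu> \<otimes> (x v \<alpha> \<otimes> g) = z \<otimes> (x w \<mu> \<otimes> g)" using c gc z(2) by (simp add: m_assoc[symmetric])
  also have "\<dots> = (z \<otimes> g') \<otimes> x w \<mu>" using c gc g'(2) by (simp add: m_assoc)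
  finally show ?case using gs_mult[OF z(1) g'(1)] by blast
qed

lemma part_tail_swap_gs:
  assumes k: "k \<in> gs (tail (Suc r))" and a: "a \<in> gs (part r)"
  shows "\<exists>a'\<in>gs (part r). k \<otimes> a = a' \<otimes> k"
  using k tail_T[of "Suc r"]
proof (induction rule: gs_induct)
  case one
  then show ?case using a gs_carrier[OF part_T a] by (intro bexI[of _ a]) auto
next
  case (mult w \<mu> k)
  then obtain a' where a': "a' \<in> gs (part r)" "k \<otimes> a = a' \<otimes> k" by blast
  obtain a'' where a'': "a'' \<in> gs (part r)" "x w \<mu> \<otimes> a' = a'' \<otimes> x w \<mu>" using part_tail_swap[OF mult(1) a'(1)] by blast
  have c: "a \<in> carrier \<Gamma>" "a' \<in> carrier \<Gamma>" "a'' \<in> carrier \<Gamma>" "k \<in> carrier \<Gamma>" "x w \<mu> \<in> carrier \<Gamma>"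
    using gs_carrier[OF part_T] a a' a'' gs_carrier[OF tail_T] mult x_closed[OF subsetD[OF tail_T]] by auto
  have "x w \<mu> \<otimes> k \<otimes> a = x w \<mu> \<otimes> a' \<otimes> k" using c a'(2) by (simp add: m_assoc)
  also have "\<dots> = a'' \<otimes> (x w \<mu> \<otimes> k)" using c a''(2) by (simp add: m_assoc)
  finally show ?case using a''(1) by blast
qed

lemma tail_factor: "g \<in> gs (tail r) \<Longrightarrow> \<exists>a\<in>gs (part r). \<exists>k\<in>gs (tail (Suc r)). g = a \<otimes> k"
proof -
  assume g: "g \<in> gs (tail r)"
  show ?thesis using g tail_T[of r]
  proof (induction rule: gs_induct)
    case one
    then show ?case using gs_one by (metis l_one one_closed)
  next
    case (mult w \<mu> g)
    then obtain a k where ak: "a \<in> gs (part r)" "k \<in> gs (tail (Suc r))" "g = a \<otimes> k" by blast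
    have c: "a \<in> carrier \<Gamma>" "k \<in> carrier \<Gamma>" "x w \<mu> \<in> carrier \<Gamma>"
      using gs_carrier[OF part_T ak(1)] gs_carrier[OF tail_T ak(2)] x_closed[OF subsetD[OF tail_T mult(1)]] by auto
    show ?case
    proof (cases "w \<in> part r")
      case True
      have "x w \<mu> \<otimes> g = (x w \<mu> \<otimes> a) \<otimes> k" using c ak by (simp add: m_assoc)
      then show ?thesis using gs_mult[OF gs_x[OF True] ak(1)] ak(2) by blast
    next
      case False
      then have w: "w \<in> tail (Suc r)" using mult(1) tail_Un by blast
      obtain a' where a': "a' \<in> gs (part r)" "x w \<mu> \<otimes> a = a' \<otimes> x w \<mu>" using part_tail_swap[OF w ak(1)] by blast
      have "a' \<in> carrier \<Gamma>" using gs_carrier[OF part_T a'(1)] .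
      then have "x w \<mu> \<otimes> g = a' \<otimes> (x w \<mu> \<otimes> k)" using c ak(3) a'(2) by (simp add: m_assoc[symmetric])
      then show ?thesis using gs_mult[OF gs_x[OF w] ak(2)] a'(1) by blast
    qed
  qed
qed

text \<open>The tail is transitive and contains no pair of degree \<open>r\<close>, so the
  coefficients at such pairs vanish on it; on the part of degree \<open>r\<close> they are the
  parameters.\<close>

lemma part_Int_tail:
  assumes r: "r \<in> {1..t}" and a: "a \<in> gs (part r)" "a \<in> gs (tail (Suc r))" shows "a = \<one>"
proof -
  have sub: "set (en r) \<subseteq> part r" using en[OF r] by (auto simp: part_def)
  obtain l where l: "a = W r l" using W_range[OF r] a(1) by blast
  have "l i = 0" if i: "i < length (en r)" for i
  proof -
    have e: "en r ! i \<in> part r" using sub i by auto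
    have "c (en r ! i) a = 0"
      by (rule c_zero[OF tail_T trans_tail _ _ a(2)]) (use e in \<open>auto simp: part_def tail_def\<close>)
    then show ?thesis using W_coeff[OF r i] l by simp
  qed
  then show ?thesis unfolding l by (intro ptau_zero[OF sub]) auto
qed

lemma factor_unique:
  assumes r: "r \<in> {1..t}" and "a \<in> gs (part r)" "a' \<in> gs (part r)" "k \<in> gs (tail (Suc r))" "k' \<in> gs (tail (Suc r))"
    "a \<otimes> k = a' \<otimes> k'"
  shows "a = a' \<and> k = k'"
proof -
  have c: "a \<in> carrier \<Gamma>" "a' \<in> carrier \<Gamma>" "k \<in> carrier \<Gamma>" "k' \<in> carrier \<Gamma>"
    using gs_carrier[OF part_T] gs_carrier[OF tail_T] assms by auto
  have e: "inv a' \<otimes> a = k' \<otimes> inv k"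
  proof -
    have "inv a' \<otimes> (a \<otimes> k) \<otimes> inv k = inv a' \<otimes> (a' \<otimes> k') \<otimes> inv k" using assms(6) by simp
    then show ?thesis using c by (simp add: m_assoc) (simp add: m_assoc[symmetric])
  qed
  have 1: "inv a' \<otimes> a \<in> gs (part r)" using gs_mult gs_inv[OF part_T] assms by blast
  have 2: "k' \<otimes> inv k \<in> gs (tail (Suc r))" using gs_mult gs_inv[OF tail_T] assms by blast
  have "inv a' \<otimes> a = \<one>" by (rule part_Int_tail[OF r 1]) (use 2 e in simp)
  then have "a = a'" using c by (metis inv_inv inv_closed inv_equality)
  then show ?thesis using assms(6) c by simp
qed

text \<open>Splits off the first factor. The remaining representation must be an extensional
  function on the shorter interval, hence the \<open>restrict\<close>.\<close>

lemma canonical_step: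
  assumes r: "r \<le> t"
  shows "canonical_rep \<Gamma> A r t g es \<longleftrightarrow> es r \<in> A r \<and> es \<in> extensional {r..t} \<and>
    (\<exists>k. canonical_rep \<Gamma> A (Suc r) t k (restrict es {Suc r..t}) \<and> g = es r \<otimes> k)"
proof -
  have up: "[r..<Suc t] = r # [Suc r..<Suc t]" using r by (simp add: upt_rec[of r])
  have f: "foldr (\<lambda>s a. restrict es {Suc r..t} s \<otimes> a) [Suc r..<Suc t] \<one> = foldr (\<lambda>s a. es s \<otimes> a) [Suc r..<Suc t] \<one>"
    by (rule foldr_cong) auto
  have ins: "{r..t} = insert r {Suc r..t}" using r by auto
  have P: "es \<in> (\<Pi>\<^sub>E s\<in>{r..t}. A s) \<longleftrightarrow> es r \<in> A r \<and> es \<in> extensional {r..t} \<and> restrict es {Suc r..t} \<in> (\<Pi>\<^sub>E s\<in>{Suc r..t}. A s)"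
    unfolding PiE_iff ins by auto
  show ?thesis unfolding canonical_rep_def P f up by auto
qed

text \<open>Downward induction on \<open>r\<close> from the trivial group at \<open>Suc t\<close>;
  the step combines \<open>tail_factor\<close> with \<open>factor_unique\<close>.\<close>

lemma canonical_exists_unique:
  assumes A: "\<forall>s\<in>{1..t}. A s = gs (part s)" and r: "1 \<le> r" "r \<le> Suc t"
  shows "\<forall>g\<in>gs (tail r). \<exists>!es. canonical_rep \<Gamma> A r t g es"
    and "\<And>g es. canonical_rep \<Gamma> A r t g es \<Longrightarrow> g \<in> gs (tail r)"
proof -
  have "(\<forall>g\<in>gs (tail r). \<exists>!es. canonical_rep \<Gamma> A r t g es) \<and> (\<forall>g es. canonical_rep \<Gamma> A r t g es \<longrightarrow> g \<in> gs (tail r))"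
    using r(2,1)
  proof (induction r rule: inc_induct)
    case base
    have "canonical_rep \<Gamma> A (Suc t) t g es \<longleftrightarrow> es = (\<lambda>_. undefined) \<and> g = \<one>" for g es
      by (simp add: canonical_rep_def)
    then show ?case by (auto simp: tail_empty gs_empty)
  next
    case (step r)
    then have r: "r \<le> t" "r \<in> {1..t}" by auto
    note st = canonical_step[OF r(1)]
    have IH: "\<forall>g\<in>gs (tail (Suc r)). \<exists>!es. canonical_rep \<Gamma> A (Suc r) t g es"
      and IH2: "canonical_rep \<Gamma> A (Suc r) t g es \<Longrightarrow> g \<in> gs (tail (Suc r))" for g es using step by auto
    have mem: "g \<in> gs (tail r)" if can: "canonical_rep \<Gamma> A r t g es" for g es
    proof -
      obtain k where "es r \<in> gs (part r)" "k \<in> gs (tail (Suc r))" "g = es r \<otimes> k"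
        using can IH2 A[rule_format, OF r(2)] unfolding st by blast
      then show ?thesis using gs_mult gs_mono[of "part r" "tail r"] gs_mono[of "tail (Suc r)" "tail r"] tail_Un by blast
    qed
    have "\<exists>!es. canonical_rep \<Gamma> A r t g es" if g: "g \<in> gs (tail r)" for g
    proof -
      obtain a k where ak: "a \<in> gs (part r)" "k \<in> gs (tail (Suc r))" "g = a \<otimes> k" using tail_factor[OF g] by blast
      obtain es' where es': "canonical_rep \<Gamma> A (Suc r) t k es'" using IH ak(2) by blast
      have ext: "es' \<in> extensional {Suc r..t}" using es' by (simp add: canonical_rep_def PiE_def)
      have re: "restrict (es'(r := a)) {Suc r..t} = es'" using ext by (auto simp: fun_eq_iff extensional_def)
      have "canonical_rep \<Gamma> A r t g (es'(r := a))"
        unfolding st re using ak es' ext A[rule_format, OF r(2)] r(1) by (auto simp: extensional_def)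
      moreover have "es = es'(r := a)" if can: "canonical_rep \<Gamma> A r t g es" for es
      proof -
        obtain k' where k': "es r \<in> gs (part r)" "es \<in> extensional {r..t}"
          "canonical_rep \<Gamma> A (Suc r) t k' (restrict es {Suc r..t})" "g = es r \<otimes> k'"
          using can A[rule_format, OF r(2)] unfolding st by blast
        have "es r = a \<and> k' = k" using factor_unique[OF r(2) k'(1) ak(1) IH2[OF k'(3)] ak(2)] k'(4) ak(3) by simp
        then have "restrict es {Suc r..t} = es'" using k'(3) es' IH ak(2) by blast
        then show ?thesis
          using k'(2) \<open>es r = a \<and> k' = k\<close> by (fastforce simp: fun_eq_iff extensional_def restrict_def)
      qed
      ultimately show ?thesis by blast
    qed
    then show ?case using mem by blast
  qed
  then show "\<forall>g\<in>gs (tail r). \<exists>!es. canonical_rep \<Gamma> A r t g es"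
    "\<And>g es. canonical_rep \<Gamma> A r t g es \<Longrightarrow> g \<in> gs (tail r)" by auto
qed

lemma strip_first_eq:
  assumes A: "\<forall>s\<in>{1..t}. A s = gs (part s)" and r: "r \<in> {1..t}"
    and a: "a \<in> gs (part r)" and k: "k \<in> gs (tail (Suc r))"
  shows "strip_first \<Gamma> A r t (a \<otimes> k) = k"
proof -
  have g: "a \<otimes> k \<in> gs (tail r)"
    using a k gs_mult gs_mono[of "part r" "tail r"] gs_mono[of "tail (Suc r)" "tail r"] tail_Un by blast
  have "\<exists>!es. canonical_rep \<Gamma> A r t (a \<otimes> k) es" using canonical_exists_unique(1)[OF A, of r] r g by auto
  then have "canonical_rep \<Gamma> A r t (a \<otimes> k) (THE es. canonical_rep \<Gamma> A r t (a \<otimes> k) es)" by (rule theI')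
  then obtain k' where k': "(THE es. canonical_rep \<Gamma> A r t (a \<otimes> k) es) r \<in> gs (part r)" "k' \<in> gs (tail (Suc r))"
    "a \<otimes> k = (THE es. canonical_rep \<Gamma> A r t (a \<otimes> k) es) r \<otimes> k'"
    using canonical_step[of r A "a \<otimes> k"] canonical_exists_unique(2)[OF A, of "Suc r"] r A[rule_format, OF r] by auto
  have "(THE es. canonical_rep \<Gamma> A r t (a \<otimes> k) es) r = a"
    using factor_unique[OF r k'(1) a k'(2) k] k'(3) by simp
  then show ?thesis using gs_carrier[OF part_T a] gs_carrier[OF tail_T k]
    by (simp add: strip_first_def m_assoc[symmetric])
qed

lemma exact_sequence:
  assumes A: "\<forall>s\<in>{1..t}. A s = gs (part s)" and r: "r \<in> {1..t}"
  shows "short_exact_sequence (\<Gamma>\<lparr>carrier := gs (tail (Suc r))\<rparr>) (\<Gamma>\<lparr>carrier := gs (tail r)\<rparr>)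
      (\<Gamma>\<lparr>carrier := A r\<rparr>) (strip_first \<Gamma> A r t) id"
    and "gs (tail (Suc r)) \<subseteq> gs (tail r)"
    and "\<And>g. g \<in> gs (tail (Suc r)) \<Longrightarrow> strip_first \<Gamma> A r t g = g"
proof -
  let ?f = "strip_first \<Gamma> A r t"
  note strip = strip_first_eq[OF A r]
  have sub1: "gs (part r) \<subseteq> gs (tail r)" and sub2: "gs (tail (Suc r)) \<subseteq> gs (tail r)"
    using gs_mono[of "part r" "tail r"] gs_mono[of "tail (Suc r)" "tail r"] tail_Un by blast+
  show "gs (tail (Suc r)) \<subseteq> gs (tail r)" by (rule sub2)
  show id: "?f g = g" if "g \<in> gs (tail (Suc r))" for g
    using strip[OF gs_one that] gs_carrier[OF tail_T that] by simp
  have AA: "A r = gs (part r)" by (rule A[rule_format, OF r])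
  have g1: "group (\<Gamma>\<lparr>carrier := gs (tail (Suc r))\<rparr>)" "group (\<Gamma>\<lparr>carrier := gs (tail r)\<rparr>)"
    "group (\<Gamma>\<lparr>carrier := A r\<rparr>)"
    unfolding AA using subgroup_imp_group[OF gs_subgroup] part_T tail_T by auto
  \<comment> \<open>Moving \<open>k\<close> past \<open>b\<close> changes only the factor of degree
    \<open>r\<close>: \<open>(a k)(b l) = (a b')(k l)\<close>.\<close>
  have hom: "?f (g \<otimes> h) = ?f g \<otimes> ?f h" if gh: "g \<in> gs (tail r)" "h \<in> gs (tail r)" for g h
  proof -
    obtain a k where ak: "a \<in> gs (part r)" "k \<in> gs (tail (Suc r))" "g = a \<otimes> k" using tail_factor[OF gh(1)] by blast
    obtain b l where bl: "b \<in> gs (part r)" "l \<in> gs (tail (Suc r))" "h = b \<otimes> l" using tail_factor[OF gh(2)] by blast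
    obtain b' where b': "b' \<in> gs (part r)" "k \<otimes> b = b' \<otimes> k" using part_tail_swap_gs[OF ak(2) bl(1)] by blast
    have cc: "a \<in> carrier \<Gamma>" "b \<in> carrier \<Gamma>" "b' \<in> carrier \<Gamma>" "k \<in> carrier \<Gamma>" "l \<in> carrier \<Gamma>"
      using gs_carrier[OF part_T] gs_carrier[OF tail_T] ak bl b' by auto
    have "g \<otimes> h = a \<otimes> ((k \<otimes> b) \<otimes> l)" using cc ak bl by (simp add: m_assoc)
    also have "\<dots> = (a \<otimes> b') \<otimes> (k \<otimes> l)" using cc b'(2) by (simp add: m_assoc)
    finally have "?f (g \<otimes> h) = k \<otimes> l" using strip[OF gs_mult[OF ak(1) b'(1)] gs_mult[OF ak(2) bl(2)]] by simp
    then show ?thesis using strip[OF ak(1,2)] strip[OF bl(1,2)] ak bl by simp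
  qed
  have im: "?f g \<in> gs (tail (Suc r))" if "g \<in> gs (tail r)" for g
    using tail_factor[OF that] strip by auto
  have f_hom: "?f \<in> hom (\<Gamma>\<lparr>carrier := gs (tail r)\<rparr>) (\<Gamma>\<lparr>carrier := gs (tail (Suc r))\<rparr>)"
    using hom im by (auto simp: hom_def)
  have id_hom: "id \<in> hom (\<Gamma>\<lparr>carrier := A r\<rparr>) (\<Gamma>\<lparr>carrier := gs (tail r)\<rparr>)"
    using sub1 by (auto simp: hom_def AA)
  have ker: "kernel (\<Gamma>\<lparr>carrier := gs (tail r)\<rparr>) (\<Gamma>\<lparr>carrier := gs (tail (Suc r))\<rparr>) ?f = id ` A r"
  proof
    show "kernel (\<Gamma>\<lparr>carrier := gs (tail r)\<rparr>) (\<Gamma>\<lparr>carrier := gs (tail (Suc r))\<rparr>) ?f \<subseteq> id ` A r"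
    proof
      fix g assume "g \<in> kernel (\<Gamma>\<lparr>carrier := gs (tail r)\<rparr>) (\<Gamma>\<lparr>carrier := gs (tail (Suc r))\<rparr>) ?f"
      then have g: "g \<in> gs (tail r)" "?f g = \<one>" by (auto simp: kernel_def)
      obtain a k where ak: "a \<in> gs (part r)" "k \<in> gs (tail (Suc r))" "g = a \<otimes> k" using tail_factor[OF g(1)] by blast
      then have "k = \<one>" using strip[OF ak(1,2)] g(2) by simp
      then show "g \<in> id ` A r" using ak gs_carrier[OF part_T ak(1)] AA by simp
    qed
    show "id ` A r \<subseteq> kernel (\<Gamma>\<lparr>carrier := gs (tail r)\<rparr>) (\<Gamma>\<lparr>carrier := gs (tail (Suc r))\<rparr>) ?f"
    proof
      fix a assume "a \<in> id ` A r"
      then have a: "a \<in> gs (part r)" using AA by simp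
      then have "?f a = \<one>" using strip[OF a gs_one] gs_carrier[OF part_T a] by simp
      then show "a \<in> kernel (\<Gamma>\<lparr>carrier := gs (tail r)\<rparr>) (\<Gamma>\<lparr>carrier := gs (tail (Suc r))\<rparr>) ?f"
        using a sub1 by (auto simp: kernel_def)
    qed
  qed
  show "short_exact_sequence (\<Gamma>\<lparr>carrier := gs (tail (Suc r))\<rparr>) (\<Gamma>\<lparr>carrier := gs (tail r)\<rparr>)
      (\<Gamma>\<lparr>carrier := A r\<rparr>) ?f id"
    unfolding short_exact_sequence_iff
  proof (intro conjI)
    show "exact_seq ([\<Gamma>\<lparr>carrier := gs (tail (Suc r))\<rparr>, \<Gamma>\<lparr>carrier := gs (tail r)\<rparr>, \<Gamma>\<lparr>carrier := A r\<rparr>], [?f, id])"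
      using g1 f_hom id_hom ker
      by (intro exact_seq.extension exact_seq.unity) (auto simp: group_hom_def group_hom_axioms_def)
    show "?f \<in> epi (\<Gamma>\<lparr>carrier := gs (tail r)\<rparr>) (\<Gamma>\<lparr>carrier := gs (tail (Suc r))\<rparr>)"
      using f_hom id sub2 im by (auto simp: epi_def image_iff subset_iff) metis
    show "id \<in> mon (\<Gamma>\<lparr>carrier := A r\<rparr>) (\<Gamma>\<lparr>carrier := gs (tail r)\<rparr>)"
      using id_hom by (auto simp: mon_def)
  qed
qed

end

section \<open>Presented groups\<close>

context fixes S :: "'g set" and rels :: "('g gword \<times> 'g gword) set"
begin

definition wds :: "'g gword set" where "wds = lists (UNIV \<times> S)"
abbreviation "R \<equiv> pres_cong S rels"

lemma wds_simps [simp]: "[] \<in> wds" "(b, a) # w \<in> wds \<longleftrightarrow> a \<in> S \<and> w \<in> wds"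
  "u @ w \<in> wds \<longleftrightarrow> u \<in> wds \<and> w \<in> wds" "rev w \<in> wds \<longleftrightarrow> w \<in> wds"
  by (auto simp: wds_def)

lemmas cong_refl = pres_cong.refl[of _ S rels, folded wds_def]
lemmas cong_cancel = pres_cong.cancel[of _ S _ _ _ rels, folded wds_def]
lemmas cong_relation = pres_cong.relation[of _ S _ _ _ rels, folded wds_def]

lemma pres_cong_lists: "(u, w) \<in> R \<Longrightarrow> u \<in> wds \<and> w \<in> wds"
  by (induction rule: pres_cong.induct) (auto simp: wds_def)

lemma equiv_pres_cong: "equiv wds R"
proof (rule equivI)
  show "R \<subseteq> wds \<times> wds" using pres_cong_lists by auto
  show "refl_on wds R" using cong_refl by (auto simp: refl_on_def)
  show "sym_on UNIV R" by (rule symI) (rule pres_cong.sym)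
  show "trans_on UNIV R" by (rule transI) (rule pres_cong.trans)
qed

lemma pres_cong_append_left: "(w, w') \<in> R \<Longrightarrow> u \<in> wds \<Longrightarrow> (u @ w, u @ w') \<in> R"
proof (induction rule: pres_cong.induct)
  case (refl w)
  then show ?case using cong_refl by (simp add: wds_def[symmetric])
next
  case (cancel v w a b)
  then have "((u @ v) @ [(b, a), (\<not> b, a)] @ w, (u @ v) @ w) \<in> R"
    by (intro cong_cancel) (simp_all add: wds_def[symmetric])
  then show ?case by simp
next
  case (relation v w l r)
  then have "((u @ v) @ l @ w, (u @ v) @ r @ w) \<in> R"
    by (intro cong_relation) (simp_all add: wds_def[symmetric])
  then show ?case by simp
qed (auto intro: pres_cong.intros)

lemma pres_cong_append_right: "(w, w') \<in> R \<Longrightarrow> u \<in> wds \<Longrightarrow> (w @ u, w' @ u) \<in> R"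
proof (induction rule: pres_cong.induct)
  case (refl w)
  then show ?case using cong_refl by (simp add: wds_def[symmetric])
next
  case (cancel v w a b)
  then have "(v @ [(b, a), (\<not> b, a)] @ (w @ u), v @ (w @ u)) \<in> R"
    by (intro cong_cancel) (simp_all add: wds_def[symmetric])
  then show ?case by simp
next
  case (relation v w l r)
  then have "(v @ l @ (w @ u), v @ r @ (w @ u)) \<in> R"
    by (intro cong_relation) (simp_all add: wds_def[symmetric])
  then show ?case by simp
qed (auto intro: pres_cong.intros)

lemma pres_cong_append: "(u, u') \<in> R \<Longrightarrow> (w, w') \<in> R \<Longrightarrow> (u @ w, u' @ w') \<in> R"
  using pres_cong_append_left[of w w' u] pres_cong_append_right[of u u' w'] pres_cong_lists
  by (meson pres_cong.trans)

abbreviation "cls w \<equiv> R `` {w}"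

lemma cls_eq_iff: "u \<in> wds \<Longrightarrow> w \<in> wds \<Longrightarrow> cls u = cls w \<longleftrightarrow> (u, w) \<in> R"
  by (rule eq_equiv_class_iff[OF equiv_pres_cong])

lemma presented_carrier: "carrier (presented_group S rels) = cls ` wds"
  by (auto simp: presented_group_def quotient_def wds_def)

text \<open>The congruence is compatible with concatenation, so the union in the definition of the
  product runs over one and the same class.\<close>

lemma presented_mult:
  assumes "u \<in> wds" "w \<in> wds"
  shows "cls u \<otimes>\<^bsub>presented_group S rels\<^esub> cls w = cls (u @ w)"
proof -
  have "cls (a @ b) = cls (u @ w)" if "a \<in> cls u" "b \<in> cls w" for a b
    using equiv_class_eq[OF equiv_pres_cong pres_cong_append[of u a w b]] that by simp
  then have "(\<Union>a\<in>cls u. \<Union>b\<in>cls w. cls (a @ b)) = (\<Union>a\<in>cls u. \<Union>b\<in>cls w. cls (u @ w))"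
    by (intro SUP_cong HOL.refl)
  moreover have "u \<in> cls u" "w \<in> cls w" using assms by (auto intro: cong_refl)
  then have "(\<Union>a\<in>cls u. \<Union>b\<in>cls w. cls (u @ w)) = cls (u @ w)" by blast
  ultimately show ?thesis by (simp add: presented_group_def)
qed

lemma presented_one: "\<one>\<^bsub>presented_group S rels\<^esub> = cls []" by (simp add: presented_group_def)

definition winv :: "'g gword \<Rightarrow> 'g gword" where "winv w = rev (map (\<lambda>(b, a). (\<not> b, a)) w)"

lemma winv_lists: "w \<in> wds \<Longrightarrow> winv w \<in> wds" by (fastforce simp: winv_def wds_def)

lemma winv_left: "w \<in> wds \<Longrightarrow> (winv w @ w, []) \<in> R"
proof (induction w)
  case Nil
  then show ?case by (simp add: winv_def cong_refl)
next
  case (Cons p w)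
  obtain b a where p: "p = (b, a)" by fastforce
  have w: "w \<in> wds" "a \<in> S" using Cons.prems p by auto
  have e: "winv (p # w) @ p # w = winv w @ [(\<not> b, a), (\<not> \<not> b, a)] @ w" by (simp add: winv_def p)
  have "(winv (p # w) @ p # w, winv w @ w) \<in> R"
    unfolding e by (rule cong_cancel[OF winv_lists[OF w(1)] w(1) w(2)])
  then show ?case using Cons.IH[OF w(1)] by (rule pres_cong.trans)
qed

lemma group_presented: "group (presented_group S rels)"
proof (rule groupI)
  let ?G = "presented_group S rels"
  show "\<one>\<^bsub>?G\<^esub> \<in> carrier ?G" by (auto simp: presented_carrier presented_one)
  show "a \<otimes>\<^bsub>?G\<^esub> b \<in> carrier ?G" if "a \<in> carrier ?G" "b \<in> carrier ?G" for a b
    using that by (auto simp: presented_carrier presented_mult)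
  show "a \<otimes>\<^bsub>?G\<^esub> b \<otimes>\<^bsub>?G\<^esub> d = a \<otimes>\<^bsub>?G\<^esub> (b \<otimes>\<^bsub>?G\<^esub> d)"
    if "a \<in> carrier ?G" "b \<in> carrier ?G" "d \<in> carrier ?G" for a b d
    using that by (auto simp: presented_carrier presented_mult)
  show "\<one>\<^bsub>?G\<^esub> \<otimes>\<^bsub>?G\<^esub> a = a" if "a \<in> carrier ?G" for a
    using that by (auto simp: presented_carrier presented_one presented_mult)
  show "\<exists>b\<in>carrier ?G. b \<otimes>\<^bsub>?G\<^esub> a = \<one>\<^bsub>?G\<^esub>" if "a \<in> carrier ?G" for a
  proof -
    obtain w where w: "w \<in> wds" "a = cls w" using \<open>a \<in> carrier ?G\<close> by (auto simp: presented_carrier)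
    have "cls (winv w) \<otimes>\<^bsub>?G\<^esub> a = \<one>\<^bsub>?G\<^esub>"
      unfolding w(2) presented_mult[OF winv_lists[OF w(1)] w(1)] presented_one
      using winv_lists[OF w(1)] w(1) winv_left[OF w(1)] by (subst cls_eq_iff) auto
    then show ?thesis using winv_lists[OF w(1)] by (auto simp: presented_carrier)
  qed
qed

lemma cls_inverse:
  assumes "a \<in> S" shows "cls [(False, a)] = inv\<^bsub>presented_group S rels\<^esub> (cls [(True, a)])"
proof -
  interpret group "presented_group S rels" by (rule group_presented)
  have "cls [(False, a)] \<otimes>\<^bsub>presented_group S rels\<^esub> cls [(True, a)] = \<one>\<^bsub>presented_group S rels\<^esub>"
    using presented_mult[of "[(False, a)]" "[(True, a)]"] winv_left[of "[(True, a)]"] assms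
    by (simp add: presented_one winv_def cls_eq_iff)
  then show ?thesis using assms by (intro inv_equality[symmetric]) (auto simp: presented_carrier)
qed

section \<open>Homomorphisms out of presented groups\<close>

context fixes G :: "'h monoid" and f :: "'g \<Rightarrow> 'h"
  assumes G: "group G" and f: "\<And>a. a \<in> S \<Longrightarrow> f a \<in> carrier G"
begin

definition weval :: "'g gword \<Rightarrow> 'h" where
  "weval w = foldr (\<lambda>(b, a) g. (if b then f a else inv\<^bsub>G\<^esub> (f a)) \<otimes>\<^bsub>G\<^esub> g) w \<one>\<^bsub>G\<^esub>"

interpretation group G by (rule G)

lemma weval_Nil: "weval [] = \<one>\<^bsub>G\<^esub>"
  and weval_Cons: "weval ((b, a) # w) = (if b then f a else inv\<^bsub>G\<^esub> (f a)) \<otimes>\<^bsub>G\<^esub> weval w"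
  by (simp_all add: weval_def)

lemma weval_closed: "w \<in> wds \<Longrightarrow> weval w \<in> carrier G"
proof (induction w)
  case (Cons p w)
  then show ?case by (cases p) (auto simp: weval_Cons f)
qed (simp add: weval_Nil)

lemma weval_append: "u \<in> wds \<Longrightarrow> w \<in> wds \<Longrightarrow> weval (u @ w) = weval u \<otimes>\<^bsub>G\<^esub> weval w"
proof (induction u)
  case (Cons p u)
  then show ?case by (cases p) (auto simp: weval_Cons f weval_closed m_assoc)
qed (simp add: weval_Nil weval_closed)

lemma weval_cong:
  assumes rels: "\<And>l r. (l, r) \<in> rels \<Longrightarrow> l \<in> wds \<Longrightarrow> r \<in> wds \<Longrightarrow> weval l = weval r"
  shows "(u, w) \<in> R \<Longrightarrow> weval u = weval w"
proof (induction rule: pres_cong.induct)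
  case (cancel u w a b)
  note cancel = cancel[folded wds_def]
  have "weval [(b, a), (\<not> b, a)] = \<one>\<^bsub>G\<^esub>" using f[OF cancel(3)] by (simp add: weval_Cons weval_Nil)
  moreover have "[(b, a), (\<not> b, a)] \<in> wds" using cancel(3) by simp
  moreover have "[(b, a), (\<not> b, a)] @ w \<in> wds" using cancel by simp
  ultimately have "weval ([(b, a), (\<not> b, a)] @ w) = weval w"
    using weval_append[of "[(b, a), (\<not> b, a)]" w] cancel(2) weval_closed[OF cancel(2)] by simp
  then show ?case
    using weval_append[OF cancel(1), of "[(b, a), (\<not> b, a)] @ w"] weval_append[OF cancel(1,2)] cancel by simp
next
  case (relation u w l r)
  note relation = relation[folded wds_def]
  have "weval (u @ l @ w) = weval u \<otimes>\<^bsub>G\<^esub> (weval l \<otimes>\<^bsub>G\<^esub> weval w)" if "l \<in> wds" for l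
    using that relation by (simp add: weval_append)
  then show ?case using rels relation by metis
qed auto

text \<open>The universal property. Only relations between words in the generators enter the
  congruence, so only those have to hold in \<open>G\<close>.\<close>

lemma presented_hom:
  assumes rels: "\<And>l r. (l, r) \<in> rels \<Longrightarrow> l \<in> wds \<Longrightarrow> r \<in> wds \<Longrightarrow> weval l = weval r"
  shows "\<exists>\<pi>\<in>hom (presented_group S rels) G. \<forall>a\<in>S. \<pi> (cls [(True, a)]) = f a"
proof -
  define \<pi> where "\<pi> A = weval (SOME w. w \<in> A)" for A
  have \<pi>: "\<pi> (cls w) = weval w" if "w \<in> wds" for w
  proof -
    have "w \<in> cls w" using that by (simp add: cong_refl)
    then have "(SOME u. u \<in> cls w) \<in> cls w" by (rule someI)
    then show ?thesis unfolding \<pi>_def using weval_cong[OF rels, of w] by simp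
  qed
  have "\<pi> \<in> hom (presented_group S rels) G"
    unfolding hom_def
    by (auto simp: presented_carrier presented_mult \<pi> weval_closed weval_append)
  moreover have "\<pi> (cls [(True, a)]) = f a" if "a \<in> S" for a
    using \<pi>[of "[(True, a)]"] that f by (simp add: weval_Cons weval_Nil)
  ultimately show ?thesis by blast
qed

end

end

section \<open>Paths and edge degrees\<close>

lemma dpaths_single [simp]: "[e] \<in> dpaths E \<longleftrightarrow> e \<in> E" by (auto simp: dpaths_def)

lemma dpaths_Cons: "q \<noteq> [] \<Longrightarrow> e # q \<in> dpaths E \<longleftrightarrow> e \<in> E \<and> q \<in> dpaths E \<and> snd e = fst (hd q)"
proof -
  assume q: "q \<noteq> []"
  have "(\<forall>i. Suc i < length (e # q) \<longrightarrow> snd ((e # q) ! i) = fst ((e # q) ! Suc i)) \<longleftrightarrow>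
     snd e = fst (hd q) \<and> (\<forall>i. Suc i < length q \<longrightarrow> snd (q ! i) = fst (q ! Suc i))" (is "?l \<longleftrightarrow> ?r")
  proof
    assume l: ?l
    show ?r
    proof (intro conjI allI impI)
      show "snd e = fst (hd q)" using l[rule_format, of 0] q by (simp add: hd_conv_nth)
      fix i assume "Suc i < length q"
      then show "snd (q ! i) = fst (q ! Suc i)" using l[rule_format, of "Suc i"] by simp
    qed
  next
    assume r: ?r
    show ?l
    proof (intro allI impI)
      fix i assume "Suc i < length (e # q)"
      then show "snd ((e # q) ! i) = fst ((e # q) ! Suc i)" using r q by (cases i) (auto simp: hd_conv_nth)
    qed
  qed
  then show ?thesis using q by (auto simp: dpaths_def)
qed

lemma dpaths_ne: "p \<in> dpaths E \<Longrightarrow> p \<noteq> []" by (simp add: dpaths_def)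

lemma dpaths_induct [consumes 1, case_names single Cons]:
  assumes "p \<in> dpaths E" "\<And>e. e \<in> E \<Longrightarrow> P [e]"
    "\<And>e q. e \<in> E \<Longrightarrow> q \<in> dpaths E \<Longrightarrow> snd e = fst (hd q) \<Longrightarrow> P q \<Longrightarrow> P (e # q)"
  shows "P p"
  using assms(1)
proof (induction p)
  case Nil
  then show ?case by (simp add: dpaths_def)
next
  case (Cons e q)
  show ?case
  proof (cases "q = []")
    case True
    then show ?thesis using assms(2) Cons.prems by simp
  next
    case False
    then show ?thesis using assms(3) Cons dpaths_Cons[OF False] by blast
  qed
qed

lemma dpaths_append:
  assumes "p \<in> dpaths E" "q \<in> dpaths E" "path_end p = path_start q"
  shows "p @ q \<in> dpaths E" "path_start (p @ q) = path_start p" "path_end (p @ q) = path_end q"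
proof -
  show "path_start (p @ q) = path_start p" "path_end (p @ q) = path_end q"
    using dpaths_ne[OF assms(1)] dpaths_ne[OF assms(2)] by (simp_all add: path_start_def path_end_def)
  show "p @ q \<in> dpaths E" using assms(1,3)
  proof (induction rule: dpaths_induct)
    case (single e)
    then show ?case using assms(2) dpaths_Cons[OF dpaths_ne[OF assms(2)]] by (simp add: path_start_def path_end_def)
  next
    case (Cons e q')
    have ne: "q' \<noteq> []" "q' @ q \<noteq> []" using dpaths_ne[OF Cons(2)] by auto
    then have "q' @ q \<in> dpaths E" using Cons by (simp add: path_end_def)
    then show ?case using Cons ne dpaths_Cons[OF ne(2), of e E] by simp
  qed
qed

lemma dpaths_trancl: "p \<in> dpaths E \<Longrightarrow> (path_start p, path_end p) \<in> E\<^sup>+"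
proof (induction rule: dpaths_induct)
  case (single e)
  then show ?case by (cases e) (auto simp: path_start_def path_end_def)
next
  case (Cons e q)
  then have "e = (fst e, path_start q)" by (cases e) (simp add: path_start_def)
  then have "(fst e, path_start q) \<in> E" using Cons(1) by simp
  then show ?case using Cons dpaths_ne[OF Cons(2)]
    by (auto simp: path_start_def path_end_def intro: trancl_into_trancl2)
qed

lemma trancl_dpaths: "(a, b) \<in> E\<^sup>+ \<Longrightarrow> \<exists>p\<in>dpaths E. path_start p = a \<and> path_end p = b"
proof (induction rule: trancl_induct)
  case (base b)
  then show ?case by (intro bexI[of _ "[(a, b)]"]) (auto simp: path_start_def path_end_def)
next
  case (step b c)
  then obtain p where p: "p \<in> dpaths E" "path_start p = a" "path_end p = b" by blast
  have "[(b, c)] \<in> dpaths E" using step by simp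
  then show ?case using dpaths_append[of p E "[(b, c)]"] p
    by (intro bexI[of _ "p @ [(b, c)]"]) (auto simp: path_start_def path_end_def)
qed

text \<open>Indexes classes of parallel paths by their end points; over \<open>E\<^sup>+\<close> the
  classes are nonempty, which makes the indexing injective.\<close>

definition pcls :: "'n rel \<Rightarrow> 'n \<times> 'n \<Rightarrow> ('n \<times> 'n) list set" where
  "pcls E p = {q \<in> dpaths E. path_start q = fst p \<and> path_end q = snd p}"

lemma pcls_ne: "p \<in> E\<^sup>+ \<Longrightarrow> pcls E p \<noteq> {}"
  using trancl_dpaths[of "fst p" "snd p" E] by (auto simp: pcls_def)

lemma pcls_inj:
  assumes "p \<in> E\<^sup>+" "pcls E p = pcls E q" shows "p = q"
proof -
  obtain q' where q': "q' \<in> pcls E p" using pcls_ne[OF assms(1)] by blast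
  then have "q' \<in> pcls E q" using assms(2) by simp
  then show ?thesis using q' by (simp add: pcls_def prod_eq_iff)
qed

lemma same_ends_class: "q \<in> dpaths E \<Longrightarrow> same_ends E `` {q} = pcls E (path_start q, path_end q)"
  by (auto simp: same_ends_def pcls_def)

text \<open>Identifying parallel paths leaves the transitive closure, with composition of pairs as
  partial product; this is the relation \<open>T\<close> of the triangular groups.\<close>

lemma path_bar_eq: "path_bar E = pcls E ` (E\<^sup>+)"
proof
  show "path_bar E \<subseteq> pcls E ` (E\<^sup>+)"
    using dpaths_trancl by (fastforce simp: path_bar_def quotient_def same_ends_class)
  show "pcls E ` (E\<^sup>+) \<subseteq> path_bar E"
  proof
    fix c assume "c \<in> pcls E ` (E\<^sup>+)"
    then obtain a b where ab: "(a, b) \<in> E\<^sup>+" "c = pcls E (a, b)" by auto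
    then obtain q where "q \<in> dpaths E" "path_start q = a" "path_end q = b" using trancl_dpaths[OF ab(1)] by blast
    then show "c \<in> path_bar E" using same_ends_class[of q E] ab(2) by (auto simp: path_bar_def quotient_def)
  qed
qed

lemma bar_prod_pcls:
  assumes "(a, b) \<in> E\<^sup>+" "(c, d) \<in> E\<^sup>+"
  shows "bar_prod E (pcls E (a, b)) (pcls E (c, d)) = (if b = c then Some (pcls E (a, d)) else None)"
proof -
  obtain p where p: "p \<in> pcls E (a, b)" using pcls_ne[OF assms(1)] by blast
  obtain q where q: "q \<in> pcls E (c, d)" using pcls_ne[OF assms(2)] by blast
  have "(\<exists>p\<in>pcls E (a, b). \<exists>q\<in>pcls E (c, d). path_end p = path_start q) \<longleftrightarrow> b = c"
    using p q by (auto simp: pcls_def)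
  moreover have "(\<Union>p\<in>pcls E (a, b). \<Union>q\<in>pcls E (b, d). same_ends E `` {p @ q}) = pcls E (a, d)" if bc: "b = c"
  proof -
    have e: "same_ends E `` {p @ q} = pcls E (a, d)" if "p \<in> pcls E (a, b)" "q \<in> pcls E (b, d)" for p q
      using dpaths_append[of p E q] same_ends_class[of "p @ q" E] that by (simp add: pcls_def)
    have "(\<Union>p\<in>pcls E (a, b). \<Union>q\<in>pcls E (b, d). same_ends E `` {p @ q}) = (\<Union>p\<in>pcls E (a, b). \<Union>q\<in>pcls E (b, d). pcls E (a, d))"
      by (intro SUP_cong HOL.refl) (rule e)
    then show ?thesis using p q bc by auto
  qed
  ultimately show ?thesis by (auto simp: bar_prod_def)
qed

section \<open>Degrees of edges\<close>

locale fin_graph = fixes E :: "'n rel" assumes gr: "graph E"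
begin

lemma finE: "finite E" using gr by (simp add: graph_def)

text \<open>A cycle through the edge \<open>(a, b)\<close> gives a closed path at \<open>b\<close>;
  the edge followed by it is a second path from \<open>a\<close> to \<open>b\<close>.\<close>

lemma irrefl_trancl: "(a, a) \<notin> E\<^sup>+"
proof
  assume "(a, a) \<in> E\<^sup>+"
  then obtain b where b: "(a, b) \<in> E" "(b, a) \<in> E\<^sup>*" using tranclD[of a a E] by blast
  then have "(b, b) \<in> E\<^sup>+" using rtrancl_into_trancl1[OF b(2,1)] by simp
  then obtain p where p: "p \<in> dpaths E" "path_start p = b" "path_end p = b" using trancl_dpaths[of b b E] by blast
  have "[(a, b)] @ p \<in> dpaths E" "path_start ([(a, b)] @ p) = a" "path_end ([(a, b)] @ p) = b"
    using dpaths_append[of "[(a, b)]" E p] b(1) p by (auto simp: path_start_def path_end_def)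
  moreover have "\<forall>p\<in>dpaths E. path_start p = a \<and> path_end p = b \<longrightarrow> p = [(a, b)]"
    using gr b(1) unfolding graph_def by blast
  ultimately have "[(a, b)] @ p = [(a, b)]" by blast
  then show False using dpaths_ne[OF p(1)] by simp
qed

lemma no_cycle: "(a, b) \<in> E \<Longrightarrow> (b, a) \<notin> E\<^sup>*"
  using irrefl_trancl[of a] by (auto dest: rtrancl_into_trancl2)

lemma edge_le_rtrancl: "edge_le E f g \<Longrightarrow> f \<noteq> g \<Longrightarrow> (snd f, fst g) \<in> E\<^sup>*"
proof -
  have "hd p = last p \<or> (snd (hd p), fst (last p)) \<in> E\<^sup>*" if "p \<in> dpaths E" for p
    using that
  proof (induction rule: dpaths_induct)
    case (Cons e q)
    have ne: "q \<noteq> []" using dpaths_ne[OF Cons(2)] .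
    have "hd q \<in> E" using Cons(2) ne by (auto simp: dpaths_def)
    then have h: "(snd e, snd (hd q)) \<in> E" using Cons(3) by simp
    have "(snd e, fst (last q)) \<in> E\<^sup>*"
    proof (cases "hd q = last q")
      case True
      then show ?thesis using Cons(3) by simp
    next
      case False
      then have "(snd (hd q), fst (last q)) \<in> E\<^sup>*" using Cons(4) by simp
      then show ?thesis by (rule converse_rtrancl_into_rtrancl[OF h])
    qed
    then show ?case using ne by simp
  qed simp
  then show "edge_le E f g \<Longrightarrow> f \<noteq> g \<Longrightarrow> (snd f, fst g) \<in> E\<^sup>*" by (auto simp: edge_le_def)
qed

lemma rtrancl_edge_le:
  assumes "f \<in> E" "g \<in> E" "(snd f, fst g) \<in> E\<^sup>*" shows "edge_le E f g"
proof -
  have "\<exists>p. (p = [] \<and> snd f = fst g) \<or> (p \<in> dpaths E \<and> path_start p = snd f \<and> path_end p = fst g)"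
    using assms(3) trancl_dpaths[of "snd f" "fst g" E] by (auto simp: rtrancl_eq_or_trancl)
  then obtain p where p: "(p = [] \<and> snd f = fst g) \<or> (p \<in> dpaths E \<and> path_start p = snd f \<and> path_end p = fst g)" by blast
  then have "p @ [g] \<in> dpaths E \<and> fst (hd (p @ [g])) = snd f"
    using assms(2) dpaths_append[of p E "[g]"] dpaths_ne[of p E] by (auto simp: path_start_def path_end_def)
  then have "f # p @ [g] \<in> dpaths E" using dpaths_Cons[of "p @ [g]" f E] assms(1) by simp
  then show ?thesis unfolding edge_le_def by (intro bexI[of _ "f # p @ [g]"]) auto
qed

abbreviation "chain fs \<equiv> fs \<noteq> [] \<and> set fs \<subseteq> E \<and> sorted_wrt (\<lambda>g h. edge_le E g h \<and> g \<noteq> h) fs"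

lemma edge_chain_iff: "edge_chain E f r \<longleftrightarrow> (\<exists>fs. chain fs \<and> length fs = r \<and> last fs = f)"
  unfolding edge_chain_def by (rule iff_exI) blast

lemma edge_chain_bound: "edge_chain E f r \<Longrightarrow> r \<le> card E"
proof -
  assume "edge_chain E f r"
  then obtain fs where fs: "chain fs" "length fs = r" by (auto simp: edge_chain_iff)
  have "distinct fs" using fs(1) by (auto simp: sorted_wrt_iff_nth_less distinct_conv_nth) (metis nat_neq_iff)
  then have "r = card (set fs)" using fs(2) distinct_card by metis
  then show ?thesis using fs(1) card_mono[OF finE] by simp
qed

lemma edge_chain_down: "edge_chain E f (Suc r) \<Longrightarrow> 1 \<le> r \<Longrightarrow> edge_chain E f r"
proof -
  assume "edge_chain E f (Suc r)" "1 \<le> r"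
  then obtain gs where gs: "chain gs" "length gs = Suc r" "last gs = f" unfolding edge_chain_iff by blast
  then obtain g fs where g: "gs = g # fs" by (cases gs) auto
  then have "fs \<noteq> []" using gs(2) \<open>1 \<le> r\<close> by auto
  then show ?thesis unfolding edge_chain_iff using gs g by (intro exI[of _ fs]) auto
qed

text \<open>Chains can be shortened at their beginning and are bounded by the number of edges, so
  their lengths fill an interval starting at 1. The description in \<open>edge_degree\<close>
  therefore singles out the largest length.\<close>

lemma edge_degree:
  assumes "f \<in> E"
  shows "edge_chain E f (edge_degree E f)" "edge_chain E f r \<Longrightarrow> r \<le> edge_degree E f" "1 \<le> edge_degree E f"
proof -
  have 1: "edge_chain E f 1" unfolding edge_chain_iff using assms by (intro exI[of _ "[f]"]) auto
  define m where "m = Max {r. edge_chain E f r}"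
  have "{r. edge_chain E f r} \<subseteq> {..card E}" using edge_chain_bound[of f] by blast
  then have fin: "finite {r. edge_chain E f r}" by (rule finite_subset) simp
  have m: "edge_chain E f m" using Max_in[OF fin] 1 unfolding m_def by blast
  have le: "r \<le> m" if "edge_chain E f r" for r unfolding m_def using Max_ge[OF fin] that by simp
  have down: "edge_chain E f r" if "1 \<le> r" "r \<le> m" for r
    using that(2,1)
  proof (induction r rule: inc_induct)
    case base
    show ?case by (rule m)
  next
    case (step r)
    have "edge_chain E f (Suc r)" by (rule step.IH) simp
    then show ?case using edge_chain_down step.prems by blast
  qed
  have "edge_degree E f = m"
    unfolding edge_degree_def
  proof (rule the_equality)
    show "edge_chain E f m \<and> \<not> edge_chain E f (Suc m)" using m le[of "Suc m"] by auto
    fix r assume r: "edge_chain E f r \<and> \<not> edge_chain E f (Suc r)"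
    show "r = m"
    proof (rule ccontr)
      assume "r \<noteq> m"
      then have "Suc r \<le> m" using le r by force
      then show False using down[of "Suc r"] r by simp
    qed
  qed
  then show "edge_chain E f (edge_degree E f)" "edge_chain E f r \<Longrightarrow> r \<le> edge_degree E f" "1 \<le> edge_degree E f"
    using m le le[OF 1] by auto
qed

lemma edge_degree_le_max: "f \<in> E \<Longrightarrow> edge_degree E f \<le> max_degree E"
  unfolding max_degree_def by (rule Max_ge) (simp_all add: finE)

text \<open>Whether an edge precedes the last edge of a chain depends only on the initial vertex of
  the latter, so the last edge can be exchanged for one with the same start. By symmetry the degree
  is a function of the initial vertex.\<close>

lemma edge_degree_start_le:
  assumes "f \<in> E" "f' \<in> E" "fst f = fst f'" shows "edge_degree E f \<le> edge_degree E f'"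
proof -
  obtain fs where fs: "chain fs" "length fs = edge_degree E f" "last fs = f"
    using edge_degree(1)[OF assms(1)] unfolding edge_chain_iff by blast
  then have spl: "fs = butlast fs @ [f]" by (metis append_butlast_last_id)
  define gs where "gs = butlast fs"
  have c: "chain (gs @ [f])" using fs(1) spl gs_def by simp
  have "edge_le E g f' \<and> g \<noteq> f'" if g: "g \<in> set gs" for g
  proof -
    have "edge_le E g f" "g \<noteq> f" "g \<in> E" using c g by (auto simp: sorted_wrt_append)
    then have r: "(snd g, fst f') \<in> E\<^sup>*" using edge_le_rtrancl[of g f] assms(3) by simp
    then have "edge_le E g f'" using rtrancl_edge_le \<open>g \<in> E\<close> assms(2) by blast
    moreover have "g \<noteq> f'" using r no_cycle[of "fst f'" "snd f'"] assms(2) by auto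
    ultimately show ?thesis by blast
  qed
  then have "chain (gs @ [f'])" using c assms(2) by (auto simp: sorted_wrt_append)
  moreover have "length (gs @ [f']) = edge_degree E f" using fs(2) spl gs_def by (metis length_append_singleton)
  ultimately have "edge_chain E f' (edge_degree E f)" unfolding edge_chain_iff by (intro exI[of _ "gs @ [f']"]) auto
  then show ?thesis by (rule edge_degree(2)[OF assms(2)])
qed

text \<open>A chain ending in \<open>f\<close> can be prolonged by \<open>g\<close>; acyclicity
  keeps its elements distinct from \<open>g\<close>.\<close>

lemma edge_degree_less:
  assumes "f \<in> E" "g \<in> E" "(snd f, fst g) \<in> E\<^sup>*" shows "edge_degree E f < edge_degree E g"
proof -
  obtain fs where fs: "chain fs" "length fs = edge_degree E f" "last fs = f"
    using edge_degree(1)[OF assms(1)] unfolding edge_chain_iff by blast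
  then have spl: "fs = butlast fs @ [f]" by (metis append_butlast_last_id)
  have "edge_le E k g \<and> k \<noteq> g" if k: "k \<in> set fs" for k
  proof -
    have kE: "k \<in> E" using fs(1) k by blast
    have r: "(snd k, fst g) \<in> E\<^sup>*"
    proof (cases "k = f")
      case True
      then show ?thesis using assms(3) by simp
    next
      case False
      then have "k \<in> set (butlast fs)" using k spl by (metis Un_iff empty_iff insert_iff list.set(1,2) set_append)
      then have "edge_le E k f" using fs(1) spl by (metis (no_types, lifting) list.set_intros(1) sorted_wrt_append)
      then have "(snd k, fst f) \<in> E\<^sup>*" using edge_le_rtrancl False by blast
      moreover have "(fst f, snd f) \<in> E\<^sup>*" using assms(1) by auto
      ultimately show ?thesis using assms(3) by (meson rtrancl_trans)
    qed
    then have "edge_le E k g" using rtrancl_edge_le kE assms(2) by blast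
    moreover have "k \<noteq> g" using r no_cycle[of "fst g" "snd g"] assms(2) by auto
    ultimately show ?thesis by blast
  qed
  then have "chain (fs @ [g])" using fs(1) assms(2) by (auto simp: sorted_wrt_append)
  then have "edge_chain E g (Suc (edge_degree E f))" unfolding edge_chain_iff
    using fs(2) by (intro exI[of _ "fs @ [g]"]) auto
  then show ?thesis using edge_degree(2)[OF assms(2)] by fastforce
qed

text \<open>Meaningful at initial vertices of edges, where the choice of the edge is
  immaterial.\<close>

definition vdeg :: "'n \<Rightarrow> nat" where "vdeg a = edge_degree E (SOME f. f \<in> E \<and> fst f = a)"

lemma vdeg: "f \<in> E \<Longrightarrow> edge_degree E f = vdeg (fst f)"
proof -
  assume f: "f \<in> E"
  then have s: "(SOME f'. f' \<in> E \<and> fst f' = fst f) \<in> E \<and> fst (SOME f'. f' \<in> E \<and> fst f' = fst f) = fst f"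
    by (intro someI[of "\<lambda>f'. f' \<in> E \<and> fst f' = fst f" f]) simp
  then show ?thesis unfolding vdeg_def using edge_degree_start_le f by (metis le_antisym)
qed

lemma trancl_edge: "(a, b) \<in> E\<^sup>+ \<Longrightarrow> \<exists>c. (a, c) \<in> E \<and> (c, b) \<in> E\<^sup>*"
  using tranclD[of a b E] .

lemma vdeg_less: "(a, b) \<in> E\<^sup>+ \<Longrightarrow> (b, d) \<in> E\<^sup>+ \<Longrightarrow> vdeg a < vdeg b"
proof -
  assume "(a, b) \<in> E\<^sup>+" "(b, d) \<in> E\<^sup>+"
  then obtain c e where "(a, c) \<in> E" "(c, b) \<in> E\<^sup>*" "(b, e) \<in> E"
    using trancl_edge[of a b] trancl_edge[of b d] by blast
  then show ?thesis using edge_degree_less[of "(a, c)" "(b, e)"] vdeg[of "(a, c)"] vdeg[of "(b, e)"] by simp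
qed

lemma vdeg_range: "(a, b) \<in> E\<^sup>+ \<Longrightarrow> 1 \<le> vdeg a \<and> vdeg a \<le> max_degree E"
proof -
  assume "(a, b) \<in> E\<^sup>+"
  then obtain c where c: "(a, c) \<in> E" using trancl_edge[of a b] by blast
  then show ?thesis using edge_degree(3)[OF c] edge_degree_le_max[OF c] vdeg[OF c] by simp
qed

lemma pcls_hd_degree: "q \<in> pcls E p \<Longrightarrow> edge_degree E (hd q) = vdeg (fst p)"
proof -
  assume "q \<in> pcls E p"
  then have q: "q \<in> dpaths E" "fst (hd q) = fst p" by (simp_all add: pcls_def path_start_def)
  have "hd q \<in> E" using q(1) dpaths_ne[OF q(1)] hd_in_set[of q] unfolding dpaths_def by blast
  then show ?thesis using vdeg[of "hd q"] q(2) by simp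
qed

end

section \<open>Commuting pairs and vanishing coefficients\<close>

context col_system begin

text \<open>If \<open>u + w\<close> were a column vector, \<open>H u\<close> and \<open>H w\<close>
  would both take the minimal value -1 at it, so all three heights would agree; but
  \<open>H u\<close> is then 0 at \<open>w\<close>, where \<open>H w\<close> is -1. This turns
  failure of both products into the commuting relation of the Steinberg group.\<close>

lemma not_sum:
  assumes u: "u \<in> C" and w: "w \<in> C" and uw: "H u (w, 0) \<le> 0" and wu: "H w (u, 0) \<le> 0"
  shows "u + w \<notin> C"
proof
  assume v: "u + w \<in> C"
  have split: "H z (u + w, 0) = H z (u, 0) + H z (w, 0)" if "z \<in> C" for z
    using H_add[OF that, of "(u, 0)" "(w, 0)"] by simp
  have s: "H (u + w) (u, 0) + H (u + w) (w, 0) = -1" using split[OF v] H_self[OF v] by simp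
  have 1: "H w (u + w, 0) = H w (u, 0) - 1" using split[OF w] H_self[OF w] by simp
  have 2: "H u (u + w, 0) = H u (w, 0) - 1" using split[OF u] H_self[OF u] by simp
  have "H w (u, 0) = 0" using H_ge[OF w v] 1 wu by simp
  then have a: "H w = H (u + w)" using H_eq[OF w v] 1 by simp
  have "H u (w, 0) = 0" using H_ge[OF u v] 2 uw by simp
  then have b: "H u = H (u + w)" using H_eq[OF u v] 2 by simp
  show False using a b \<open>H u (w, 0) = 0\<close> H_self[OF w] by simp
qed

text \<open>Closure under products makes every \<open>v\<close> outside \<open>S\<close>
  irreducible. Applied to \<open>[U]\<close>, this is the vanishing used for intersections.\<close>

lemma cf_zero:
  assumes S: "prod_closed S" and v: "v \<in> C" "v \<notin> S" and g: "g \<in> generate BG (evs S)"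
  shows "cf v g = 0"
proof -
  interpret BG: group BG by (rule group_BG)
  have SC: "S \<subseteq> C" using S by (simp add: prod_closed_def)
  have i: "indec S v" using S v(2) by (auto simp: prod_closed_def indec_def)
  show ?thesis using g
  proof (induction rule: BG.generate_left_induct)
    case carrier
    show ?case using ev_Bij SC by blast
  next
    case (inv a)
    then show ?case using ev_inv SC by blast
  next
    case one
    show ?case by (rule cf_one[OF v(1)])
  next
    case (mult a g)
    then obtain w \<alpha> where a: "a = ev w \<alpha>" "w \<in> S" by blast
    then show ?case using cf_step[OF S i v(1) a(2) mult(2), of \<alpha>] mult(3) v(2) by auto
  qed
qed

end

section \<open>Rigid systems\<close>

lemma strong_prods_cong:
  assumes "\<forall>u\<in>V. \<forall>w\<in>V. m u w = m' u w"
  shows "strong_prods m V = strong_prods m' V"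
proof -
  have "(\<forall>i. Suc i < length vs \<longrightarrow> m (vs ! i) (vs ! Suc i) \<noteq> None) \<longleftrightarrow>
      (\<forall>i. Suc i < length vs \<longrightarrow> m' (vs ! i) (vs ! Suc i) \<noteq> None)" if "set vs \<subseteq> V" for vs
    using assms that by (auto simp: subset_iff)
  then show ?thesis unfolding strong_prods_def by blast
qed

context spectrum begin

lemma col_prod_closed:
  assumes "col_prod (PP i) u w = Some z" shows "u \<in> Col (PP i)" "w \<in> Col (PP i)" "z \<in> Col (PP i)"
proof -
  show u: "u \<in> Col (PP i)" and w: "w \<in> Col (PP i)" using assms by (auto simp: col_prod_def split: if_splits)
  obtain S where S: "lpoly (PP i) (dm i) S" using lpoly_at by blast
  have z: "u + w \<noteq> 0" "SH w (u, 0) = 1" "z = u + w"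
    using assms unfolding col_prod_at[OF u w] by (auto split: if_splits)
  then show "z \<in> Col (PP i)" using lpoly.col_product[OF S u w z(1)] SH_col[OF w u] by simp
qed

lemma Col_spec: "v \<in> Col (PP i) \<Longrightarrow> v \<in> spec_Col PP" by (auto simp: spec_Col_def)

context fixes j V assumes rig: "rigid (PP j) V"
begin

abbreviation "B \<equiv> strong_prods (spec_prod PP) V"

lemma V_Col: "V \<subseteq> Col (PP j)" using rig by (simp add: rigid_def)

lemma strong_eq: "strong_prods (col_prod (PP j)) V = B"
  by (rule strong_prods_cong) (intro ballI spec_prod_at subsetD[OF V_Col])

lemma B_weak: "B = weak_prods (col_prod (PP j)) V"
  using rig strong_eq by (simp add: rigid_def)

lemma weak_prod_Col: "weak_prod (col_prod (PP j)) vs a \<Longrightarrow> set vs \<subseteq> V \<Longrightarrow> a \<in> Col (PP j)"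
proof (induction rule: weak_prod.induct)
  case (single v)
  then show ?case using V_Col by auto
next
  case (bracket us a vs b c)
  then show ?case using col_prod_closed(3) by blast
qed

lemma B_Col: "B \<subseteq> Col (PP j)"
proof
  fix v assume "v \<in> B"
  then obtain vs where "set vs \<subseteq> V" "weak_prod (col_prod (PP j)) vs v" unfolding B_weak weak_prods_def by blast
  then show "v \<in> Col (PP j)" using weak_prod_Col by simp
qed

lemma B_spec: "v \<in> B \<Longrightarrow> v \<in> spec_Col PP" using B_Col Col_spec by blast

lemma V_B: "V \<subseteq> B"
proof
  fix v assume "v \<in> V"
  then show "v \<in> B" unfolding B_weak weak_prods_def
    by (auto intro!: exI[of _ "[v]"] weak_prod.single)
qed

text \<open>Rigidity enters through the equality of strong and weak products: two bracketed products
  combine to a bracketed product, which is again a strong one.\<close>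

lemma B_prod: assumes "u \<in> B" "w \<in> B" "spec_prod PP u w = Some z" shows "z \<in> B"
proof -
  have p: "col_prod (PP j) u w = Some z" using assms B_Col spec_prod_at[of u j w] by auto
  obtain us ws where us: "set us \<subseteq> V" "weak_prod (col_prod (PP j)) us u"
    and ws: "set ws \<subseteq> V" "weak_prod (col_prod (PP j)) ws w"
    using assms(1,2) unfolding B_weak weak_prods_def by blast
  have "weak_prod (col_prod (PP j)) (us @ ws) z" by (rule weak_prod.bracket[OF us(2) ws(2) p])
  then show ?thesis unfolding B_weak weak_prods_def using us(1) ws(1)
    by (intro CollectI exI[of _ "us @ ws"]) simp
qed

lemma B_neg: "v \<in> B \<Longrightarrow> - v \<notin> B" using rig strong_eq by (auto simp: rigid_def)

lemma B_sum: "u \<in> B \<Longrightarrow> w \<in> B \<Longrightarrow> u + w \<noteq> 0"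
  using B_neg[of u] by (auto simp: add_eq_0_iff)

lemma B_spec_prod: "u \<in> B \<Longrightarrow> w \<in> B \<Longrightarrow> spec_prod PP u w = (if SH w (u, 0) = 1 then Some (u + w) else None)"
  using B_spec B_sum by (simp add: spec_prod_eq)

lemma prod_closed_B: "C.prod_closed B"
  unfolding C.prod_closed_def
proof (intro conjI ballI impI)
  show "B \<subseteq> spec_Col PP" using B_spec by blast
  fix p q assume pq: "p \<in> B" "q \<in> B" "SH q (p, 0) = 1"
  then show "p + q \<in> B" using B_prod[OF pq(1,2)] B_spec_prod[OF pq(1,2)] by simp
next
  fix p assume "p \<in> B"
  then show "- p \<notin> B" by (rule B_neg)
qed

lemma supports_eq: "supports (col_prod (PP j)) V F h \<longleftrightarrow> supports (spec_prod PP) V F h"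
proof -
  have "\<forall>x\<in>B. \<forall>y\<in>B. col_prod (PP j) x y = spec_prod PP x y"
    by (intro ballI spec_prod_at subsetD[OF B_Col])
  then show ?thesis unfolding supports_def partial_prod_iso_def strong_eq by simp
qed

lemma degree_tail_eq: "degree_tail (col_prod (PP j)) V F h r = degree_tail (spec_prod PP) V F h r"
  unfolding degree_tail_def strong_eq ..

end

end

text \<open>The common ground of the elementary and the stable Steinberg group, with the commutator
  relations cleared of inverses, so that both are treated at once.\<close>

locale steinberg_family = spectrum PP + group \<Gamma> for PP :: "nat \<Rightarrow> pt set" and \<Gamma> :: "'g monoid" (structure) +
  fixes g :: "pt \<Rightarrow> 'r::comm_ring_1 \<Rightarrow> 'g"
  assumes g_closed: "v \<in> spec_Col PP \<Longrightarrow> g v \<alpha> \<in> carrier \<Gamma>"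
    and g_add: "v \<in> spec_Col PP \<Longrightarrow> g v \<alpha> \<otimes> g v \<beta> = g v (\<alpha> + \<beta>)"
    and g_prod: "spec_prod PP u w = Some z \<Longrightarrow> g u \<alpha> \<otimes> g w \<beta> = g z (- (\<alpha> * \<beta>)) \<otimes> (g w \<beta> \<otimes> g u \<alpha>)"
    and g_comm: "u \<in> spec_Col PP \<Longrightarrow> w \<in> spec_Col PP \<Longrightarrow> u + w \<notin> spec_Col PP \<union> {0} \<Longrightarrow>
      g u \<alpha> \<otimes> g w \<beta> = g w \<beta> \<otimes> g u \<alpha>"
begin

lemma gen_carrier: "S \<subseteq> spec_Col PP \<Longrightarrow> {g v \<alpha> | v \<alpha>. v \<in> S} \<subseteq> carrier \<Gamma>" using g_closed by auto

text \<open>With parameters \<open>- \<alpha>\<close> and 1 the product relation exhibits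
  \<open>g z \<alpha>\<close> as a commutator.\<close>

lemma g_product_in_subgroup:
  assumes K: "subgroup K \<Gamma>" and p: "spec_prod PP u w = Some z"
    and "\<forall>\<alpha>. g u \<alpha> \<in> K" "\<forall>\<alpha>. g w \<alpha> \<in> K"
  shows "g z \<alpha> \<in> K"
proof -
  have uwz: "u \<in> spec_Col PP" "w \<in> spec_Col PP" "z \<in> spec_Col PP"
    using p C.H_prod[of u w] by (auto simp: spec_prod_eq split: if_splits)
  have c: "g u (- \<alpha>) \<in> carrier \<Gamma>" "g w 1 \<in> carrier \<Gamma>" "g z \<alpha> \<in> carrier \<Gamma>" using uwz g_closed by auto
  have "g u (- \<alpha>) \<otimes> g w 1 = g z \<alpha> \<otimes> (g w 1 \<otimes> g u (- \<alpha>))" using g_prod[OF p, of "- \<alpha>" 1] by simp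
  then have "g z \<alpha> = (g u (- \<alpha>) \<otimes> g w 1) \<otimes> inv (g w 1 \<otimes> g u (- \<alpha>))"
    using c by (simp add: inv_solve_right)
  then show ?thesis using assms(3,4) subgroup.m_closed[OF K] subgroup.m_inv_closed[OF K] by simp
qed

text \<open>Every element of \<open>[V]\<close> has a bracketing, along which its generators are
  obtained as iterated commutators.\<close>

lemma generate_B:
  assumes rig: "rigid (PP j) V"
  shows "generate \<Gamma> {g v \<alpha> | v \<alpha>. v \<in> strong_prods (spec_prod PP) V} = generate \<Gamma> {g v \<alpha> | v \<alpha>. v \<in> V}"
    (is "_ = ?K")
proof
  have VC: "V \<subseteq> spec_Col PP" using V_Col[OF rig] Col_spec by blast
  have K: "subgroup ?K \<Gamma>" by (rule generate_is_subgroup[OF gen_carrier[OF VC]])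
  have "\<forall>\<alpha>. g a \<alpha> \<in> ?K" if "weak_prod (col_prod (PP j)) vs a" "set vs \<subseteq> V" for vs a
    using that
  proof (induction rule: weak_prod.induct)
    case (single v)
    then show ?case by (intro allI generate.incl) auto
  next
    case (bracket us a vs b c)
    have "spec_prod PP a b = Some c" using col_prod_closed[OF bracket(3)] spec_prod_at[of a j b] bracket(3) by simp
    then show ?case using g_product_in_subgroup[OF K] bracket by auto
  qed
  then have "{g v \<alpha> | v \<alpha>. v \<in> strong_prods (spec_prod PP) V} \<subseteq> ?K"
    unfolding B_weak[OF rig] weak_prods_def by blast
  then show "generate \<Gamma> {g v \<alpha> | v \<alpha>. v \<in> strong_prods (spec_prod PP) V} \<subseteq> ?K"
    by (rule generate_subgroup_incl[OF _ K])
  show "?K \<subseteq> generate \<Gamma> {g v \<alpha> | v \<alpha>. v \<in> strong_prods (spec_prod PP) V}"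
    by (rule mono_generate) (use V_B[OF rig] in blast)
qed

end

section \<open>Rigid systems as transitive relations\<close>

locale rigid_sys = spectrum PP for PP :: "nat \<Rightarrow> pt set" +
  fixes V :: "pt set" and F :: "'n rel" and h :: "pt \<Rightarrow> ('n \<times> 'n) list set"
  assumes spec_rig: "spec_rigid PP V" and sup: "supports (spec_prod PP) V F h"
begin

definition "rj = (SOME j. rigid (PP j) V)"
lemma rig: "rigid (PP rj) V"
  using spec_rig unfolding spec_rigid_def rj_def by (rule someI_ex)

sublocale Gr: fin_graph F using sup by unfold_locales (simp add: supports_def)

abbreviation "T \<equiv> F\<^sup>+"
abbreviation "BV \<equiv> strong_prods (spec_prod PP) V"
definition vv :: "'n \<times> 'n \<Rightarrow> pt" where "vv p = inv_into BV h (pcls F p)"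

lemma h_bij: "bij_betw h BV (pcls F ` T)"
  using sup by (simp add: supports_def partial_prod_iso_def path_bar_eq)

lemma vv: "p \<in> T \<Longrightarrow> vv p \<in> BV" "p \<in> T \<Longrightarrow> h (vv p) = pcls F p"
  unfolding vv_def using bij_betw_imp_surj_on[OF h_bij]
  by (auto intro!: inv_into_into f_inv_into_f)

lemma vv_inj: "inj_on vv T"
proof (rule inj_onI)
  fix p q assume pq: "p \<in> T" "q \<in> T" "vv p = vv q"
  then have "pcls F p = pcls F q" using vv(2) by metis
  then show "p = q" by (rule pcls_inj[OF pq(1)])
qed

lemma vv_eqI: assumes "z \<in> BV" "p \<in> T" "h z = pcls F p" shows "z = vv p"
  using inj_onD[OF bij_betw_imp_inj_on[OF h_bij], of z "vv p"] vv[OF assms(2)] assms by simp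

lemma vv_image: "vv ` T = BV"
proof
  show "vv ` T \<subseteq> BV" using vv(1) by blast
  show "BV \<subseteq> vv ` T"
  proof
    fix z assume z: "z \<in> BV"
    then obtain p where "p \<in> T" "h z = pcls F p" using bij_betwE[OF h_bij] by blast
    then show "z \<in> vv ` T" using vv_eqI[OF z] by blast
  qed
qed

lemma vv_spec: "p \<in> T \<Longrightarrow> vv p \<in> spec_Col PP" using B_spec[OF rig vv(1)] .

text \<open>The supporting isomorphism turns products into concatenation of path classes. The value
  lies in \<open>[V]\<close>, where \<open>h\<close> is injective, and is thereby
  identified.\<close>

lemma vv_prod:
  assumes ab: "(a, b) \<in> T" and cd: "(c, d) \<in> T"
  shows "spec_prod PP (vv (a, b)) (vv (c, d)) = (if b = c then Some (vv (a, d)) else None)"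
proof -
  have m: "map_option h (spec_prod PP (vv (a, b)) (vv (c, d))) = bar_prod F (pcls F (a, b)) (pcls F (c, d))"
    using sup vv[OF ab] vv[OF cd] by (simp add: supports_def partial_prod_iso_def)
  show ?thesis
  proof (cases "b = c")
    case True
    then have ad: "(a, d) \<in> T" using ab cd by (meson trancl_trans)
    obtain z where z: "spec_prod PP (vv (a, b)) (vv (c, d)) = Some z" "h z = pcls F (a, d)"
      using m unfolding bar_prod_pcls[OF ab cd] using True by auto
    have "z \<in> BV" by (rule B_prod[OF rig vv(1)[OF ab] vv(1)[OF cd] z(1)])
    then show ?thesis using vv_eqI[OF _ ad z(2)] z(1) True by simp
  next
    case False
    then show ?thesis using m unfolding bar_prod_pcls[OF ab cd] by simp
  qed
qed

lemma SH_vv: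
  assumes ab: "(a, b) \<in> T" and cd: "(c, d) \<in> T"
  shows "SH (vv (c, d)) (vv (a, b), 0) = 1 \<longleftrightarrow> b = c"
    and "b = c \<Longrightarrow> vv (a, b) + vv (c, d) = vv (a, d)"
  using vv_prod[OF assms] B_spec_prod[OF rig vv(1)[OF ab] vv(1)[OF cd]] by (auto split: if_splits)

lemma prod_closed_vv:
  assumes S: "S \<subseteq> T" "trans S" shows "C.prod_closed (vv ` S)"
  unfolding C.prod_closed_def
proof (intro conjI ballI impI)
  show "vv ` S \<subseteq> spec_Col PP" using vv_spec S by blast
  fix p assume "p \<in> vv ` S"
  then obtain a b where p: "p = vv (a, b)" "(a, b) \<in> S" by fastforce
  have "(a, b) \<in> T" using p(2) S(1) by (rule rev_subsetD)
  then have "- p \<notin> vv ` T" unfolding p(1) vv_image by (intro B_neg[OF rig] vv(1))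
  then show "- p \<notin> vv ` S" using S(1) by (meson image_mono subsetD)
  fix q assume "q \<in> vv ` S" and H: "SH q (p, 0) = 1"
  then obtain c d where q: "q = vv (c, d)" "(c, d) \<in> S" by fastforce
  have T: "(a, b) \<in> T" "(c, d) \<in> T" using p q S by auto
  have bc: "b = c" using SH_vv(1)[OF T] H p q by simp
  then have "(a, d) \<in> S" using p q transD[OF S(2)] by blast
  then show "p + q \<in> vv ` S" using SH_vv(2)[OF T bc] p q by simp
qed

text \<open>Together with \<open>prod_closed_vv\<close> this expresses the hypotheses of
  \<open>cf_step\<close> by the relation \<open>S\<close> alone: transitivity and absence of
  \<open>v\<close> from \<open>S O S\<close>.\<close>

lemma indec_vv:
  assumes S: "S \<subseteq> T" and v: "v \<in> T" "v \<notin> S O S" shows "C.indec (vv ` S) (vv v)"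
  unfolding C.indec_def
proof (intro ballI impI)
  fix p q assume "p \<in> vv ` S" "q \<in> vv ` S" and H: "SH q (p, 0) = 1"
  then obtain a b c d where p: "p = vv (a, b)" "(a, b) \<in> S" and q: "q = vv (c, d)" "(c, d) \<in> S" by fastforce
  have T: "(a, b) \<in> T" "(c, d) \<in> T" using p q S by auto
  have bc: "b = c" using SH_vv(1)[OF T] H p q by simp
  have "(a, d) \<in> T" using T bc by (meson trancl_trans)
  moreover have "v \<noteq> (a, d)" using v(2) p q bc by blast
  ultimately have "vv (a, d) \<noteq> vv v" using inj_onD[OF vv_inj] v(1) by blast
  then show "p + q \<noteq> vv v" using SH_vv(2)[OF T bc] p q by simp
qed

lemma h_vv_degree: "p \<in> T \<Longrightarrow> q \<in> h (vv p) \<Longrightarrow> edge_degree F (hd q) = Gr.vdeg (fst p)"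
  using Gr.pcls_hd_degree vv(2) by simp

lemma h_vv_ne: "p \<in> T \<Longrightarrow> \<exists>q. q \<in> h (vv p)" using pcls_ne[of p F] vv(2)[of p] by auto

lemma degree_tail_vv: "degree_tail (spec_prod PP) V F h r = vv ` {p \<in> T. r \<le> Gr.vdeg (fst p)}"
proof -
  have "(\<exists>q\<in>h (vv p). r \<le> edge_degree F (hd q)) \<longleftrightarrow> r \<le> Gr.vdeg (fst p)" if "p \<in> T" for p
    using h_vv_degree[OF that] h_vv_ne[OF that] by auto
  then show ?thesis unfolding degree_tail_def vv_image[symmetric] by blast
qed

lemma degree_part_vv: "degree_part (spec_prod PP) V F h r = vv ` {p \<in> T. Gr.vdeg (fst p) = r}"
proof -
  have "(\<exists>q\<in>h (vv p). edge_degree F (hd q) = r) \<longleftrightarrow> Gr.vdeg (fst p) = r" if "p \<in> T" for p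
    using h_vv_degree[OF that] h_vv_ne[OF that] by auto
  then show ?thesis unfolding degree_part_def vv_image[symmetric] by blast
qed

lemma finite_T: "finite T" using Gr.finE by (rule finite_trancl[THEN iffD2])

lemma tri_rel_vv:
  fixes \<Gamma> :: "'g monoid" and g :: "pt \<Rightarrow> 'r::comm_ring_1 \<Rightarrow> 'g"
  assumes "steinberg_family PP \<Gamma> g"
  shows "tri_rel \<Gamma> T (\<lambda>p. g (vv p))"
proof -
  interpret S: steinberg_family PP \<Gamma> g by (rule assms)
  show ?thesis
  proof
    show "finite T" by (rule finite_T)
    show "trans T" by (rule trans_trancl)
    show "irrefl T" using Gr.irrefl_trancl by (auto simp: irrefl_def)
    show "g (vv p) \<alpha> \<in> carrier \<Gamma>" if "p \<in> T" for p \<alpha> using S.g_closed[OF vv_spec[OF that]] .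
    show "g (vv p) \<alpha> \<otimes>\<^bsub>\<Gamma>\<^esub> g (vv p) \<beta> = g (vv p) (\<alpha> + \<beta>)" if "p \<in> T" for p \<alpha> \<beta>
      using S.g_add[OF vv_spec[OF that]] .
    show "g (vv (a, b)) \<alpha> \<otimes>\<^bsub>\<Gamma>\<^esub> g (vv (b, c)) \<beta> =
        g (vv (a, c)) (- (\<alpha> * \<beta>)) \<otimes>\<^bsub>\<Gamma>\<^esub> (g (vv (b, c)) \<beta> \<otimes>\<^bsub>\<Gamma>\<^esub> g (vv (a, b)) \<alpha>)"
      if "(a, b) \<in> T" "(b, c) \<in> T" for a b c \<alpha> \<beta>
      by (rule S.g_prod) (use vv_prod[OF that] in simp)
    fix a b c d \<alpha> \<beta> assume T: "(a, b) \<in> T" "(c, d) \<in> T" and ne: "b \<noteq> c" "d \<noteq> a"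
    have sp: "vv (a, b) \<in> spec_Col PP" "vv (c, d) \<in> spec_Col PP" using vv_spec T by auto
    \<comment> \<open>Pairs composing in neither order have nonpositive values both ways, so the sum
      is not a column vector; by rigidity it is not zero either.\<close>
    have "SH (vv (c, d)) (vv (a, b), 0) \<le> 0" "SH (vv (a, b)) (vv (c, d), 0) \<le> 0"
      using SH_vv(1)[OF T] SH_vv(1)[OF T(2,1)] ne C.H_cases[OF sp] C.H_cases[OF sp(2,1)] by auto
    then have "vv (a, b) + vv (c, d) \<notin> spec_Col PP" using C.not_sum[OF sp] by blast
    then show "g (vv (a, b)) \<alpha> \<otimes>\<^bsub>\<Gamma>\<^esub> g (vv (c, d)) \<beta> = g (vv (c, d)) \<beta> \<otimes>\<^bsub>\<Gamma>\<^esub> g (vv (a, b)) \<alpha>"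
      using B_sum[OF rig vv(1)[OF T(1)] vv(1)[OF T(2)]] by (intro S.g_comm[OF sp]) simp
  qed
qed

end

section \<open>The elementary and the Steinberg group\<close>

lemma (in group) commutator_solve:
  assumes "x \<in> carrier G" "y \<in> carrier G" "x \<otimes> (y \<otimes> (inv x \<otimes> inv y)) = z"
  shows "x \<otimes> y = z \<otimes> (y \<otimes> x)"
proof -
  have "z \<otimes> (y \<otimes> x) = x \<otimes> (y \<otimes> (inv x \<otimes> (inv y \<otimes> (y \<otimes> x))))"
    unfolding assms(3)[symmetric] using assms(1,2) by (simp add: m_assoc)
  also have "inv y \<otimes> (y \<otimes> x) = x" using assms(1,2) by (simp add: m_assoc[symmetric])
  finally show ?thesis using assms(1,2) by simp
qed

lemma (in group) commutator_eq:
  assumes "x \<in> carrier G" "y \<in> carrier G" "z \<in> carrier G" "x \<otimes> y = z \<otimes> (y \<otimes> x)"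
  shows "x \<otimes> (y \<otimes> (inv x \<otimes> inv y)) = z"
proof -
  have "x \<otimes> (y \<otimes> (inv x \<otimes> inv y)) = (x \<otimes> y) \<otimes> inv (y \<otimes> x)"
    using assms(1,2) by (simp add: m_assoc inv_mult_group)
  then show ?thesis using assms by (simp add: m_assoc r_inv)
qed

context spectrum begin

lemma RM_eq: "C.RM = spec_ring PP" by (simp add: C.RM_def spec_ring_eq)

lemma spec_aut_ev:
  assumes v: "v \<in> spec_Col PP" shows "spec_aut PP v \<alpha> = C.ev v \<alpha>"
proof
  fix f :: "'a galg"
  show "spec_aut PP v \<alpha> f = C.ev v \<alpha> f"
  proof (cases "f \<in> spec_ring PP")
    case True
    then have "f \<in> C.RM" by (simp add: RM_eq)
    then show ?thesis using spec_aut_eq[OF v True, of \<alpha>] C.ev_apply[of f v \<alpha>] by (simp add: C.act_def C.hn_def)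
  next
    case False
    then show ?thesis by (simp add: spec_aut_def C.ev_def RM_eq)
  qed
qed

lemma evs_eq: "S \<subseteq> spec_Col PP \<Longrightarrow> {spec_aut PP v \<alpha> | v \<alpha>. v \<in> S} = C.evs S"
proof (rule Collect_cong)
  fix z :: "'a galg \<Rightarrow> 'a galg" assume S: "S \<subseteq> spec_Col PP"
  have "(z = spec_aut PP v \<alpha> \<and> v \<in> S) = (z = C.ev v \<alpha> \<and> v \<in> S)" for v \<alpha>
    using spec_aut_ev[of v \<alpha>] S by auto
  then show "(\<exists>v \<alpha>. z = spec_aut PP v \<alpha> \<and> v \<in> S) = (\<exists>v \<alpha>. z = C.ev v \<alpha> \<and> v \<in> S)" by simp
qed

lemma elem_group_eq:
  "elem_group TYPE('r::comm_ring_1) PP = (C.BG :: ('r galg \<Rightarrow> 'r galg) monoid)\<lparr>carrier := generate C.BG (C.evs (spec_Col PP))\<rparr>"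
  unfolding elem_group_def gen_subgroup_def RM_eq[symmetric] evs_eq[OF order.refl] ..

lemma evs_carrier: "S \<subseteq> spec_Col PP \<Longrightarrow> C.evs S \<subseteq> carrier C.BG" using C.ev_Bij by blast

lemma elem_subgroup: "subgroup (generate C.BG (C.evs (spec_Col PP))) C.BG"
  by (rule group.generate_is_subgroup[OF C.group_BG evs_carrier[OF order.refl]])

lemma group_elem: "group (elem_group TYPE('r::comm_ring_1) PP)"
  unfolding elem_group_eq by (rule group.subgroup_imp_group[OF C.group_BG elem_subgroup])

lemma generate_elem:
  assumes "S \<subseteq> spec_Col PP"
  shows "generate (elem_group TYPE('r::comm_ring_1) PP) {spec_aut PP v \<alpha> | v \<alpha>. v \<in> S} = generate C.BG (C.evs S)"
proof -
  have sub: "C.evs S \<subseteq> generate C.BG (C.evs (spec_Col PP))"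
    using assms by (auto intro: generate.incl)
  show ?thesis unfolding elem_group_eq evs_eq[OF assms]
    by (rule group.generate_consistent[OF C.group_BG sub elem_subgroup])
qed

lemma steinberg_elem: "steinberg_family PP (elem_group TYPE('r::comm_ring_1) PP) (spec_aut PP)"
proof -
  interpret E: group "elem_group TYPE('r) PP" by (rule group_elem)
  have m: "x \<otimes>\<^bsub>elem_group TYPE('r) PP\<^esub> y = x \<otimes>\<^bsub>C.BG\<^esub> y" for x y by (simp add: elem_group_eq)
  show ?thesis
  proof (unfold_locales)
    fix v and \<alpha> \<beta> :: 'r assume v: "v \<in> spec_Col PP"
    show "spec_aut PP v \<alpha> \<in> carrier (elem_group TYPE('r) PP)"
      unfolding elem_group_eq spec_aut_ev[OF v] using v by (auto intro: generate.incl)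
    show "spec_aut PP v \<alpha> \<otimes>\<^bsub>elem_group TYPE('r) PP\<^esub> spec_aut PP v \<beta> = spec_aut PP v (\<alpha> + \<beta>)"
      unfolding m spec_aut_ev[OF v] by (rule C.ev_add[OF v])
  next
    fix u w z and \<alpha> \<beta> :: 'r assume "spec_prod PP u w = Some z"
    then have p: "u \<in> spec_Col PP" "w \<in> spec_Col PP" "SH w (u, 0) = 1" "u + w \<noteq> 0" "z = u + w"
      by (auto simp: spec_prod_eq split: if_splits)
    have z: "z \<in> spec_Col PP" using C.product_form(1)[OF p(1-4)] p(5) by simp
    show "spec_aut PP u \<alpha> \<otimes>\<^bsub>elem_group TYPE('r) PP\<^esub> spec_aut PP w \<beta> = spec_aut PP z (- (\<alpha> * \<beta>)) \<otimes>\<^bsub>elem_group TYPE('r) PP\<^esub>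
        (spec_aut PP w \<beta> \<otimes>\<^bsub>elem_group TYPE('r) PP\<^esub> spec_aut PP u \<alpha>)"
      unfolding m spec_aut_ev[OF p(1)] spec_aut_ev[OF p(2)] p(5) spec_aut_ev[OF z[unfolded p(5)]]
      by (rule C.ev_product[OF p(1-4)])
  next
    fix u w and \<alpha> \<beta> :: 'r assume u: "u \<in> spec_Col PP" and w: "w \<in> spec_Col PP" and n: "u + w \<notin> spec_Col PP \<union> {0}"
    \<comment> \<open>A value 1 in either order would make the sum a column vector.\<close>
    have "SH u (w, 0) \<noteq> 1" "SH w (u, 0) \<noteq> 1"
      using C.H_prod[OF u w] C.H_prod[OF w u] n by (auto simp: add.commute)
    then have "SH u (w, 0) \<le> 0" "SH w (u, 0) \<le> 0" using C.H_cases[OF u w] C.H_cases[OF w u] by auto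
    then show "spec_aut PP u \<alpha> \<otimes>\<^bsub>elem_group TYPE('r) PP\<^esub> spec_aut PP w \<beta> =
        spec_aut PP w \<beta> \<otimes>\<^bsub>elem_group TYPE('r) PP\<^esub> spec_aut PP u \<alpha>"
      unfolding m spec_aut_ev[OF u] spec_aut_ev[OF w] by (rule C.ev_commute[OF u w])
  qed
qed

lemma group_steinberg: "group (steinberg TYPE('r::comm_ring_1) PP)"
  unfolding steinberg_def by (rule group_presented)

lemma comm_word_cls:
  fixes \<alpha> \<beta> :: "'r::comm_ring_1"
  assumes u: "u \<in> spec_Col PP" and v: "v \<in> spec_Col PP"
  shows "st_gen PP u \<alpha> \<otimes>\<^bsub>steinberg TYPE('r) PP\<^esub> (st_gen PP v \<beta> \<otimes>\<^bsub>steinberg TYPE('r) PP\<^esub>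
      (inv\<^bsub>steinberg TYPE('r) PP\<^esub> (st_gen PP u \<alpha>) \<otimes>\<^bsub>steinberg TYPE('r) PP\<^esub> inv\<^bsub>steinberg TYPE('r) PP\<^esub> (st_gen PP v \<beta>)))
    = pres_cong (st_gens PP) (st_rels PP) `` {comm_word (u, \<alpha>) (v, \<beta>)}"
proof -
  have g: "(u, \<alpha>) \<in> st_gens PP" "(v, \<beta>) \<in> st_gens PP" using u v by (auto simp: st_gens_def)
  show ?thesis unfolding st_gen_def steinberg_def cls_inverse[OF g(1), symmetric] cls_inverse[OF g(2), symmetric]
    using g by (simp add: presented_mult comm_word_def)
qed

lemma steinberg_st: "steinberg_family PP (steinberg TYPE('r::comm_ring_1) PP) (st_gen PP)"
proof -
  let ?S = "steinberg TYPE('r) PP"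
  let ?c = "\<lambda>w. pres_cong (st_gens PP) (st_rels PP :: ((pt \<times> 'r) gword \<times> (pt \<times> 'r) gword) set) `` {w}"
  interpret E: group ?S by (rule group_steinberg)
  have closed: "st_gen PP v \<alpha> \<in> carrier ?S" if "v \<in> spec_Col PP" for v and \<alpha> :: 'r
    using that unfolding st_gen_def steinberg_def presented_carrier by (auto simp: st_gens_def)
  have rel: "?c l = ?c r" if "(l, r) \<in> st_rels PP" "l \<in> wds (st_gens PP)" "r \<in> wds (st_gens PP)" for l r
    using cong_relation[of "[]" "st_gens PP" "[]" l r "st_rels PP"] that by (simp add: cls_eq_iff)
  have cw: "comm_word (u, \<alpha>) (w, \<beta>) \<in> wds (st_gens PP)" if "u \<in> spec_Col PP" "w \<in> spec_Col PP" for u w and \<alpha> \<beta> :: 'r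
    using that by (simp add: comm_word_def st_gens_def)
  show ?thesis
  proof (unfold_locales)
    fix v and \<alpha> \<beta> :: 'r assume v: "v \<in> spec_Col PP"
    show "st_gen PP v \<alpha> \<in> carrier ?S" by (rule closed[OF v])
    have "?c [(True, (v, \<alpha>)), (True, (v, \<beta>))] = ?c [(True, (v, \<alpha> + \<beta>))]"
      using v by (intro rel) (auto simp: st_rels_def st_gens_def)
    then show "st_gen PP v \<alpha> \<otimes>\<^bsub>?S\<^esub> st_gen PP v \<beta> = st_gen PP v (\<alpha> + \<beta>)"
      unfolding st_gen_def steinberg_def using v by (simp add: presented_mult st_gens_def)
  next
    fix u w z and \<alpha> \<beta> :: 'r assume uw: "spec_prod PP u w = Some z"
    then have p: "u \<in> spec_Col PP" "w \<in> spec_Col PP" "SH w (u, 0) = 1" "u + w \<noteq> 0" "z = u + w"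
      by (auto simp: spec_prod_eq split: if_splits)
    have z: "z \<in> spec_Col PP" using C.product_form(1)[OF p(1-4)] p(5) by simp
    have "(comm_word (u, \<alpha>) (w, \<beta>), [(True, (z, - (\<alpha> * \<beta>)))]) \<in> st_rels PP" using uw unfolding st_rels_def by blast
    then have "?c (comm_word (u, \<alpha>) (w, \<beta>)) = st_gen PP z (- (\<alpha> * \<beta>))"
      unfolding st_gen_def by (rule rel[OF _ cw[OF p(1,2)]]) (use z in \<open>simp add: st_gens_def\<close>)
    then show "st_gen PP u \<alpha> \<otimes>\<^bsub>?S\<^esub> st_gen PP w \<beta> = st_gen PP z (- (\<alpha> * \<beta>)) \<otimes>\<^bsub>?S\<^esub> (st_gen PP w \<beta> \<otimes>\<^bsub>?S\<^esub> st_gen PP u \<alpha>)"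
      by (intro E.commutator_solve closed p(1,2)) (simp only: comm_word_cls[OF p(1,2)])
  next
    fix u w and \<alpha> \<beta> :: 'r assume u: "u \<in> spec_Col PP" and w: "w \<in> spec_Col PP" and n: "u + w \<notin> spec_Col PP \<union> {0}"
    have "(comm_word (u, \<alpha>) (w, \<beta>), []) \<in> st_rels PP" using u w n unfolding st_rels_def by blast
    then have "?c (comm_word (u, \<alpha>) (w, \<beta>)) = ?c []" by (rule rel[OF _ cw[OF u w]]) simp
    then have "?c (comm_word (u, \<alpha>) (w, \<beta>)) = \<one>\<^bsub>?S\<^esub>" by (simp add: steinberg_def presented_one)
    then have "st_gen PP u \<alpha> \<otimes>\<^bsub>?S\<^esub> st_gen PP w \<beta> = \<one>\<^bsub>?S\<^esub> \<otimes>\<^bsub>?S\<^esub> (st_gen PP w \<beta> \<otimes>\<^bsub>?S\<^esub> st_gen PP u \<alpha>)"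
      by (intro E.commutator_solve closed u w) (simp only: comm_word_cls[OF u w])
    then show "st_gen PP u \<alpha> \<otimes>\<^bsub>?S\<^esub> st_gen PP w \<beta> = st_gen PP w \<beta> \<otimes>\<^bsub>?S\<^esub> st_gen PP u \<alpha>"
      using closed[OF u] closed[OF w] by simp
  qed
qed

text \<open>The Steinberg group is universal among groups with a family satisfying its relations;
  for the elementary group this gives the natural map.\<close>

lemma steinberg_hom:
  fixes \<Gamma> :: "'g monoid" and g :: "pt \<Rightarrow> 'r::comm_ring_1 \<Rightarrow> 'g"
  assumes "steinberg_family PP \<Gamma> g"
  shows "\<exists>\<pi>\<in>hom (steinberg TYPE('r) PP) \<Gamma>. \<forall>v\<in>spec_Col PP. \<forall>\<alpha>. \<pi> (st_gen PP v \<alpha>) = g v \<alpha>"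
proof -
  interpret G: steinberg_family PP \<Gamma> g by (rule assms)
  let ?f = "\<lambda>(v, \<alpha>). g v \<alpha>"
  have f: "?f a \<in> carrier \<Gamma>" if "a \<in> st_gens PP" for a using that G.g_closed by (auto simp: st_gens_def)
  note wev = weval_Cons[of \<Gamma> "st_gens PP" ?f, OF G.is_group f] weval_Nil[of \<Gamma> "st_gens PP" ?f, OF G.is_group f]
  have cw: "weval \<Gamma> ?f (comm_word (u, \<alpha>) (w, \<beta>)) =
      g u \<alpha> \<otimes>\<^bsub>\<Gamma>\<^esub> (g w \<beta> \<otimes>\<^bsub>\<Gamma>\<^esub> (inv\<^bsub>\<Gamma>\<^esub> (g u \<alpha>) \<otimes>\<^bsub>\<Gamma>\<^esub> inv\<^bsub>\<Gamma>\<^esub> (g w \<beta>)))"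
    if "u \<in> spec_Col PP" "w \<in> spec_Col PP" for u w \<alpha> \<beta>
    using G.g_closed[OF that(1), of \<alpha>] G.g_closed[OF that(2), of \<beta>] by (simp add: comm_word_def wev)
  have "\<exists>\<pi>\<in>hom (presented_group (st_gens PP) (st_rels PP)) \<Gamma>. \<forall>a\<in>st_gens PP.
      \<pi> (pres_cong (st_gens PP) (st_rels PP) `` {[(True, a)]}) = ?f a"
  proof (rule presented_hom[OF G.is_group f])
    fix l r :: "(pt \<times> 'r) gword" assume "(l, r) \<in> st_rels PP"
    then consider (a) v \<alpha> \<mu> where "v \<in> spec_Col PP" "l = [(True, (v, \<alpha>)), (True, (v, \<mu>))]" "r = [(True, (v, \<alpha> + \<mu>))]"
      | (b) u v w \<alpha> \<mu> where "spec_prod PP u v = Some w" "l = comm_word (u, \<alpha>) (v, \<mu>)" "r = [(True, (w, - (\<alpha> * \<mu>)))]"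
      | (c) u v \<alpha> \<mu> where "u \<in> spec_Col PP" "v \<in> spec_Col PP" "u + v \<notin> spec_Col PP \<union> {0}" "l = comm_word (u, \<alpha>) (v, \<mu>)" "r = []"
      unfolding st_rels_def by blast
    then show "weval \<Gamma> ?f l = weval \<Gamma> ?f r"
    proof cases
      case a
      have "weval \<Gamma> ?f l = g v \<alpha> \<otimes>\<^bsub>\<Gamma>\<^esub> g v \<mu>" using a G.g_closed[OF a(1)] by (simp add: wev)
      moreover have "weval \<Gamma> ?f r = g v (\<alpha> + \<mu>)" using a G.g_closed[OF a(1)] by (simp add: wev)
      ultimately show ?thesis using G.g_add[OF a(1)] by simp
    next
      case b
      then have p: "u \<in> spec_Col PP" "v \<in> spec_Col PP" "SH v (u, 0) = 1" "u + v \<noteq> 0" "w = u + v"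
        by (auto simp: spec_prod_eq split: if_splits)
      have z: "w \<in> spec_Col PP" using C.product_form(1)[OF p(1-4)] p(5) by simp
      have "weval \<Gamma> ?f r = g w (- (\<alpha> * \<mu>))" using b G.g_closed[OF z] by (simp add: wev)
      then show ?thesis unfolding b(2) cw[OF p(1,2)]
        using G.commutator_eq[OF G.g_closed[OF p(1)] G.g_closed[OF p(2)] G.g_closed[OF z] G.g_prod[OF b(1)]] by simp
    next
      case c
      have "g u \<alpha> \<otimes>\<^bsub>\<Gamma>\<^esub> g v \<mu> = \<one>\<^bsub>\<Gamma>\<^esub> \<otimes>\<^bsub>\<Gamma>\<^esub> (g v \<mu> \<otimes>\<^bsub>\<Gamma>\<^esub> g u \<alpha>)"
        using G.g_comm[OF c(1-3)] G.g_closed c(1,2) by simp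
      then show ?thesis unfolding c(4,5) cw[OF c(1,2)]
        using G.commutator_eq[OF G.g_closed[OF c(1)] G.g_closed[OF c(2)] G.one_closed] by (simp add: wev)
    qed
  qed
  then show ?thesis by (auto simp: steinberg_def st_gen_def st_gens_def)
qed

end

context rigid_sys begin

lemma tri_elem: "tri (elem_group TYPE('r::comm_ring_1) PP) T (\<lambda>p. spec_aut PP (vv p)) (\<lambda>p. C.cf (vv p))"
proof -
  interpret tri_rel "elem_group TYPE('r) PP" T "\<lambda>p. spec_aut PP (vv p)" by (rule tri_rel_vv[OF steinberg_elem])
  show ?thesis
  proof (unfold_locales)
    fix v assume v: "v \<in> T"
    show "C.cf (vv v) \<one>\<^bsub>elem_group TYPE('r) PP\<^esub> = 0" using C.cf_one[OF vv_spec[OF v]] by (simp add: elem_group_eq)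
  next
    fix S v w g and \<alpha> :: 'r
    assume S: "S \<subseteq> T" "trans S" and v: "v \<in> T" "v \<notin> S O S" and w: "w \<in> S"
      and g: "g \<in> generate (elem_group TYPE('r) PP) {spec_aut PP (vv p) \<alpha> | p \<alpha>. p \<in> S}"
    have sub: "vv ` S \<subseteq> spec_Col PP" using vv_spec S(1) by blast
    have "{spec_aut PP (vv p) \<alpha> | p (\<alpha>::'r). p \<in> S} = {spec_aut PP v \<alpha> | v \<alpha>. v \<in> vv ` S}" by blast
    then have g: "g \<in> generate C.BG (C.evs (vv ` S))" using g by (simp only: generate_elem[OF sub])
    have wv: "vv w = vv v \<longleftrightarrow> w = v" using inj_onD[OF vv_inj] w v(1) S(1) by blast
    have "C.cf (vv v) (C.ev (vv w) \<alpha> \<otimes>\<^bsub>C.BG\<^esub> g) = (if vv w = vv v then \<alpha> else 0) + C.cf (vv v) g"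
      by (rule C.cf_step[OF prod_closed_vv[OF S] indec_vv[OF S(1) v] vv_spec[OF v(1)] _ g]) (use w in blast)
    moreover have "spec_aut PP (vv w) \<alpha> = C.ev (vv w) \<alpha>" using spec_aut_ev vv_spec w S(1) by blast
    ultimately show "C.cf (vv v) (spec_aut PP (vv w) \<alpha> \<otimes>\<^bsub>elem_group TYPE('r) PP\<^esub> g) = (if w = v then \<alpha> else 0) + C.cf (vv v) g"
      unfolding wv by (simp add: elem_group_eq)
  qed
qed

text \<open>Coefficients in the Steinberg group are those of the image under the natural
  map.\<close>

lemma tri_st:
  fixes \<pi> :: "(pt \<times> 'r::comm_ring_1) gword set \<Rightarrow> 'r galg \<Rightarrow> 'r galg"
  assumes "\<pi> \<in> hom (steinberg TYPE('r) PP) (elem_group TYPE('r) PP)"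
    "\<forall>v\<in>spec_Col PP. \<forall>\<alpha>. \<pi> (st_gen PP v \<alpha>) = spec_aut PP v \<alpha>"
  shows "tri (steinberg TYPE('r) PP) T (\<lambda>p. st_gen PP (vv p)) (\<lambda>p g. C.cf (vv p) (\<pi> g))"
  by (rule tri_hom_iso(1)[OF tri_rel_vv[OF steinberg_st] tri_elem assms(1)]) (use assms(2) vv_spec in blast)

lemma gens_vv: "{g v \<alpha> | v \<alpha>. v \<in> vv ` S} = {g (vv p) \<alpha> | p \<alpha>. p \<in> S}" by blast

end

section \<open>The filtration and intersections for a rigid system\<close>

locale rigid_tri = rigid_sys PP V F h + fam: steinberg_family PP \<Gamma> g
  for PP :: "nat \<Rightarrow> pt set" and V and F :: "'n rel" and h and \<Gamma> :: "'g monoid" (structure)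
    and g :: "pt \<Rightarrow> 'r::comm_ring_1 \<Rightarrow> 'g" +
  fixes c :: "'n \<times> 'n \<Rightarrow> 'g \<Rightarrow> 'r" and enum :: "nat \<Rightarrow> pt list"
  assumes tri_c: "tri \<Gamma> T (\<lambda>p. g (vv p)) c"
    and enum: "\<And>r. r \<in> {1..max_degree F} \<Longrightarrow>
      distinct (enum r) \<and> set (enum r) = degree_part (spec_prod PP) V F h r"
begin

text \<open>Transfers the enumeration of column vectors to the pairs that index the abstract
  filtration.\<close>

definition "en r = map (inv_into T vv) (enum r)"
abbreviation "t \<equiv> max_degree F"

sublocale D: tri_deg \<Gamma> T "\<lambda>p. g (vv p)" c Gr.vdeg t en
proof (rule tri_deg.intro[OF tri_c], unfold_locales)
  show "Gr.vdeg a < Gr.vdeg b" if "(a, b) \<in> T" "(b, d) \<in> T" for a b d by (rule Gr.vdeg_less[OF that])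
  show "Gr.vdeg a \<le> t" if "(a, b) \<in> T" for a b using Gr.vdeg_range[OF that] by simp
  fix r assume r: "r \<in> {1..t}"
  have s: "set (enum r) = vv ` {p \<in> T. Gr.vdeg (fst p) = r}" using enum[OF r] degree_part_vv by simp
  have "inj_on (inv_into T vv) (set (enum r))"
    unfolding s by (rule inj_on_subset[OF inj_on_inv_into[OF order.refl]]) blast
  moreover have "inv_into T vv ` vv ` {p \<in> T. Gr.vdeg (fst p) = r} = {p \<in> T. Gr.vdeg (fst p) = r}"
    by (rule inv_into_image_cancel[OF vv_inj]) blast
  ultimately show "distinct (en r) \<and> set (en r) = {p \<in> T. Gr.vdeg (fst p) = r}"
    using enum[OF r] by (simp add: en_def distinct_map s)
qed

lemma gen_vv: "gen_subgroup \<Gamma> g (vv ` S) = \<Gamma>\<lparr>carrier := D.gs S\<rparr>"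
  unfolding gen_subgroup_def D.gs_def gens_vv ..

lemma gen_tail: "gen_subgroup \<Gamma> g (degree_tail (spec_prod PP) V F h r) = \<Gamma>\<lparr>carrier := D.gs (D.tail r)\<rparr>"
  unfolding degree_tail_vv gen_vv D.tail_def ..

lemma gen_V: "gen_subgroup \<Gamma> g V = \<Gamma>\<lparr>carrier := D.gs T\<rparr>"
  unfolding gen_vv[symmetric] vv_image gen_subgroup_def fam.generate_B[OF rig] ..

lemma tau_W: assumes r: "r \<in> {1..t}" shows "tau \<Gamma> g (enum r) l = D.W r l"
proof -
  have "vv (en r ! i) = enum r ! i" if "i < length (enum r)" for i
  proof -
    have "set (enum r) \<subseteq> vv ` T" using enum[OF r] degree_part_vv by auto
    then have "enum r ! i \<in> vv ` T" using that nth_mem by blast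
    then show ?thesis using that by (simp add: en_def f_inv_into_f)
  qed
  then show ?thesis unfolding tau_def D.ptau_def by (intro foldr_cong) (auto simp: en_def)
qed

lemma additive_power_carrier: "carrier (additive_power N :: (nat \<Rightarrow> 'r) monoid) = extensional {..<N}"
  by (simp add: additive_power_def carrier_product_group additive_group_def PiE_UNIV_domain PiE_def)

lemma length_en: "length (en r) = length (enum r)" by (simp add: en_def)

lemma tau_image_gs: assumes r: "r \<in> {1..t}" shows "tau_image \<Gamma> g (enum r) = D.gs (D.part r)"
proof -
  have "range (D.W r) = D.W r ` extensional {..<length (enum r)}"
  proof
    show "range (D.W r) \<subseteq> D.W r ` extensional {..<length (enum r)}"
    proof
      fix z assume "z \<in> range (D.W r)"
      then obtain l where "z = D.W r l" by blast
      \<comment> \<open>The product depends only on the parameters at actual indices; tuples in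
        \<open>additive_power\<close> are undefined elsewhere.\<close>
      moreover have "D.W r l = D.W r (restrict l {..<length (enum r)})" by (rule D.W_cong) (simp add: length_en)
      ultimately show "z \<in> D.W r ` extensional {..<length (enum r)}" by blast
    qed
  qed blast
  then show ?thesis unfolding tau_image_def additive_power_carrier D.W_range[OF r] using tau_W[OF r] by simp
qed

lemma tau_mon:
  assumes r: "r \<in> {1..t}"
  shows "tau \<Gamma> g (enum r) \<in> mon (additive_power (length (enum r)))
    (gen_subgroup \<Gamma> g (degree_tail (spec_prod PP) V F h r))"
proof -
  let ?N = "length (enum r)"
  have "D.W r l \<in> D.gs (D.tail r)" for l
    using D.W_gs[OF r] D.gs_mono[of "D.part r" "D.tail r"] D.tail_Un[of r] by blast
  moreover have "D.W r (l \<otimes>\<^bsub>additive_power ?N\<^esub> l') = D.W r l \<otimes> D.W r l'" for l l'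
    unfolding D.W_add[OF r, symmetric]
    by (rule D.W_cong) (simp add: length_en additive_power_def product_group_def additive_group_def)
  moreover have "inj_on (D.W r) (extensional {..<?N})"
  proof (rule inj_onI)
    fix l l' assume l: "l \<in> extensional {..<?N}" "l' \<in> extensional {..<?N}" and e: "D.W r l = D.W r l'"
    show "l = l'"
    proof (rule extensionalityI[OF l])
      fix k assume "k \<in> {..<?N}"
      then show "l k = l' k" using D.W_coeff[OF r, of k l] D.W_coeff[OF r, of k l'] e by (simp add: length_en)
    qed
  qed
  ultimately show ?thesis
    unfolding mon_def gen_tail hom_def additive_power_carrier using tau_W[OF r] by (auto simp: inj_on_def)
qed

lemma exact:
  assumes r: "r \<in> {1..<t}"
  shows "short_exact_sequence (gen_subgroup \<Gamma> g (degree_tail (spec_prod PP) V F h (r + 1)))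
      (gen_subgroup \<Gamma> g (degree_tail (spec_prod PP) V F h r)) (\<Gamma>\<lparr>carrier := tau_image \<Gamma> g (enum r)\<rparr>)
      (strip_first \<Gamma> (\<lambda>r. tau_image \<Gamma> g (enum r)) r t) id"
    and "carrier (gen_subgroup \<Gamma> g (degree_tail (spec_prod PP) V F h (r + 1))) \<subseteq>
      carrier (gen_subgroup \<Gamma> g (degree_tail (spec_prod PP) V F h r))"
    and "\<forall>\<epsilon>\<in>carrier (gen_subgroup \<Gamma> g (degree_tail (spec_prod PP) V F h (r + 1))).
      strip_first \<Gamma> (\<lambda>r. tau_image \<Gamma> g (enum r)) r t \<epsilon> = \<epsilon>"
proof -
  have A: "\<forall>s\<in>{1..t}. tau_image \<Gamma> g (enum s) = D.gs (D.part s)" using tau_image_gs by blast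
  have r': "r \<in> {1..t}" using r by simp
  note ex = D.exact_sequence[where A = "\<lambda>r. tau_image \<Gamma> g (enum r)", OF A r']
  show "short_exact_sequence (gen_subgroup \<Gamma> g (degree_tail (spec_prod PP) V F h (r + 1)))
      (gen_subgroup \<Gamma> g (degree_tail (spec_prod PP) V F h r)) (\<Gamma>\<lparr>carrier := tau_image \<Gamma> g (enum r)\<rparr>)
      (strip_first \<Gamma> (\<lambda>r. tau_image \<Gamma> g (enum r)) r t) id"
    "carrier (gen_subgroup \<Gamma> g (degree_tail (spec_prod PP) V F h (r + 1))) \<subseteq>
      carrier (gen_subgroup \<Gamma> g (degree_tail (spec_prod PP) V F h r))"
    "\<forall>\<epsilon>\<in>carrier (gen_subgroup \<Gamma> g (degree_tail (spec_prod PP) V F h (r + 1))).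
      strip_first \<Gamma> (\<lambda>r. tau_image \<Gamma> g (enum r)) r t \<epsilon> = \<epsilon>"
    unfolding gen_tail using ex by simp_all
qed

lemma canonical:
  assumes r: "r \<in> {1..t}"
  shows "\<forall>\<epsilon>\<in>carrier (gen_subgroup \<Gamma> g (degree_tail (spec_prod PP) V F h r)).
    \<exists>!es. canonical_rep \<Gamma> (\<lambda>r. tau_image \<Gamma> g (enum r)) r t \<epsilon> es"
proof -
  have A: "\<forall>s\<in>{1..t}. tau_image \<Gamma> g (enum s) = D.gs (D.part s)" using tau_image_gs by blast
  show ?thesis unfolding gen_tail
    using D.canonical_exists_unique(1)[where A = "\<lambda>r. tau_image \<Gamma> g (enum r)", OF A, of r] r by simp
qed

text \<open>The vanishing \<open>c0\<close> is left as a hypothesis because it is computed directly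
  in the elementary group but through the natural map in the Steinberg group.\<close>

lemma intersection:
  assumes U: "spec_rigid PP U"
    and c0: "\<forall>x\<in>generate \<Gamma> {g v \<alpha> | v \<alpha>. v \<in> strong_prods (spec_prod PP) U}.
      \<forall>p\<in>T. vv p \<notin> strong_prods (spec_prod PP) U \<longrightarrow> c p x = 0"
  shows "carrier (gen_subgroup \<Gamma> g U) \<inter> carrier (gen_subgroup \<Gamma> g V) =
    carrier (gen_subgroup \<Gamma> g (strong_prods (spec_prod PP) U \<inter> BV))"
proof -
  obtain i where i: "rigid (PP i) U" using U by (auto simp: spec_rigid_def)
  let ?U = "strong_prods (spec_prod PP) U"
  let ?K = "generate \<Gamma> {g v \<alpha> | v \<alpha>. v \<in> ?U}"
  have Usub: "?U \<subseteq> spec_Col PP" using B_spec[OF i] by blast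
  have KU: "carrier (gen_subgroup \<Gamma> g U) = ?K" unfolding fam.generate_B[OF i] gen_subgroup_def by simp
  define E where "E = {p \<in> T. vv p \<in> ?U}"
  have E: "vv ` E = ?U \<inter> BV" unfolding E_def vv_image[symmetric] by blast
  have "x \<in> D.gs E" if x: "x \<in> ?K" "x \<in> D.gs T" for x
  proof (rule D.subgroup_Int_gs[where K = ?K and S = T])
    show "subgroup ?K \<Gamma>" by (rule fam.generate_is_subgroup[OF fam.gen_carrier[OF Usub]])
    show "g (vv v) \<alpha> \<in> ?K" if "v \<in> E" for v \<alpha> using that unfolding E_def by (intro generate.incl) blast
    show "E \<subseteq> T" by (auto simp: E_def)
    show "c v x = 0" if "x \<in> ?K" "v \<in> T" "v \<notin> E" for x v using c0 that by (auto simp: E_def)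
    show "D.ideal_in T" by (rule D.ideal_T)
    show "x \<in> ?K" "x \<in> D.gs T" by (fact x)+
  qed
  moreover have "D.gs E \<subseteq> ?K" unfolding D.gs_def by (rule fam.mono_generate) (auto simp: E_def)
  moreover have "D.gs E \<subseteq> D.gs T" by (rule D.gs_mono) (auto simp: E_def)
  ultimately have "?K \<inter> D.gs T = D.gs E" by blast
  then show ?thesis unfolding KU E[symmetric] gen_vv gen_V by simp
qed

end

context rigid_sys begin

lemma degree_tail_iso:
  fixes \<Gamma> :: "'g monoid" and \<Delta> :: "'d monoid" and g :: "pt \<Rightarrow> 'r::comm_ring_1 \<Rightarrow> 'g"
  assumes W: "rigid_sys QQ W F k"
    and tri: "tri \<Gamma> T (\<lambda>p. g (vv p)) c" "tri \<Delta> T (\<lambda>p. g' (rigid_sys.vv QQ W F k p)) c'"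
  shows "\<exists>\<theta>\<in>iso (gen_subgroup \<Delta> g' (degree_tail (spec_prod QQ) W F k r))
      (gen_subgroup \<Gamma> g (degree_tail (spec_prod PP) V F h r)).
    \<forall>w\<in>degree_tail (spec_prod QQ) W F k r. \<forall>v\<in>degree_tail (spec_prod PP) V F h r. k w = h v \<longrightarrow>
      (\<forall>\<alpha>. \<theta> (g' w \<alpha>) = g v \<alpha>)"
proof -
  interpret Q: rigid_sys QQ W F k by (rule W)
  let ?S = "{p \<in> T. r \<le> Gr.vdeg (fst p)}"
  obtain \<theta> where \<theta>: "\<theta> \<in> iso (\<Delta>\<lparr>carrier := generate \<Delta> {g' (Q.vv p) \<alpha> | p \<alpha>. p \<in> ?S}\<rparr>)
      (\<Gamma>\<lparr>carrier := generate \<Gamma> {g (vv p) \<alpha> | p \<alpha>. p \<in> ?S}\<rparr>)"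
    "\<forall>p\<in>?S. \<forall>\<alpha>. \<theta> (g' (Q.vv p) \<alpha>) = g (vv p) \<alpha>"
    using tri_iso[OF tri(2,1), of ?S] by blast
  have "\<theta> (g' w \<alpha>) = g v \<alpha>" if wv: "w \<in> Q.vv ` ?S" "v \<in> vv ` ?S" "k w = h v" for w v \<alpha>
  proof -
    obtain p q where pq: "p \<in> ?S" "w = Q.vv p" "q \<in> ?S" "v = vv q" using wv by blast
    \<comment> \<open>Equal values of \<open>k\<close> and \<open>h\<close> mean the same class of
      paths, hence the same pair.\<close>
    have "pcls F p = pcls F q" using pq wv(3) vv(2)[of q] Q.vv(2)[of p] by simp
    then have "p = q" using pcls_inj[of p F q] pq(1) by simp
    then show ?thesis using \<theta>(2)[rule_format, OF pq(3)] pq(2,4) by simp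
  qed
  then show ?thesis unfolding degree_tail_vv Q.degree_tail_vv gen_subgroup_def gens_vv Q.gens_vv
    by (intro bexI[OF _ \<theta>(1)] ballI impI allI) blast
qed

end

theorem theorem5p4:
  fixes P :: "pt set" and PP :: "nat \<Rightarrow> pt set" and V :: "pt set"
    and F :: "'n rel" and h :: "pt \<Rightarrow> ('n \<times> 'n) list set"
    and enum :: "nat \<Rightarrow> pt list"
  assumes "lattice_polytope P" and "balanced P" and "Col P \<noteq> {}"
    and "doubling_spectrum PP" and "PP 0 = P"
    and "spec_rigid PP V" and "supports (spec_prod PP) V F h"
    and enum: "\<And>r. r \<in> {1..max_degree F} \<Longrightarrow>
      distinct (enum r) \<and> set (enum r) = degree_part (spec_prod PP) V F h r"
  shows
   "let t = max_degree F;
        E = elem_group TYPE('r::comm_ring_1) PP; e = spec_aut PP;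
        St = steinberg TYPE('r) PP; x = st_gen PP;
        Vr = degree_tail (spec_prod PP) V F h;
        Gr = (\<lambda>r. gen_subgroup E e (Vr r)); Gr' = (\<lambda>r. gen_subgroup St x (Vr r));
        A = (\<lambda>r. tau_image E e (enum r)); A' = (\<lambda>r. tau_image St x (enum r))
    in
     \<comment> \<open>(a)\<close>
     (\<forall>r\<in>{1..<t}.
        short_exact_sequence (Gr (r + 1)) (Gr r) (E\<lparr>carrier := A r\<rparr>) (strip_first E A r t) id \<and>
        carrier (Gr (r + 1)) \<subseteq> carrier (Gr r) \<and>
        (\<forall>\<epsilon>\<in>carrier (Gr (r + 1)). strip_first E A r t \<epsilon> = \<epsilon>)) \<and>
     \<comment> \<open>(b)\<close>
     (\<forall>Q QQ W k. lattice_polytope Q \<and> balanced Q \<and> doubling_spectrum QQ \<and> QQ 0 = Q \<and>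
        rigid Q W \<and> supports (col_prod Q) W F k \<longrightarrow>
        (\<forall>r\<in>{1..t}. \<exists>\<theta> \<in> iso (gen_subgroup (elem_group TYPE('r) QQ) (spec_aut QQ)
                                 (degree_tail (col_prod Q) W F k r)) (Gr r).
           \<forall>w\<in>degree_tail (col_prod Q) W F k r. \<forall>v\<in>Vr r. k w = h v \<longrightarrow>
             (\<forall>\<alpha>. \<theta> (spec_aut QQ w \<alpha>) = e v \<alpha>))) \<and>
     \<comment> \<open>(c)\<close>
     (\<forall>U. spec_rigid PP U \<longrightarrow>
        carrier (gen_subgroup E e U) \<inter> carrier (gen_subgroup E e V) =
        carrier (gen_subgroup E e (strong_prods (spec_prod PP) U \<inter> strong_prods (spec_prod PP) V))) \<and>
     \<comment> \<open>(d), the natural map\<close>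
     (\<exists>\<pi> \<in> hom St E. (\<forall>v\<in>spec_Col PP. \<forall>\<alpha>. \<pi> (x v \<alpha>) = e v \<alpha>) \<and>
        (\<forall>r\<in>{1..t}. \<pi> \<in> iso (Gr' r) (Gr r))) \<and>
     \<comment> \<open>(d), the analogue of (a)\<close>
     (\<forall>r\<in>{1..<t}.
        short_exact_sequence (Gr' (r + 1)) (Gr' r) (St\<lparr>carrier := A' r\<rparr>) (strip_first St A' r t) id \<and>
        carrier (Gr' (r + 1)) \<subseteq> carrier (Gr' r) \<and>
        (\<forall>\<epsilon>\<in>carrier (Gr' (r + 1)). strip_first St A' r t \<epsilon> = \<epsilon>)) \<and>
     \<comment> \<open>(d), the analogue of (b)\<close>
     (\<forall>Q QQ W k. lattice_polytope Q \<and> balanced Q \<and> doubling_spectrum QQ \<and> QQ 0 = Q \<and>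
        rigid Q W \<and> supports (col_prod Q) W F k \<longrightarrow>
        (\<forall>r\<in>{1..t}. \<exists>\<theta> \<in> iso (gen_subgroup (steinberg TYPE('r) QQ) (st_gen QQ)
                                 (degree_tail (col_prod Q) W F k r)) (Gr' r).
           \<forall>w\<in>degree_tail (col_prod Q) W F k r. \<forall>v\<in>Vr r. k w = h v \<longrightarrow>
             (\<forall>\<alpha>. \<theta> (st_gen QQ w \<alpha>) = x v \<alpha>))) \<and>
     \<comment> \<open>(d), the analogue of (c)\<close>
     (\<forall>U. spec_rigid PP U \<longrightarrow>
        carrier (gen_subgroup St x U) \<inter> carrier (gen_subgroup St x V) =
        carrier (gen_subgroup St x (strong_prods (spec_prod PP) U \<inter> strong_prods (spec_prod PP) V))) \<and>
     \<comment> \<open>(d), the maps \<open>\<tau>'\<close> and canonical representations\<close>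
     (\<forall>r\<in>{1..t}. tau St x (enum r) \<in> mon (additive_power (length (enum r))) (Gr' r)) \<and>
     (\<forall>r\<in>{1..t}. \<forall>\<epsilon>\<in>carrier (Gr' r). \<exists>!es. canonical_rep St A' r t \<epsilon> es)"
proof -
  interpret R: rigid_sys PP V F h using assms by unfold_locales auto
  let ?E = "elem_group TYPE('r) PP" and ?St = "steinberg TYPE('r) PP"
  let ?e = "spec_aut PP :: pt \<Rightarrow> 'r \<Rightarrow> _" and ?x = "st_gen PP :: pt \<Rightarrow> 'r \<Rightarrow> _"
  let ?Vr = "degree_tail (spec_prod PP) V F h"
  obtain \<pi> where \<pi>: "\<pi> \<in> hom ?St ?E" "\<forall>v\<in>spec_Col PP. \<forall>\<alpha>. \<pi> (?x v \<alpha>) = ?e v \<alpha>"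
    using R.steinberg_hom[OF R.steinberg_elem] by blast
  have E: "rigid_tri PP V F h ?E ?e (\<lambda>p. R.C.cf (R.vv p)) enum"
    by (intro rigid_tri.intro rigid_tri_axioms.intro R.rigid_sys_axioms R.steinberg_elem R.tri_elem enum)
  have S: "rigid_tri PP V F h ?St ?x (\<lambda>p a. R.C.cf (R.vv p) (\<pi> a)) enum"
    by (intro rigid_tri.intro rigid_tri_axioms.intro R.rigid_sys_axioms R.steinberg_st R.tri_st \<pi> enum)
  interpret E: rigid_tri PP V F h ?E ?e "\<lambda>p. R.C.cf (R.vv p)" enum by (rule E)
  interpret S: rigid_tri PP V F h ?St ?x "\<lambda>p a. R.C.cf (R.vv p) (\<pi> a)" enum by (rule S)
  have natural: "\<pi> \<in> iso (gen_subgroup ?St ?x (?Vr r)) (gen_subgroup ?E ?e (?Vr r))" for r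
  proof -
    have "\<pi> \<in> iso (?St\<lparr>carrier := generate ?St {?x (R.vv p) \<alpha> | p \<alpha>. p \<in> {p \<in> R.T. r \<le> R.Gr.vdeg (fst p)}}\<rparr>)
      (?E\<lparr>carrier := generate ?E {?e (R.vv p) \<alpha> | p \<alpha>. p \<in> {p \<in> R.T. r \<le> R.Gr.vdeg (fst p)}}\<rparr>)"
      by (rule tri_hom_iso(2)[OF R.tri_rel_vv[OF R.steinberg_st] R.tri_elem \<pi>(1)]) (use \<pi>(2) R.vv_spec in blast)+
    then show ?thesis unfolding R.degree_tail_vv gen_subgroup_def R.gens_vv .
  qed
  \<comment> \<open>\<open>Q\<close> is stage 0 of its spectrum, so products and degrees computed in
    \<open>Q\<close> agree with those of the spectrum.\<close>
  have other: "rigid_sys QQ W F k \<and> degree_tail (col_prod Q) W F k = degree_tail (spec_prod QQ) W F k"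
    if "lattice_polytope Q" "balanced Q" "doubling_spectrum QQ" "QQ 0 = Q" "rigid Q W" "supports (col_prod Q) W F k"
    for Q QQ W k
  proof -
    interpret Q: spectrum QQ using that by unfold_locales auto
    have rig: "rigid (QQ 0) W" using that by simp
    have "supports (spec_prod QQ) W F k" using Q.supports_eq[OF rig, of F k] that by simp
    moreover have "spec_rigid QQ W" using rig by (auto simp: spec_rigid_def)
    ultimately show ?thesis using Q.degree_tail_eq[OF rig, of F k] that Q.spectrum_axioms
      by (auto simp: rigid_sys_def rigid_sys_axioms_def fun_eq_iff)
  qed
  have isoE: "\<exists>\<theta>\<in>iso (gen_subgroup (elem_group TYPE('r) QQ) (spec_aut QQ) (degree_tail (spec_prod QQ) W F k r))
      (gen_subgroup ?E ?e (?Vr r)).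
    \<forall>w\<in>degree_tail (spec_prod QQ) W F k r. \<forall>v\<in>?Vr r. k w = h v \<longrightarrow> (\<forall>\<alpha>. \<theta> (spec_aut QQ w \<alpha>) = ?e v \<alpha>)"
    if "rigid_sys QQ W F k" for QQ W k r
    by (rule R.degree_tail_iso[OF that R.tri_elem rigid_sys.tri_elem[OF that]])
  have isoS: "\<exists>\<theta>\<in>iso (gen_subgroup (steinberg TYPE('r) QQ) (st_gen QQ) (degree_tail (spec_prod QQ) W F k r))
      (gen_subgroup ?St ?x (?Vr r)).
    \<forall>w\<in>degree_tail (spec_prod QQ) W F k r. \<forall>v\<in>?Vr r. k w = h v \<longrightarrow> (\<forall>\<alpha>. \<theta> (st_gen QQ w \<alpha>) = ?x v \<alpha>)"
    if Q: "rigid_sys QQ W F k" for QQ W k r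
  proof -
    interpret Q: rigid_sys QQ W F k by (rule Q)
    obtain \<rho> where \<rho>: "\<rho> \<in> hom (steinberg TYPE('r) QQ) (elem_group TYPE('r) QQ)"
      "\<forall>v\<in>spec_Col QQ. \<forall>\<alpha>. \<rho> (st_gen QQ v \<alpha>) = spec_aut QQ v \<alpha>"
      using Q.steinberg_hom[OF Q.steinberg_elem] by blast
    show ?thesis by (rule R.degree_tail_iso[OF Q R.tri_st[OF \<pi>] Q.tri_st[OF \<rho>]])
  qed
  have cE: "R.C.cf (R.vv p) x = 0"
    if U: "spec_rigid PP U" and x: "x \<in> generate ?E {?e v \<alpha> | v \<alpha>. v \<in> strong_prods (spec_prod PP) U}"
      and p: "p \<in> R.T" "R.vv p \<notin> strong_prods (spec_prod PP) U" for U x p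
  proof -
    obtain i where i: "rigid (PP i) U" using U by (auto simp: spec_rigid_def)
    have "strong_prods (spec_prod PP) U \<subseteq> spec_Col PP" using R.B_spec[OF i] by blast
    from x[unfolded R.generate_elem[OF this]] show ?thesis
      by (rule R.C.cf_zero[OF R.prod_closed_B[OF i] R.vv_spec[OF p(1)] p(2)])
  qed
  \<comment> \<open>Carries the vanishing over to the Steinberg group: \<open>\<pi>\<close> maps the
    subgroup generated over \<open>S\<close> into the corresponding elementary one.\<close>
  have \<pi>_gen: "\<pi> x \<in> generate ?E {?e v \<alpha> | v \<alpha>. v \<in> S}"
    if sub: "S \<subseteq> spec_Col PP" and x: "x \<in> generate ?St {?x v \<alpha> | v \<alpha>. v \<in> S}" for S x
  proof -
    interpret \<pi>: group_hom ?St ?E \<pi>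
      using \<pi>(1) R.group_steinberg R.group_elem by (simp add: group_hom_def group_hom_axioms_def)
    have sub': "\<pi> ` {?x v \<alpha> | v \<alpha>. v \<in> S} \<subseteq> {?e v \<alpha> | v \<alpha>. v \<in> S}"
    proof (rule image_subsetI)
      fix a assume "a \<in> {?x v \<alpha> | v \<alpha>. v \<in> S}"
      then obtain v \<alpha> where a: "a = ?x v \<alpha>" "v \<in> S" by blast
      then have "\<pi> a = ?e v \<alpha>" using \<pi>(2) sub by (simp add: subsetD)
      then show "\<pi> a \<in> {?e v \<alpha> | v \<alpha>. v \<in> S}" using a(2) by blast
    qed
    have "\<pi> x \<in> \<pi> ` generate ?St {?x v \<alpha> | v \<alpha>. v \<in> S}" using x by (rule imageI)
    also have "\<dots> = generate ?E (\<pi> ` {?x v \<alpha> | v \<alpha>. v \<in> S})"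
      by (rule \<pi>.generate_img[OF S.fam.gen_carrier[OF sub], symmetric])
    also have "\<dots> \<subseteq> generate ?E {?e v \<alpha> | v \<alpha>. v \<in> S}"
      by (rule group.mono_generate[OF R.group_elem sub'])
    finally show ?thesis .
  qed
  have c: "carrier (gen_subgroup ?E ?e U) \<inter> carrier (gen_subgroup ?E ?e V) =
        carrier (gen_subgroup ?E ?e (strong_prods (spec_prod PP) U \<inter> strong_prods (spec_prod PP) V)) \<and>
      carrier (gen_subgroup ?St ?x U) \<inter> carrier (gen_subgroup ?St ?x V) =
        carrier (gen_subgroup ?St ?x (strong_prods (spec_prod PP) U \<inter> strong_prods (spec_prod PP) V))"
    if U: "spec_rigid PP U" for U
  proof -
    obtain i where i: "rigid (PP i) U" using U by (auto simp: spec_rigid_def)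
    have sub: "strong_prods (spec_prod PP) U \<subseteq> spec_Col PP"
      by (rule subsetI) (rule R.B_spec[OF i])
    have 1: "\<forall>x\<in>generate ?E {?e v \<alpha> | v \<alpha>. v \<in> strong_prods (spec_prod PP) U}.
        \<forall>p\<in>R.T. R.vv p \<notin> strong_prods (spec_prod PP) U \<longrightarrow> R.C.cf (R.vv p) x = 0"
      by (intro ballI impI) (rule cE[OF U])
    have 2: "\<forall>x\<in>generate ?St {?x v \<alpha> | v \<alpha>. v \<in> strong_prods (spec_prod PP) U}.
        \<forall>p\<in>R.T. R.vv p \<notin> strong_prods (spec_prod PP) U \<longrightarrow> R.C.cf (R.vv p) (\<pi> x) = 0"
      by (intro ballI impI) (rule cE[OF U \<pi>_gen[OF sub]])
    show ?thesis by (rule conjI[OF E.intersection[OF U 1] S.intersection[OF U 2]])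
  qed
  show ?thesis
    unfolding Let_def
  proof (intro conjI ballI allI impI)
    fix r assume r: "r \<in> {1..<max_degree F}"
    note e = E.exact[OF r] and s = S.exact[OF r]
    show "short_exact_sequence (gen_subgroup ?E ?e (?Vr (r + 1))) (gen_subgroup ?E ?e (?Vr r))
        (?E\<lparr>carrier := tau_image ?E ?e (enum r)\<rparr>) (strip_first ?E (\<lambda>r. tau_image ?E ?e (enum r)) r (max_degree F)) id"
      by (rule e(1))
    show "carrier (gen_subgroup ?E ?e (?Vr (r + 1))) \<subseteq> carrier (gen_subgroup ?E ?e (?Vr r))" by (rule e(2))
    show "strip_first ?E (\<lambda>r. tau_image ?E ?e (enum r)) r (max_degree F) \<epsilon> = \<epsilon>"
      if "\<epsilon> \<in> carrier (gen_subgroup ?E ?e (?Vr (r + 1)))" for \<epsilon> by (rule e(3)[rule_format, OF that])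
    show "short_exact_sequence (gen_subgroup ?St ?x (?Vr (r + 1))) (gen_subgroup ?St ?x (?Vr r))
        (?St\<lparr>carrier := tau_image ?St ?x (enum r)\<rparr>) (strip_first ?St (\<lambda>r. tau_image ?St ?x (enum r)) r (max_degree F)) id"
      by (rule s(1))
    show "carrier (gen_subgroup ?St ?x (?Vr (r + 1))) \<subseteq> carrier (gen_subgroup ?St ?x (?Vr r))" by (rule s(2))
    show "strip_first ?St (\<lambda>r. tau_image ?St ?x (enum r)) r (max_degree F) \<epsilon> = \<epsilon>"
      if "\<epsilon> \<in> carrier (gen_subgroup ?St ?x (?Vr (r + 1)))" for \<epsilon> by (rule s(3)[rule_format, OF that])
  next
    fix Q QQ W k r
    assume "lattice_polytope Q \<and> balanced Q \<and> doubling_spectrum QQ \<and> QQ 0 = Q \<and>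
        rigid Q W \<and> supports (col_prod Q) W F k"
    then have o: "rigid_sys QQ W F k" "degree_tail (col_prod Q) W F k = degree_tail (spec_prod QQ) W F k"
      using other[of Q QQ W k] by auto
    show "\<exists>\<theta>\<in>iso (gen_subgroup (elem_group TYPE('r) QQ) (spec_aut QQ) (degree_tail (col_prod Q) W F k r))
        (gen_subgroup ?E ?e (?Vr r)).
      \<forall>w\<in>degree_tail (col_prod Q) W F k r. \<forall>v\<in>?Vr r. k w = h v \<longrightarrow> (\<forall>\<alpha>. \<theta> (spec_aut QQ w \<alpha>) = ?e v \<alpha>)"
      unfolding o(2) by (rule isoE[OF o(1)])
    show "\<exists>\<theta>\<in>iso (gen_subgroup (steinberg TYPE('r) QQ) (st_gen QQ) (degree_tail (col_prod Q) W F k r))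
        (gen_subgroup ?St ?x (?Vr r)).
      \<forall>w\<in>degree_tail (col_prod Q) W F k r. \<forall>v\<in>?Vr r. k w = h v \<longrightarrow> (\<forall>\<alpha>. \<theta> (st_gen QQ w \<alpha>) = ?x v \<alpha>)"
      unfolding o(2) by (rule isoS[OF o(1)])
  next
    fix U assume U: "spec_rigid PP U"
    show "carrier (gen_subgroup ?E ?e U) \<inter> carrier (gen_subgroup ?E ?e V) =
        carrier (gen_subgroup ?E ?e (strong_prods (spec_prod PP) U \<inter> strong_prods (spec_prod PP) V))"
      by (rule conjunct1[OF c[OF U]])
    show "carrier (gen_subgroup ?St ?x U) \<inter> carrier (gen_subgroup ?St ?x V) =
        carrier (gen_subgroup ?St ?x (strong_prods (spec_prod PP) U \<inter> strong_prods (spec_prod PP) V))"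
      by (rule conjunct2[OF c[OF U]])
  next
    show "\<exists>\<pi>\<in>hom ?St ?E. (\<forall>v\<in>spec_Col PP. \<forall>\<alpha>. \<pi> (?x v \<alpha>) = ?e v \<alpha>) \<and>
        (\<forall>r\<in>{1..max_degree F}. \<pi> \<in> iso (gen_subgroup ?St ?x (?Vr r)) (gen_subgroup ?E ?e (?Vr r)))"
      by (intro bexI[OF _ \<pi>(1)] conjI \<pi>(2) ballI natural)
  next
    fix r assume r: "r \<in> {1..max_degree F}"
    show "tau ?St ?x (enum r) \<in> mon (additive_power (length (enum r))) (gen_subgroup ?St ?x (?Vr r))"
      by (rule S.tau_mon[OF r])
    show "\<exists>!es. canonical_rep ?St (\<lambda>r. tau_image ?St ?x (enum r)) r (max_degree F) \<epsilon> es"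
      if "\<epsilon> \<in> carrier (gen_subgroup ?St ?x (?Vr r))" for \<epsilon>
      by (rule S.canonical[OF r, rule_format, OF that])
  qed
qed

end
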